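(* Let $\delta>0$. Let $\varphi\in C([0,1])$ and let $\Phi(X):=\langle\varphi,X\rangle=\int_0^1\varphi(r)X(r)\,dr$ for $X\in L^2([0,1])$. Then for every $h\in C^2_c(0,1)$, $$E^{\delta}\big[\partial_h\Phi(X)\big]=-E^{\delta}\big[\langle h'',X\rangle\,\Phi(X)\big]-\frac{\Gamma(\delta)}{4(\delta-2)}\int_0^1 h(r)\,\big\langle\mu_{\delta-3}(db),\Sigma^{\delta}_r(\Phi\,|\,b)\big\rangle\,dr,$$ where, for $\delta=2$, the apparent singularity $\frac1{\delta-2}$ is removed as specified in the context.
   Context: $C([0,1])$ is the space of continuous real-valued functions on $[0,1]$; $C^2_c(0,1)$ is the space of $C^2$ functions with compact support in $(0,1)$; $\langle f,g\rangle=\int_0^1 f(r)g(r)\,dr$; $\Gamma$ is the Gamma function. For a Fréchet differentiable $\Phi:L^2([0,1])\to\mathbb R$ and $h\in L^2([0,1])$, $\partial_h\Phi(X)=\lim_{\epsilon\to0}\frac{\Phi(X+\epsilon h)-\Phi(X)}{\epsilon}$. In particular, for $\Phi=\langle\varphi,\cdot\rangle$, $\partial_h\Phi(X)=\langle\varphi,h\rangle$. For $\delta>0$, a $\delta$-dimensional Bessel process is the square root of a squared Bessel process of dimension $\delta$ (the nonnegative solution of $dZ_t=2\sqrt{Z_t}\,dB_t+\delta\,dt$). $P^\delta$ is the law on $C([0,1])$ of the $\delta$-dimensional Bessel bridge from $0$ to $0$ on $[0,1]$ (the $\delta$-dimensional Bessel process started at $0$ conditioned, in the usual weak-limit sense,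 to be at $0$ at time $1$), and $E^\delta$ is the corresponding expectation; $X$ denotes the canonical path. For $r\in(0,1)$, the density of $X_r$ under $P^\delta$ is $$p^\delta_r(b)=\frac{b^{\delta-1}}{2^{\frac\delta2-1}\Gamma(\frac\delta2)(r(1-r))^{\delta/2}}\exp\Big(-\frac{b^2}{2r(1-r)}\Big),\qquad b\ge0.$$ For $b\ge0$, $P^\delta[dX\,|\,X_r=b]$ denotes the law of the $\delta$-Bessel bridge between $0$ and $0$ pinned at $b$ at time $r$ (i.e. the concatenation of two independent $\delta$-Bessel bridges, from $0$ to $b$ on $[0,r]$ and from $b$ to $0$ on $[r,1]$; this is the version of the conditional law that is continuous in $b$). Define the measure $$\Sigma^\delta_r(dX\,|\,b):=\frac{p^\delta_r(b)}{b^{\delta-1}}\,P^\delta[dX\,|\,X_r=b],$$ where $p^\delta_r(b)/b^{\delta-1}$ is understood as $\frac{1}{2^{\delta/2-1}\Gamma(\delta/2)(r(1-r))^{\delta/2}}e^{-b^2/(2r(1-r))}$ (also at $b=0$), and write $\Sigma^\delta_r(\Phi\,|\,b):=\int\Phi(X)\,\Sigma^\delta_r(dX\,|\,b)$. Let $S([0,\infty))$ be the space of $C^\infty$ functions $\psi:[0,\infty)\to\mathbb R$ such that for all integers $k,\ell\ge0$ there is $C_{k,\ell}\ge 0$ with $|\psi^{(k)}(x)|x^\ell\le C_{k,\ell}$ for all $x\ge0$. For $\alpha\in\mathbb R$ the distribution $\mu_\alpha$ on $[0,\infty)$ is defined as follows: if $\alpha=-k$ with $k\in\{0,1,2,\dots\}$,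 $\langle\mu_\alpha,\psi\rangle:=(-1)^k\psi^{(k)}(0)$; otherwise, $$\langle\mu_\alpha,\psi\rangle:=\int_0^{\infty}\Big(\psi(x)-\sum_{0\le j\le-\alpha}\frac{x^j}{j!}\psi^{(j)}(0)\Big)\frac{x^{\alpha-1}}{\Gamma(\alpha)}\,dx$$ (the sum being empty if $\alpha>0$). The notation $\langle\mu_{\delta-3}(db),\Sigma^\delta_r(\Phi|b)\rangle$ means this formula, with $\alpha=\delta-3$, evaluated at $\psi(b)=\Sigma^\delta_r(\Phi\,|\,b)$. Convention at $\delta=2$: here $\frac{d}{db}\Sigma^\delta_r(\Phi|b)|_{b=0}=0$, so $\langle\mu_{-1},\Sigma^2_r(\Phi|\cdot)\rangle=0$ and the factor $\frac{1}{\delta-2}$ produces a removable singularity. Since, for $\delta\in(1,3)\setminus\{2\}$ and $\psi$ with $\psi'(0)=0$, $\frac{\Gamma(\delta)}{4(\delta-2)}\langle\mu_{\delta-3},\psi\rangle=\frac{(\delta-1)(\delta-3)}{4}\int_0^\infty b^{\delta-4}(\psi(b)-\psi(0))\,db$, for $\delta=2$ the expression $\frac{\Gamma(\delta)}{4(\delta-2)}\langle\mu_{\delta-3}(db),\Sigma^\delta_r(\Phi|b)\rangle$ is understood as $-\frac14\int_0^\infty b^{-2}\big(\Sigma^2_r(\Phi|b)-\Sigma^2_r(\Phi|0)\big)\,db$. *)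

theory Defs
  imports "HOL-Probability.Probability"
begin

section \<open>Squared Bessel processes\<close>

text \<open>
  The filtration is indexed by all reals, but only times \<open>t \<ge> 0\<close> are ever used.
\<close>

definition brownian_motion_wrt ::
  "'w measure \<Rightarrow> (real \<Rightarrow> 'w measure) \<Rightarrow> (real \<Rightarrow> 'w \<Rightarrow> real) \<Rightarrow> bool" where
  "brownian_motion_wrt M F B \<longleftrightarrow>
     prob_space M \<and> filtration (space M) F \<and> (\<forall>t. sets (F t) \<subseteq> sets M) \<and>
     (\<forall>t\<ge>0. B t \<in> borel_measurable (F t)) \<and>
     (\<forall>\<omega>\<in>space M. B 0 \<omega> = 0 \<and> continuous_on {0..} (\<lambda>t. B t \<omega>)) \<and>
     (\<forall>s t. 0 \<le> s \<and> s < t \<longrightarrow>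
        distributed M lborel (\<lambda>\<omega>. B t \<omega> - B s \<omega>) (normal_density 0 (sqrt (t - s))) \<and>
        prob_space.indep_set M (sets (F s))
          (sets (vimage_algebra (space M) (\<lambda>\<omega>. B t \<omega> - B s \<omega>) borel)))"

text \<open>
  \<open>Y = \<integral>\<^sub>0\<^sup>t H\<^sub>s dB\<^sub>s\<close>. For a continuous adapted integrand \<open>H\<close> (the only case used
  here) the Ito integral is the limit in probability of the non-anticipating Riemann sums.
\<close>

definition has_ito_integral ::
  "'w measure \<Rightarrow> (real \<Rightarrow> 'w \<Rightarrow> real) \<Rightarrow> (real \<Rightarrow> 'w \<Rightarrow> real) \<Rightarrow> real \<Rightarrow> ('w \<Rightarrow> real) \<Rightarrow> bool" where
  "has_ito_integral M B H t Y \<longleftrightarrow>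
     Y \<in> borel_measurable M \<and>
     (\<forall>\<epsilon>>0. (\<lambda>n. measure M {\<omega>\<in>space M.
          \<epsilon> < \<bar>(\<Sum>i<n. H (t * real i / real n) \<omega> *
                 (B (t * real (Suc i) / real n) \<omega> - B (t * real i / real n) \<omega>)) - Y \<omega>\<bar>})
        \<longlonglongrightarrow> 0)"

text \<open>
  \<open>Z\<close> is a nonnegative (weak) solution of \<open>dZ = 2 \<surd>Z dB + \<delta> dt\<close> with \<open>Z\<^sub>0 = z\<close>.
\<close>

definition squared_bessel_process ::
  "real \<Rightarrow> real \<Rightarrow> 'w measure \<Rightarrow> (real \<Rightarrow> 'w measure) \<Rightarrow> (real \<Rightarrow> 'w \<Rightarrow> real) \<Rightarrow>
   (real \<Rightarrow> 'w \<Rightarrow> real) \<Rightarrow> bool" where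
  "squared_bessel_process \<delta> z M F B Z \<longleftrightarrow>
     brownian_motion_wrt M F B \<and>
     (\<forall>t\<ge>0. Z t \<in> borel_measurable (F t)) \<and>
     (\<forall>\<omega>\<in>space M. Z 0 \<omega> = z \<and> continuous_on {0..} (\<lambda>t. Z t \<omega>) \<and> (\<forall>t\<ge>0. 0 \<le> Z t \<omega>)) \<and>
     (\<forall>t\<ge>0. has_ito_integral M B (\<lambda>s \<omega>. 2 * sqrt (Z s \<omega>)) t (\<lambda>\<omega>. Z t \<omega> - z - \<delta> * t))"


section \<open>Laws on path space\<close>

text \<open>\<open>C([0,l])\<close> with the supremum metric; paths are \<open>undefined\<close> off \<open>[0,l]\<close>.\<close>

definition path_metric :: "real \<Rightarrow> (real \<Rightarrow> real) metric" where
  "path_metric l = cfunspace (top_of_set {0..l}) euclidean_metric"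

text \<open>
  The \<open>\<sigma>\<close>-algebra generated by the coordinates; since \<open>C([0,l])\<close> is separable, this is also
  its Borel \<open>\<sigma>\<close>-algebra.
\<close>

definition path_borel :: "real \<Rightarrow> (real \<Rightarrow> real) measure" where
  "path_borel l = restrict_space (Pi\<^sub>M {0..l} (\<lambda>_. borel)) (mspace (path_metric l))"

text \<open>
  The law on \<open>C([0,l])\<close> of the Bessel process started at \<open>a \<ge> 0\<close>. The SDE may be solved on any
  filtered probability space; asking for one whose points are functions \<open>real \<Rightarrow> real \<times> real\<close>
  is no restriction on the law, as the pair \<open>(B, Z)\<close> can always be moved to the space of its
  paths.
\<close>

definition bessel_law :: "real \<Rightarrow> real \<Rightarrow> real \<Rightarrow> (real \<Rightarrow> real) measure \<Rightarrow> bool" where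
  "bessel_law \<delta> l a R \<longleftrightarrow>
     (\<exists>(M :: (real \<Rightarrow> real \<times> real) measure) F B Z.
        squared_bessel_process \<delta> (a\<^sup>2) M F B Z \<and>
        R = distr M (path_borel l) (\<lambda>\<omega>. \<lambda>t\<in>{0..l}. sqrt (Z t \<omega>)))"

definition weakly_converges ::
  "real \<Rightarrow> ('i \<Rightarrow> (real \<Rightarrow> real) measure) \<Rightarrow> (real \<Rightarrow> real) measure \<Rightarrow> 'i filter \<Rightarrow> bool" where
  "weakly_converges l Q P \<F> \<longleftrightarrow>
     (\<forall>G K. continuous_map (mtopology_of (path_metric l)) euclideanreal G \<and>
          (\<forall>x\<in>mspace (path_metric l). \<bar>G x\<bar> \<le> K) \<longrightarrow>
        ((\<lambda>i. \<integral>x. G x \<partial>Q i) \<longlongrightarrow> (\<integral>x. G x \<partial>P)) \<F>)"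

text \<open>
  The law on \<open>C([0,l])\<close> of the Bessel bridge from \<open>a\<close> to \<open>b\<close> of length \<open>l\<close>: the weak limit,
  as \<open>\<epsilon> \<down> 0\<close>, of the Bessel process from \<open>a\<close> conditioned on \<open>\<bar>X\<^sub>l - b\<bar> \<le> \<epsilon>\<close>
  (an event of positive probability).
\<close>

definition bessel_bridge_law ::
  "real \<Rightarrow> real \<Rightarrow> real \<Rightarrow> real \<Rightarrow> (real \<Rightarrow> real) measure \<Rightarrow> bool" where
  "bessel_bridge_law \<delta> l a b P \<longleftrightarrow>
     prob_space P \<and> sets P = sets (path_borel l) \<and>
     (\<exists>R. bessel_law \<delta> l a R \<and>
        weakly_converges l (\<lambda>\<epsilon>. uniform_measure R {x\<in>space R. \<bar>x l - b\<bar> \<le> \<epsilon>}) P (at_right 0))"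

text \<open>
  Concatenation of a path on \<open>[0,r]\<close> with a path on \<open>[0,1-r]\<close>. The shift \<open>x r - y 0\<close> makes
  the result continuous for every pair of paths; it is almost surely zero below, where
  both \<open>x r\<close> and \<open>y 0\<close> equal \<open>b\<close>.
\<close>

definition path_concat :: "real \<Rightarrow> (real \<Rightarrow> real) \<Rightarrow> (real \<Rightarrow> real) \<Rightarrow> real \<Rightarrow> real" where
  "path_concat r x y = (\<lambda>t\<in>{0..1}. if t \<le> r then x t else y (t - r) + (x r - y 0))"

definition pinned_bessel_bridge_law ::
  "real \<Rightarrow> real \<Rightarrow> real \<Rightarrow> (real \<Rightarrow> real) measure \<Rightarrow> bool" where
  "pinned_bessel_bridge_law \<delta> r b Q \<longleftrightarrow>
     (\<exists>P\<^sub>1 P\<^sub>2. bessel_bridge_law \<delta> r 0 b P\<^sub>1 \<and> bessel_bridge_law \<delta> (1 - r) b 0 P\<^sub>2 \<and>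
        Q = distr (P\<^sub>1 \<Otimes>\<^sub>M P\<^sub>2) (path_borel 1) (\<lambda>(x, y). path_concat r x y))"


section \<open>The measures $\Sigma^\delta_r$\<close>

definition bessel_bridge_density :: "real \<Rightarrow> real \<Rightarrow> real \<Rightarrow> real" where
  "bessel_bridge_density \<delta> r b =
     b powr (\<delta> - 1) / (2 powr (\<delta> / 2 - 1) * Gamma (\<delta> / 2) * (r * (1 - r)) powr (\<delta> / 2)) *
     exp (- (b\<^sup>2 / (2 * r * (1 - r))))"

text \<open>\<open>bessel_bridge_density \<delta> r b / b powr (\<delta> - 1)\<close>, extended continuously to \<open>b = 0\<close>.\<close>

definition Sigma_weight :: "real \<Rightarrow> real \<Rightarrow> real \<Rightarrow> real" where
  "Sigma_weight \<delta> r b =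
     1 / (2 powr (\<delta> / 2 - 1) * Gamma (\<delta> / 2) * (r * (1 - r)) powr (\<delta> / 2)) *
     exp (- (b\<^sup>2 / (2 * r * (1 - r))))"

lemma Sigma_weight_eq:
  assumes "b > 0"
  shows "Sigma_weight \<delta> r b = bessel_bridge_density \<delta> r b / b powr (\<delta> - 1)"
  using assms by (simp add: Sigma_weight_def bessel_bridge_density_def)

text \<open>\<open>\<Sigma>\<^sup>\<delta>\<^sub>r(dX | b)\<close>, with \<open>Q\<close> the law of the bridge pinned at \<open>b\<close> at time \<open>r\<close>.\<close>

definition Sigma_measure ::
  "real \<Rightarrow> real \<Rightarrow> real \<Rightarrow> (real \<Rightarrow> real) measure \<Rightarrow> (real \<Rightarrow> real) measure" where
  "Sigma_measure \<delta> r b Q = density Q (\<lambda>_. ennreal (Sigma_weight \<delta> r b))"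


section \<open>The distributions $\mu_\alpha$\<close>

text \<open>The \<open>k\<close>-th derivative of a function on \<open>[0,\<infinity>)\<close>, one-sided at \<open>0\<close>.\<close>

definition half_line_deriv :: "nat \<Rightarrow> (real \<Rightarrow> real) \<Rightarrow> real \<Rightarrow> real" where
  "half_line_deriv k = (\<lambda>f x. vector_derivative f (at x within {0..})) ^^ k"

definition mu :: "real \<Rightarrow> (real \<Rightarrow> real) \<Rightarrow> real" where
  "mu \<alpha> \<psi> =
     (if \<alpha> \<in> \<int>\<^sub>\<le>\<^sub>0 then (let k = nat \<lfloor>- \<alpha>\<rfloor> in (- 1) ^ k * half_line_deriv k \<psi> 0)
      else (LINT x:{0<..}|lborel.
              (\<psi> x - (\<Sum>j | real j \<le> - \<alpha>. x ^ j / fact j * half_line_deriv j \<psi> 0)) *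
              (x powr (\<alpha> - 1) / Gamma \<alpha>)))"

text \<open>
  \<open>\<Gamma>(\<delta>) / (4 (\<delta> - 2)) \<langle>\<mu>\<^bsub>\<delta>-3\<^esub>, \<psi>\<rangle>\<close>, with the removable singularity at \<open>\<delta> = 2\<close>
  (for \<open>\<psi>'(0) = 0\<close>) filled in.
\<close>

definition boundary_term :: "real \<Rightarrow> (real \<Rightarrow> real) \<Rightarrow> real" where
  "boundary_term \<delta> \<psi> =
     (if \<delta> = 2 then - (1 / 4) * (LINT b:{0<..}|lborel. b powr (- 2) * (\<psi> b - \<psi> 0))
      else Gamma \<delta> / (4 * (\<delta> - 2)) * mu (\<delta> - 3) \<psi>)"


section \<open>Functionals and test functions\<close>

definition inner01 :: "(real \<Rightarrow> real) \<Rightarrow> (real \<Rightarrow> real) \<Rightarrow> real" where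
  "inner01 f g = (LINT r:{0..1}|lborel. f r * g r)"

definition directional_deriv ::
  "(real \<Rightarrow> real) \<Rightarrow> ((real \<Rightarrow> real) \<Rightarrow> real) \<Rightarrow> (real \<Rightarrow> real) \<Rightarrow> real" where
  "directional_deriv h \<Phi> X = Lim (at 0) (\<lambda>\<epsilon>. (\<Phi> (\<lambda>r. X r + \<epsilon> * h r) - \<Phi> X) / \<epsilon>)"

text \<open>\<open>C\<^sup>2\<^sub>c(0,1)\<close>, its elements being extended by zero to the whole line.\<close>

definition C2_compact_support :: "(real \<Rightarrow> real) set" where
  "C2_compact_support =
     {h. (\<forall>x. h differentiable at x) \<and> (\<forall>x. deriv h differentiable at x) \<and>
         continuous_on UNIV (deriv (deriv h)) \<and> closure {x. h x \<noteq> 0} \<subseteq> {0<..<1}}"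

end

theory Submission
  imports Defs
begin

text \<open>
  Since \<open>x = \<integral>\<^sub>0\<^sup>\<infinity> (\<pi> a) powr (- 1 / 2) x\<^sup>2 exp (- a x\<^sup>2) da\<close> for \<open>x \<ge> 0\<close>, everything is a mixture of
  expectations of \<open>X\<^sub>s\<^sup>2 exp (- a X\<^sub>s\<^sup>2)\<close>, and these are explicit: the exponential martingales of the
  Riemann sums of the Ito integral yield the Laplace transform of the squared Bessel process.
  As a function of \<open>b\<close>, the value of \<open>\<Sigma>\<^sub>r(\<cdot> | b)\<close> on such a functional is
  \<open>(\<alpha> + \<beta> b\<^sup>2) exp (- A b\<^sup>2)\<close>, so that \<open>\<mu>\<close> acts on it through Gamma integrals, and the outcome is
  \<open>- \<partial>\<^sub>r\<^sup>2\<close> of the kernel \<open>E[X\<^sub>r X\<^sub>s\<^sup>2 exp (- a X\<^sub>s\<^sup>2)]\<close> for \<open>r \<noteq> s\<close>. Integrating by parts twice in \<open>r\<close>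
  leaves the jump of \<open>\<partial>\<^sub>r\<close> of the kernel at \<open>r = s\<close>, whose integral against the mixing weight is \<open>- 1\<close>.
\<close>

section \<open>Laplace transforms of squared Bessel processes\<close>

text \<open>Two obstacles shape the proof. First, \<open>has_ito_integral\<close> speaks only of the
  unweighted integrand \<open>2 * sqrt Z\<close> on equidistant partitions, while the exponential
  martingale that linearises the process needs the time dependent weight
  \<open>lam / (1 + 2 * lam * (t - u))\<close>, the solution of the Riccati equation
  \<open>ell' = 2 * ell^2\<close>. The weight is therefore frozen on coarse cells, each of which is
  filled with a much finer mesh. Second, the mean of \<open>X s\<close> under a bridge with one end
  at \<open>b\<close> is a confluent hypergeometric function of \<open>b\<close>; squares times
  Gaussian factors have elementary means, and this is what the mixing over \<open>a\<close> buys.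
  The price is integrability: the kernels are singular where the covariance determinant vanishes, at
  \<open>s = 0\<close>, \<open>s = 1\<close> and \<open>s = r\<close>, and they decay slowly in
  \<open>a\<close>, so every exchange of integrals rests on one domination with carefully balanced
  exponents. The distributions \<open>mu\<close> change their form with \<delta>, but on Gaussian
  mixtures they have one value valid for every \<delta>, so no case distinction survives beyond that
  point.\<close>

lemma nn_integral_normal_exp_tilt:
  fixes \<xi> w :: real
  assumes "w > 0"
  shows "(\<integral>\<^sup>+x. ennreal (exp (- \<xi> * x - \<xi>\<^sup>2 * w / 2)) \<partial>density lborel (normal_density 0 (sqrt w))) = 1"
proof -
  \<comment> \<open>Completing the square: the tilt moves the mean to \<open>- \<xi> * w\<close>,
    keeps the variance and leaves no constant.\<close>
  have "normal_density 0 (sqrt w) x * exp (- \<xi> * x - \<xi>\<^sup>2 * w / 2) = normal_density (- \<xi> * w) (sqrt w) x" for x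
  proof -
    have "- (x\<^sup>2 / (2 * w)) + (- \<xi> * x - \<xi>\<^sup>2 * w / 2) = - ((x + \<xi> * w)\<^sup>2 / (2 * w))"
      using assms by (simp add: field_simps power2_eq_square)
    then show ?thesis
      using assms by (simp add: normal_density_def mult_exp_exp)
  qed
  then have "(\<integral>\<^sup>+x. ennreal (exp (- \<xi> * x - \<xi>\<^sup>2 * w / 2)) \<partial>density lborel (normal_density 0 (sqrt w))) =
      (\<integral>\<^sup>+x. ennreal (normal_density (- \<xi> * w) (sqrt w) x) \<partial>lborel)"
    by (simp add: nn_integral_density ennreal_mult'[symmetric])
  also have "\<dots> = emeasure (density lborel (normal_density (- \<xi> * w) (sqrt w))) UNIV"
    by (simp add: emeasure_density)
  also have "\<dots> = 1"
    using prob_space.emeasure_space_1[OF prob_space_normal_density[of "sqrt w" "- \<xi> * w"]] assms by simp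
  finally show ?thesis .
qed

section \<open>Exponential martingales of a squared Bessel process on a mesh\<close>

locale squared_bessel =
  fixes \<delta> z :: real and M :: "'w measure" and F :: "real \<Rightarrow> 'w measure"
    and B Z :: "real \<Rightarrow> 'w \<Rightarrow> real"
  assumes sbp: "squared_bessel_process \<delta> z M F B Z"
begin

lemma bm: "brownian_motion_wrt M F B" and
  Z_adapted: "0 \<le> t \<Longrightarrow> Z t \<in> borel_measurable (F t)" and
  Z_0: "om \<in> space M \<Longrightarrow> Z 0 om = z" and
  Z_cont: "om \<in> space M \<Longrightarrow> continuous_on {0..} (\<lambda>t. Z t om)" and
  Z_nonneg: "om \<in> space M \<Longrightarrow> 0 \<le> t \<Longrightarrow> 0 \<le> Z t om" and
  Z_ito: "0 \<le> t \<Longrightarrow> has_ito_integral M B (\<lambda>s om. 2 * sqrt (Z s om)) t (\<lambda>om. Z t om - z - \<delta> * t)"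
  using sbp unfolding squared_bessel_process_def by blast+

lemma prob_space_M: "prob_space M"
  using bm unfolding brownian_motion_wrt_def by blast

sublocale prob_space M by (rule prob_space_M)

lemma space_F [simp]: "space (F t) = space M" and
  sets_F_mono: "s \<le> t \<Longrightarrow> sets (F s) \<subseteq> sets (F t)" and
  sets_F: "sets (F t) \<subseteq> sets M" and
  B_adapted: "0 \<le> t \<Longrightarrow> B t \<in> borel_measurable (F t)"
  using bm unfolding brownian_motion_wrt_def filtration_def by auto

lemma measurable_F_mono: "f \<in> measurable (F s) N \<Longrightarrow> s \<le> t \<Longrightarrow> f \<in> measurable (F t) N"
  by (rule measurable_from_subalg) (auto simp: subalgebra_def sets_F_mono[THEN subsetD])

lemma measurable_F: "f \<in> measurable (F s) N \<Longrightarrow> f \<in> measurable M N"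
  by (rule measurable_from_subalg) (auto simp: subalgebra_def sets_F[THEN subsetD])

lemma Z_measurable [measurable (raw)]: "0 \<le> t \<Longrightarrow> Z t \<in> borel_measurable M"
  using Z_adapted measurable_F by blast

lemma B_measurable [measurable (raw)]: "0 \<le> t \<Longrightarrow> B t \<in> borel_measurable M"
  using B_adapted measurable_F by blast

text \<open>Given \<open>F u\<close> the increment is centred normal with variance
  \<open>v - u\<close>, while \<open>Y\<close> and the slope \<open>\<xi>\<close> are known at time
  \<open>u\<close>. So the slope may be treated as a constant, and the tilted normal density
  integrates to 1. \<open>Y\<close> is \<open>ennreal\<close> valued, which keeps integrability out
  of the argument.\<close>

lemma exponential_step:
  assumes uv: "0 \<le> u" "u < v" and Y: "Y \<in> borel_measurable (F u)" and \<xi>: "\<xi> \<in> borel_measurable (F u)"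
  shows "(\<integral>\<^sup>+om. Y om * ennreal (exp (- \<xi> om * (B v om - B u om) - (\<xi> om)\<^sup>2 * (v - u) / 2)) \<partial>M) =
    (\<integral>\<^sup>+om. Y om \<partial>M)"
proof -
  note [measurable] = measurable_F[OF Y] measurable_F[OF \<xi>]
  have [measurable]: "B u \<in> borel_measurable M" "B v \<in> borel_measurable M" using uv by auto
  let ?X = "\<lambda>om. (Y om, \<xi> om)" and ?W = "\<lambda>om. B v om - B u om"
  let ?N = "density lborel (normal_density 0 (sqrt (v - u)))"
  have dist: "distributed M lborel ?W (normal_density 0 (sqrt (v - u)))" and
    ind: "indep_set (sets (F u)) (sets (vimage_algebra (space M) ?W borel))"
    using bm uv unfolding brownian_motion_wrt_def by auto
  \<comment> \<open>\<open>indep_var\<close> relates random variables of one common value type; the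
    constant first component gives the increment the type of the pair \<open>?X\<close>.\<close>
  let ?W' = "\<lambda>om. (0 :: ennreal, ?W om)"
  have "indep_var (borel \<Otimes>\<^sub>M borel) ?X (borel \<Otimes>\<^sub>M borel) ?W'"
    unfolding indep_var_eq
  proof (intro conjI)
    have X: "?X \<in> measurable (F u) (borel \<Otimes>\<^sub>M borel)" using Y \<xi> by measurable
    have "{?X -` A \<inter> space M |A. A \<in> sets (borel \<Otimes>\<^sub>M borel)} \<subseteq> sets (F u)"
      using measurable_sets[OF X] by auto
    then have 1: "sigma_sets (space M) {?X -` A \<inter> space M |A. A \<in> sets (borel \<Otimes>\<^sub>M borel)} \<subseteq> sets (F u)"
      using sets.sigma_sets_subset[of _ "F u"] by simp
    have "?W \<in> measurable (vimage_algebra (space M) ?W borel) borel"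
      by (rule measurable_vimage_algebra1) auto
    then have "?W' \<in> measurable (vimage_algebra (space M) ?W borel) (borel \<Otimes>\<^sub>M borel)"
      by measurable
    from measurable_sets[OF this]
    have "{?W' -` A \<inter> space M |A. A \<in> sets (borel \<Otimes>\<^sub>M borel)} \<subseteq> sets (vimage_algebra (space M) ?W borel)"
      by auto
    then have 2: "sigma_sets (space M) {?W' -` A \<inter> space M |A. A \<in> sets (borel \<Otimes>\<^sub>M borel)} \<subseteq> sets (vimage_algebra (space M) ?W borel)"
      using sets.sigma_sets_subset[of _ "vimage_algebra (space M) ?W borel"] by simp
    show "indep_set (sigma_sets (space M) {?X -` A \<inter> space M |A. A \<in> sets (borel \<Otimes>\<^sub>M borel)})
       (sigma_sets (space M) {?W' -` A \<inter> space M |A. A \<in> sets (borel \<Otimes>\<^sub>M borel)})"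
      using ind 1 2 unfolding indep_sets2_eq by blast
  qed measurable
  then have eq: "distr M (borel \<Otimes>\<^sub>M borel) ?X \<Otimes>\<^sub>M distr M (borel \<Otimes>\<^sub>M borel) ?W' =
      distr M ((borel \<Otimes>\<^sub>M borel) \<Otimes>\<^sub>M (borel \<Otimes>\<^sub>M borel)) (\<lambda>om. (?X om, ?W' om))"
    unfolding indep_var_distribution_eq by blast
  have N: "distr M borel ?W = ?N"
    using distributed_distr_eq_density[OF dist] by (metis distr_cong sets_lborel)
  let ?W2 = "distr M (borel \<Otimes>\<^sub>M borel) ?W'"
  interpret N: prob_space ?W2 by (rule prob_space_distr) measurable
  let ?g = "\<lambda>(p :: ennreal \<times> real, x :: ennreal \<times> real). fst p * ennreal (exp (- snd p * snd x - (snd p)\<^sup>2 * (v - u) / 2))"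
  have "(\<integral>\<^sup>+om. Y om * ennreal (exp (- \<xi> om * (B v om - B u om) - (\<xi> om)\<^sup>2 * (v - u) / 2)) \<partial>M) =
      (\<integral>\<^sup>+y. ?g y \<partial>distr M ((borel \<Otimes>\<^sub>M borel) \<Otimes>\<^sub>M (borel \<Otimes>\<^sub>M borel)) (\<lambda>om. (?X om, ?W' om)))"
    by (subst nn_integral_distr) auto
  also have "\<dots> = (\<integral>\<^sup>+y. ?g y \<partial>(distr M (borel \<Otimes>\<^sub>M borel) ?X \<Otimes>\<^sub>M ?W2))"
    using eq by simp
  also have "\<dots> = (\<integral>\<^sup>+p. (\<integral>\<^sup>+x. ?g (p, x) \<partial>?W2) \<partial>distr M (borel \<Otimes>\<^sub>M borel) ?X)"
    by (subst N.nn_integral_fst) auto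
  also have "\<dots> = (\<integral>\<^sup>+p. fst p \<partial>distr M (borel \<Otimes>\<^sub>M borel) ?X)"
  proof (intro nn_integral_cong)
    fix p :: "ennreal \<times> real"
    have "(\<integral>\<^sup>+x. ?g (p, x) \<partial>?W2) = (\<integral>\<^sup>+om. fst p * ennreal (exp (- snd p * ?W om - (snd p)\<^sup>2 * (v - u) / 2)) \<partial>M)"
      by (subst nn_integral_distr) auto
    also have "\<dots> = (\<integral>\<^sup>+x. fst p * ennreal (exp (- snd p * x - (snd p)\<^sup>2 * (v - u) / 2)) \<partial>?N)"
      unfolding N[symmetric] by (subst nn_integral_distr) auto
    also have "\<dots> = fst p"
      using nn_integral_normal_exp_tilt[of "v - u" "snd p"] uv
      by (simp add: nn_integral_cmult)
    finally show "(\<integral>\<^sup>+x. ?g (p, x) \<partial>?W2) = fst p" .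
  qed
  also have "\<dots> = (\<integral>\<^sup>+om. Y om \<partial>M)"
    by (subst nn_integral_distr) auto
  finally show ?thesis .
qed

text \<open>The logarithm of a discrete exponential martingale with integrand
  \<open>- l k * (2 * sqrt Z)\<close>: the subtracted term is half the squared integrand times the
  mesh width.\<close>

definition expo :: "(nat \<Rightarrow> real) \<Rightarrow> real \<Rightarrow> nat \<Rightarrow> nat \<Rightarrow> 'w \<Rightarrow> real" where
  "expo l d i j om = (\<Sum>k=i..<j. - (l k * (2 * sqrt (Z (real k * d) om))) * (B (real (Suc k) * d) om - B (real k * d) om)
      - 2 * (l k)\<^sup>2 * Z (real k * d) om * d)"

lemma expo_measurable [measurable]:
  assumes "0 \<le> d"
  shows "expo l d i j \<in> borel_measurable M"
proof -
  have [measurable]: "Z (real k * d) \<in> borel_measurable M" "B (real k * d) \<in> borel_measurable M" for k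
    using assms by auto
  show ?thesis unfolding expo_def[abs_def] by measurable
qed

text \<open>The martingale property: the last increment is peeled off by
  \<open>exponential_step\<close>, all earlier ones being measurable at its left end and absorbed
  into \<open>Y\<close>.\<close>

lemma nn_integral_expo:
  assumes d: "0 < d" and ij: "i \<le> j" and Y: "Y \<in> borel_measurable (F (real i * d))"
  shows "(\<integral>\<^sup>+om. Y om * ennreal (exp (expo l d i j om)) \<partial>M) = (\<integral>\<^sup>+om. Y om \<partial>M)"
  using ij
proof (induction j rule: dec_induct)
  case base
  then show ?case by (simp add: expo_def)
next
  case (step n)
  define \<xi> where "\<xi> = (\<lambda>om. l n * (2 * sqrt (Z (real n * d) om)))"
  have \<xi>: "\<xi> \<in> borel_measurable (F (real n * d))"
    unfolding \<xi>_def using Z_adapted[of "real n * d"] d by simp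
  have E: "expo l d i n \<in> borel_measurable (F (real n * d))"
    unfolding expo_def[abs_def]
  proof (intro borel_measurable_sum borel_measurable_diff borel_measurable_times borel_measurable_const borel_measurable_uminus)
    fix k assume k: "k \<in> {i..<n}"
    have m: "real k * d \<le> real n * d" "real (Suc k) * d \<le> real n * d"
      using k d by (auto intro!: mult_right_mono)
    show Zk: "Z (real k * d) \<in> borel_measurable (F (real n * d))"
      using Z_adapted[of "real k * d"] measurable_F_mono[OF _ m(1)] d by simp
    show "(\<lambda>om. sqrt (Z (real k * d) om)) \<in> borel_measurable (F (real n * d))" using Zk by measurable
    show "B (real k * d) \<in> borel_measurable (F (real n * d))"
      using B_adapted[of "real k * d"] measurable_F_mono[OF _ m(1)] d by simp
    show "B (real (Suc k) * d) \<in> borel_measurable (F (real n * d))"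
      using B_adapted[of "real (Suc k) * d"] measurable_F_mono[OF _ m(2)] d by simp
  qed
  have Y': "(\<lambda>om. Y om * ennreal (exp (expo l d i n om))) \<in> borel_measurable (F (real n * d))"
  proof -
    have "real i * d \<le> real n * d" using step(1) d by simp
    note [measurable] = E measurable_F_mono[OF Y this]
    show ?thesis by measurable
  qed
  have "Y om * ennreal (exp (expo l d i (Suc n) om)) = (Y om * ennreal (exp (expo l d i n om))) *
     ennreal (exp (- \<xi> om * (B (real (Suc n) * d) om - B (real n * d) om) - (\<xi> om)\<^sup>2 * (real (Suc n) * d - real n * d) / 2))" 
     if "om \<in> space M" for om
  proof -
    have "real (Suc n) * d - real n * d = d" by (simp add: algebra_simps)
    moreover have "(\<xi> om)\<^sup>2 = 4 * (l n)\<^sup>2 * Z (real n * d) om"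
      using Z_nonneg[OF that, of "real n * d"] d by (simp add: \<xi>_def power_mult_distrib)
    ultimately have "expo l d i (Suc n) om = expo l d i n om + (- \<xi> om * (B (real (Suc n) * d) om - B (real n * d) om) - (\<xi> om)\<^sup>2 * (real (Suc n) * d - real n * d) / 2)"
      using step(1) by (simp add: expo_def \<xi>_def)
    then show ?thesis by (simp add: exp_add ennreal_mult' mult.assoc)
  qed
  then have "(\<integral>\<^sup>+om. Y om * ennreal (exp (expo l d i (Suc n) om)) \<partial>M) =
     (\<integral>\<^sup>+om. (Y om * ennreal (exp (expo l d i n om))) *
     ennreal (exp (- \<xi> om * (B (real (Suc n) * d) om - B (real n * d) om) - (\<xi> om)\<^sup>2 * (real (Suc n) * d - real n * d) / 2)) \<partial>M)"
    by (intro nn_integral_cong) auto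
  also have "\<dots> = (\<integral>\<^sup>+om. Y om * ennreal (exp (expo l d i n om)) \<partial>M)"
    using d by (intro exponential_step[OF _ _ Y' \<xi>]) auto
  finally show ?case using step.IH by simp
qed

end

section \<open>The pathwise limit of the exponent\<close>

lemma tendsto_0_approxI:
  fixes A b :: "nat \<Rightarrow> real"
  assumes K: "K \<ge> 0" and b: "b \<longlonglongrightarrow> 0" and A: "\<And>\<eta>. \<eta> > 0 \<Longrightarrow> \<forall>\<^sub>F m in sequentially. \<bar>A m\<bar> \<le> b m + K * \<eta>"
  shows "A \<longlonglongrightarrow> 0"
proof (rule tendstoI)
  fix e :: real assume e: "e > 0"
  define \<eta> where "\<eta> = e / (2 * (K + 1))"
  have \<eta>: "\<eta> > 0" "K * \<eta> < e / 2"
    using e K by (auto simp: \<eta>_def field_simps)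
  have "\<forall>\<^sub>F m in sequentially. b m < e / 2"
    using order_tendstoD(2)[OF b, of "e / 2"] e by simp
  with A[OF \<eta>(1)] show "\<forall>\<^sub>F m in sequentially. dist (A m) 0 < e"
    by eventually_elim (use \<eta> in auto)
qed

text \<open>The weight \<open>ell\<close> solves the Riccati equation
  \<open>ell' = 2 * ell^2\<close> with \<open>ell t = lam\<close>. Summation by parts against
  \<open>R\<close>, which is close to \<open>\<zeta> - z - \<delta> * time\<close>, turns the
  derivative of \<open>ell\<close> into a term that cancels \<open>2 * ell^2 * \<zeta>\<close>; the
  boundary values and \<delta> times the integral of \<open>ell\<close>, half of the logarithm,
  remain. The statement is deterministic: \<open>R m k\<close> stands for the Riemann sum up to the
  coarse time \<open>a * k / m\<close>, and \<open>ell\<close> is frozen on each coarse cell. The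
  sign of \<open>lam\<close> is left free, since negative values later give exponential
  moments.\<close>

lemma exponent_limit:
  fixes a lam z \<delta> :: real and p q :: nat and \<zeta> :: "real \<Rightarrow> real" and R :: "nat \<Rightarrow> nat \<Rightarrow> real" and n :: "nat \<Rightarrow> nat"
  defines "s \<equiv> a * p" and "t \<equiv> a * q"
  defines "ell \<equiv> \<lambda>u. lam / (1 + 2 * lam * (t - u))"
  assumes a: "a > 0" and pq: "p < q" and pos: "1 + 2 * lam * (t - s) > 0"
    and \<zeta>: "continuous_on {0..} \<zeta>" and n: "\<And>m. n m > 0"
    and R: "\<forall>\<^sub>F m in sequentially. \<forall>k\<le>q * m. \<bar>R m k - (\<zeta> (a * k / m) - z - \<delta> * (a * k / m))\<bar> \<le> (1/4) ^ m"
  shows "(\<lambda>m. \<Sum>k=p*m..<q*m. - ell (a * k / m) * (R m (Suc k) - R m k) -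
      2 * (ell (a * k / m))\<^sup>2 * (a / (real m * real (n m))) * (\<Sum>i=k*n m..<Suc k*n m. \<zeta> (real i * (a / (real m * real (n m))))))
    \<longlonglongrightarrow> - lam * \<zeta> t + ell s * \<zeta> s + \<delta> / 2 * ln (1 + 2 * lam * (t - s))"
proof -
  define T where "T m k = a * real k / real m" for m k :: nat
  define E where "E m k = R m k - (\<zeta> (T m k) - z - \<delta> * T m k)" for m k
  define L where "L m k = ell (T m k)" for m k
  define x where "x m k = 1 + 2 * lam * (t - T m k)" for m k
  define d where "d m = a / (real m * real (n m))" for m
  define \<kappa> where "\<kappa> = min 1 (1 + 2 * lam * (t - s))"
  define \<Lambda> where "\<Lambda> = \<bar>lam\<bar> / \<kappa>"
  have \<kappa>: "\<kappa> > 0" using pos by (simp add: \<kappa>_def)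
  have st: "s < t" "0 \<le> s" using a pq by (auto simp: s_def t_def)
  \<comment> \<open>The minimum in \<open>\<kappa>\<close> serves both signs of \<open>lam\<close>:
    the denominator is smallest at \<open>u = t\<close> or at \<open>u = s\<close>.\<close>
  have den: "1 + 2 * lam * (t - u) \<ge> \<kappa>" if "s \<le> u" "u \<le> t" for u
  proof (cases "lam \<ge> 0")
    case True
    then show ?thesis using that by (simp add: \<kappa>_def min_le_iff_disj)
  next
    case False
    then have "lam * (t - s) \<le> lam * (t - u)" using that by (intro mult_left_mono_neg) auto
    then show ?thesis by (simp add: \<kappa>_def min_le_iff_disj)
  qed
  have \<Lambda>: "\<bar>ell u\<bar> \<le> \<Lambda>" if "s \<le> u" "u \<le> t" for u
    using den[OF that] \<kappa> by (simp add: ell_def \<Lambda>_def frac_le)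
  have \<Lambda>0: "\<Lambda> \<ge> 0" using \<kappa> by (simp add: \<Lambda>_def)
  have Trange: "s \<le> T m k" "T m k \<le> t" if "m > 0" "p * m \<le> k" "k \<le> q * m" for m k
  proof -
    have "real p * real m \<le> real k" "real k \<le> real q * real m"
      using that by (metis of_nat_mult of_nat_le_iff)+
    then show "s \<le> T m k" "T m k \<le> t" using a that by (simp_all add: T_def s_def t_def field_simps)
  qed
  have xpos: "x m k > 0" if "m > 0" "p * m \<le> k" "k \<le> q * m" for m k
    using den[OF Trange[OF that]] \<kappa> by (simp add: x_def)
  have Lx: "L m k = lam / x m k" for m k by (simp add: L_def ell_def x_def)
  have L\<Lambda>: "\<bar>L m k\<bar> \<le> \<Lambda>" if "m > 0" "p * m \<le> k" "k \<le> q * m" for m k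
    unfolding L_def using \<Lambda>[OF Trange[OF that]] .
  have TSuc: "T m (Suc k) = T m k + a / m" for m k
    by (simp add: T_def field_simps add_divide_distrib)
  have xSuc: "x m k = x m (Suc k) + 2 * lam * (a / m)" for m k
    by (simp add: x_def TSuc algebra_simps)
  \<comment> \<open>The Riccati equation in an exact discrete form, because the denominator of
    \<open>L\<close> is affine in \<open>k\<close>.\<close>
  have LSuc: "L m (Suc k) - L m k = 2 * (a / m) * L m k * L m (Suc k)" if "m > 0" "p * m \<le> k" "k < q * m" for m k
    using xpos[of m k] xpos[of m "Suc k"] that unfolding Lx
    by (simp add: field_simps xSuc[of m k])
  have LSuc': "\<bar>L m (Suc k) - L m k\<bar> \<le> 2 * (a / m) * \<Lambda>\<^sup>2" if "m > 0" "p * m \<le> k" "k < q * m" for m k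
  proof -
    have "\<bar>L m k * L m (Suc k)\<bar> \<le> \<Lambda> * \<Lambda>"
      unfolding abs_mult using L\<Lambda>[of m k] L\<Lambda>[of m "Suc k"] that by (intro mult_mono) auto
    then have "2 * (a / m) * \<bar>L m k * L m (Suc k)\<bar> \<le> 2 * (a / m) * \<Lambda>\<^sup>2"
      unfolding power2_eq_square using a by (intro mult_left_mono) auto
    then show ?thesis unfolding LSuc[OF that] using a by (simp add: abs_mult mult.assoc)
  qed
  \<comment> \<open>What is left after summation by parts: \<open>A1\<close> comes from replacing
    \<open>R\<close> by the path, \<open>A2\<close> from the cancellation with the path frozen at
    the right end of each coarse cell, and \<open>A3\<close> is the Riemann sum of
    \<open>ell\<close>.\<close>
  define A1 where "A1 m = (\<Sum>k=p*m..<q*m. - L m k * (E m (Suc k) - E m k))" for m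
  define A2 where "A2 m = (\<Sum>k=p*m..<q*m. \<Sum>i=k*n m..<Suc k*n m.
      2 * d m * (L m k * L m (Suc k) * \<zeta> (T m (Suc k)) - (L m k)\<^sup>2 * \<zeta> (i * d m)))" for m
  define A3 where "A3 m = (\<Sum>k=p*m..<q*m. L m k * (a / m))" for m
  have decomp: "(\<Sum>k=p*m..<q*m. - L m k * (R m (Suc k) - R m k) -
      2 * (L m k)\<^sup>2 * d m * (\<Sum>i=k*n m..<Suc k*n m. \<zeta> (i * d m)))
      = A1 m + A2 m + \<delta> * A3 m + (ell s * \<zeta> s - lam * \<zeta> t)" if m: "m > 0" for m
  proof -
    have card: "real (Suc k * n m - k * n m) * d m = a / m" for k
      using n[of m] m by (simp add: d_def field_simps)
    have "- L m k * (R m (Suc k) - R m k) - 2 * (L m k)\<^sup>2 * d m * (\<Sum>i=k*n m..<Suc k*n m. \<zeta> (i * d m)) =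
      - L m k * (E m (Suc k) - E m k) + (\<Sum>i=k*n m..<Suc k*n m.
      2 * d m * (L m k * L m (Suc k) * \<zeta> (T m (Suc k)) - (L m k)\<^sup>2 * \<zeta> (i * d m)))
      + \<delta> * (L m k * (a / m)) - (L m (Suc k) * \<zeta> (T m (Suc k)) - L m k * \<zeta> (T m k))"
      if k: "k \<in> {p*m..<q*m}" for k
    proof -
      have 1: "(\<Sum>i=k*n m..<Suc k*n m. 2 * d m * (L m k * L m (Suc k) * \<zeta> (T m (Suc k)) - (L m k)\<^sup>2 * \<zeta> (i * d m)))
        = 2 * (real (Suc k * n m - k * n m) * d m) * L m k * L m (Suc k) * \<zeta> (T m (Suc k)) -
          2 * (L m k)\<^sup>2 * d m * (\<Sum>i=k*n m..<Suc k*n m. \<zeta> (i * d m))"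
        by (simp add: right_diff_distrib sum_subtractf sum_distrib_left mult.assoc mult.left_commute)
      have 2: "2 * (a / m) * L m k * L m (Suc k) * \<zeta> (T m (Suc k)) = (L m (Suc k) - L m k) * \<zeta> (T m (Suc k))"
        using LSuc[of m k] k m by simp
      have 3: "R m (Suc k) - R m k = (E m (Suc k) - E m k) + (\<zeta> (T m (Suc k)) - \<zeta> (T m k)) - \<delta> * (a / m)"
        by (simp add: E_def TSuc algebra_simps)
      show ?thesis unfolding 1 card 2 3 by (simp add: algebra_simps)
    qed
    then have "(\<Sum>k=p*m..<q*m. - L m k * (R m (Suc k) - R m k) -
      2 * (L m k)\<^sup>2 * d m * (\<Sum>i=k*n m..<Suc k*n m. \<zeta> (i * d m))) =
      A1 m + A2 m + \<delta> * A3 m - (\<Sum>k=p*m..<q*m. L m (Suc k) * \<zeta> (T m (Suc k)) - L m k * \<zeta> (T m k))"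
      unfolding A1_def A2_def A3_def
      by (simp add: sum.distrib sum_subtractf sum_distrib_left sum_negf)
    also have "(\<Sum>k=p*m..<q*m. L m (Suc k) * \<zeta> (T m (Suc k)) - L m k * \<zeta> (T m k)) = 
        L m (q*m) * \<zeta> (T m (q*m)) - L m (p*m) * \<zeta> (T m (p*m))"
      using pq by (intro sum_Suc_diff'[of "p*m" "q*m" "\<lambda>k. L m k * \<zeta> (T m k)"]) auto
    also have "T m (q * m) = t" "T m (p * m) = s" using m by (auto simp: T_def s_def t_def)
    ultimately show ?thesis using m by (simp add: L_def T_def[of m "q*m"] T_def[of m "p*m"] s_def t_def ell_def)
  qed
  \<comment> \<open>There are \<open>(q - p) * m\<close> cells, each with an error of order
    \<open>(1/4) ^ m\<close>: the geometric rate in the hypothesis \<open>R\<close> beats the number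
    of cells.\<close>
  have A1: "A1 \<longlonglongrightarrow> 0"
  proof (rule Lim_null_comparison)
    have "\<forall>\<^sub>F m in sequentially. m > (0::nat)" by (rule eventually_gt_at_top)
    with R show "\<forall>\<^sub>F m in sequentially. norm (A1 m) \<le> (2 * \<Lambda> * (q - p)) * (real m * (1/4) ^ m)"
    proof eventually_elim
      case (elim m)
      have E: "\<bar>E m k\<bar> \<le> (1/4) ^ m" if "k \<le> q * m" for k
        using elim(1) that by (simp add: E_def T_def)
      have "\<bar>A1 m\<bar> \<le> (\<Sum>k=p*m..<q*m. \<Lambda> * (2 * (1/4) ^ m))"
        unfolding A1_def
      proof (intro order_trans[OF sum_abs] sum_mono)
        fix k assume k: "k \<in> {p*m..<q*m}"
        have "\<bar>E m (Suc k) - E m k\<bar> \<le> 2 * (1/4) ^ m"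
          using E[of k] E[of "Suc k"] k by (auto simp: abs_le_iff)
        then show "\<bar>- L m k * (E m (Suc k) - E m k)\<bar> \<le> \<Lambda> * (2 * (1 / 4) ^ m)"
          unfolding abs_mult using L\<Lambda>[of m k] k elim by (intro mult_mono) auto
      qed
      also have "\<dots> = (2 * \<Lambda> * (q - p)) * (real m * (1/4) ^ m)"
        using pq by (simp add: of_nat_diff diff_mult_distrib[symmetric] field_simps)
      finally show ?case by simp
    qed
    show "(\<lambda>m. (2 * \<Lambda> * (q - p)) * (real m * (1/4) ^ m)) \<longlonglongrightarrow> 0"
      by (intro tendsto_mult_right_zero powser_times_n_limit_0) auto
  qed
  have A2: "A2 \<longlonglongrightarrow> 0"
  proof -
    have \<zeta>': "continuous_on {0..t} \<zeta>" using \<zeta> by (rule continuous_on_subset) auto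
    obtain C where "\<forall>x\<in>\<zeta> ` {0..t}. norm x \<le> C"
      using compact_imp_bounded[OF compact_continuous_image[OF \<zeta>' compact_Icc]] unfolding bounded_iff by blast
    then have C: "\<bar>\<zeta> u\<bar> \<le> C" if "u \<in> {0..t}" for u using that by auto
    have uc: "uniformly_continuous_on {0..t} \<zeta>" by (rule compact_uniformly_continuous[OF \<zeta>' compact_Icc])
    let ?b = "\<lambda>m. (4 * (q - p) * a * a * \<Lambda>^3 * C) * (1 / real m)"
    have C0: "C \<ge> 0" using C[of 0] st by force
    show ?thesis
    proof (rule tendsto_0_approxI[where b = ?b and K = "2 * (q - p) * a * \<Lambda>\<^sup>2"])
      show "?b \<longlonglongrightarrow> 0" by (intro tendsto_mult_right_zero lim_1_over_n)
      fix \<eta> :: real assume "\<eta> > 0"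
      then obtain \<rho> where \<rho>: "\<rho> > 0" "\<And>u v. u \<in> {0..t} \<Longrightarrow> v \<in> {0..t} \<Longrightarrow> \<bar>v - u\<bar> < \<rho> \<Longrightarrow> \<bar>\<zeta> v - \<zeta> u\<bar> < \<eta>"
        using uc unfolding uniformly_continuous_on_def dist_real_def by blast
      have "(\<lambda>m. a * (1 / real m)) \<longlonglongrightarrow> 0" by (intro tendsto_mult_right_zero lim_1_over_n)
      from order_tendstoD(2)[OF this \<rho>(1)] have "\<forall>\<^sub>F m in sequentially. a * (1 / real m) < \<rho>" .
      with eventually_gt_at_top[of "0::nat"]
      show "\<forall>\<^sub>F m in sequentially. \<bar>A2 m\<bar> \<le> ?b m + 2 * (q - p) * a * \<Lambda>\<^sup>2 * \<eta>"
      proof eventually_elim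
        case (elim m)
        have dm: "d m > 0" using elim a n[of m] by (simp add: d_def)
        have "\<bar>A2 m\<bar> \<le> (\<Sum>k=p*m..<q*m. \<Sum>i=k*n m..<Suc k*n m. 2 * d m * (2 * (a / m) * \<Lambda>\<^sup>2 * \<Lambda> * C + \<Lambda>\<^sup>2 * \<eta>))"
          unfolding A2_def
        proof (intro order_trans[OF sum_abs] sum_mono)
          fix k i assume k: "k \<in> {p*m..<q*m}" and i: "i \<in> {k*n m..<Suc k*n m}"
          have r1: "T m k \<le> i * d m" "i * d m \<le> T m (Suc k)"
          proof -
            have "real k * n m \<le> i" "real i \<le> Suc k * n m"
              using i by (metis atLeastLessThan_iff of_nat_mult of_nat_le_iff less_imp_le)+
            then have "real k * n m * d m \<le> i * d m" "i * d m \<le> Suc k * n m * d m"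
              using dm by (auto intro!: mult_right_mono)
            moreover have "real k * n m * d m = T m k" "Suc k * n m * d m = T m (Suc k)"
              using n[of m] elim by (auto simp: d_def T_def field_simps)
            ultimately show "T m k \<le> i * d m" "i * d m \<le> T m (Suc k)" by simp_all
          qed
          have r2: "s \<le> T m k" "T m (Suc k) \<le> t"
            using Trange[of m k] Trange[of m "Suc k"] k elim by auto
          have "\<bar>T m (Suc k) - i * d m\<bar> < \<rho>"
            using r1 elim TSuc[of m k] by auto
          then have z1: "\<bar>\<zeta> (T m (Suc k)) - \<zeta> (i * d m)\<bar> \<le> \<eta>"
            using r1 r2 st by (intro less_imp_le \<rho>(2)) auto
          have z2: "\<bar>\<zeta> (T m (Suc k))\<bar> \<le> C" using r1 r2 st by (intro C) auto
          \<comment> \<open>The first summand contains the change of \<open>ell\<close> over one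
            cell, of order \<open>1 / m\<close>; the second the oscillation of the path, at most
            \<open>\<eta>\<close>.\<close>
          have "L m k * L m (Suc k) * \<zeta> (T m (Suc k)) - (L m k)\<^sup>2 * \<zeta> (i * d m) =
            (L m (Suc k) - L m k) * L m k * \<zeta> (T m (Suc k)) + (L m k)\<^sup>2 * (\<zeta> (T m (Suc k)) - \<zeta> (i * d m))"
            by (simp add: algebra_simps power2_eq_square)
          also have "\<bar>\<dots>\<bar> \<le> 2 * (a / m) * \<Lambda>\<^sup>2 * \<Lambda> * C + \<Lambda>\<^sup>2 * \<eta>"
          proof (intro order_trans[OF abs_triangle_ineq] add_mono)
            show "\<bar>(L m (Suc k) - L m k) * L m k * \<zeta> (T m (Suc k))\<bar> \<le> 2 * (a / m) * \<Lambda>\<^sup>2 * \<Lambda> * C"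
              unfolding abs_mult using LSuc'[of m k] L\<Lambda>[of m k] k elim z2 a \<Lambda>0 C0
              by (intro mult_mono) auto
            have "\<bar>L m k\<bar>\<^sup>2 \<le> \<Lambda>\<^sup>2" using L\<Lambda>[of m k] k elim by (intro power_mono) auto
            then show "\<bar>(L m k)\<^sup>2 * (\<zeta> (T m (Suc k)) - \<zeta> (i * d m))\<bar> \<le> \<Lambda>\<^sup>2 * \<eta>"
              unfolding abs_mult using z1 \<Lambda>0 by (intro mult_mono) auto
          qed
          finally show "\<bar>2 * d m * (L m k * L m (Suc k) * \<zeta> (T m (Suc k)) - (L m k)\<^sup>2 * \<zeta> (i * d m))\<bar>
            \<le> 2 * d m * (2 * (a / m) * \<Lambda>\<^sup>2 * \<Lambda> * C + \<Lambda>\<^sup>2 * \<eta>)"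
            unfolding abs_mult[of "2 * d m"] using dm by (auto intro!: mult_left_mono)
        qed
        also have "\<dots> = ?b m + 2 * (q - p) * a * \<Lambda>\<^sup>2 * \<eta>"
          using n[of m] elim pq by (simp add: d_def of_nat_diff diff_mult_distrib[symmetric] field_simps power3_eq_cube power2_eq_square)
        finally show ?case .
      qed
    qed (use a pq in auto)
  qed
  have A3: "A3 \<longlonglongrightarrow> ln (1 + 2 * lam * (t - s)) / 2"
  proof -
    let ?b = "\<lambda>m. (2 * a * a * (q - p) * \<Lambda>\<^sup>2) * (1 / real m)"
    have "\<forall>\<^sub>F m in sequentially. norm (A3 m - ln (1 + 2 * lam * (t - s)) / 2) \<le> ?b m"
      using eventually_gt_at_top[of "0::nat"]
    proof eventually_elim
      case (elim m)
      have "(\<Sum>k=p*m..<q*m. (- ln (x m (Suc k)) / 2) - (- ln (x m k) / 2)) = (- ln (x m (q*m)) / 2) - (- ln (x m (p*m)) / 2)"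
        using pq by (intro sum_Suc_diff') auto
      also have "\<dots> = ln (1 + 2 * lam * (t - s)) / 2"
        using elim by (simp add: x_def T_def s_def t_def)
      finally have tel: "(\<Sum>k=p*m..<q*m. (- ln (x m (Suc k)) / 2) - (- ln (x m k) / 2)) = ln (1 + 2 * lam * (t - s)) / 2" .
      have "A3 m - ln (1 + 2 * lam * (t - s)) / 2 = 
          (\<Sum>k=p*m..<q*m. L m k * (a / m) - (ln (x m k) - ln (x m (Suc k))) / 2)"
        unfolding A3_def tel[symmetric] sum_subtractf[symmetric] by (intro sum.cong refl) (simp add: field_simps)
      also have "\<bar>\<dots>\<bar> \<le> (\<Sum>k=p*m..<q*m. 2 * (a / m) * \<Lambda>\<^sup>2 * (a / m))"
      proof (intro order_trans[OF sum_abs] sum_mono)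
        fix k assume k: "k \<in> {p*m..<q*m}"
        have xp: "x m k > 0" "x m (Suc k) > 0" using xpos[of m k] xpos[of m "Suc k"] k elim by auto
        \<comment> \<open>Concavity of \<open>ln\<close> traps its increment between the step size
          times the two end values of \<open>2 * ell\<close>, so the error per cell is governed by
          \<open>L m (Suc k) - L m k\<close>.\<close>
        have u: "ln (x m k) - ln (x m (Suc k)) \<le> 2 * L m (Suc k) * (a / m)"
          using ln_diff_le[OF xp] xSuc[of m k] by (simp add: Lx mult_ac)
        have "ln (x m (Suc k)) - ln (x m k) \<le> - (2 * L m k * (a / m))"
          using ln_diff_le[OF xp(2,1)] xSuc[of m k] by (simp add: Lx mult_ac)
        then have v: "2 * L m k * (a / m) \<le> ln (x m k) - ln (x m (Suc k))" by simp
        have "\<bar>L m k * (a / m) - (ln (x m k) - ln (x m (Suc k))) / 2\<bar> \<le> (L m (Suc k) - L m k) * (a / m)"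
          using u v by (simp add: algebra_simps)
        also have "\<dots> \<le> 2 * (a / m) * \<Lambda>\<^sup>2 * (a / m)"
          using LSuc'[of m k] k elim a by (intro mult_right_mono) auto
        finally show "\<bar>L m k * (a / m) - (ln (x m k) - ln (x m (Suc k))) / 2\<bar> \<le> 2 * (a / m) * \<Lambda>\<^sup>2 * (a / m)" .
      qed
      also have "\<dots> = ?b m"
        using elim pq by (simp add: of_nat_diff diff_mult_distrib[symmetric] field_simps)
      finally show ?case by simp
    qed
    moreover have "?b \<longlonglongrightarrow> 0" by (intro tendsto_mult_right_zero lim_1_over_n)
    ultimately have "(\<lambda>m. A3 m - ln (1 + 2 * lam * (t - s)) / 2) \<longlonglongrightarrow> 0" by (rule Lim_null_comparison)
    then show ?thesis by (simp add: LIM_zero_iff)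
  qed
  have "(\<lambda>m. A1 m + A2 m + \<delta> * A3 m + (ell s * \<zeta> s - lam * \<zeta> t)) \<longlonglongrightarrow> 0 + 0 + \<delta> * (ln (1 + 2 * lam * (t - s)) / 2) + (ell s * \<zeta> s - lam * \<zeta> t)"
    by (intro tendsto_intros A1 A2 A3)
  moreover have "\<forall>\<^sub>F m in sequentially. A1 m + A2 m + \<delta> * A3 m + (ell s * \<zeta> s - lam * \<zeta> t) = 
     (\<Sum>k=p*m..<q*m. - L m k * (R m (Suc k) - R m k) -
      2 * (L m k)\<^sup>2 * d m * (\<Sum>i=k*n m..<Suc k*n m. \<zeta> (i * d m)))"
    using eventually_gt_at_top[of "0::nat"] by eventually_elim (rule decomp[symmetric])
  ultimately have "(\<lambda>m. \<Sum>k=p*m..<q*m. - L m k * (R m (Suc k) - R m k) -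
      2 * (L m k)\<^sup>2 * d m * (\<Sum>i=k*n m..<Suc k*n m. \<zeta> (i * d m))) \<longlonglongrightarrow> 0 + 0 + \<delta> * (ln (1 + 2 * lam * (t - s)) / 2) + (ell s * \<zeta> s - lam * \<zeta> t)"
    by (rule Lim_transform_eventually)
  then show ?thesis by (simp add: L_def T_def d_def algebra_simps)
qed

text \<open>Uniform integrability from second moments. Fatou bounds the integral of the limit only
  from above; for a bound from below no mass may escape, which
  \<open>D \<le> min D N + D^2 / N\<close> ensures, while the truncated part converges by
  domination.\<close>

lemma nn_integral_limit_L2:
  fixes D :: "nat \<Rightarrow> 'a \<Rightarrow> real" and Y D' :: "'a \<Rightarrow> real"
  assumes "prob_space M"
    and [measurable]: "\<And>m. D m \<in> borel_measurable M" "D' \<in> borel_measurable M" "Y \<in> borel_measurable M"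
    and Y: "\<And>x. x \<in> space M \<Longrightarrow> 0 \<le> Y x" "\<And>x. x \<in> space M \<Longrightarrow> Y x \<le> 1"
    and D: "\<And>m x. 0 \<le> D m x" "\<And>x. 0 \<le> D' x"
    and lim: "AE x in M. (\<lambda>m. D m x) \<longlonglongrightarrow> D' x"
    and I: "\<And>m. I \<le> (\<integral>\<^sup>+x. ennreal (Y x * D m x) \<partial>M)"
    and K: "\<And>m. (\<integral>\<^sup>+x. ennreal (Y x * (D m x)\<^sup>2) \<partial>M) \<le> ennreal K" "K \<ge> 0"
  shows "I \<le> (\<integral>\<^sup>+x. ennreal (Y x * D' x) \<partial>M)"
proof (rule ennreal_le_epsilon)
  interpret prob_space M by fact
  fix e :: real assume e: "e > 0"
  \<comment> \<open>Makes the discarded part \<open>K / N\<close> at most \<open>e\<close>; the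
    summand 1 keeps \<open>N\<close> positive when \<open>K = 0\<close>.\<close>
  define N where "N = K / e + 1"
  have N: "N > 0" "K / N \<le> e"
    using e K(2) by (auto simp: N_def field_simps add_nonneg_pos)
  have "I \<le> (\<integral>\<^sup>+x. ennreal (Y x * min (D m x) N) \<partial>M) + ennreal (K / N)" for m
  proof -
    have pt: "ennreal (Y x * D m x) \<le> ennreal (Y x * min (D m x) N) + ennreal (Y x * (D m x)\<^sup>2) * ennreal (1 / N)"
      if "x \<in> space M" for x
    proof -
      have "D m x \<le> min (D m x) N + (D m x)\<^sup>2 * (1 / N)"
      proof (cases "D m x \<le> N")
        case False
        then have "D m x * N \<le> D m x * D m x" using D by (intro mult_left_mono) auto
        then have "D m x * N \<le> D m x * D m x + N * N" using zero_le_square[of N] by linarith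
        then show ?thesis using N False by (simp add: field_simps power2_eq_square)
      qed (use N in auto)
      then have "Y x * D m x \<le> Y x * (min (D m x) N + (D m x)\<^sup>2 * (1 / N))"
        using Y(1)[OF that] by (rule mult_left_mono)
      then have "ennreal (Y x * D m x) \<le> ennreal (Y x * min (D m x) N + Y x * (D m x)\<^sup>2 * (1 / N))"
        by (intro ennreal_leI) (simp add: algebra_simps)
      also have "\<dots> = ennreal (Y x * min (D m x) N) + ennreal (Y x * (D m x)\<^sup>2) * ennreal (1 / N)"
        using Y(1)[OF that] D N by (subst ennreal_plus) (auto simp: ennreal_mult'[symmetric])
      finally show ?thesis .
    qed
    have "I \<le> (\<integral>\<^sup>+x. ennreal (Y x * D m x) \<partial>M)" by (rule I)
    also have "\<dots> \<le> (\<integral>\<^sup>+x. ennreal (Y x * min (D m x) N) + ennreal (Y x * (D m x)\<^sup>2) * ennreal (1 / N) \<partial>M)"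
      by (rule nn_integral_mono) (rule pt)
    also have "\<dots> = (\<integral>\<^sup>+x. ennreal (Y x * min (D m x) N) \<partial>M) + (\<integral>\<^sup>+x. ennreal (Y x * (D m x)\<^sup>2) \<partial>M) * ennreal (1 / N)"
      by (subst nn_integral_add) (auto simp: nn_integral_multc)
    also have "(\<integral>\<^sup>+x. ennreal (Y x * (D m x)\<^sup>2) \<partial>M) * ennreal (1 / N) \<le> ennreal K * ennreal (1 / N)"
      by (intro mult_right_mono K) simp
    also have "\<dots> = ennreal (K / N)" using K N by (simp add: ennreal_mult'[symmetric])
    finally show ?thesis by (simp add: add_left_mono)
  qed
  moreover have "(\<lambda>m. (\<integral>\<^sup>+x. ennreal (Y x * min (D m x) N) \<partial>M)) \<longlonglongrightarrow> (\<integral>\<^sup>+x. ennreal (Y x * min (D' x) N) \<partial>M)"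
  proof (rule nn_integral_dominated_convergence[where w = "\<lambda>_. ennreal N"])
    show "AE x in M. ennreal (Y x * min (D j x) N) \<le> ennreal N" for j
    proof (intro AE_I2 ennreal_leI)
      fix x assume x: "x \<in> space M"
      have "Y x * min (D j x) N \<le> 1 * N" using Y[OF x] D N by (intro mult_mono) auto
      then show "Y x * min (D j x) N \<le> N" by simp
    qed
    show "AE x in M. (\<lambda>m. ennreal (Y x * min (D m x) N)) \<longlonglongrightarrow> ennreal (Y x * min (D' x) N)"
      using lim by eventually_elim (intro tendsto_ennrealI tendsto_mult tendsto_min tendsto_const)
  qed (auto simp: emeasure_space_1)
  then have "(\<lambda>m. (\<integral>\<^sup>+x. ennreal (Y x * min (D m x) N) \<partial>M) + ennreal (K / N)) \<longlonglongrightarrow> (\<integral>\<^sup>+x. ennreal (Y x * min (D' x) N) \<partial>M) + ennreal (K / N)"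
    by (intro tendsto_add tendsto_const)
  ultimately have "I \<le> (\<integral>\<^sup>+x. ennreal (Y x * min (D' x) N) \<partial>M) + ennreal (K / N)"
    by (intro LIMSEQ_le_const) auto
  also have "\<dots> \<le> (\<integral>\<^sup>+x. ennreal (Y x * D' x) \<partial>M) + ennreal e"
    using N Y D by (intro add_mono nn_integral_mono ennreal_leI mult_left_mono) auto
  finally show "I \<le> (\<integral>\<^sup>+x. ennreal (Y x * D' x) \<partial>M) + ennreal e" .
qed

lemma sum_blocks:
  fixes f :: "nat \<Rightarrow> 'a::comm_monoid_add"
  assumes "k0 \<le> k1"
  shows "(\<Sum>i=k0*n..<k1*n. f i) = (\<Sum>k=k0..<k1. \<Sum>i=k*n..<Suc k*n. f i)"
  using assms
proof (induction k1 rule: dec_induct)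
  case (step k)
  have "(\<Sum>i=k0*n..<Suc k*n. f i) = (\<Sum>i=k0*n..<k*n. f i) + (\<Sum>i=k*n..<Suc k*n. f i)"
    using step by (intro sum.atLeastLessThan_concat[symmetric]) auto
  then show ?case using step by simp
qed simp

section \<open>Almost sure convergence along a nested mesh\<close>

context squared_bessel begin

definition rsum :: "real \<Rightarrow> nat \<Rightarrow> 'w \<Rightarrow> real" where
  "rsum d j om = (\<Sum>k<j. 2 * sqrt (Z (real k * d) om) * (B (real (Suc k) * d) om - B (real k * d) om))"

lemma rsum_measurable [measurable]:
  assumes "0 \<le> d"
  shows "rsum d j \<in> borel_measurable M"
proof -
  have [measurable]: "Z (real k * d) \<in> borel_measurable M" "B (real k * d) \<in> borel_measurable M" for k
    using assms by auto
  show ?thesis unfolding rsum_def[abs_def] by measurable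
qed

text \<open>With a weight constant on blocks of \<open>n\<close> fine steps, the stochastic part of
  a block is a multiple of one increment of the unweighted sum \<open>rsum\<close>, the only kind of
  sum controlled by the Ito hypothesis.\<close>

lemma expo_blocks:
  assumes n: "n > 0" and k: "k0 \<le> k1"
  shows "expo (\<lambda>i. L (i div n)) d (k0 * n) (k1 * n) om =
    (\<Sum>k=k0..<k1. - L k * (rsum d (Suc k * n) om - rsum d (k * n) om) - 
       2 * (L k)\<^sup>2 * d * (\<Sum>i=k*n..<Suc k*n. Z (real i * d) om))"
  unfolding expo_def sum_blocks[OF k]
proof (rule sum.cong[OF refl])
  fix k
  have "i div n = k" if "i \<in> {k*n..<Suc k*n}" for i
    using that n by (auto intro!: div_nat_eqI simp: mult.commute)
  then have "(\<Sum>i=k*n..<Suc k*n. - (L (i div n) * (2 * sqrt (Z (real i * d) om))) * (B (real (Suc i) * d) om - B (real i * d) om) -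
         2 * (L (i div n))\<^sup>2 * Z (real i * d) om * d) =
      (\<Sum>i=k*n..<Suc k*n. - L k * (2 * sqrt (Z (real i * d) om) * (B (real (Suc i) * d) om - B (real i * d) om)) -
         2 * (L k)\<^sup>2 * d * Z (real i * d) om)"
    by (intro sum.cong refl) (simp add: algebra_simps)
  also have "\<dots> = - L k * (\<Sum>i=k*n..<Suc k*n. 2 * sqrt (Z (real i * d) om) * (B (real (Suc i) * d) om - B (real i * d) om)) - 
      2 * (L k)\<^sup>2 * d * (\<Sum>i=k*n..<Suc k*n. Z (real i * d) om)"
    by (simp add: sum_subtractf sum_distrib_left)
  also have "(\<Sum>i=k*n..<Suc k*n. 2 * sqrt (Z (real i * d) om) * (B (real (Suc i) * d) om - B (real i * d) om)) =
    rsum d (Suc k * n) om - rsum d (k * n) om"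
    unfolding rsum_def lessThan_atLeast0
    using sum.atLeastLessThan_concat[of 0 "k*n" "Suc k*n" "\<lambda>i. 2 * sqrt (Z (real i * d) om) * (B (real (Suc i) * d) om - B (real i * d) om)"]
    by simp
  finally show "(\<Sum>i=k*n..<Suc k*n. - (L (i div n) * (2 * sqrt (Z (real i * d) om))) * (B (real (Suc i) * d) om - B (real i * d) om) -
         2 * (L (i div n))\<^sup>2 * Z (real i * d) om * d) =
     - L k * (rsum d (Suc k * n) om - rsum d (k * n) om) - 2 * (L k)\<^sup>2 * d * (\<Sum>i=k*n..<Suc k*n. Z (real i * d) om)" .
qed

text \<open>The first \<open>k * n\<close> steps of width \<open>a / (m * n)\<close> form the
  equidistant partition of the interval from 0 to \<open>a * k / m\<close> into \<open>k * n\<close>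
  pieces. Along \<open>n\<close> this is a subsequence of the limit that defines the Ito integral up
  to that time.\<close>

lemma rsum_tendsto:
  assumes a: "a > 0" and m: "m > 0" and e: "e > 0"
  shows "(\<lambda>n. prob {om\<in>space M. e < \<bar>rsum (a / (real m * real n)) (k * n) om - (Z (a * k / m) om - z - \<delta> * (a * k / m))\<bar>}) \<longlonglongrightarrow> 0"
proof (cases "k = 0")
  case True
  have "{om\<in>space M. e < \<bar>rsum (a / (real m * real n)) (k * n) om - (Z (a * k / m) om - z - \<delta> * (a * k / m))\<bar>} = {}" for n
    using True e Z_0 by (auto simp: rsum_def)
  then show ?thesis by (simp only: measure_empty tendsto_const)
next
  case False
  let ?t = "a * k / m"
  let ?P = "\<lambda>N. prob {om\<in>space M. e < \<bar>(\<Sum>i<N. 2 * sqrt (Z (?t * real i / real N) om) *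
     (B (?t * real (Suc i) / real N) om - B (?t * real i / real N) om)) - (Z ?t om - z - \<delta> * ?t)\<bar>}"
  have "?t \<ge> 0" using a by simp
  from Z_ito[OF this] have "?P \<longlonglongrightarrow> 0" using e unfolding has_ito_integral_def by blast
  moreover have "filterlim (\<lambda>n. k * n) at_top sequentially"
    using False by (intro filterlim_subseq) (auto simp: strict_mono_def)
  ultimately have "(\<lambda>n. ?P (k * n)) \<longlonglongrightarrow> 0" by (rule filterlim_compose)
  moreover have "?P (k * n) = prob {om\<in>space M. e < \<bar>rsum (a / (real m * real n)) (k * n) om - (Z (a * k / m) om - z - \<delta> * (a * k / m))\<bar>}" for n
  proof -
    have eq: "?t * real i / real (k * n) = real i * (a / (real m * real n))" for i
      using False by simp
    show ?thesis unfolding rsum_def eq ..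
  qed
  ultimately show ?thesis by simp
qed

text \<open>For each \<open>m\<close> the refinement \<open>n m\<close> is so fine that the
  \<open>q * m + 1\<close> coarse times together fail with probability at most
  \<open>(1/2) ^ m\<close>. Borel-Cantelli then upgrades convergence in probability to an almost
  sure estimate with a rate.\<close>

lemma good_mesh:
  assumes a: "a > 0"
  shows "\<exists>n :: nat \<Rightarrow> nat. (\<forall>m. n m > 0) \<and> (AE om in M. \<forall>\<^sub>F m in sequentially. \<forall>k\<le>q * m.
    \<bar>rsum (a / (real m * real (n m))) (k * n m) om - (Z (a * k / m) om - z - \<delta> * (a * k / m))\<bar> \<le> (1/4) ^ m)"
proof -
  let ?A = "\<lambda>m n k. {om\<in>space M. (1/4) ^ m < \<bar>rsum (a / (real m * real n)) (k * n) om - (Z (a * k / m) om - z - \<delta> * (a * k / m))\<bar>}"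
  have ex: "\<exists>n>0. \<forall>k\<in>{..q*m}. prob (?A m n k) < (1/2)^m / (q * m + 1)" if m: "m > 0" for m
  proof -
    have "\<forall>\<^sub>F n in sequentially. \<forall>k\<in>{..q*m}. prob (?A m n k) < (1/2)^m / (q * m + 1)"
      by (intro eventually_ball_finite ballI order_tendstoD(2)[OF rsum_tendsto[OF a m]])
        (auto intro!: divide_pos_pos add_pos_nonneg)
    then have "\<forall>\<^sub>F n in sequentially. n > 0 \<and> (\<forall>k\<in>{..q*m}. prob (?A m n k) < (1/2)^m / (q * m + 1))"
      using eventually_gt_at_top[of "0::nat"] by eventually_elim auto
    then show ?thesis by (auto simp: eventually_sequentially)
  qed
  \<comment> \<open>At \<open>m = 0\<close> there is no coarse mesh; the value 1 merely keeps
    \<open>n m\<close> positive.\<close>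
  define n where "n m = (if m = 0 then 1 else SOME n. n > 0 \<and> (\<forall>k\<in>{..q*m}. prob (?A m n k) < (1/2)^m / (q * m + 1)))" for m
  have n: "n m > 0" "m > 0 \<Longrightarrow> \<forall>k\<in>{..q*m}. prob (?A m (n m) k) < (1/2)^m / (q * m + 1)" for m
    using someI_ex[OF ex[of m]] by (auto simp: n_def)
  have A [measurable]: "?A m (n m) k \<in> sets M" for m k
  proof -
    have [measurable]: "rsum (a / (real m * real (n m))) (k * n m) \<in> borel_measurable M" 
      "Z (a * k / m) \<in> borel_measurable M" using a by auto
    show ?thesis by measurable
  qed
  let ?B = "\<lambda>m. \<Union>k\<in>{..q*m}. ?A m (n m) k"
  have "AE om in M. eventually (\<lambda>m. om \<in> space M - ?B m) sequentially"
  proof (rule borel_cantelli_AE1)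
    show "?B m \<in> sets M" for m by measurable
    show "emeasure M (?B m) < \<infinity>" for m by (simp add: less_top[symmetric])
    show "summable (\<lambda>m. prob (?B m))"
    proof (rule summable_comparison_test_ev)
      show "summable (\<lambda>m. (1/2::real)^m)" by (simp add: summable_geometric)
      show "\<forall>\<^sub>F m in sequentially. norm (prob (?B m)) \<le> (1/2)^m"
        using eventually_gt_at_top[of "0::nat"]
      proof eventually_elim
        case (elim m)
        have "prob (?B m) \<le> (\<Sum>k\<in>{..q*m}. prob (?A m (n m) k))"
          using A by (intro finite_measure_subadditive_finite finite_atMost) blast
        also have "\<dots> \<le> (\<Sum>k\<in>{..q*m}. (1/2)^m / (q * m + 1))"
          using n(2)[OF elim] by (intro sum_mono less_imp_le) auto
        also have "\<dots> = (1/2)^m"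
        proof -
          have "1 + real q * real m \<noteq> 0" by (metis add_nonneg_pos add.commute less_irrefl of_nat_0_le_iff of_nat_mult zero_less_one)
          then show ?thesis by (simp add: add.commute)
        qed
        finally show ?case by simp
      qed
    qed
  qed
  then have "AE om in M. \<forall>\<^sub>F m in sequentially. \<forall>k\<le>q * m.
    \<bar>rsum (a / (real m * real (n m))) (k * n m) om - (Z (a * k / m) om - z - \<delta> * (a * k / m))\<bar> \<le> (1/4) ^ m"
    by (rule AE_mp) (auto intro!: AE_I2 elim!: eventually_mono simp: not_less)
  then show ?thesis using n(1) by blast
qed


text \<open>The weight \<open>ell\<close> of \<open>exponent_limit\<close> with end time
  \<open>a * q\<close>, taken at the left end of the coarse cell that contains the fine step
  \<open>i\<close>.\<close>

definition mesh_weight :: "real \<Rightarrow> nat \<Rightarrow> real \<Rightarrow> nat \<Rightarrow> nat \<Rightarrow> nat \<Rightarrow> real" where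
  "mesh_weight a q lam m n i = lam / (1 + 2 * lam * (a * q - a * real (i div n) / m))"

text \<open>The mesh comes from \<open>good_mesh\<close>, which does not see \<open>lam\<close>; so
  one mesh and one null set serve every admissible \<open>lam\<close> of either sign.\<close>

lemma expo_mesh_tendsto:
  fixes p q :: nat and a :: real
  assumes a: "a > 0" and pq: "p < q"
  shows "\<exists>n :: nat \<Rightarrow> nat. (\<forall>m. n m > 0) \<and> (AE om in M. \<forall>lam. 1 + 2 * lam * (a * q - a * p) > 0 \<longrightarrow>
    (\<lambda>m. expo (mesh_weight a q lam m (n m)) (a / (real m * real (n m))) (p * m * n m) (q * m * n m) om)
     \<longlonglongrightarrow> - lam * Z (a * q) om + lam / (1 + 2 * lam * (a * q - a * p)) * Z (a * p) om +
       \<delta> / 2 * ln (1 + 2 * lam * (a * q - a * p)))"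
proof -
  obtain n where n: "\<And>m. n m > 0" and ae: "AE om in M. \<forall>\<^sub>F m in sequentially. \<forall>k\<le>q * m.
    \<bar>rsum (a / (real m * real (n m))) (k * n m) om - (Z (a * k / m) om - z - \<delta> * (a * k / m))\<bar> \<le> (1/4) ^ m"
    using good_mesh[OF a, of q] by blast
  have "AE om in M. \<forall>lam. 1 + 2 * lam * (a * q - a * p) > 0 \<longrightarrow>
    (\<lambda>m. expo (mesh_weight a q lam m (n m)) (a / (real m * real (n m))) (p * m * n m) (q * m * n m) om)
     \<longlonglongrightarrow> - lam * Z (a * q) om + lam / (1 + 2 * lam * (a * q - a * p)) * Z (a * p) om +
       \<delta> / 2 * ln (1 + 2 * lam * (a * q - a * p))"
    using ae AE_space
  proof eventually_elim
    case (elim om)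
    show ?case
    proof (intro allI impI)
      fix lam assume pos: "1 + 2 * lam * (a * q - a * p) > 0"
      have "p * m \<le> q * m" for m using pq by simp
      note eb = expo_blocks[OF n this]
      show "(\<lambda>m. expo (mesh_weight a q lam m (n m)) (a / (real m * real (n m))) (p * m * n m) (q * m * n m) om)
        \<longlonglongrightarrow> - lam * Z (a * q) om + lam / (1 + 2 * lam * (a * q - a * p)) * Z (a * p) om +
         \<delta> / 2 * ln (1 + 2 * lam * (a * q - a * p))"
        unfolding mesh_weight_def[abs_def] eb[where L = "\<lambda>k. lam / (1 + 2 * lam * (a * real q - a * real k / real m))" for m]
        by (rule exponent_limit[where R = "\<lambda>m k. rsum (a / (real m * real (n m))) (k * n m) om",
              OF a pq pos Z_cont[OF elim(2)] n elim(1)])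
    qed
  qed
  with n show ?thesis by blast
qed

text \<open>Fatou for nonnegative exponential martingales whose integrals are constant.
  \<open>lam\<close> may be negative as long as the denominator stays positive.\<close>

lemma nn_integral_exp_le:
  fixes p q :: nat and a lam :: real
  assumes a: "a > 0" and pq: "p < q" and pos: "1 + 2 * lam * (a * q - a * p) > 0"
    and Y: "Y \<in> borel_measurable (F (a * p))" "\<And>om. 0 \<le> Y om"
  shows "(\<integral>\<^sup>+om. ennreal (Y om * exp (- lam * Z (a * q) om + lam / (1 + 2 * lam * (a * q - a * p)) * Z (a * p) om +
       \<delta> / 2 * ln (1 + 2 * lam * (a * q - a * p)))) \<partial>M) \<le> (\<integral>\<^sup>+om. ennreal (Y om) \<partial>M)"
proof -
  obtain n where n: "\<And>m. n m > 0" and ae: "AE om in M. \<forall>lam. 1 + 2 * lam * (a * q - a * p) > 0 \<longrightarrow>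
    (\<lambda>m. expo (mesh_weight a q lam m (n m)) (a / (real m * real (n m))) (p * m * n m) (q * m * n m) om)
     \<longlonglongrightarrow> - lam * Z (a * q) om + lam / (1 + 2 * lam * (a * q - a * p)) * Z (a * p) om +
       \<delta> / 2 * ln (1 + 2 * lam * (a * q - a * p))" (is "AE om in M. \<forall>lam. _ \<longrightarrow> (\<lambda>m. ?e lam m om) \<longlonglongrightarrow> ?l lam om")
    using expo_mesh_tendsto[OF a pq] by blast
  note [measurable] = measurable_F[OF Y(1)]
  have [measurable]: "?e lam m \<in> borel_measurable M" for m using a by simp
  \<comment> \<open>The index is shifted because at \<open>m = 0\<close> the mesh width is a
    division by zero.\<close>
  have "(\<integral>\<^sup>+om. ennreal (Y om * exp (?l lam om)) \<partial>M) = (\<integral>\<^sup>+om. liminf (\<lambda>m. ennreal (Y om * exp (?e lam (Suc m) om))) \<partial>M)"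
  proof (rule nn_integral_cong_AE)
    show "AE om in M. ennreal (Y om * exp (?l lam om)) = liminf (\<lambda>m. ennreal (Y om * exp (?e lam (Suc m) om)))"
      using ae
    proof eventually_elim
      case (elim om)
      then have "(\<lambda>m. ennreal (Y om * exp (?e lam (Suc m) om))) \<longlonglongrightarrow> ennreal (Y om * exp (?l lam om))"
        using pos by (intro tendsto_ennrealI tendsto_mult tendsto_const tendsto_exp LIMSEQ_Suc[of "\<lambda>m. ?e lam m om"]) blast
      then show ?case by (intro lim_imp_Liminf[symmetric]) auto
    qed
  qed
  also have "\<dots> \<le> liminf (\<lambda>m. \<integral>\<^sup>+om. ennreal (Y om * exp (?e lam (Suc m) om)) \<partial>M)"
    by (intro nn_integral_liminf) measurable
  also have "(\<lambda>m. \<integral>\<^sup>+om. ennreal (Y om * exp (?e lam (Suc m) om)) \<partial>M) = (\<lambda>m. \<integral>\<^sup>+om. ennreal (Y om) \<partial>M)"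
  proof
    fix m
    let ?d = "a / (real (Suc m) * real (n (Suc m)))"
    have d: "?d > 0" using a n[of "Suc m"] by simp
    have gen: "real p * x * y * (a / (x * y)) = a * p" if "x \<noteq> 0" "y \<noteq> 0" for x y :: real
      using that by simp
    have "real (p * Suc m * n (Suc m)) * ?d = a * p" 
      unfolding of_nat_mult by (rule gen) (use n[of "Suc m"] in auto)
    then have Y': "(\<lambda>om. ennreal (Y om)) \<in> borel_measurable (F (real (p * Suc m * n (Suc m)) * ?d))"
      using Y(1) by simp
    have "p * Suc m * n (Suc m) \<le> q * Suc m * n (Suc m)" using pq by (intro mult_le_mono) auto
    from nn_integral_expo[OF d this Y']
    show "(\<integral>\<^sup>+om. ennreal (Y om * exp (?e lam (Suc m) om)) \<partial>M) = (\<integral>\<^sup>+om. ennreal (Y om) \<partial>M)"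
      using Y(2) by (simp add: ennreal_mult')
  qed
  finally show ?thesis by (simp add: Liminf_const)
qed

end

section \<open>The reverse inequality: second moments of the exponential martingales\<close>

context squared_bessel begin

text \<open>\<open>2 * expo l\<close> is the mean of the exponent \<open>expo (4 * l)\<close>, again
  that of a martingale, and of a compensator \<open>S\<close>: the quadratic coefficients are -4 on
  the left and -32 / 2 = -16 from the martingale, so \<open>S / 2\<close> contributes 12 and
  \<open>S\<close> carries 24. As \<open>S\<close> is an average over the steps with weights
  \<open>d / \<tau>\<close>, Jensen reduces it to exponential moments of \<open>Z\<close> at single
  times.\<close>

lemma expo_square_le:
  assumes om: "om \<in> space M" and d: "d > 0" and ij: "i < j" and \<tau>: "\<tau> = real (j - i) * d"
    and l: "\<And>k. k \<in> {i..<j} \<Longrightarrow> 0 \<le> l k \<and> l k \<le> lam"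
  shows "(exp (expo l d i j om))\<^sup>2 \<le> exp (expo (\<lambda>k. 4 * l k) d i j om) +
    (\<Sum>k=i..<j. d / \<tau> * exp (24 * \<tau> * lam\<^sup>2 * Z (real k * d) om))"
proof -
  have \<tau>0: "\<tau> > 0" using \<tau> d ij by simp
  define S where "S = (\<Sum>k=i..<j. (d / \<tau>) *\<^sub>R (24 * \<tau> * (l k)\<^sup>2 * Z (real k * d) om))"
  define x where "x = expo (\<lambda>k. 4 * l k) d i j om"
  have "2 * expo l d i j om = (x + S) / 2"
    unfolding x_def S_def expo_def sum_distrib_left sum.distrib[symmetric] sum_divide_distrib
    using \<tau>0 by (intro sum.cong refl) (simp add: field_simps power2_eq_square)
  then have "(exp (expo l d i j om))\<^sup>2 = exp (x / 2) * exp (S / 2)"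
    by (simp add: exp_double[symmetric] mult_exp_exp add_divide_distrib)
  also have "\<dots> \<le> (exp (x / 2))\<^sup>2 + (exp (S / 2))\<^sup>2"
  proof -
    have "2 * exp (x/2) * exp (S/2) \<le> (exp (x / 2))\<^sup>2 + (exp (S / 2))\<^sup>2" by (rule sum_squares_bound)
    moreover have "exp (x/2) * exp (S/2) \<ge> 0" by simp
    ultimately show ?thesis by linarith
  qed
  also have "\<dots> = exp x + exp S" by (simp add: exp_double[symmetric])
  also have "exp S \<le> (\<Sum>k=i..<j. d / \<tau> * exp (24 * \<tau> * (l k)\<^sup>2 * Z (real k * d) om))"
    unfolding S_def
  proof (rule convex_on_sum[OF _ _ exp_convex])
    show "(\<Sum>k=i..<j. d / \<tau>) = 1" using \<tau> ij d by simp
  qed (use ij d \<tau>0 in auto)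
  also have "\<dots> \<le> (\<Sum>k=i..<j. d / \<tau> * exp (24 * \<tau> * lam\<^sup>2 * Z (real k * d) om))"
  proof (intro sum_mono mult_left_mono)
    fix k assume k: "k \<in> {i..<j}"
    have "Z (real k * d) om \<ge> 0" using Z_nonneg[OF om] d by simp
    then show "exp (24 * \<tau> * (l k)\<^sup>2 * Z (real k * d) om) \<le> exp (24 * \<tau> * lam\<^sup>2 * Z (real k * d) om)"
      using l[OF k] \<tau>0 by (auto intro!: mult_right_mono mult_left_mono power_mono)
  qed (use d \<tau>0 in auto)
  finally show ?thesis by (simp add: x_def)
qed

text \<open>\<open>nn_integral_exp_le\<close> at \<open>lam = - \<mu>\<close>. The condition
  \<open>4 * \<mu>\<close> times elapsed time at most 1 keeps the denominator above
  \<open>1 / 2\<close>, whence the factors \<open>2 * \<mu>\<close> and \<open>ln 2\<close> in the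
  bound; \<open>Y\<close> localises to a bounded starting value.\<close>

lemma nn_integral_exp_moment:
  fixes a \<mu> :: real and p q :: nat
  assumes a: "a > 0" and pq: "p \<le> q" and \<delta>: "\<delta> \<ge> 0" and \<mu>: "0 \<le> \<mu>" "4 * \<mu> * (a * q - a * p) \<le> 1"
    and Y: "Y \<in> borel_measurable (F (a * p))" "\<And>om. 0 \<le> Y om" "\<And>om. Y om \<le> 1"
    and C: "\<And>om. Y om \<noteq> 0 \<Longrightarrow> Z (a * p) om \<le> C" "C \<ge> 0"
  shows "(\<integral>\<^sup>+om. ennreal (Y om * exp (\<mu> * Z (a * q) om)) \<partial>M) \<le> ennreal (exp (2 * \<mu> * C + \<delta> / 2 * ln 2))"
proof -
  let ?K = "exp (2 * \<mu> * C + \<delta> / 2 * ln 2)"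
  have Y1: "(\<integral>\<^sup>+om. ennreal (Y om) \<partial>M) \<le> 1"
  proof -
    have "(\<integral>\<^sup>+om. ennreal (Y om) \<partial>M) \<le> (\<integral>\<^sup>+om. 1 \<partial>M)" by (intro nn_integral_mono) (simp add: Y)
    then show ?thesis by (simp add: emeasure_space_1)
  qed
  note [measurable] = measurable_F[OF Y(1)]
  have [measurable]: "Z (a * p) \<in> borel_measurable M" "Z (a * q) \<in> borel_measurable M" using a by auto
  show ?thesis
  proof (cases "p = q")
    case True
    have "(\<integral>\<^sup>+om. ennreal (Y om * exp (\<mu> * Z (a * q) om)) \<partial>M) \<le> (\<integral>\<^sup>+om. ennreal (Y om) * ennreal ?K \<partial>M)"
    proof (intro nn_integral_mono)
      fix om assume "om \<in> space M"
      have "Y om * exp (\<mu> * Z (a * q) om) \<le> Y om * ?K"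
      proof (cases "Y om = 0")
        case False
        then have "\<mu> * Z (a * q) om \<le> \<mu> * C" using C \<mu> True by (intro mult_left_mono) auto
        moreover have "\<mu> * C \<ge> 0" "\<delta> / 2 * ln 2 \<ge> 0" using \<mu> C(2) \<delta> by auto
        ultimately have "\<mu> * Z (a * q) om \<le> 2 * \<mu> * C + \<delta> / 2 * ln 2" by linarith
        then show ?thesis using Y(2) by (intro mult_left_mono) auto
      qed simp
      then show "ennreal (Y om * exp (\<mu> * Z (a * q) om)) \<le> ennreal (Y om) * ennreal ?K"
        using Y(2) by (simp add: ennreal_mult'[symmetric] ennreal_leI)
    qed
    also have "\<dots> = (\<integral>\<^sup>+om. ennreal (Y om) \<partial>M) * ennreal ?K"
      by (rule nn_integral_multc) measurable
    also have "\<dots> \<le> 1 * ennreal ?K" by (intro mult_right_mono Y1) simp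
    finally show ?thesis by simp
  next
    case False
    then have pq': "p < q" using pq by simp
    define x where "x = 1 + 2 * (- \<mu>) * (a * q - a * p)"
    have x: "x \<ge> 1/2" using \<mu> by (simp add: x_def)
    let ?E = "\<lambda>om. - (- \<mu>) * Z (a * q) om + (- \<mu>) / x * Z (a * p) om + \<delta> / 2 * ln x"
    have "(\<integral>\<^sup>+om. ennreal (Y om * exp (\<mu> * Z (a * q) om)) \<partial>M) \<le> (\<integral>\<^sup>+om. ennreal (Y om * exp (?E om)) * ennreal ?K \<partial>M)"
    proof (intro nn_integral_mono)
      fix om assume om: "om \<in> space M"
      have "Y om * exp (\<mu> * Z (a * q) om) \<le> Y om * (exp (?E om) * ?K)"
      proof (cases "Y om = 0")
        case False
        have "\<mu> / x \<le> \<mu> / (1/2)" using x \<mu> by (intro divide_left_mono) auto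
        then have "\<mu> / x \<le> 2 * \<mu>" by simp
        then have 1: "\<mu> / x * Z (a * p) om \<le> 2 * \<mu> * C"
          using C False \<mu> x Z_nonneg[OF om, of "a * p"] a by (intro mult_mono) auto
        have "ln (1/2) \<le> ln x" using x by (subst ln_le_cancel_iff) auto
        then have "- ln 2 \<le> ln x" by (simp add: ln_div)
        then have 2: "\<delta> / 2 * (- ln x) \<le> \<delta> / 2 * ln 2" using \<delta> by (intro mult_left_mono) auto
        have "\<mu> * Z (a * q) om \<le> ?E om + (2 * \<mu> * C + \<delta> / 2 * ln 2)" using 1 2 by simp
        then show ?thesis using Y(2) by (intro mult_left_mono) (auto simp: mult_exp_exp)
      qed simp
      then show "ennreal (Y om * exp (\<mu> * Z (a * q) om)) \<le> ennreal (Y om * exp (?E om)) * ennreal ?K"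
        using Y(2) by (simp add: ennreal_mult'[symmetric] ennreal_leI mult.assoc)
    qed
    also have "\<dots> = (\<integral>\<^sup>+om. ennreal (Y om * exp (?E om)) \<partial>M) * ennreal ?K"
      by (rule nn_integral_multc) measurable
    also have "\<dots> \<le> (\<integral>\<^sup>+om. ennreal (Y om) \<partial>M) * ennreal ?K"
      using x unfolding x_def by (intro mult_right_mono nn_integral_exp_le[OF a pq' _ Y(1,2)]) auto
    also have "\<dots> \<le> 1 * ennreal ?K" by (intro mult_right_mono Y1) simp
    finally show ?thesis by simp
  qed
qed

text \<open>\<open>expo_square_le\<close> and \<open>nn_integral_exp_moment\<close> bound the second
  moments of the discrete martingales, so no mass is lost in the limit. With
  \<open>\<mu> = 24 * \<tau> * lam^2\<close> the condition \<open>4 * \<mu> * \<tau> \<le> 1\<close>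
  reads \<open>96 * (lam * \<tau>)^2 \<le> 1\<close>, which explains the factor 10.\<close>

lemma nn_integral_exp_ge:
  fixes a lam :: real and p q :: nat
  assumes a: "a > 0" and pq: "p < q" and \<delta>: "\<delta> \<ge> 0" and lam: "0 \<le> lam" "10 * lam * (a * q - a * p) \<le> 1"
    and Y: "Y \<in> borel_measurable (F (a * p))" "\<And>om. 0 \<le> Y om" "\<And>om. Y om \<le> 1"
    and C: "\<And>om. Y om \<noteq> 0 \<Longrightarrow> Z (a * p) om \<le> C" "C \<ge> 0"
  shows "(\<integral>\<^sup>+om. ennreal (Y om) \<partial>M) \<le> (\<integral>\<^sup>+om. ennreal (Y om * exp (- lam * Z (a * q) om + lam / (1 + 2 * lam * (a * q - a * p)) * Z (a * p) om +
       \<delta> / 2 * ln (1 + 2 * lam * (a * q - a * p)))) \<partial>M)"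
proof -
  define \<tau> where "\<tau> = a * q - a * p"
  have \<tau>: "\<tau> > 0" using a pq by (simp add: \<tau>_def)
  have pos: "1 + 2 * lam * (a * q - a * p) > 0"
    using lam \<tau> unfolding \<tau>_def by (intro add_pos_nonneg) auto
  define \<mu> where "\<mu> = 24 * \<tau> * lam\<^sup>2"
  have \<mu>: "\<mu> \<ge> 0" "4 * \<mu> * \<tau> \<le> 1"
  proof -
    have "(10 * lam * \<tau>)\<^sup>2 \<le> 1\<^sup>2" using lam \<tau> unfolding \<tau>_def by (intro power_mono) auto
    then show "4 * \<mu> * \<tau> \<le> 1" by (simp add: \<mu>_def power2_eq_square algebra_simps)
    show "\<mu> \<ge> 0" using \<tau> by (simp add: \<mu>_def)
  qed
  let ?K = "exp (2 * \<mu> * C + \<delta> / 2 * ln 2)"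
  obtain n where n: "\<And>m. n m > 0" and ae: "AE om in M. \<forall>lam. 1 + 2 * lam * (a * q - a * p) > 0 \<longrightarrow>
    (\<lambda>m. expo (mesh_weight a q lam m (n m)) (a / (real m * real (n m))) (p * m * n m) (q * m * n m) om)
     \<longlonglongrightarrow> - lam * Z (a * q) om + lam / (1 + 2 * lam * (a * q - a * p)) * Z (a * p) om +
       \<delta> / 2 * ln (1 + 2 * lam * (a * q - a * p))" (is "AE om in M. \<forall>lam. _ \<longrightarrow> (\<lambda>m. ?e lam m om) \<longlonglongrightarrow> ?l lam om")
    using expo_mesh_tendsto[OF a pq] by blast
  note [measurable] = measurable_F[OF Y(1)]
  have [measurable]: "?e lam m \<in> borel_measurable M" for m using a by simp
  have [measurable]: "Z (a * p) \<in> borel_measurable M" "Z (a * q) \<in> borel_measurable M" using a by auto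
  have Y1: "(\<integral>\<^sup>+om. ennreal (Y om) \<partial>M) \<le> 1"
  proof -
    have "(\<integral>\<^sup>+om. ennreal (Y om) \<partial>M) \<le> (\<integral>\<^sup>+om. 1 \<partial>M)" by (intro nn_integral_mono) (simp add: Y)
    then show ?thesis by (simp add: emeasure_space_1)
  qed
  have step: "(\<integral>\<^sup>+om. ennreal (Y om * exp (?e lam (Suc m) om)) \<partial>M) = (\<integral>\<^sup>+om. ennreal (Y om) \<partial>M)"
    "(\<integral>\<^sup>+om. ennreal (Y om * (exp (?e lam (Suc m) om))\<^sup>2) \<partial>M) \<le> ennreal (1 + ?K)" for m
  proof -
    define N where "N = n (Suc m)"
    define d where "d = a / (real (Suc m) * real N)"
    define i where "i = p * Suc m * N"
    define j where "j = q * Suc m * N"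
    define l where "l = mesh_weight a q lam (Suc m) N"
    have N: "N > 0" using n by (simp add: N_def)
    have d: "d > 0" using a N by (simp add: d_def)
    have gen: "real k * x * y * (a / (x * y)) = a * k" if "x \<noteq> 0" "y \<noteq> 0" for x y :: real and k
      using that by simp
    have id: "real i * d = a * p" "real j * d = a * q"
      unfolding i_def j_def d_def of_nat_mult by (rule gen; use N in auto)+
    have ij: "i < j" unfolding i_def j_def using pq N by (intro mult_less_mono1) auto
    have \<tau>d: "\<tau> = real (j - i) * d" using id ij by (simp add: \<tau>_def of_nat_diff algebra_simps)
    have Y': "(\<lambda>om. ennreal (Y om)) \<in> borel_measurable (F (real i * d))"
      using Y(1) id by simp
    have ee: "?e lam (Suc m) = expo l d i j" by (simp add: l_def d_def i_def j_def N_def)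
    have ex: "(\<integral>\<^sup>+om. ennreal (Y om * exp (expo l' d i j om)) \<partial>M) = (\<integral>\<^sup>+om. ennreal (Y om) \<partial>M)" for l'
      using nn_integral_expo[OF d less_imp_le[OF ij] Y', of l'] Y(2) by (simp add: ennreal_mult')
    from ex[of l] show "(\<integral>\<^sup>+om. ennreal (Y om * exp (?e lam (Suc m) om)) \<partial>M) = (\<integral>\<^sup>+om. ennreal (Y om) \<partial>M)"
      unfolding ee .
    have l: "0 \<le> l k \<and> l k \<le> lam" if k: "k \<in> {i..<j}" for k
    proof -
      have "k div N < q * Suc m" using k N by (simp add: j_def less_mult_imp_div_less)
      then have "real (k div N) \<le> real q * real (Suc m)" by (metis less_imp_le of_nat_le_iff of_nat_mult)
      then have "a * real (k div N) \<le> a * (real q * real (Suc m))" using a by (intro mult_left_mono) auto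
      then have "a * real (k div N) / real (Suc m) \<le> a * q" by (simp add: field_simps)
      then have "1 \<le> 1 + 2 * lam * (a * q - a * real (k div N) / real (Suc m))"
        using lam by simp
      then show ?thesis unfolding l_def mesh_weight_def using lam frac_le[of lam lam 1 "1 + 2 * lam * (a * q - a * real (k div N) / real (Suc m))"] by auto
    qed
    have [measurable]: "expo l' d i j \<in> borel_measurable M" for l' using d by simp
    have [measurable]: "Z (real k * d) \<in> borel_measurable M" for k using d by simp
    have mom: "(\<integral>\<^sup>+om. ennreal (Y om * exp (\<mu> * Z (real k * d) om)) \<partial>M) \<le> ennreal ?K" if k: "k \<in> {i..<j}" for k
    proof -
      have "real k * d \<le> real j * d" using k d by (intro mult_right_mono) auto
      then have "d * real k - d * real i \<le> \<tau>" using id by (simp add: \<tau>_def mult.commute)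
      then have "4 * \<mu> * (d * real k - d * real i) \<le> 4 * \<mu> * \<tau>" using \<mu> by (intro mult_left_mono) auto
      then have "4 * \<mu> * (d * real k - d * real i) \<le> 1" using \<mu> by linarith
      from nn_integral_exp_moment[OF d _ \<delta> \<mu>(1) this, of Y C] k Y C id
      show ?thesis by (simp add: mult.commute)
    qed
    have "(\<integral>\<^sup>+om. ennreal (Y om * (exp (expo l d i j om))\<^sup>2) \<partial>M) \<le>
       (\<integral>\<^sup>+om. ennreal (Y om * exp (expo (\<lambda>k. 4 * l k) d i j om)) + (\<Sum>k=i..<j. ennreal (d / \<tau>) * ennreal (Y om * exp (\<mu> * Z (real k * d) om))) \<partial>M)"
    proof (rule nn_integral_mono)
      fix om assume om: "om \<in> space M"
      have "Y om * (exp (expo l d i j om))\<^sup>2 \<le> Y om * (exp (expo (\<lambda>k. 4 * l k) d i j om) +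
         (\<Sum>k=i..<j. d / \<tau> * exp (24 * \<tau> * lam\<^sup>2 * Z (real k * d) om)))"
        by (intro mult_left_mono expo_square_le[OF om d ij \<tau>d l] Y(2))
      also have "\<dots> = Y om * exp (expo (\<lambda>k. 4 * l k) d i j om) + (\<Sum>k=i..<j. d / \<tau> * (Y om * exp (\<mu> * Z (real k * d) om)))"
        by (simp add: distrib_left sum_distrib_left \<mu>_def mult.left_commute)
      finally have "ennreal (Y om * (exp (expo l d i j om))\<^sup>2) \<le> ennreal \<dots>" by (rule ennreal_leI)
      also have "\<dots> = ennreal (Y om * exp (expo (\<lambda>k. 4 * l k) d i j om)) + (\<Sum>k=i..<j. ennreal (d / \<tau>) * ennreal (Y om * exp (\<mu> * Z (real k * d) om)))"
      proof -
        have nn: "0 \<le> d / \<tau> * (Y om * exp (\<mu> * Z (real k * d) om))" for k using Y(2) d \<tau> by simp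
        have "ennreal (d / \<tau> * y) = ennreal (d / \<tau>) * ennreal y" for y
          using d \<tau> by (intro ennreal_mult') simp
        then have "ennreal (\<Sum>k=i..<j. d / \<tau> * (Y om * exp (\<mu> * Z (real k * d) om))) = (\<Sum>k=i..<j. ennreal (d / \<tau>) * ennreal (Y om * exp (\<mu> * Z (real k * d) om)))"
          using nn by (subst sum_ennreal[symmetric]) auto
        then show ?thesis
          using Y(2) nn by (subst ennreal_plus) (auto intro!: sum_nonneg)
      qed
      finally show "ennreal (Y om * (exp (expo l d i j om))\<^sup>2) \<le> \<dots>" .
    qed
    also have "\<dots> = (\<integral>\<^sup>+om. ennreal (Y om * exp (expo (\<lambda>k. 4 * l k) d i j om)) \<partial>M) +
        (\<Sum>k=i..<j. ennreal (d / \<tau>) * (\<integral>\<^sup>+om. ennreal (Y om * exp (\<mu> * Z (real k * d) om)) \<partial>M))"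
      by (simp add: nn_integral_add nn_integral_sum nn_integral_cmult)
    also have "\<dots> \<le> 1 + (\<Sum>k=i..<j. ennreal (d / \<tau>) * ennreal ?K)"
      unfolding ex using Y1 by (intro add_mono sum_mono mult_left_mono mom) auto
    also have "(\<Sum>k=i..<j. ennreal (d / \<tau>) * ennreal ?K) = ennreal (\<Sum>k=i..<j. d / \<tau> * ?K)"
    proof -
      have "ennreal (d / \<tau> * ?K) = ennreal (d / \<tau>) * ennreal ?K"
        using d \<tau> by (intro ennreal_mult') simp
      then show ?thesis using d \<tau> by (subst sum_ennreal[symmetric]) auto
    qed
    also have "(\<Sum>k=i..<j. d / \<tau> * ?K) = ?K" using \<tau>d d ij by simp
    also have "1 + ennreal ?K = ennreal (1 + ?K)" using ennreal_plus[of 1 ?K] by simp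
    finally show "(\<integral>\<^sup>+om. ennreal (Y om * (exp (?e lam (Suc m) om))\<^sup>2) \<partial>M) \<le> ennreal (1 + ?K)"
      unfolding ee .
  qed
  show ?thesis
  proof (rule nn_integral_limit_L2[where D = "\<lambda>m om. exp (?e lam (Suc m) om)" and K = "1 + ?K", OF prob_space_M])
    show "AE om in M. (\<lambda>m. exp (?e lam (Suc m) om)) \<longlonglongrightarrow> exp (?l lam om)"
      using ae by eventually_elim (use pos in \<open>intro tendsto_exp LIMSEQ_Suc[of "\<lambda>m. ?e lam m _"], blast\<close>)
    show "(\<integral>\<^sup>+om. ennreal (Y om) \<partial>M) \<le> (\<integral>\<^sup>+om. ennreal (Y om * exp (?e lam (Suc m) om)) \<partial>M)" for m
      using step(1)[of m] by simp
    show "(\<lambda>om. exp (?e lam (Suc m) om)) \<in> borel_measurable M" for m by measurable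
    show "(\<lambda>om. exp (?l lam om)) \<in> borel_measurable M" by measurable
    show "(\<integral>\<^sup>+om. ennreal (Y om * (exp (?e lam (Suc m) om))\<^sup>2) \<partial>M) \<le> ennreal (1 + ?K)" for m by (rule step)
    show "0 \<le> 1 + ?K" by (intro add_nonneg_nonneg) auto
  qed (use Y in auto)
qed


end

section \<open>The Laplace transform and the Markov property\<close>

context squared_bessel begin

text \<open>Both inequalities are applied to \<open>Y * exp (- (lam / x) * Z)\<close>, cut off where
  \<open>Z (a * p)\<close> exceeds \<open>N\<close>: this factor cancels the term of the exponent at
  the earlier time. Letting \<open>N\<close> grow removes the cut-off.\<close>

lemma laplace_grid_small:
  fixes a lam :: real and p q :: nat
  assumes a: "a > 0" and pq: "p < q" and \<delta>: "\<delta> \<ge> 0" and lam: "0 \<le> lam" "10 * lam * (a * q - a * p) \<le> 1"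
    and Y: "Y \<in> borel_measurable (F (a * p))" "\<And>om. 0 \<le> Y om" "\<And>om. Y om \<le> 1"
  defines "x \<equiv> 1 + 2 * lam * (a * q - a * p)"
  shows "(\<integral>\<^sup>+om. ennreal (Y om * exp (- lam * Z (a * q) om)) \<partial>M) =
    ennreal (x powr (- \<delta> / 2)) * (\<integral>\<^sup>+om. ennreal (Y om * exp (- (lam / x) * Z (a * p) om)) \<partial>M)"
proof -
  have x: "x \<ge> 1" unfolding x_def using lam a pq by simp
  note [measurable] = measurable_F[OF Y(1)]
  have Zm [measurable]: "Z (a * p) \<in> borel_measurable M" "Z (a * q) \<in> borel_measurable M" using a by auto
  have eqN: "(\<integral>\<^sup>+om. ennreal (if 0 \<le> Z (a * p) om \<and> Z (a * p) om \<le> real N then Y om * exp (- lam * Z (a * q) om) else 0) \<partial>M) =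
    ennreal (x powr (- \<delta> / 2)) * (\<integral>\<^sup>+om. ennreal (if 0 \<le> Z (a * p) om \<and> Z (a * p) om \<le> real N then Y om * exp (- (lam / x) * Z (a * p) om) else 0) \<partial>M)" for N :: nat
  proof -
    define Y' where "Y' om = (if 0 \<le> Z (a * p) om \<and> Z (a * p) om \<le> real N then Y om * exp (- (lam / x) * Z (a * p) om) else 0)" for om
    have Zp [measurable]: "Z (a * p) \<in> borel_measurable (F (a * p))" using Z_adapted[of "a * p"] a by simp
    note [measurable] = Y(1)
    have Y'm: "Y' \<in> borel_measurable (F (a * p))" unfolding Y'_def[abs_def] by measurable
    have Y'0: "0 \<le> Y' om" for om using Y by (simp add: Y'_def)
    have Y'1: "Y' om \<le> 1" for om
    proof (cases "0 \<le> Z (a * p) om")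
      case True
      then have "exp (- (lam / x) * Z (a * p) om) \<le> 1" using lam x by simp
      then have "Y om * exp (- (lam / x) * Z (a * p) om) \<le> 1 * 1" using Y by (intro mult_mono) auto
      then show ?thesis by (simp add: Y'_def)
    qed (simp add: Y'_def)
    have Y'C: "Z (a * p) om \<le> real N" if "Y' om \<noteq> 0" for om
      using that by (auto simp: Y'_def split: if_splits)
    let ?E = "\<lambda>om. exp (- lam * Z (a * q) om + lam / x * Z (a * p) om + \<delta> / 2 * ln x)"
    have "(\<integral>\<^sup>+om. ennreal (Y' om) \<partial>M) = (\<integral>\<^sup>+om. ennreal (Y' om * ?E om) \<partial>M)"
      unfolding x_def
    proof (rule antisym)
      show "(\<integral>\<^sup>+om. ennreal (Y' om) \<partial>M) \<le> (\<integral>\<^sup>+om. ennreal (Y' om * exp (- lam * Z (a * q) om + lam / (1 + 2 * lam * (a * q - a * p)) * Z (a * p) om + \<delta> / 2 * ln (1 + 2 * lam * (a * q - a * p)))) \<partial>M)"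
        by (rule nn_integral_exp_ge[OF a pq \<delta> lam Y'm Y'0 Y'1 Y'C]) auto
      show "(\<integral>\<^sup>+om. ennreal (Y' om * exp (- lam * Z (a * q) om + lam / (1 + 2 * lam * (a * q - a * p)) * Z (a * p) om + \<delta> / 2 * ln (1 + 2 * lam * (a * q - a * p)))) \<partial>M) \<le> (\<integral>\<^sup>+om. ennreal (Y' om) \<partial>M)"
        using x unfolding x_def by (intro nn_integral_exp_le[OF a pq _ Y'm Y'0]) auto
    qed
    also have "\<dots> = (\<integral>\<^sup>+om. ennreal (if 0 \<le> Z (a * p) om \<and> Z (a * p) om \<le> real N then Y om * exp (- lam * Z (a * q) om) else 0) * ennreal (x powr (\<delta> / 2)) \<partial>M)"
    proof (rule nn_integral_cong)
      fix om
      have "exp (- (lam / x) * Z (a * p) om) * ?E om = exp (- lam * Z (a * q) om) * x powr (\<delta> / 2)"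
        using x by (simp add: powr_def mult_exp_exp)
      then show "ennreal (Y' om * ?E om) = ennreal (if 0 \<le> Z (a * p) om \<and> Z (a * p) om \<le> real N then Y om * exp (- lam * Z (a * q) om) else 0) * ennreal (x powr (\<delta> / 2))"
        by (simp add: Y'_def ennreal_mult''[symmetric] mult.assoc)
    qed
    also have "\<dots> = (\<integral>\<^sup>+om. ennreal (if 0 \<le> Z (a * p) om \<and> Z (a * p) om \<le> real N then Y om * exp (- lam * Z (a * q) om) else 0) \<partial>M) * ennreal (x powr (\<delta> / 2))"
      by (rule nn_integral_multc) measurable
    finally have "ennreal (x powr (- \<delta> / 2)) * (\<integral>\<^sup>+om. ennreal (Y' om) \<partial>M) =
       (\<integral>\<^sup>+om. ennreal (if 0 \<le> Z (a * p) om \<and> Z (a * p) om \<le> real N then Y om * exp (- lam * Z (a * q) om) else 0) \<partial>M) * (ennreal (x powr (- \<delta> / 2)) * ennreal (x powr (\<delta> / 2)))"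
      by (simp add: mult_ac)
    also have "ennreal (x powr (- \<delta> / 2)) * ennreal (x powr (\<delta> / 2)) = 1"
      using x by (simp add: ennreal_mult'[symmetric] powr_add[symmetric])
    finally show ?thesis by (simp add: Y'_def)
  qed
  have lim: "(\<lambda>N. \<integral>\<^sup>+om. ennreal (if 0 \<le> Z (a * p) om \<and> Z (a * p) om \<le> real N then Y om * g om else 0) \<partial>M) \<longlonglongrightarrow> (\<integral>\<^sup>+om. ennreal (Y om * g om) \<partial>M)"
    if [measurable]: "g \<in> borel_measurable M" and g: "\<And>om. om \<in> space M \<Longrightarrow> 0 \<le> g om \<and> g om \<le> 1" for g
  proof (rule nn_integral_dominated_convergence[where w = "\<lambda>_. 1"])
    show "AE om in M. ennreal (if 0 \<le> Z (a * p) om \<and> Z (a * p) om \<le> real N then Y om * g om else 0) \<le> 1" for N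
    proof (intro AE_I2)
      fix om assume "om \<in> space M"
      then have "Y om * g om \<le> 1 * 1" using g Y by (intro mult_mono) auto
      then show "ennreal (if 0 \<le> Z (a * p) om \<and> Z (a * p) om \<le> real N then Y om * g om else 0) \<le> 1" by simp
    qed
    show "AE om in M. (\<lambda>N. ennreal (if 0 \<le> Z (a * p) om \<and> Z (a * p) om \<le> real N then Y om * g om else 0)) \<longlonglongrightarrow> ennreal (Y om * g om)"
    proof (intro AE_I2 tendsto_eventually)
      fix om assume "om \<in> space M"
      then have Z0: "0 \<le> Z (a * p) om" using Z_nonneg a by simp
      have "\<forall>\<^sub>F N in sequentially. Z (a * p) om \<le> real N"
        using filterlim_real_sequentially unfolding filterlim_at_top by blast
      then show "\<forall>\<^sub>F N in sequentially. ennreal (if 0 \<le> Z (a * p) om \<and> Z (a * p) om \<le> real N then Y om * g om else 0) = ennreal (Y om * g om)"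
        by (rule eventually_mono) (simp add: Z0)
    qed
  qed (auto simp: emeasure_space_1)
  have g1: "0 \<le> exp (- lam * Z (a * q) om) \<and> exp (- lam * Z (a * q) om) \<le> 1" "0 \<le> exp (- (lam / x) * Z (a * p) om) \<and> exp (- (lam / x) * Z (a * p) om) \<le> 1" 
    if "om \<in> space M" for om
    using Z_nonneg[OF that] a lam x by auto
  have L: "(\<lambda>N. \<integral>\<^sup>+om. ennreal (if 0 \<le> Z (a * p) om \<and> Z (a * p) om \<le> real N then Y om * exp (- lam * Z (a * q) om) else 0) \<partial>M) \<longlonglongrightarrow> (\<integral>\<^sup>+om. ennreal (Y om * exp (- lam * Z (a * q) om)) \<partial>M)"
    by (rule lim[OF _ g1(1)]) measurable
  have "(\<lambda>N. ennreal (x powr (- \<delta> / 2)) * (\<integral>\<^sup>+om. ennreal (if 0 \<le> Z (a * p) om \<and> Z (a * p) om \<le> real N then Y om * exp (- (lam / x) * Z (a * p) om) else 0) \<partial>M)) \<longlonglongrightarrow>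
     ennreal (x powr (- \<delta> / 2)) * (\<integral>\<^sup>+om. ennreal (Y om * exp (- (lam / x) * Z (a * p) om)) \<partial>M)"
    by (intro ennreal_tendsto_cmult lim[OF _ g1(2)]) auto
  with L show ?thesis unfolding eqN by (rule LIMSEQ_unique)
qed

text \<open>The maps \<open>lam \<mapsto> lam / (1 + 2 * lam * t)\<close> form a semigroup in
  \<open>t\<close>, and the prefactors multiply accordingly, so short steps can be chained.
  \<open>lam\<close> only shrinks on the way, which preserves the smallness condition.\<close>

lemma laplace_grid_steps:
  fixes a lam :: real and p k :: nat
  assumes a: "a > 0" and \<delta>: "\<delta> \<ge> 0" and lam: "0 \<le> lam" "10 * lam * a \<le> 1"
    and Y: "Y \<in> borel_measurable (F (a * p))" "\<And>om. 0 \<le> Y om" "\<And>om. Y om \<le> 1"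
  shows "(\<integral>\<^sup>+om. ennreal (Y om * exp (- lam * Z (a * real (p + k)) om)) \<partial>M) =
    ennreal ((1 + 2 * lam * (a * k)) powr (- \<delta> / 2)) * (\<integral>\<^sup>+om. ennreal (Y om * exp (- (lam / (1 + 2 * lam * (a * k))) * Z (a * p) om)) \<partial>M)"
  using lam
proof (induction k arbitrary: lam)
  case (Suc k)
  define x where "x = 1 + 2 * lam * a"
  have x: "x \<ge> 1" using Suc a by (simp add: x_def)
  have lx: "0 \<le> lam / x" "10 * (lam / x) * a \<le> 1"
  proof -
    have "lam / x \<le> lam" using x Suc frac_le[of lam lam 1 x] by simp
    then have "10 * (lam / x) * a \<le> 10 * lam * a" using a by (intro mult_right_mono mult_left_mono) auto
    then show "10 * (lam / x) * a \<le> 1" using Suc by simp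
    show "0 \<le> lam / x" using x Suc by simp
  qed
  have st: "a * real (p + Suc k) - a * real (p + k) = a" by (simp add: algebra_simps)
  have "a * real p \<le> a * real (p + k)" using a by simp
  from measurable_F_mono[OF Y(1) this] have Y': "Y \<in> borel_measurable (F (a * real (p + k)))" .
  have "(\<integral>\<^sup>+om. ennreal (Y om * exp (- lam * Z (a * real (p + Suc k)) om)) \<partial>M) =
     ennreal (x powr (- \<delta> / 2)) * (\<integral>\<^sup>+om. ennreal (Y om * exp (- (lam / x) * Z (a * real (p + k)) om)) \<partial>M)"
    using laplace_grid_small[OF a _ \<delta> _ _ Y' Y(2,3), of "p + Suc k" lam] Suc.prems
    unfolding st x_def by simp
  also have "\<dots> = ennreal (x powr (- \<delta> / 2)) * (ennreal ((1 + 2 * (lam / x) * (a * k)) powr (- \<delta> / 2)) * (\<integral>\<^sup>+om. ennreal (Y om * exp (- (lam / x / (1 + 2 * (lam / x) * (a * k))) * Z (a * p) om)) \<partial>M))"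
    using Suc.IH[OF lx] by simp
  also have "lam / x / (1 + 2 * (lam / x) * (a * k)) = lam / (1 + 2 * lam * (a * Suc k))"
  proof -
    have "x * (1 + 2 * (lam / x) * (a * k)) = 1 + 2 * lam * (a * Suc k)"
      using x by (simp add: field_simps) (simp add: x_def algebra_simps)
    then show ?thesis by (metis divide_divide_eq_left)
  qed
  also have "ennreal (x powr (- \<delta> / 2)) * (ennreal ((1 + 2 * (lam / x) * (a * k)) powr (- \<delta> / 2)) * c) = ennreal ((1 + 2 * lam * (a * Suc k)) powr (- \<delta> / 2)) * c" for c
  proof -
    have "x * (1 + 2 * (lam / x) * (a * k)) = 1 + 2 * lam * (a * Suc k)"
      using x by (simp add: field_simps) (simp add: x_def algebra_simps)
    moreover have "0 \<le> 1 + 2 * (lam / x) * (a * k)"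
    proof -
      have "0 \<le> 2 * (lam / x) * (a * k)" using lx(1) a by (intro mult_nonneg_nonneg) auto
      then show ?thesis by linarith
    qed
    ultimately show ?thesis
      using x by (simp add: ennreal_mult'[symmetric] mult.assoc[symmetric] powr_mult[symmetric] del: of_nat_Suc)
  qed
  finally show ?case .
qed simp

lemma laplace_grid:
  fixes a lam :: real and p q :: nat
  assumes a: "a > 0" and pq: "p \<le> q" and \<delta>: "\<delta> \<ge> 0" and lam: "0 \<le> lam"
    and Y: "Y \<in> borel_measurable (F (a * p))" "\<And>om. 0 \<le> Y om" "\<And>om. Y om \<le> 1"
  shows "(\<integral>\<^sup>+om. ennreal (Y om * exp (- lam * Z (a * q) om)) \<partial>M) =
    ennreal ((1 + 2 * lam * (a * q - a * p)) powr (- \<delta> / 2)) * (\<integral>\<^sup>+om. ennreal (Y om * exp (- (lam / (1 + 2 * lam * (a * q - a * p))) * Z (a * p) om)) \<partial>M)"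
proof -
  \<comment> \<open>Dividing each grid step into \<open>N\<close> parts makes a single step short
    enough for \<open>laplace_grid_steps\<close>.\<close>
  obtain N :: nat where N: "N > 0" "10 * lam * a \<le> N"
  proof -
    obtain N :: nat where "10 * lam * a \<le> N" using real_arch_simple by blast
    then show ?thesis using that[of "Suc N"] by simp
  qed
  define b where "b = a / N"
  have b: "b > 0" "10 * lam * b \<le> 1" using a N by (auto simp: b_def field_simps)
  have p': "b * real (p * N) = a * p" and q': "b * real (p * N + (q - p) * N) = a * q" and d: "b * real ((q - p) * N) = a * q - a * p"
    using N pq by (auto simp: b_def of_nat_diff field_simps)
  show ?thesis
    using laplace_grid_steps[OF b(1) \<delta> lam b(2), of Y "p * N" "(q - p) * N"] Y unfolding p' q' d by simp
qed

text \<open>Two times with irrational ratio lie on no common grid through 0. So \<open>s\<close> is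
  approached from above by points \<open>u j\<close> of the grid of width \<open>t / Suc j\<close>:
  \<open>t\<close> is a point of every grid, \<open>Y\<close> remains measurable at
  \<open>u j\<close>, and continuity of the paths gives the limit.\<close>

theorem laplace_markov:
  assumes st: "0 \<le> s" "s \<le> t" and \<delta>: "\<delta> \<ge> 0" and lam: "0 \<le> lam"
    and Y: "Y \<in> borel_measurable (F s)" "\<And>om. 0 \<le> Y om" "\<And>om. Y om \<le> 1"
  shows "(\<integral>\<^sup>+om. ennreal (Y om * exp (- lam * Z t om)) \<partial>M) =
    ennreal ((1 + 2 * lam * (t - s)) powr (- \<delta> / 2)) * (\<integral>\<^sup>+om. ennreal (Y om * exp (- (lam / (1 + 2 * lam * (t - s))) * Z s om)) \<partial>M)"
proof (cases "s = t")
  case False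
  then have t: "t > 0" "s < t" using st by auto
  define k where "k j = nat \<lceil>s / t * real (Suc j)\<rceil>" for j
  define u where "u j = t / Suc j * real (k j)" for j
  have k0: "real (k j) = of_int \<lceil>s / t * real (Suc j)\<rceil>" for j
    using st t by (simp add: k_def)
  have kj: "s / t * real (Suc j) \<le> real (k j)" "real (k j) \<le> s / t * real (Suc j) + 1" for j
    unfolding k0 by linarith+
  have kl: "k j \<le> Suc j" for j
  proof -
    have "s / t * real (Suc j) \<le> real (Suc j)" using st t by (simp add: divide_le_eq mult_right_mono)
    then show ?thesis unfolding k_def by linarith
  qed
  have u1: "s \<le> u j" for j
    using kj(1)[of j] t by (simp add: u_def field_simps del: of_nat_Suc)
  have u2: "u j \<le> t" for j
  proof -
    have "real (k j) \<le> real (Suc j)" using kl of_nat_le_iff by blast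
    then show ?thesis using t by (simp add: u_def field_simps del: of_nat_Suc)
  qed
  have u3: "u j \<le> s + t * (1 / Suc j)" for j
    using kj(2)[of j] t by (simp add: u_def field_simps del: of_nat_Suc)
  have "(\<lambda>j. s + t * (1 / real (Suc j))) \<longlonglongrightarrow> s + t * 0"
    by (intro tendsto_intros LIMSEQ_Suc[OF lim_1_over_n])
  then have u: "u \<longlonglongrightarrow> s"
    by (intro tendsto_sandwich[of "\<lambda>_. s" u sequentially "\<lambda>j. s + t * (1 / Suc j)"] always_eventually allI u1 u3) auto
  let ?x = "\<lambda>r. 1 + 2 * lam * (t - r)"
  have xu: "?x (u j) \<ge> 1" for j using lam u2[of j] by simp
  have xs: "?x s \<ge> 1" using lam st by simp
  have eq: "(\<integral>\<^sup>+om. ennreal (Y om * exp (- lam * Z t om)) \<partial>M) =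
      ennreal (?x (u j) powr (- \<delta> / 2)) * (\<integral>\<^sup>+om. ennreal (Y om * exp (- (lam / ?x (u j)) * Z (u j) om)) \<partial>M)" for j
  proof -
    have tj: "t / Suc j * real (Suc j) = t" by (simp del: of_nat_Suc)
    have "Y \<in> borel_measurable (F (t / Suc j * real (k j)))"
      using measurable_F_mono[OF Y(1) u1[of j]] by (simp add: u_def)
    from laplace_grid[OF _ kl \<delta> lam this Y(2,3)] t show ?thesis unfolding tj u_def[symmetric] by simp
  qed
  note [measurable] = measurable_F[OF Y(1)]
  have [measurable]: "Z (u j) \<in> borel_measurable M" "Z s \<in> borel_measurable M" for j 
    using u1[of j] st by auto
  have "(\<lambda>j. ennreal (?x (u j) powr (- \<delta> / 2)) * (\<integral>\<^sup>+om. ennreal (Y om * exp (- (lam / ?x (u j)) * Z (u j) om)) \<partial>M)) \<longlonglongrightarrow>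
     ennreal (?x s powr (- \<delta> / 2)) * (\<integral>\<^sup>+om. ennreal (Y om * exp (- (lam / ?x s) * Z s om)) \<partial>M)"
  proof (intro tendsto_mult_ennreal)
    show "(\<lambda>j. ennreal (?x (u j) powr (- \<delta> / 2))) \<longlonglongrightarrow> ennreal (?x s powr (- \<delta> / 2))"
      using xs by (intro tendsto_ennrealI tendsto_powr tendsto_intros u) auto
    show "(\<lambda>j. \<integral>\<^sup>+om. ennreal (Y om * exp (- (lam / ?x (u j)) * Z (u j) om)) \<partial>M) \<longlonglongrightarrow> (\<integral>\<^sup>+om. ennreal (Y om * exp (- (lam / ?x s) * Z s om)) \<partial>M)"
    proof (rule nn_integral_dominated_convergence[where w = "\<lambda>_. 1"])
      show "AE om in M. ennreal (Y om * exp (- (lam / ?x (u j)) * Z (u j) om)) \<le> 1" for j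
      proof (intro AE_I2)
        fix om assume om: "om \<in> space M"
        have "0 \<le> lam / ?x (u j) * Z (u j) om"
          using Z_nonneg[OF om, of "u j"] u1[of j] st xu[of j] lam by (intro mult_nonneg_nonneg divide_nonneg_nonneg) auto
        then have "Y om * exp (- (lam / ?x (u j)) * Z (u j) om) \<le> 1 * 1" 
          using Y by (intro mult_mono) auto
        then show "ennreal (Y om * exp (- (lam / ?x (u j)) * Z (u j) om)) \<le> 1" by simp
      qed
      show "AE om in M. (\<lambda>j. ennreal (Y om * exp (- (lam / ?x (u j)) * Z (u j) om))) \<longlonglongrightarrow> ennreal (Y om * exp (- (lam / ?x s) * Z s om))"
      proof (intro AE_I2)
        fix om assume om: "om \<in> space M"
        have "(\<lambda>j. Z (u j) om) \<longlonglongrightarrow> Z s om"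
          using u1 st by (intro continuous_on_tendsto_compose[OF Z_cont[OF om] u])
            (auto intro!: always_eventually intro: order_trans[OF st(1)])
        then show "(\<lambda>j. ennreal (Y om * exp (- (lam / ?x (u j)) * Z (u j) om))) \<longlonglongrightarrow> ennreal (Y om * exp (- (lam / ?x s) * Z s om))"
          using xs by (intro tendsto_ennrealI tendsto_intros u) auto
      qed
    qed (auto simp: emeasure_space_1)
    have "(\<integral>\<^sup>+om. ennreal (Y om * exp (- (lam / ?x s) * Z s om)) \<partial>M) \<le> (\<integral>\<^sup>+om. 1 \<partial>M)"
    proof (rule nn_integral_mono)
      fix om assume om: "om \<in> space M"
      have "0 \<le> lam / ?x s * Z s om"
        using Z_nonneg[OF om, of s] st xs lam by (intro mult_nonneg_nonneg divide_nonneg_nonneg) auto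
      then have "Y om * exp (- (lam / ?x s) * Z s om) \<le> 1 * 1" 
        using Y by (intro mult_mono) auto
      then show "ennreal (Y om * exp (- (lam / ?x s) * Z s om)) \<le> 1" by simp
    qed
    then have "(\<integral>\<^sup>+om. ennreal (Y om * exp (- (lam / ?x s) * Z s om)) \<partial>M) \<noteq> top"
      by (auto simp: emeasure_space_1 top_unique)
    then show "\<not> ((ennreal (?x s powr (- \<delta> / 2)) = 0 \<and> (\<integral>\<^sup>+om. ennreal (Y om * exp (- (lam / ?x s) * Z s om)) \<partial>M) = \<infinity>) \<or>
      (ennreal (?x s powr (- \<delta> / 2)) = \<infinity> \<and> (\<integral>\<^sup>+om. ennreal (Y om * exp (- (lam / ?x s) * Z s om)) \<partial>M) = 0))"
      by simp
  qed
  then show ?thesis unfolding eq[symmetric] by (simp add: LIMSEQ_const_iff)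
qed simp

end

section \<open>Gamma mixtures and uniqueness of Laplace transforms\<close>

lemma nn_integral_gamma_scaled:
  assumes s: "s > 0" and b: "b > (0::real)"
  shows "(\<integral>\<^sup>+y. ennreal (indicator {0<..} y * y powr (s - 1) * exp (- b * y)) \<partial>lborel) = ennreal (Gamma s * b powr (- s))"
proof -
  have "ennreal (Gamma s) = (\<integral>\<^sup>+t. ennreal (indicator {0..} t * t powr (s - 1) / exp t) \<partial>lborel)"
    using Gamma_conv_nn_integral_real[OF s] .
  also have "\<dots> = ennreal b * (\<integral>\<^sup>+y. ennreal (indicator {0..} (b * y) * (b * y) powr (s - 1) / exp (b * y)) \<partial>lborel)"
    using b by (subst nn_integral_real_affine[where c = b and t = 0]) auto
  also have "\<dots> = ennreal b * (\<integral>\<^sup>+y. ennreal (b powr (s - 1)) * ennreal (indicator {0<..} y * y powr (s - 1) * exp (- b * y)) \<partial>lborel)"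
    using b by (intro arg_cong2[where f = "(*)"] nn_integral_cong refl)
      (auto simp: indicator_def powr_mult exp_minus field_simps ennreal_mult'[symmetric] zero_le_mult_iff)
  also have "\<dots> = ennreal (b powr s) * (\<integral>\<^sup>+y. ennreal (indicator {0<..} y * y powr (s - 1) * exp (- b * y)) \<partial>lborel)"
  proof -
    have "b * b powr (s - 1) = b powr s" using b by (simp add: powr_diff)
    then show ?thesis using b by (subst nn_integral_cmult) (auto simp: mult.assoc[symmetric] ennreal_mult'[symmetric])
  qed
  finally have eq: "ennreal (Gamma s) = \<dots>" .
  have "ennreal (Gamma s * b powr (- s)) = ennreal (b powr (- s)) * ennreal (Gamma s)"
    using b by (simp add: ennreal_mult''[symmetric] mult.commute)
  also have "\<dots> = ennreal (b powr (- s)) * ennreal (b powr s) * (\<integral>\<^sup>+y. ennreal (indicator {0<..} y * y powr (s - 1) * exp (- b * y)) \<partial>lborel)"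
    unfolding eq by (simp add: mult.assoc)
  also have "ennreal (b powr (- s)) * ennreal (b powr s) = 1"
    using b by (simp add: ennreal_mult'[symmetric] powr_add[symmetric])
  finally show ?thesis by simp
qed

text \<open>With \<open>y = exp (- x)\<close> in the unit interval the hypothesis is equality of all
  moments, and polynomials are uniformly dense in the continuous functions there. So natural
  arguments of the Laplace transform suffice.\<close>

lemma finite_measure_eqI_laplace:
  fixes \<mu> \<nu> :: "real measure"
  assumes fin: "finite_measure \<mu>" "finite_measure \<nu>"
    and sets [measurable_cong]: "sets \<mu> = sets borel" "sets \<nu> = sets borel"
    and nonneg: "AE x in \<mu>. 0 \<le> x" "AE x in \<nu>. 0 \<le> x"
    and eq: "\<And>n :: nat. (\<integral>x. exp (- real n * x) \<partial>\<mu>) = (\<integral>x. exp (- real n * x) \<partial>\<nu>)"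
  shows "\<mu> = \<nu>"
proof -
  interpret \<mu>: finite_measure \<mu> by fact
  interpret \<nu>: finite_measure \<nu> by fact
  have sp: "space \<mu> = UNIV" "space \<nu> = UNIV" using sets[THEN sets_eq_imp_space_eq] by auto
  have mass: "measure \<mu> UNIV = measure \<nu> UNIV" using eq[of 0] sp by simp
  have int: "integrable \<mu> (\<lambda>x. f (exp (- x)))" "integrable \<nu> (\<lambda>x. f (exp (- x)))"
    if f: "f \<in> borel_measurable borel" and C: "\<And>y. y \<in> {0..1} \<Longrightarrow> \<bar>f y\<bar> \<le> C" for f and C :: real
  proof -
    have "AE x in \<mu>. norm (f (exp (- x))) \<le> C" using nonneg(1) by eventually_elim (auto intro!: C)
    then show "integrable \<mu> (\<lambda>x. f (exp (- x)))" using f by (intro \<mu>.integrable_const_bound) auto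
    have "AE x in \<nu>. norm (f (exp (- x))) \<le> C" using nonneg(2) by eventually_elim (auto intro!: C)
    then show "integrable \<nu> (\<lambda>x. f (exp (- x)))" using f by (intro \<nu>.integrable_const_bound) auto
  qed
  have poly: "(\<integral>x. g (exp (- x)) \<partial>\<mu>) = (\<integral>x. g (exp (- x)) \<partial>\<nu>)" if rp: "real_polynomial_function g" for g :: "real \<Rightarrow> real"
  proof -
    obtain a n where g: "g = (\<lambda>x. \<Sum>i\<le>n. a i * x ^ i)"
      using rp unfolding real_polynomial_function_iff_sum by blast
    have pw: "exp (- x) ^ i = exp (- real i * x)" for x :: real and i by (simp add: exp_of_nat_mult[symmetric])
    have "integrable \<mu> (\<lambda>x. exp (- x) ^ i)" "integrable \<nu> (\<lambda>x. exp (- x) ^ i)" for i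
      by (intro int[where f = "\<lambda>y. y ^ i" and C = 1]; auto intro!: power_le_one)+
    then show ?thesis unfolding g using eq by (simp add: pw)
  qed
  have cont: "(\<integral>x. f (exp (- x)) \<partial>\<mu>) = (\<integral>x. f (exp (- x)) \<partial>\<nu>)" if f: "continuous_on UNIV f" for f :: "real \<Rightarrow> real"
  proof -
    have fm: "f \<in> borel_measurable borel" by (rule borel_measurable_continuous_onI[OF f])
    have f01: "continuous_on {0..1} f" using f continuous_on_subset by blast
    obtain C where "\<forall>x\<in>f ` {0..1}. norm x \<le> C"
      using compact_imp_bounded[OF compact_continuous_image[OF f01 compact_Icc]] unfolding bounded_iff by blast
    then have C: "\<bar>f y\<bar> \<le> C" if "y \<in> {0..1}" for y using that by auto
    have "\<bar>(\<integral>x. f (exp (- x)) \<partial>\<mu>) - (\<integral>x. f (exp (- x)) \<partial>\<nu>)\<bar> \<le> e * (2 * measure \<mu> UNIV)" if e: "e > 0" for e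
    proof -
      obtain g where g: "real_polynomial_function g" "\<And>x. x \<in> {0..1} \<Longrightarrow> \<bar>f x - g x\<bar> < e"
        using Stone_Weierstrass_real_polynomial_function[OF compact_Icc f01 e] by blast
      have gm: "g \<in> borel_measurable borel"
        using g(1) continuous_real_polymonial_function continuous_at_imp_continuous_on borel_measurable_continuous_onI by blast
      have gC: "\<bar>g y\<bar> \<le> C + e" if "y \<in> {0..1}" for y using C[OF that] g(2)[OF that] by linarith
      have d: "\<bar>(\<integral>x. f (exp (- x)) \<partial>N) - (\<integral>x. g (exp (- x)) \<partial>N)\<bar> \<le> e * measure N UNIV"
        if N: "finite_measure N" "sets N = sets borel" "AE x in N. 0 \<le> x" and i: "integrable N (\<lambda>x. f (exp (- x)))" "integrable N (\<lambda>x. g (exp (- x)))" for N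
      proof -
        interpret N: finite_measure N by fact
        have "(\<integral>x. f (exp (- x)) \<partial>N) - (\<integral>x. g (exp (- x)) \<partial>N) = (\<integral>x. f (exp (- x)) - g (exp (- x)) \<partial>N)"
          using i by simp
        also have "\<bar>\<dots>\<bar> \<le> (\<integral>x. \<bar>f (exp (- x)) - g (exp (- x))\<bar> \<partial>N)" by (rule integral_abs_bound)
        also have "\<dots> \<le> (\<integral>x. e \<partial>N)"
        proof (rule integral_mono_AE)
          show "AE x in N. \<bar>f (exp (- x)) - g (exp (- x))\<bar> \<le> e"
            using N(3) by eventually_elim (auto intro!: less_imp_le g(2))
        qed (use i in auto)
        also have "\<dots> = e * measure N UNIV" using sets_eq_imp_space_eq[OF N(2)] by simp
        finally show ?thesis .
      qed
      show ?thesis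
        using d[OF fin(1) sets(1) nonneg(1) int(1)[OF fm C] int(1)[OF gm gC]]
          d[OF fin(2) sets(2) nonneg(2) int(2)[OF fm C] int(2)[OF gm gC]] poly[OF g(1)] mass by simp
    qed
    note bd = this
    have "\<bar>(\<integral>x. f (exp (- x)) \<partial>\<mu>) - (\<integral>x. f (exp (- x)) \<partial>\<nu>)\<bar> \<le> 0"
    proof (rule field_le_epsilon)
      fix e :: real assume e: "e > 0"
      let ?m = "measure \<mu> UNIV"
      have m0: "?m \<ge> 0" "2 * ?m + 1 > 0" using measure_nonneg[of \<mu> UNIV] by linarith+
      have "e / (2 * ?m + 1) * (2 * ?m) = e * (2 * ?m / (2 * ?m + 1))" by simp
      also have "\<dots> \<le> e * 1" using e m0 by (intro mult_left_mono) (auto simp: divide_le_eq_1)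
      finally have "e / (2 * ?m + 1) * (2 * ?m) \<le> e" by simp
      moreover have "e / (2 * ?m + 1) > 0" using e m0 by (intro divide_pos_pos add_nonneg_pos) auto
      ultimately show "\<bar>(\<integral>x. f (exp (- x)) \<partial>\<mu>) - (\<integral>x. f (exp (- x)) \<partial>\<nu>)\<bar> \<le> 0 + e"
        using bd[of "e / (2 * ?m + 1)"] by linarith
    qed
    then show ?thesis by simp
  qed
  have Iic: "measure \<mu> {..a} = measure \<nu> {..a}" for a
  proof -
    \<comment> \<open>Piecewise linear in \<open>y\<close>, equal to 1 for
      \<open>y \<ge> exp (- a)\<close>; along \<open>y = exp (- x)\<close> it decreases in
      \<open>k\<close> to the indicator of \<open>x \<le> a\<close>.\<close>
    define \<phi> where "\<phi> k y = max 0 (min 1 (1 + real k * (y - exp (- a))))" for k :: nat and y :: real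
    have lim: "(\<lambda>k. \<phi> k (exp (- x))) \<longlonglongrightarrow> indicator {..a} x" for x
    proof (cases "x \<le> a")
      case True
      then have "\<phi> k (exp (- x)) = 1" for k by (simp add: \<phi>_def)
      then show ?thesis using True by simp
    next
      case False
      then have pos: "exp (- a) - exp (- x) > 0" by simp
      have "\<forall>\<^sub>F k in sequentially. 1 / (exp (- a) - exp (- x)) \<le> real k"
        using filterlim_real_sequentially unfolding filterlim_at_top by blast
      then have "\<forall>\<^sub>F k in sequentially. \<phi> k (exp (- x)) = 0"
        by eventually_elim (use pos in \<open>auto simp: \<phi>_def field_simps max_def\<close>)
      then show ?thesis using False by (simp add: tendsto_eventually)
    qed
    have conv: "(\<lambda>k. \<integral>x. \<phi> k (exp (- x)) \<partial>N) \<longlonglongrightarrow> measure N {..a}"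
      if N: "finite_measure N" "sets N = sets borel" for N
    proof -
      interpret N: finite_measure N by fact
      have [measurable_cong]: "sets N = sets borel" by fact
      have spN: "space N = UNIV" using sets_eq_imp_space_eq[OF N(2)] by simp
      have "(\<lambda>k. \<integral>x. \<phi> k (exp (- x)) \<partial>N) \<longlonglongrightarrow> (\<integral>x. indicator {..a} x \<partial>N)"
        by (rule integral_dominated_convergence[where w = "\<lambda>_. 1"]) (auto simp: lim, auto simp: \<phi>_def)
      then show ?thesis using spN by simp
    qed
    have "(\<integral>x. \<phi> k (exp (- x)) \<partial>\<mu>) = (\<integral>x. \<phi> k (exp (- x)) \<partial>\<nu>)" for k
      by (rule cont) (auto simp: \<phi>_def intro!: continuous_intros)
    with conv[OF fin(1) sets(1)] conv[OF fin(2) sets(2)] show ?thesis by (auto intro: LIMSEQ_unique)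
  qed
  show ?thesis
  proof (rule measure_eqI_lessThan)
    show "emeasure \<mu> {x<..} < \<infinity>" for x by (simp add: \<mu>.emeasure_eq_measure)
    fix x
    have "{x<..} = space \<mu> - {..x}" "{x<..} = space \<nu> - {..x}" using sp by auto
    then have "measure \<mu> {x<..} = measure \<mu> UNIV - measure \<mu> {..x}" "measure \<nu> {x<..} = measure \<nu> UNIV - measure \<nu> {..x}"
      using \<mu>.finite_measure_compl[of "{..x}"] \<nu>.finite_measure_compl[of "{..x}"] sp by auto
    then show "emeasure \<mu> {x<..} = emeasure \<nu> {x<..}"
      using Iic mass by (simp add: \<mu>.emeasure_eq_measure \<nu>.emeasure_eq_measure)
  qed (use sets in auto)
qed

lemma Gamma_real_plus1: "x > 0 \<Longrightarrow> Gamma (x + 1) = x * Gamma (x :: real)"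
  by (rule Gamma_plus1) (auto elim!: nonpos_Ints_cases)

lemma powr_add_nat: "x > 0 \<Longrightarrow> x powr (c + real k) = x powr c * x ^ k"
  by (simp add: powr_add powr_realpow)

lemma powr_minus_add_nat: "x > 0 \<Longrightarrow> x powr (- (c + real k)) = x powr (- c) / x ^ k"
  using powr_diff[of x "- c" "real k"] by (simp add: powr_realpow)

text \<open>Equal to \<open>t powr ((1 - c) / 2)\<close> times the modified Bessel function of the
  first kind of order \<open>c - 1\<close> at \<open>2 * sqrt t\<close>. Stripped of that power it
  is a power series, continuous and positive also at \<open>t = 0\<close>.\<close>

definition bessel_series :: "real \<Rightarrow> real \<Rightarrow> real" where
  "bessel_series c t = (\<Sum>k. t ^ k / (fact k * Gamma (c + real k)))"

lemma summable_bessel_series: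
  assumes c: "c > 0"
  shows "summable (\<lambda>k. t ^ k / (fact k * Gamma (c + real k)))"
proof (rule summable_comparison_test_ev)
  have G: "Gamma (c + real k) \<ge> Gamma (c + 1) * 1" if "k \<ge> 1" for k
    using that
  proof (induction k rule: dec_induct)
    case (step k)
    have "Gamma (c + real (Suc k)) = (c + real k) * Gamma (c + real k)"
      using c Gamma_real_plus1[of "c + real k"] by (simp add: add_ac)
    moreover have "c + real k \<ge> 1" using step c by simp
    moreover have "Gamma (c + real k) > 0" using c by (intro Gamma_real_pos) auto
    ultimately show ?case using step.IH by (metis mult_le_cancel_right1 order_trans less_le_not_le)
  qed simp
  have G1: "Gamma (c + 1) > 0" using c by (intro Gamma_real_pos) auto
  show "summable (\<lambda>k. \<bar>t\<bar> ^ k / fact k * (1 / Gamma (c + 1)))"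
    using summable_exp[of "\<bar>t\<bar>"] by (intro summable_mult2) (simp add: field_simps)
  show "\<forall>\<^sub>F k in sequentially. norm (t ^ k / (fact k * Gamma (c + real k))) \<le> \<bar>t\<bar> ^ k / fact k * (1 / Gamma (c + 1))"
    using eventually_ge_at_top[of "1::nat"]
  proof eventually_elim
    case (elim k)
    then have "Gamma (c + real k) \<ge> Gamma (c + 1)" using G by simp
    then show ?case using G1 by (auto simp: abs_mult power_abs intro!: divide_left_mono mult_left_mono)
  qed
qed

lemma isCont_bessel_series: "c > 0 \<Longrightarrow> isCont (bessel_series c) t"
proof -
  assume c: "c > 0"
  have "isCont (\<lambda>x. \<Sum>k. (1 / (fact k * Gamma (c + real k))) * x ^ k) t"
  proof (rule isCont_powser)
    show "summable (\<lambda>k. (1 / (fact k * Gamma (c + real k))) * (\<bar>t\<bar> + 1) ^ k)"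
      using summable_bessel_series[OF c, of "\<bar>t\<bar> + 1"] by simp
  qed auto
  then show ?thesis by (simp add: bessel_series_def[abs_def])
qed

lemma bessel_series_0: "c > 0 \<Longrightarrow> bessel_series c 0 = 1 / Gamma c"
  using powser_zero[of "\<lambda>k. 1 / (fact k * Gamma (c + real k))"] by (simp add: bessel_series_def)

lemma bessel_series_pos:
  assumes "c > 0" "t \<ge> 0"
  shows "bessel_series c t > 0"
proof -
  have "Gamma (c + real k) > 0" for k using assms by (intro Gamma_real_pos) auto
  then show ?thesis unfolding bessel_series_def
    using assms by (intro suminf_pos2[where i = 0] summable_bessel_series) (auto intro!: divide_nonneg_pos mult_pos_pos simp: less_imp_le)
qed

text \<open>The density, relative to \<open>y powr (c - 1)\<close>, of a mixture of gamma laws with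
  scale \<open>\<xi>\<close> and shapes \<open>c + k\<close>, weighted by
  \<open>C * p ^ k / fact k\<close>; up to a factor and scaling a noncentral chi-square law. The
  power of \<open>y\<close> is kept outside so that the rest is continuous up to
  \<open>y = 0\<close>, where bridges to 0 are evaluated.\<close>

definition gamma_mix :: "real \<Rightarrow> real \<Rightarrow> real \<Rightarrow> real \<Rightarrow> real \<Rightarrow> real" where
  "gamma_mix C \<xi> c p y = C * \<xi> powr (- c) * exp (- y / \<xi>) * bessel_series c (p * y / \<xi>)"

lemma isCont_gamma_mix:
  assumes c: "c > 0"
  shows "isCont (gamma_mix C \<xi> c p) y"
proof -
  have 1: "isCont (\<lambda>y. p * y * inverse \<xi>) y" by (intro continuous_intros)
  have 2: "isCont (\<lambda>y. bessel_series c (p * y * inverse \<xi>)) y"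
    by (rule isCont_o2[OF 1 isCont_bessel_series[OF c]])
  show ?thesis unfolding gamma_mix_def[abs_def] divide_inverse
    by (intro continuous_mult continuous_const 2 isCont_exp' continuous_minus continuous_ident)
qed

lemma gamma_mix_measurable [measurable]: "c > 0 \<Longrightarrow> gamma_mix C \<xi> c p \<in> borel_measurable borel"
  by (intro borel_measurable_continuous_onI continuous_at_imp_continuous_on ballI isCont_gamma_mix)

lemma gamma_mix_nonneg: "c > 0 \<Longrightarrow> C \<ge> 0 \<Longrightarrow> \<xi> > 0 \<Longrightarrow> p \<ge> 0 \<Longrightarrow> y \<ge> 0 \<Longrightarrow> gamma_mix C \<xi> c p y \<ge> 0"
  unfolding gamma_mix_def using bessel_series_pos[of c "p * y / \<xi>"] by (simp add: less_imp_le)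

text \<open>Term by term the summands are multiples of gamma densities with Laplace transform
  \<open>(1 + \<xi> * lam) powr (- (c + k))\<close>; summing over \<open>k\<close> produces the
  exponential.\<close>

lemma nn_integral_gamma_mix:
  assumes c: "c > 0" and C: "C \<ge> 0" and \<xi>: "\<xi> > 0" and p: "p \<ge> 0" and lam: "lam \<ge> 0"
  shows "(\<integral>\<^sup>+y. ennreal (indicator {0<..} y * y powr (c - 1) * gamma_mix C \<xi> c p y * exp (- lam * y)) \<partial>lborel) =
    ennreal (C * (1 + \<xi> * lam) powr (- c) * exp (p / (1 + \<xi> * lam)))"
proof -
  define x where "x = 1 + \<xi> * lam"
  have x: "x \<ge> 1" using \<xi> lam by (simp add: x_def)
  have G: "Gamma (c + real k) > 0" for k using c by (intro Gamma_real_pos) auto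
  define h where "h k y = C * p ^ k / fact k * (\<xi> powr (- (c + k)) / Gamma (c + k)) * (indicator {0<..} y * y powr (c + k - 1) * exp (- (x / \<xi>) * y))" for k :: nat and y :: real
  have hs: "(\<lambda>k. h k y) sums (indicator {0<..} y * y powr (c - 1) * gamma_mix C \<xi> c p y * exp (- lam * y))" for y
  proof (cases "y > 0")
    case True
    have "(\<lambda>k. C * \<xi> powr (- c) * exp (- y / \<xi>) * y powr (c - 1) * exp (- lam * y) * ((p * y / \<xi>) ^ k / (fact k * Gamma (c + real k)))) sums
      (C * \<xi> powr (- c) * exp (- y / \<xi>) * y powr (c - 1) * exp (- lam * y) * bessel_series c (p * y / \<xi>))"
      unfolding bessel_series_def by (intro sums_mult summable_sums summable_bessel_series c)
    moreover have "C * \<xi> powr (- c) * exp (- y / \<xi>) * y powr (c - 1) * exp (- lam * y) * ((p * y / \<xi>) ^ k / (fact k * Gamma (c + real k))) = h k y" for k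
    proof -
      have e: "exp (- y / \<xi>) * exp (- lam * y) = exp (- (x / \<xi>) * y)"
        using \<xi> by (simp add: mult_exp_exp x_def field_simps)
      have t: "\<xi> powr (- (c + k)) = \<xi> powr (- c) / \<xi> ^ k"
        by (rule powr_minus_add_nat[OF \<xi>])
      have yy: "y powr (c + k - 1) = y powr (c - 1) * y ^ k"
        using powr_add_nat[OF True, of "c - 1" k] by (simp add: algebra_simps)
      show ?thesis unfolding h_def t yy e[symmetric] using True by (simp add: power_divide power_mult_distrib field_simps)
    qed
    ultimately show ?thesis using True by (simp add: gamma_mix_def mult_ac)
  qed (simp add: h_def)
  have h0: "h k y \<ge> 0" for k y
    using C p \<xi> G[of k] by (auto simp: h_def intro!: mult_nonneg_nonneg divide_nonneg_nonneg)
  have [measurable]: "h k \<in> borel_measurable borel" for k unfolding h_def[abs_def] by measurable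
  have "(\<integral>\<^sup>+y. ennreal (indicator {0<..} y * y powr (c - 1) * gamma_mix C \<xi> c p y * exp (- lam * y)) \<partial>lborel) =
     (\<integral>\<^sup>+y. (\<Sum>k. ennreal (h k y)) \<partial>lborel)"
  proof (intro nn_integral_cong)
    fix y
    show "ennreal (indicator {0<..} y * y powr (c - 1) * gamma_mix C \<xi> c p y * exp (- lam * y)) = (\<Sum>k. ennreal (h k y))"
      using hs[of y] h0 by (subst suminf_ennreal2) (auto simp: sums_iff)
  qed
  also have "\<dots> = (\<Sum>k. \<integral>\<^sup>+y. ennreal (h k y) \<partial>lborel)" by (rule nn_integral_suminf) measurable
  also have "\<dots> = (\<Sum>k. ennreal (C * x powr (- c) * ((p / x) ^ k / fact k)))"
  proof (intro suminf_cong)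
    fix k
    let ?K = "C * p ^ k / fact k * (\<xi> powr (- (c + k)) / Gamma (c + k))"
    have K: "?K \<ge> 0" using C p G[of k] by (auto intro!: mult_nonneg_nonneg divide_nonneg_nonneg)
    have "(\<integral>\<^sup>+y. ennreal (h k y) \<partial>lborel) = ennreal ?K * (\<integral>\<^sup>+y. ennreal (indicator {0<..} y * y powr (c + k - 1) * exp (- (x / \<xi>) * y)) \<partial>lborel)"
    proof -
      have "ennreal (h k y) = ennreal ?K * ennreal (indicator {0<..} y * y powr (c + k - 1) * exp (- (x / \<xi>) * y))" for y
        unfolding h_def using K by (intro ennreal_mult')
      then show ?thesis by (simp add: nn_integral_cmult)
    qed
    also have "\<dots> = ennreal ?K * ennreal (Gamma (c + k) * (x / \<xi>) powr (- (c + k)))"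
      using c x \<xi> by (subst nn_integral_gamma_scaled) auto
    also have "\<dots> = ennreal (?K * (Gamma (c + k) * (x / \<xi>) powr (- (c + k))))"
      by (rule ennreal_mult'[symmetric, OF K])
    also have "?K * (Gamma (c + k) * (x / \<xi>) powr (- (c + k))) = C * p ^ k / fact k * x powr (- (c + k))"
      using G[of k] x \<xi> by (simp add: powr_divide)
    also have "\<dots> = C * x powr (- c) * ((p / x) ^ k / fact k)"
      using x powr_minus_add_nat[of x c k] by (simp add: power_divide mult_ac)
    finally show "(\<integral>\<^sup>+y. ennreal (h k y) \<partial>lborel) = ennreal (C * x powr (- c) * ((p / x) ^ k / fact k))" .
  qed
  also have "\<dots> = ennreal (\<Sum>k. C * x powr (- c) * ((p / x) ^ k / fact k))"
  proof (rule suminf_ennreal2)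
    show "summable (\<lambda>k. C * x powr (- c) * ((p / x) ^ k / fact k))"
      using summable_exp[of "p / x"] by (intro summable_mult) (simp add: field_simps)
  qed (use C p x in auto)
  also have "(\<Sum>k. C * x powr (- c) * ((p / x) ^ k / fact k)) = C * x powr (- c) * exp (p / x)"
    using sums_mult[OF exp_converges[of "p / x"], of "C * x powr (- c)"] by (simp add: sums_iff divide_inverse mult_ac)
  finally show ?thesis by (simp add: x_def)
qed

definition gamma_mix_measure :: "real \<Rightarrow> real \<Rightarrow> real \<Rightarrow> real \<Rightarrow> real measure" where
  "gamma_mix_measure C \<xi> c p = density lborel (\<lambda>y. ennreal (indicator {0<..} y * y powr (c - 1) * gamma_mix C \<xi> c p y))"

lemma gamma_mix_measure_unique:
  fixes \<mu> :: "real measure"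
  assumes c: "c > 0" and C: "C \<ge> 0" and \<xi>: "\<xi> > 0" and p: "p \<ge> 0"
    and sets [measurable_cong]: "sets \<mu> = sets borel" and nonneg: "AE x in \<mu>. 0 \<le> x"
    and L: "\<And>lam. lam \<ge> 0 \<Longrightarrow> (\<integral>\<^sup>+x. ennreal (exp (- lam * x)) \<partial>\<mu>) = ennreal (C * (1 + \<xi> * lam) powr (- c) * exp (p / (1 + \<xi> * lam)))"
  shows "\<mu> = gamma_mix_measure C \<xi> c p"
proof -
  let ?\<nu> = "gamma_mix_measure C \<xi> c p"
  have [measurable]: "gamma_mix C \<xi> c p \<in> borel_measurable borel" using c by measurable
  have s\<nu> [measurable_cong]: "sets ?\<nu> = sets borel" by (simp add: gamma_mix_measure_def)
  have L\<nu>: "(\<integral>\<^sup>+x. ennreal (exp (- lam * x)) \<partial>?\<nu>) = ennreal (C * (1 + \<xi> * lam) powr (- c) * exp (p / (1 + \<xi> * lam)))" if "lam \<ge> 0" for lam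
    unfolding gamma_mix_measure_def nn_integral_gamma_mix[OF c C \<xi> p that, symmetric]
    using gamma_mix_nonneg[OF c C \<xi> p] by (subst nn_integral_density) (auto intro!: nn_integral_cong simp: ennreal_mult'[symmetric] indicator_def)
  have "emeasure \<mu> (space \<mu>) = ennreal (C * exp p)" using L[of 0] by simp
  then have f1: "finite_measure \<mu>" by (intro finite_measureI) simp
  have "emeasure ?\<nu> (space ?\<nu>) = ennreal (C * exp p)" using L\<nu>[of 0] by simp
  then have f2: "finite_measure ?\<nu>" by (intro finite_measureI) simp
  have "AE x in ?\<nu>. 0 \<le> x"
    unfolding gamma_mix_measure_def by (subst AE_density) (auto simp: indicator_def)
  then show ?thesis
    using f1 f2 sets s\<nu> nonneg L L\<nu> by (intro finite_measure_eqI_laplace) (auto simp: integral_eq_nn_integral)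
qed

section \<open>Path space and Bessel bridges\<close>

definition weighted :: "real \<Rightarrow> (real \<Rightarrow> real) \<Rightarrow> real measure" where
  "weighted c f = density lborel (\<lambda>y. ennreal (indicator {0<..} y * y powr (c - 1) * f y))"

lemma gamma_mix_measure_eq: "gamma_mix_measure C \<xi> c p = weighted c (gamma_mix C \<xi> c p)"
  by (simp add: gamma_mix_measure_def weighted_def)

definition sqrt_ball :: "real \<Rightarrow> real \<Rightarrow> real set" where
  "sqrt_ball b \<epsilon> = {y. \<bar>sqrt y - b\<bar> \<le> \<epsilon>}"

lemma sqrt_ball_sets [measurable]: "sqrt_ball b \<epsilon> \<in> sets borel"
  unfolding sqrt_ball_def by measurable

lemma sqrt_ball_bounds:
  assumes "b \<ge> 0" "\<epsilon> > 0" "y \<in> sqrt_ball b \<epsilon>" "y > 0"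
  shows "y \<le> (b + \<epsilon>)\<^sup>2" "\<bar>y - b\<^sup>2\<bar> \<le> \<epsilon> * (2 * b + \<epsilon>)"
proof -
  have s: "\<bar>sqrt y - b\<bar> \<le> \<epsilon>" "sqrt y \<ge> 0" using assms by (auto simp: sqrt_ball_def)
  then have "sqrt y \<le> b + \<epsilon>" by linarith
  then have "(sqrt y)\<^sup>2 \<le> (b + \<epsilon>)\<^sup>2" using s by (intro power_mono) auto
  then show "y \<le> (b + \<epsilon>)\<^sup>2" using assms by simp
  have "y - b\<^sup>2 = (sqrt y - b) * (sqrt y + b)" using assms by (simp add: algebra_simps power2_eq_square)
  then have "\<bar>y - b\<^sup>2\<bar> = \<bar>sqrt y - b\<bar> * \<bar>sqrt y + b\<bar>" by (simp add: abs_mult)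
  also have "\<dots> \<le> \<epsilon> * (2 * b + \<epsilon>)" using s assms \<open>sqrt y \<le> b + \<epsilon>\<close> by (intro mult_mono) auto
  finally show "\<bar>y - b\<^sup>2\<bar> \<le> \<epsilon> * (2 * b + \<epsilon>)" .
qed

lemma emeasure_weighted:
  assumes [measurable]: "f \<in> borel_measurable borel" "S \<in> sets borel" and f: "\<And>y. y > 0 \<Longrightarrow> 0 \<le> f y"
  shows "emeasure (weighted c f) S = (\<integral>\<^sup>+y. ennreal (f y) * ennreal (indicator {0<..} y * y powr (c - 1) * indicator S y) \<partial>lborel)"
  unfolding weighted_def using f
  by (subst emeasure_density) (auto intro!: nn_integral_cong simp: indicator_def ennreal_mult'[symmetric] mult_ac)

text \<open>Finite because \<open>y \<le> (b + \<epsilon>)^2\<close> on the ball, so a gamma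
  integral dominates even when \<open>c < 1\<close> makes the weight singular at 0. Positive because
  the ball contains an open interval to the right of \<open>b^2\<close>.\<close>

lemma sqrt_ball_weight:
  assumes c: "c > 0" and b: "b \<ge> 0" "\<epsilon> > 0"
  shows "emeasure (weighted c (\<lambda>_. 1)) (sqrt_ball b \<epsilon>) < \<infinity>" "0 < emeasure (weighted c (\<lambda>_. 1)) (sqrt_ball b \<epsilon>)"
proof -
  let ?w = "\<lambda>y. ennreal (indicator {0<..} y * y powr (c - 1) * indicator (sqrt_ball b \<epsilon>) y)"
  have eq: "emeasure (weighted c (\<lambda>_. 1)) (sqrt_ball b \<epsilon>) = (\<integral>\<^sup>+y. ?w y \<partial>lborel)"
    by (subst emeasure_weighted) auto
  have "(\<integral>\<^sup>+y. ?w y \<partial>lborel) \<le> (\<integral>\<^sup>+y. ennreal (exp ((b + \<epsilon>)\<^sup>2)) * ennreal (indicator {0<..} y * y powr (c - 1) * exp (- 1 * y)) \<partial>lborel)"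
  proof (rule nn_integral_mono)
    fix y
    have "indicator {0<..} y * y powr (c - 1) * indicator (sqrt_ball b \<epsilon>) y \<le> exp ((b + \<epsilon>)\<^sup>2) * (indicator {0<..} y * y powr (c - 1) * exp (- 1 * y))"
    proof (cases "y > 0 \<and> y \<in> sqrt_ball b \<epsilon>")
      case True
      then have "1 \<le> exp ((b + \<epsilon>)\<^sup>2) * exp (- y)" using sqrt_ball_bounds(1)[OF b] by (simp add: mult_exp_exp)
      then have "y powr (c - 1) * 1 \<le> y powr (c - 1) * (exp ((b + \<epsilon>)\<^sup>2) * exp (- y))" by (intro mult_left_mono) auto
      then show ?thesis using True by (simp add: mult_ac)
    qed (auto simp: indicator_def)
    then show "?w y \<le> ennreal (exp ((b + \<epsilon>)\<^sup>2)) * ennreal (indicator {0<..} y * y powr (c - 1) * exp (- 1 * y))"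
      by (simp add: ennreal_mult'[symmetric] ennreal_leI)
  qed
  also have "\<dots> < \<infinity>"
    by (subst nn_integral_cmult, measurable, subst nn_integral_gamma_scaled) (use c in \<open>auto simp: ennreal_mult'[symmetric]\<close>)
  finally show "emeasure (weighted c (\<lambda>_. 1)) (sqrt_ball b \<epsilon>) < \<infinity>" unfolding eq .
  show "0 < emeasure (weighted c (\<lambda>_. 1)) (sqrt_ball b \<epsilon>)"
  proof (rule ccontr)
    assume "\<not> ?thesis"
    then have "(\<integral>\<^sup>+y. ?w y \<partial>lborel) = 0" unfolding eq by simp
    then have "AE y in lborel. ?w y = 0" by (subst (asm) nn_integral_0_iff_AE) auto
    then have "AE y in lborel. y \<notin> {b\<^sup>2<..<(b + \<epsilon>)\<^sup>2}"
    proof eventually_elim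
      case (elim y)
      show ?case
      proof
        assume y: "y \<in> {b\<^sup>2<..<(b + \<epsilon>)\<^sup>2}"
        have y0: "y > 0" using y by (auto intro: le_less_trans[OF zero_le_power2])
        have "b < sqrt y" using y b y0 by (intro real_less_rsqrt) auto
        moreover have "sqrt y < b + \<epsilon>" using y b y0 by (intro real_less_lsqrt) auto
        ultimately have "y \<in> sqrt_ball b \<epsilon>" using b by (auto simp: sqrt_ball_def)
        then show False using elim y0 by simp
      qed
    qed
    then have "emeasure lborel {b\<^sup>2<..<(b + \<epsilon>)\<^sup>2} = 0"
      by (subst (asm) AE_iff_null_sets[symmetric]) auto
    moreover have "b\<^sup>2 < (b + \<epsilon>)\<^sup>2" using b by (intro power_strict_mono) auto
    ultimately show False by simp
  qed
qed

text \<open>Only continuity of \<open>f\<close> at \<open>b^2\<close> enters. The weight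
  \<open>y powr (c - 1)\<close>, which may vanish or blow up at 0, stands in numerator and
  denominator alike, so \<open>b = 0\<close> is treated like any other point.\<close>

lemma small_ball_limit:
  assumes c: "c > 0" and b: "b \<ge> 0" and [measurable]: "f \<in> borel_measurable borel"
    and f: "\<And>y. y \<ge> 0 \<Longrightarrow> 0 \<le> f y" "isCont f (b\<^sup>2)"
  shows "((\<lambda>\<epsilon>. measure (weighted c f) (sqrt_ball b \<epsilon>) / measure (weighted c (\<lambda>_. 1)) (sqrt_ball b \<epsilon>)) \<longlongrightarrow> f (b\<^sup>2)) (at_right 0)"
proof (rule tendstoI)
  fix e :: real assume e: "e > 0"
  define \<eta> where "\<eta> = e / 2"
  have \<eta>: "\<eta> > 0" "\<eta> < e" using e by (auto simp: \<eta>_def)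
  obtain d where d: "d > 0" "\<And>y. \<bar>y - b\<^sup>2\<bar> < d \<Longrightarrow> \<bar>f y - f (b\<^sup>2)\<bar> < \<eta>"
    using f(2) \<eta>(1) unfolding continuous_at_eps_delta dist_real_def by blast
  have "((\<lambda>\<epsilon>. \<epsilon> * (2 * b + \<epsilon>)) \<longlongrightarrow> 0 * (2 * b + 0)) (at_right 0)"
    by (intro tendsto_intros tendsto_ident_at)
  then have "\<forall>\<^sub>F \<epsilon> in at_right 0. \<epsilon> * (2 * b + \<epsilon>) < d" using d(1) by (intro order_tendstoD(2)) auto
  with eventually_at_right_less[of 0]
  show "\<forall>\<^sub>F \<epsilon> in at_right 0. dist (measure (weighted c f) (sqrt_ball b \<epsilon>) / measure (weighted c (\<lambda>_. 1)) (sqrt_ball b \<epsilon>)) (f (b\<^sup>2)) < e"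
  proof eventually_elim
    case (elim \<epsilon>)
    let ?S = "sqrt_ball b \<epsilon>"
    let ?w = "\<lambda>y. ennreal (indicator {0<..} y * y powr (c - 1) * indicator ?S y)"
    let ?m = "emeasure (weighted c (\<lambda>_. 1)) ?S"
    note m = sqrt_ball_weight[OF c b elim(1)]
    have meq: "?m = (\<integral>\<^sup>+y. ?w y \<partial>lborel)" by (subst emeasure_weighted) auto
    have F: "emeasure (weighted c f) ?S = (\<integral>\<^sup>+y. ennreal (f y) * ?w y \<partial>lborel)"
      using f(1) by (intro emeasure_weighted) auto
    have near: "\<bar>f y - f (b\<^sup>2)\<bar> < \<eta>" if "y > 0" "y \<in> ?S" for y
      using sqrt_ball_bounds(2)[OF b elim(1) that(2,1)] elim(2) by (intro d(2)) auto
    have fb: "f (b\<^sup>2) \<ge> 0" using f(1) by simp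
    have "emeasure (weighted c f) ?S \<le> (\<integral>\<^sup>+y. ennreal (f (b\<^sup>2) + \<eta>) * ?w y \<partial>lborel)"
      unfolding F
    proof (rule nn_integral_mono)
      fix y show "ennreal (f y) * ?w y \<le> ennreal (f (b\<^sup>2) + \<eta>) * ?w y"
        using near[of y] by (cases "y > 0 \<and> y \<in> ?S") (auto intro!: mult_right_mono ennreal_leI simp: indicator_def)
    qed
    also have "\<dots> = ennreal (f (b\<^sup>2) + \<eta>) * ?m" unfolding meq by (rule nn_integral_cmult) measurable
    finally have up: "emeasure (weighted c f) ?S \<le> ennreal (f (b\<^sup>2) + \<eta>) * ?m" .
    have "ennreal (f (b\<^sup>2) - \<eta>) * ?m = (\<integral>\<^sup>+y. ennreal (f (b\<^sup>2) - \<eta>) * ?w y \<partial>lborel)"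
      unfolding meq by (rule nn_integral_cmult[symmetric]) measurable
    also have "\<dots> \<le> emeasure (weighted c f) ?S"
      unfolding F
    proof (rule nn_integral_mono)
      fix y show "ennreal (f (b\<^sup>2) - \<eta>) * ?w y \<le> ennreal (f y) * ?w y"
        using near[of y] by (cases "y > 0 \<and> y \<in> ?S") (auto intro!: mult_right_mono ennreal_leI simp: indicator_def)
    qed
    finally have low: "ennreal (f (b\<^sup>2) - \<eta>) * ?m \<le> emeasure (weighted c f) ?S" .
    obtain mm where mm: "?m = ennreal mm" "mm > 0"
      using m by (cases ?m) (auto simp: less_top)
    have up2: "emeasure (weighted c f) ?S \<le> ennreal ((f (b\<^sup>2) + \<eta>) * mm)"
      using up mm \<eta> fb by (simp add: ennreal_mult')
    then obtain ff where ff: "emeasure (weighted c f) ?S = ennreal ff" "ff \<ge> 0"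
      by (cases "emeasure (weighted c f) ?S") (auto simp: top_unique)
    have 1: "ff \<le> (f (b\<^sup>2) + \<eta>) * mm"
      using up2 mm ff \<eta> fb by (simp del: ennreal_plus)
    have 2: "(f (b\<^sup>2) - \<eta>) * mm \<le> ff"
    proof (cases "f (b\<^sup>2) - \<eta> \<ge> 0")
      case True
      then show ?thesis using low mm ff by (simp add: ennreal_mult'[symmetric])
    next
      case False
      then have "(f (b\<^sup>2) - \<eta>) * mm \<le> 0" using mm by (intro mult_nonpos_nonneg) auto
      then show ?thesis using ff by simp
    qed
    have "\<bar>ff / mm - f (b\<^sup>2)\<bar> \<le> \<eta>" using 1 2 mm by (simp add: abs_le_iff field_simps)
    then show ?case using \<eta> mm ff by (simp add: measure_def dist_real_def)
  qed
qed

lemma small_ball_ratio: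
  assumes c: "c > 0" and b: "b \<ge> 0"
    and [measurable]: "f \<in> borel_measurable borel" "g \<in> borel_measurable borel"
    and f: "\<And>y. y \<ge> 0 \<Longrightarrow> 0 \<le> f y" "isCont f (b\<^sup>2)"
    and g: "\<And>y. y \<ge> 0 \<Longrightarrow> 0 \<le> g y" "isCont g (b\<^sup>2)" "g (b\<^sup>2) > 0"
  shows "((\<lambda>\<epsilon>. measure (weighted c f) (sqrt_ball b \<epsilon>) / measure (weighted c g) (sqrt_ball b \<epsilon>)) \<longlongrightarrow> f (b\<^sup>2) / g (b\<^sup>2)) (at_right 0)"
proof -
  let ?m = "\<lambda>\<epsilon>. measure (weighted c (\<lambda>_. 1)) (sqrt_ball b \<epsilon>)"
  have "((\<lambda>\<epsilon>. (measure (weighted c f) (sqrt_ball b \<epsilon>) / ?m \<epsilon>) / (measure (weighted c g) (sqrt_ball b \<epsilon>) / ?m \<epsilon>)) \<longlongrightarrow> f (b\<^sup>2) / g (b\<^sup>2)) (at_right 0)"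
    using f g by (intro tendsto_divide small_ball_limit c b) auto
  moreover have "\<forall>\<^sub>F \<epsilon> in at_right 0. (measure (weighted c f) (sqrt_ball b \<epsilon>) / ?m \<epsilon>) / (measure (weighted c g) (sqrt_ball b \<epsilon>) / ?m \<epsilon>) =
      measure (weighted c f) (sqrt_ball b \<epsilon>) / measure (weighted c g) (sqrt_ball b \<epsilon>)"
    using eventually_at_right_less[of 0]
  proof eventually_elim
    case (elim \<epsilon>)
    have "?m \<epsilon> > 0" using sqrt_ball_weight[OF c b elim] by (auto simp: measure_def enn2real_positive_iff less_top)
    then show ?case by simp
  qed
  ultimately show ?thesis by (rule Lim_transform_eventually)
qed

section \<open>Paths: evaluation, continuity and measurability\<close>

lemma mspace_path_metric:
  "mspace (path_metric l) = {x. x \<in> extensional {0..l} \<and> continuous_on {0..l} x}"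
proof -
  have "Metric_space.mbounded UNIV dist (x ` {0..l})" if "continuous_on {0..l} x" for x :: "real \<Rightarrow> real"
    using compact_imp_bounded[OF compact_continuous_image[OF that compact_Icc]] by simp
  then show ?thesis by (auto simp: path_metric_def)
qed

lemma continuous_map_eval_path:
  assumes s: "0 \<le> s" "s \<le> l"
  shows "continuous_map (mtopology_of (path_metric l)) euclideanreal (\<lambda>x. x s)"
proof -
  have "Lipschitz_continuous_map (path_metric l) euclidean_metric (\<lambda>x. x s)"
    unfolding Lipschitz_continuous_map_def
  proof (intro conjI exI[of _ 1] ballI)
    fix x y assume "x \<in> mspace (path_metric l)" "y \<in> mspace (path_metric l)"
    then show "mdist euclidean_metric (x s) (y s) \<le> 1 * mdist (path_metric l) x y"
      unfolding path_metric_def using s mdist_cfunspace_imp_mdist_le[of x "top_of_set {0..l}" euclidean_metric y "mdist (path_metric l) x y" s]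
      by (simp add: path_metric_def)
  qed simp
  then show ?thesis
    using Lipschitz_continuous_imp_continuous_map by fastforce
qed

lemma space_path_borel: "space (path_borel l) = {x. x \<in> extensional {0..l} \<and> continuous_on {0..l} x}"
  unfolding path_borel_def by (auto simp: space_restrict_space space_PiM mspace_path_metric PiE_def)

lemma measurable_eval_path:
  assumes "s \<in> {0..l}"
  shows "(\<lambda>x. x s) \<in> borel_measurable (path_borel l)"
  unfolding path_borel_def using assms by (intro measurable_restrict_space1 measurable_component_singleton)

lemma measurable_into_path_borel:
  assumes "\<And>t. t \<in> {0..l} \<Longrightarrow> (\<lambda>om. f om t) \<in> borel_measurable N"
    and "\<And>om. om \<in> space N \<Longrightarrow> f om \<in> space (path_borel l)"
  shows "f \<in> measurable N (path_borel l)"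
  unfolding path_borel_def
proof (rule measurable_restrict_space2)
  show "f \<in> space N \<rightarrow> mspace (path_metric l)" using assms(2) by (auto simp: space_path_borel mspace_path_metric)
  show "f \<in> measurable N (Pi\<^sub>M {0..l} (\<lambda>_. borel))"
    using assms by (intro measurable_PiM_single') (auto simp: space_path_borel PiE_def)
qed

text \<open>The degenerate cases agree by convention: a real quotient by 0 is 0, and
  \<open>enn2real\<close> sends an infinite quotient to 0 as well.\<close>

lemma enn2real_divide: "enn2real (a / b) = enn2real a / enn2real b"
proof (cases "b = 0 \<or> b = top")
  case True
  then show ?thesis
    by (cases "a = 0") (auto simp: divide_ennreal_def ennreal_mult_top)
next
  case False
  then show ?thesis
    by (cases a; cases b) (auto simp: divide_ennreal ennreal_top_divide)
qed

section \<open>Joint Laplace transforms and conditioning at the end point\<close>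

context squared_bessel begin

lemma laplace_markov_space:
  assumes st: "0 \<le> s" "s \<le> t" and \<delta>: "\<delta> \<ge> 0" and lam: "0 \<le> lam"
    and Y: "Y \<in> borel_measurable (F s)" "\<And>om. om \<in> space M \<Longrightarrow> 0 \<le> Y om" "\<And>om. om \<in> space M \<Longrightarrow> Y om \<le> 1"
  shows "(\<integral>\<^sup>+om. ennreal (Y om * exp (- lam * Z t om)) \<partial>M) =
    ennreal ((1 + 2 * lam * (t - s)) powr (- \<delta> / 2)) * (\<integral>\<^sup>+om. ennreal (Y om * exp (- (lam / (1 + 2 * lam * (t - s))) * Z s om)) \<partial>M)"
proof -
  let ?Y = "\<lambda>om. indicator (space M) om * Y om"
  have "space M \<in> sets (F s)" using sets.top[of "F s"] by simp
  then have "?Y \<in> borel_measurable (F s)" using Y(1) by measurable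
  moreover have "0 \<le> ?Y om" "?Y om \<le> 1" for om using Y by (auto simp: indicator_def)
  ultimately have "(\<integral>\<^sup>+om. ennreal (?Y om * exp (- lam * Z t om)) \<partial>M) =
    ennreal ((1 + 2 * lam * (t - s)) powr (- \<delta> / 2)) * (\<integral>\<^sup>+om. ennreal (?Y om * exp (- (lam / (1 + 2 * lam * (t - s))) * Z s om)) \<partial>M)"
    by (intro laplace_markov st \<delta> lam)
  moreover have "(\<integral>\<^sup>+om. ennreal (?Y om * g om) \<partial>M) = (\<integral>\<^sup>+om. ennreal (Y om * g om) \<partial>M)" for g
    by (intro nn_integral_cong) simp
  ultimately show ?thesis by simp
qed

lemma laplace_start:
  assumes "0 \<le> t" "\<delta> \<ge> 0" "0 \<le> lam"
  shows "(\<integral>\<^sup>+om. ennreal (exp (- lam * Z t om)) \<partial>M) =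
    ennreal ((1 + 2 * lam * t) powr (- \<delta> / 2) * exp (- (lam / (1 + 2 * lam * t)) * z))"
proof -
  have "(\<integral>\<^sup>+om. ennreal (exp (- (lam / (1 + 2 * lam * t)) * Z 0 om)) \<partial>M) = (\<integral>\<^sup>+om. ennreal (exp (- (lam / (1 + 2 * lam * t)) * z)) \<partial>M)"
    by (intro nn_integral_cong) (simp add: Z_0)
  then show ?thesis
    using laplace_markov[of 0 t lam "\<lambda>_. 1"] assms by (simp add: emeasure_space_1 ennreal_mult'[symmetric])
qed

lemma exp_Z_measurable: "0 \<le> s \<Longrightarrow> (\<lambda>om. exp (- \<alpha> * Z s om)) \<in> borel_measurable (F s)"
  using Z_adapted[of s] by measurable

lemma exp_Z_bounds: "om \<in> space M \<Longrightarrow> 0 \<le> s \<Longrightarrow> 0 \<le> \<alpha> \<Longrightarrow> exp (- \<alpha> * Z s om) \<le> 1"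
  using Z_nonneg by simp

lemma laplace_two:
  fixes \<alpha> lam :: real
  assumes st: "0 \<le> s" "s \<le> t" and \<delta>: "\<delta> \<ge> 0" and lam: "0 \<le> lam" "0 \<le> \<alpha>"
  defines "\<beta> \<equiv> \<alpha> + lam / (1 + 2 * lam * (t - s))"
  shows "(\<integral>\<^sup>+om. ennreal (exp (- \<alpha> * Z s om) * exp (- lam * Z t om)) \<partial>M) =
    ennreal (((1 + 2 * lam * (t - s)) * (1 + 2 * \<beta> * s)) powr (- \<delta> / 2) * exp (- (\<beta> / (1 + 2 * \<beta> * s)) * z))"
proof -
  have x: "1 + 2 * lam * (t - s) \<ge> 1" using st lam by simp
  have \<beta>: "\<beta> \<ge> 0" using x lam by (simp add: \<beta>_def)
  have "(\<integral>\<^sup>+om. ennreal (exp (- \<alpha> * Z s om) * exp (- lam * Z t om)) \<partial>M) =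
    ennreal ((1 + 2 * lam * (t - s)) powr (- \<delta> / 2)) * (\<integral>\<^sup>+om. ennreal (exp (- \<alpha> * Z s om) * exp (- (lam / (1 + 2 * lam * (t - s))) * Z s om)) \<partial>M)"
    by (intro laplace_markov_space st \<delta> lam exp_Z_measurable exp_Z_bounds) (use lam in auto)
  also have "(\<lambda>om. exp (- \<alpha> * Z s om) * exp (- (lam / (1 + 2 * lam * (t - s))) * Z s om)) = (\<lambda>om. exp (- \<beta> * Z s om))"
    by (simp add: mult_exp_exp \<beta>_def algebra_simps)
  also have "(\<integral>\<^sup>+om. ennreal (exp (- \<beta> * Z s om)) \<partial>M) = ennreal ((1 + 2 * \<beta> * s) powr (- \<delta> / 2) * exp (- (\<beta> / (1 + 2 * \<beta> * s)) * z))"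
    by (rule laplace_start[OF st(1) \<delta> \<beta>])
  also have "ennreal ((1 + 2 * lam * (t - s)) powr (- \<delta> / 2)) * ennreal ((1 + 2 * \<beta> * s) powr (- \<delta> / 2) * exp (- (\<beta> / (1 + 2 * \<beta> * s)) * z))
      = ennreal (((1 + 2 * lam * (t - s)) * (1 + 2 * \<beta> * s)) powr (- \<delta> / 2) * exp (- (\<beta> / (1 + 2 * \<beta> * s)) * z))"
    using x \<beta> st by (simp add: ennreal_mult'[symmetric] powr_mult mult.assoc)
  finally show ?thesis .
qed

text \<open>The Markov property at the middle time, followed by \<open>laplace_two\<close>. The
  nested fractions are multiplied out to a polynomial that is affine in \<open>lam\<close>; from
  this shape the gamma law of the end point is read off.\<close>

lemma laplace_three:
  fixes \<alpha> \<alpha>' lam :: real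
  assumes st: "0 \<le> r" "r \<le> s" "s \<le> t" and \<delta>: "\<delta> \<ge> 0" and lam: "0 \<le> lam" "0 \<le> \<alpha>" "0 \<le> \<alpha>'" and z: "z = 0"
  shows "(\<integral>\<^sup>+om. ennreal (exp (- \<alpha>' * Z r om) * exp (- \<alpha> * Z s om) * exp (- lam * Z t om)) \<partial>M) =
    ennreal (((1 + 2 * lam * (t - s)) * (1 + 2 * \<alpha>' * r) * (1 + 2 * \<alpha> * (s - r)) + 2 * lam * (s - r) * (1 + 2 * \<alpha>' * r) 
       + 2 * r * (\<alpha> * (1 + 2 * lam * (t - s)) + lam)) powr (- \<delta> / 2))"
proof -
  define x where "x = 1 + 2 * lam * (t - s)"
  define \<beta> where "\<beta> = \<alpha> + lam / x"
  define y where "y = 1 + 2 * \<beta> * (s - r)"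
  have x: "x \<ge> 1" unfolding x_def using st lam by simp
  have \<beta>: "\<beta> \<ge> 0" using x lam by (simp add: \<beta>_def)
  have y: "y \<ge> 1" unfolding y_def using st \<beta> by simp
  define \<gamma> where "\<gamma> = \<alpha>' + \<beta> / y"
  have \<gamma>: "\<gamma> \<ge> 0" using y \<beta> lam by (simp add: \<gamma>_def)
  have Y: "(\<lambda>om. exp (- \<alpha>' * Z r om) * exp (- \<alpha> * Z s om)) \<in> borel_measurable (F s)"
    using st by (intro borel_measurable_times measurable_F_mono[OF exp_Z_measurable st(2)] exp_Z_measurable) auto
  have "(\<integral>\<^sup>+om. ennreal (exp (- \<alpha>' * Z r om) * exp (- \<alpha> * Z s om) * exp (- lam * Z t om)) \<partial>M) =
    ennreal (x powr (- \<delta> / 2)) * (\<integral>\<^sup>+om. ennreal (exp (- \<alpha>' * Z r om) * exp (- \<alpha> * Z s om) * exp (- (lam / x) * Z s om)) \<partial>M)"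
    unfolding x_def
  proof (rule laplace_markov_space[OF _ st(3) \<delta> lam(1) Y])
    fix om assume om: "om \<in> space M"
    have "exp (- \<alpha>' * Z r om) * exp (- \<alpha> * Z s om) \<le> 1 * 1"
      using st lam by (intro mult_mono exp_Z_bounds[OF om]) auto
    then show "exp (- \<alpha>' * Z r om) * exp (- \<alpha> * Z s om) \<le> 1" by simp
  qed (use st in auto)
  also have "(\<lambda>om. exp (- \<alpha>' * Z r om) * exp (- \<alpha> * Z s om) * exp (- (lam / x) * Z s om)) = (\<lambda>om. exp (- \<alpha>' * Z r om) * exp (- \<beta> * Z s om))"
    by (simp add: mult_exp_exp \<beta>_def algebra_simps)
  also have "(\<integral>\<^sup>+om. ennreal (exp (- \<alpha>' * Z r om) * exp (- \<beta> * Z s om)) \<partial>M) = ennreal ((y * (1 + 2 * \<gamma> * r)) powr (- \<delta> / 2))"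
    using laplace_two[OF st(1,2) \<delta> \<beta> lam(3)] z by (simp add: \<gamma>_def y_def)
  also have "ennreal (x powr (- \<delta> / 2)) * ennreal ((y * (1 + 2 * \<gamma> * r)) powr (- \<delta> / 2)) = ennreal ((x * (y * (1 + 2 * \<gamma> * r))) powr (- \<delta> / 2))"
    using x y \<gamma> st by (simp add: ennreal_mult'[symmetric] powr_mult)
  also have "x * (y * (1 + 2 * \<gamma> * r)) = x * y * (1 + 2 * \<alpha>' * r) + 2 * r * (x * \<beta>)"
    using y by (simp add: \<gamma>_def field_simps)
  also have "x * \<beta> = \<alpha> * x + lam" using x by (simp add: \<beta>_def field_simps)
  also have "x * y = x * (1 + 2 * \<alpha> * (s - r)) + 2 * lam * (s - r)"
    using x by (simp add: y_def \<beta>_def field_simps)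
  finally show ?thesis unfolding x_def by (simp add: algebra_simps)
qed

definition path :: "real \<Rightarrow> 'w \<Rightarrow> real \<Rightarrow> real" where
  "path l om = (\<lambda>t\<in>{0..l}. sqrt (Z t om))"

lemma path_measurable [measurable]: "path l \<in> measurable M (path_borel l)"
proof (rule measurable_into_path_borel)
  fix t assume "t \<in> {0..l}"
  then show "(\<lambda>om. path l om t) \<in> borel_measurable M" by (auto simp: path_def)
next
  fix om assume om: "om \<in> space M"
  have "continuous_on {0..l} (\<lambda>t. sqrt (Z t om))"
    by (intro continuous_intros continuous_on_subset[OF Z_cont[OF om]]) auto
  then have "continuous_on {0..l} (path l om)"
    by (subst continuous_on_cong[OF refl, of _ _ "\<lambda>t. sqrt (Z t om)"]) (simp_all add: path_def)
  then show "path l om \<in> space (path_borel l)"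
    by (auto simp: space_path_borel path_def)
qed

text \<open>Uniqueness of Laplace transforms, applied to the law of \<open>Z l\<close> under the
  measure with density \<open>g\<close>.\<close>

lemma tilted_law:
  assumes \<delta>: "\<delta> > 0" and l: "0 \<le> l" and [measurable]: "g \<in> borel_measurable M" and g: "\<And>om. om \<in> space M \<Longrightarrow> 0 \<le> g om"
    and C: "C \<ge> 0" "\<xi> > 0" "p \<ge> 0"
    and L: "\<And>lam. lam \<ge> 0 \<Longrightarrow> (\<integral>\<^sup>+om. ennreal (g om * exp (- lam * Z l om)) \<partial>M) =
      ennreal (C * (1 + \<xi> * lam) powr (- (\<delta> / 2)) * exp (p / (1 + \<xi> * lam)))"
    and S: "S \<in> sets borel"
  shows "(\<integral>\<^sup>+om. ennreal (g om) * indicator S (Z l om) \<partial>M) = emeasure (weighted (\<delta> / 2) (gamma_mix C \<xi> (\<delta> / 2) p)) S"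
proof -
  have [measurable]: "Z l \<in> borel_measurable M" using l by simp
  let ?\<mu> = "distr (density M (\<lambda>om. ennreal (g om))) borel (Z l)"
  have "?\<mu> = gamma_mix_measure C \<xi> (\<delta> / 2) p"
  proof (rule gamma_mix_measure_unique)
    show "AE x in ?\<mu>. 0 \<le> x"
      using Z_nonneg l by (subst AE_distr_iff) (auto simp: AE_density intro!: AE_I2)
    fix lam :: real assume lam: "lam \<ge> 0"
    have "(\<integral>\<^sup>+x. ennreal (exp (- lam * x)) \<partial>?\<mu>) = (\<integral>\<^sup>+om. ennreal (g om * exp (- lam * Z l om)) \<partial>M)"
      using g by (subst nn_integral_distr, measurable, subst nn_integral_density) (auto intro!: nn_integral_cong simp: ennreal_mult')
    then show "(\<integral>\<^sup>+x. ennreal (exp (- lam * x)) \<partial>?\<mu>) = ennreal (C * (1 + \<xi> * lam) powr (- (\<delta> / 2)) * exp (p / (1 + \<xi> * lam)))"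
      using L[OF lam] by simp
  qed (use \<delta> C in auto)
  then have "emeasure (weighted (\<delta> / 2) (gamma_mix C \<xi> (\<delta> / 2) p)) S = emeasure ?\<mu> S"
    by (simp add: gamma_mix_measure_eq)
  also have "\<dots> = (\<integral>\<^sup>+om. ennreal (g om) * indicator S (Z l om) \<partial>M)"
    using S by (subst emeasure_distr, measurable, subst emeasure_density)
      (auto intro!: nn_integral_cong simp: indicator_def measurable_sets[of "Z l" M borel S, simplified])
  finally show ?thesis ..
qed

text \<open>Numerator and denominator of the conditional expectation are small ball masses of two
  gamma mixtures over the same weight, so the quotient tends to the quotient of their continuous
  densities at \<open>b^2\<close>. The lower mixture is the law of \<open>Z l\<close> started at
  \<open>z\<close>. The weak limit is tested only on the single functional \<open>G\<close>.\<close>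

lemma bridge_ratio:
  assumes \<delta>: "\<delta> > 0" and l: "0 < l" and b: "0 \<le> b"
    and W: "weakly_converges l (\<lambda>\<epsilon>. uniform_measure (distr M (path_borel l) (path l))
        {x\<in>space (distr M (path_borel l) (path l)). \<bar>x l - b\<bar> \<le> \<epsilon>}) P (at_right 0)"
    and Gc: "continuous_map (mtopology_of (path_metric l)) euclideanreal G"
    and Gm: "G \<in> borel_measurable (path_borel l)"
    and G: "\<And>x. x \<in> space (path_borel l) \<Longrightarrow> 0 \<le> G x \<and> G x \<le> 1"
    and C: "C \<ge> 0" "\<xi> > 0" "p \<ge> 0"
    and L: "\<And>lam. lam \<ge> 0 \<Longrightarrow> (\<integral>\<^sup>+om. ennreal (G (path l om) * exp (- lam * Z l om)) \<partial>M) =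
      ennreal (C * (1 + \<xi> * lam) powr (- (\<delta> / 2)) * exp (p / (1 + \<xi> * lam)))"
    and z: "z \<ge> 0"
  shows "(\<integral>x. G x \<partial>P) = gamma_mix C \<xi> (\<delta> / 2) p (b\<^sup>2) / gamma_mix (exp (- z / (2 * l))) (2 * l) (\<delta> / 2) (z / (2 * l)) (b\<^sup>2)"
proof -
  let ?R = "distr M (path_borel l) (path l)"
  let ?S = "\<lambda>\<epsilon>. {x\<in>space ?R. \<bar>x l - b\<bar> \<le> \<epsilon>}"
  let ?f = "gamma_mix C \<xi> (\<delta> / 2) p" and ?h = "gamma_mix (exp (- z / (2 * l))) (2 * l) (\<delta> / 2) (z / (2 * l))"
  note [measurable] = Gm
  have [measurable]: "(\<lambda>x. x l) \<in> borel_measurable (path_borel l)" using l by (intro measurable_eval_path) auto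
  have Sm [measurable]: "?S \<epsilon> \<in> sets (path_borel l)" for \<epsilon> by simp
  have Zm [measurable]: "Z l \<in> borel_measurable M" using l by simp
  have psp: "path l om \<in> space (path_borel l)" if "om \<in> space M" for om
    using measurable_space[OF path_measurable that] .
  have c: "\<delta> / 2 > 0" using \<delta> by simp
  have L0: "(\<integral>\<^sup>+om. ennreal (1 * exp (- lam * Z l om)) \<partial>M) =
      ennreal (exp (- z / (2 * l)) * (1 + 2 * l * lam) powr (- (\<delta> / 2)) * exp (z / (2 * l) / (1 + 2 * l * lam)))" if "lam \<ge> 0" for lam
  proof -
    define y where "y = 1 + 2 * l * lam"
    have y: "y > 0" unfolding y_def using l that by (intro add_pos_nonneg) auto
    have "lam = (y - 1) / (2 * l)" using l by (simp add: y_def)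
    \<comment> \<open>Partial fractions: the exponent becomes a constant plus a multiple of
      \<open>1 / y\<close>, the form required for a gamma mixture.\<close>
    then have ly: "lam / y = (1 - 1 / y) / (2 * l)" using y l by (simp add: field_simps)
    have "- (lam / (1 + 2 * l * lam)) * z = - z / (2 * l) + z / (2 * l) / (1 + 2 * l * lam)"
      unfolding y_def[symmetric] ly using l by (simp add: field_simps)
    then have "exp (- (lam / (1 + 2 * l * lam)) * z) = exp (- z / (2 * l)) * exp (z / (2 * l) / (1 + 2 * l * lam))"
      by (simp only: exp_add[symmetric])
    then show ?thesis using laplace_start[of l lam] \<delta> l that by (simp add: mult_ac)
  qed
  \<comment> \<open>Applied twice: to \<open>G\<close> for the numerator and to the constant 1 for
    the conditioning event.\<close>
  have key: "(\<integral>\<^sup>+x. ennreal (H x) * indicator (?S \<epsilon>) x \<partial>?R) = emeasure (weighted (\<delta> / 2) (gamma_mix C' \<xi>' (\<delta> / 2) p')) (sqrt_ball b \<epsilon>)"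
    if [measurable]: "H \<in> borel_measurable (path_borel l)" and H: "\<And>x. x \<in> space (path_borel l) \<Longrightarrow> 0 \<le> H x"
      and "C' \<ge> 0" "\<xi>' > 0" "p' \<ge> 0"
      and "\<And>lam. lam \<ge> 0 \<Longrightarrow> (\<integral>\<^sup>+om. ennreal (H (path l om) * exp (- lam * Z l om)) \<partial>M) =
      ennreal (C' * (1 + \<xi>' * lam) powr (- (\<delta> / 2)) * exp (p' / (1 + \<xi>' * lam)))" for H C' \<xi>' p' \<epsilon>
  proof -
    have "(\<integral>\<^sup>+x. ennreal (H x) * indicator (?S \<epsilon>) x \<partial>?R) = (\<integral>\<^sup>+om. ennreal (H (path l om)) * indicator (?S \<epsilon>) (path l om) \<partial>M)"
      by (rule nn_integral_distr) measurable
    also have "\<dots> = (\<integral>\<^sup>+om. ennreal (H (path l om)) * indicator (sqrt_ball b \<epsilon>) (Z l om) \<partial>M)"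
      using psp l by (intro nn_integral_cong) (auto simp: indicator_def sqrt_ball_def path_def)
    also have "\<dots> = emeasure (weighted (\<delta> / 2) (gamma_mix C' \<xi>' (\<delta> / 2) p')) (sqrt_ball b \<epsilon>)"
      using that psp l by (intro tilted_law \<delta>) auto
    finally show ?thesis .
  qed
  have E: "(\<integral>x. G x \<partial>uniform_measure ?R (?S \<epsilon>)) = measure (weighted (\<delta> / 2) ?f) (sqrt_ball b \<epsilon>) / measure (weighted (\<delta> / 2) ?h) (sqrt_ball b \<epsilon>)" for \<epsilon>
  proof -
    have "(\<integral>x. G x \<partial>uniform_measure ?R (?S \<epsilon>)) = enn2real (\<integral>\<^sup>+x. ennreal (G x) \<partial>uniform_measure ?R (?S \<epsilon>))"
      using G by (intro integral_eq_nn_integral) (auto intro!: AE_I2)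
    also have "(\<integral>\<^sup>+x. ennreal (G x) \<partial>uniform_measure ?R (?S \<epsilon>)) = (\<integral>\<^sup>+x. ennreal (G x) * indicator (?S \<epsilon>) x \<partial>?R) / emeasure ?R (?S \<epsilon>)"
      by (rule nn_integral_uniform_measure) auto
    also have "(\<integral>\<^sup>+x. ennreal (G x) * indicator (?S \<epsilon>) x \<partial>?R) = emeasure (weighted (\<delta> / 2) ?f) (sqrt_ball b \<epsilon>)"
      by (rule key[OF Gm _ C L]) (use G in auto)
    also have "emeasure ?R (?S \<epsilon>) = (\<integral>\<^sup>+x. ennreal 1 * indicator (?S \<epsilon>) x \<partial>?R)" by simp
    also have "\<dots> = emeasure (weighted (\<delta> / 2) ?h) (sqrt_ball b \<epsilon>)"
      by (rule key[of "\<lambda>_. 1", OF _ _ _ _ _ L0]) (use l z in auto)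
    finally show ?thesis by (simp add: measure_def enn2real_divide)
  qed
  have "((\<lambda>\<epsilon>. \<integral>x. G x \<partial>uniform_measure ?R (?S \<epsilon>)) \<longlongrightarrow> ?f (b\<^sup>2) / ?h (b\<^sup>2)) (at_right 0)"
    unfolding E
  proof (rule small_ball_ratio[OF c b])
    show "0 < ?h (b\<^sup>2)" unfolding gamma_mix_def using bessel_series_pos[OF c, of "z / (2 * l) * b\<^sup>2 / (2 * l)"] l z by simp
  qed (use c C l z in \<open>auto intro!: gamma_mix_nonneg isCont_gamma_mix\<close>)
  moreover have "((\<lambda>\<epsilon>. \<integral>x. G x \<partial>uniform_measure ?R (?S \<epsilon>)) \<longlongrightarrow> (\<integral>x. G x \<partial>P)) (at_right 0)"
  proof -
    have "\<forall>x\<in>mspace (path_metric l). \<bar>G x\<bar> \<le> 1"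
      using G by (auto simp: mspace_path_metric space_path_borel)
    then show ?thesis using W Gc unfolding weakly_converges_def by blast
  qed
  ultimately show ?thesis by (intro tendsto_unique[OF trivial_limit_at_right_real]) auto
qed

end

section \<open>Explicit Laplace transforms of Bessel bridges\<close>

lemma bessel_bridge_lawE:
  assumes "bessel_bridge_law \<delta> l a b P"
  obtains M :: "(real \<Rightarrow> real \<times> real) measure" and F B Z where "squared_bessel \<delta> (a\<^sup>2) M F B Z"
    "weakly_converges l (\<lambda>\<epsilon>. uniform_measure (distr M (path_borel l) (squared_bessel.path Z l))
        {x\<in>space (distr M (path_borel l) (squared_bessel.path Z l)). \<bar>x l - b\<bar> \<le> \<epsilon>}) P (at_right 0)"
proof -
  obtain M :: "(real \<Rightarrow> real \<times> real) measure" and F B Z where sb: "squared_bessel_process \<delta> (a\<^sup>2) M F B Z"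
    and w: "weakly_converges l (\<lambda>\<epsilon>. uniform_measure (distr M (path_borel l) (\<lambda>om. \<lambda>t\<in>{0..l}. sqrt (Z t om)))
        {x\<in>space (distr M (path_borel l) (\<lambda>om. \<lambda>t\<in>{0..l}. sqrt (Z t om))). \<bar>x l - b\<bar> \<le> \<epsilon>}) P (at_right 0)"
    using assms unfolding bessel_bridge_law_def bessel_law_def by blast
  interpret squared_bessel \<delta> "a\<^sup>2" M F B Z by unfold_locales (rule sb)
  have "path l = (\<lambda>om. \<lambda>t\<in>{0..l}. sqrt (Z t om))" by (simp add: path_def fun_eq_iff)
  with w show ?thesis using that squared_bessel_axioms by auto
qed

lemma bessel_bridge_law_prob: "bessel_bridge_law \<delta> l a b P \<Longrightarrow> prob_space P"
  and bessel_bridge_law_sets: "bessel_bridge_law \<delta> l a b P \<Longrightarrow> sets P = sets (path_borel l)"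
  unfolding bessel_bridge_law_def by auto

lemma continuous_map_path_exp:
  assumes "0 \<le> s" "s \<le> l"
  shows "continuous_map (mtopology_of (path_metric l)) euclideanreal (\<lambda>x. exp (- \<alpha> * (x s)\<^sup>2))"
proof -
  have "continuous_map euclideanreal euclideanreal (\<lambda>y. exp (- \<alpha> * y\<^sup>2))"
    by (auto intro!: continuous_intros)
  from continuous_map_compose[OF continuous_map_eval_path[OF assms] this] show ?thesis
    by (simp add: comp_def)
qed

lemma path_exp_measurable:
  assumes "0 \<le> s" "s \<le> l"
  shows "(\<lambda>x. exp (- \<alpha> * (x s)\<^sup>2)) \<in> borel_measurable (path_borel l)"
  using measurable_eval_path[of s l] assms by simp

text \<open>For a start at 0 both mixtures have \<open>p = 0\<close>, so the Bessel series is the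
  same constant above and below and only powers and exponentials survive.\<close>

lemma bridge_from_0_laplace:
  assumes P: "bessel_bridge_law \<delta> l 0 b P" and \<delta>: "\<delta> > 0" and b: "b \<ge> 0" and s: "0 < s" "s < l" and \<alpha>: "\<alpha> \<ge> 0"
  shows "(\<integral>x. exp (- \<alpha> * (x s)\<^sup>2) \<partial>P) = ((l + 2 * \<alpha> * s * (l - s)) / l) powr (- (\<delta> / 2)) *
     exp (b\<^sup>2 / (2 * l) - b\<^sup>2 * (1 + 2 * \<alpha> * s) / (2 * (l + 2 * \<alpha> * s * (l - s))))"
proof -
  from P obtain M :: "(real \<Rightarrow> real \<times> real) measure" and F B Z where sb: "squared_bessel \<delta> (0\<^sup>2) M F B Z"
    and w: "weakly_converges l (\<lambda>\<epsilon>. uniform_measure (distr M (path_borel l) (squared_bessel.path Z l))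
        {x\<in>space (distr M (path_borel l) (squared_bessel.path Z l)). \<bar>x l - b\<bar> \<le> \<epsilon>}) P (at_right 0)"
    by (rule bessel_bridge_lawE)
  interpret squared_bessel \<delta> "0\<^sup>2" M F B Z by (rule sb)
  define c where "c = \<delta> / 2"
  have c: "c > 0" using \<delta> by (simp add: c_def)
  define N where "N = l + 2 * \<alpha> * s * (l - s)"
  define u where "u = 1 + 2 * \<alpha> * s"
  have N: "N > 0" unfolding N_def using s \<alpha> by (intro add_pos_nonneg) auto
  have u: "u > 0" unfolding u_def using s \<alpha> by (intro add_pos_nonneg) auto
  define \<xi> where "\<xi> = 2 * N / u"
  have \<xi>: "\<xi> > 0" using N u by (simp add: \<xi>_def)
  have L: "(\<integral>\<^sup>+om. ennreal (exp (- \<alpha> * (path l om s)\<^sup>2) * exp (- lam * Z l om)) \<partial>M) =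
      ennreal (u powr (- c) * (1 + \<xi> * lam) powr (- (\<delta> / 2)) * exp (0 / (1 + \<xi> * lam)))" if lam: "lam \<ge> 0" for lam
  proof -
    define x where "x = 1 + 2 * lam * (l - s)"
    have x: "x > 0" unfolding x_def using s lam by (intro add_pos_nonneg) auto
    have "(\<integral>\<^sup>+om. ennreal (exp (- \<alpha> * (path l om s)\<^sup>2) * exp (- lam * Z l om)) \<partial>M) =
      (\<integral>\<^sup>+om. ennreal (exp (- \<alpha> * Z s om) * exp (- lam * Z l om)) \<partial>M)"
      using s Z_nonneg by (intro nn_integral_cong) (simp add: path_def)
    also have "\<dots> = ennreal ((x * (1 + 2 * (\<alpha> + lam / x) * s)) powr (- \<delta> / 2))"
      using laplace_two[of s l lam \<alpha>] s \<delta> lam \<alpha> unfolding x_def by simp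
    also have "x * (1 + 2 * (\<alpha> + lam / x) * s) = u * (1 + \<xi> * lam)"
    proof -
      have "x * (1 + 2 * (\<alpha> + lam / x) * s) = x * u + 2 * lam * s"
        using x by (simp add: u_def field_simps)
      also have "\<dots> = u + 2 * N * lam" by (simp add: x_def u_def N_def algebra_simps)
      also have "\<dots> = u * (1 + \<xi> * lam)" using u by (simp add: \<xi>_def field_simps)
      finally show ?thesis .
    qed
    finally show ?thesis using u \<xi> lam by (simp add: powr_mult c_def)
  qed
  have "(\<integral>x. exp (- \<alpha> * (x s)\<^sup>2) \<partial>P) = gamma_mix (u powr (- c)) \<xi> (\<delta> / 2) 0 (b\<^sup>2) / gamma_mix (exp (- 0\<^sup>2 / (2 * l))) (2 * l) (\<delta> / 2) (0\<^sup>2 / (2 * l)) (b\<^sup>2)"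
    by (rule bridge_ratio[OF \<delta> _ b w continuous_map_path_exp path_exp_measurable _ _ \<xi> _ L]) (use s \<alpha> in auto)
  also have "\<dots> = (u powr (- c) * \<xi> powr (- c) * exp (- b\<^sup>2 / \<xi>)) / ((2 * l) powr (- c) * exp (- b\<^sup>2 / (2 * l)))"
    using bessel_series_pos[OF c, of 0] by (simp add: gamma_mix_def c_def[symmetric])
  also have "u powr (- c) * \<xi> powr (- c) = (2 * N) powr (- c)"
    using u N \<xi> powr_mult[of u \<xi> "- c"] by (simp add: \<xi>_def)
  also have "(2 * N) powr (- c) * exp (- b\<^sup>2 / \<xi>) / ((2 * l) powr (- c) * exp (- b\<^sup>2 / (2 * l))) =
     ((2 * N) powr (- c) / (2 * l) powr (- c)) * exp (b\<^sup>2 / (2 * l) - b\<^sup>2 / \<xi>)"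
    by (simp add: exp_diff exp_minus field_simps)
  also have "(2 * N) powr (- c) / (2 * l) powr (- c) = (N / l) powr (- c)"
    using N s by (simp add: powr_divide[symmetric])
  also have "b\<^sup>2 / \<xi> = b\<^sup>2 * u / (2 * N)" by (simp add: \<xi>_def)
  finally show ?thesis by (simp add: N_def u_def c_def)
qed

text \<open>Here \<open>p\<close> need not be 0, but the densities are evaluated at
  \<open>y = 0\<close>, where the series is again a constant. This is why bridges with one end at 0
  are elementary at a single interior time.\<close>

lemma bridge_to_0_laplace:
  assumes P: "bessel_bridge_law \<delta> l b 0 P" and \<delta>: "\<delta> > 0" and b: "b \<ge> 0" and s: "0 < s" "s < l" and \<alpha>: "\<alpha> \<ge> 0"
  shows "(\<integral>x. exp (- \<alpha> * (x s)\<^sup>2) \<partial>P) = ((l + 2 * \<alpha> * s * (l - s)) / l) powr (- (\<delta> / 2)) *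
     exp (b\<^sup>2 / (2 * l) - b\<^sup>2 * (1 + 2 * \<alpha> * (l - s)) / (2 * (l + 2 * \<alpha> * s * (l - s))))"
proof -
  from P obtain M :: "(real \<Rightarrow> real \<times> real) measure" and F B Z where sb: "squared_bessel \<delta> (b\<^sup>2) M F B Z"
    and w: "weakly_converges l (\<lambda>\<epsilon>. uniform_measure (distr M (path_borel l) (squared_bessel.path Z l))
        {x\<in>space (distr M (path_borel l) (squared_bessel.path Z l)). \<bar>x l - 0\<bar> \<le> \<epsilon>}) P (at_right 0)"
    by (rule bessel_bridge_lawE)
  interpret squared_bessel \<delta> "b\<^sup>2" M F B Z by (rule sb)
  define c where "c = \<delta> / 2"
  have c: "c > 0" using \<delta> by (simp add: c_def)
  define \<tau> where "\<tau> = l - s"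
  define N where "N = l + 2 * \<alpha> * s * \<tau>"
  define u where "u = 1 + 2 * \<alpha> * s"
  have \<tau>: "\<tau> > 0" "l = s + \<tau>" using s by (auto simp: \<tau>_def)
  have N: "N > 0" unfolding N_def using s \<alpha> \<tau> by (intro add_pos_nonneg) auto
  have u: "u > 0" unfolding u_def using s \<alpha> by (intro add_pos_nonneg) auto
  define \<xi> where "\<xi> = 2 * N / u"
  have \<xi>: "\<xi> > 0" using N u by (simp add: \<xi>_def)
  define C where "C = u powr (- c) * exp (- (b\<^sup>2 * (1 + 2 * \<alpha> * \<tau>) / (2 * N)))"
  define p where "p = b\<^sup>2 / (2 * u * N)"
  have L: "(\<integral>\<^sup>+om. ennreal (exp (- \<alpha> * (path l om s)\<^sup>2) * exp (- lam * Z l om)) \<partial>M) =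
      ennreal (C * (1 + \<xi> * lam) powr (- (\<delta> / 2)) * exp (p / (1 + \<xi> * lam)))" if lam: "lam \<ge> 0" for lam
  proof -
    define x where "x = 1 + 2 * lam * \<tau>"
    define q where "q = u + 2 * N * lam"
    have x: "x > 0" unfolding x_def using \<tau> lam by (intro add_pos_nonneg) auto
    have q: "q > 0" unfolding q_def using u N lam by (intro add_pos_nonneg) auto
    have xq: "x * (1 + 2 * (\<alpha> + lam / x) * s) = q"
    proof -
      have "x * (1 + 2 * (\<alpha> + lam / x) * s) = x * u + 2 * lam * s"
        using x by (simp add: u_def field_simps)
      also have "\<dots> = q" by (simp add: q_def x_def u_def N_def \<tau>(2) algebra_simps)
      finally show ?thesis .
    qed
    have qu: "q = u * (1 + \<xi> * lam)" using u by (simp add: q_def \<xi>_def field_simps)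
    have "(\<integral>\<^sup>+om. ennreal (exp (- \<alpha> * (path l om s)\<^sup>2) * exp (- lam * Z l om)) \<partial>M) =
      (\<integral>\<^sup>+om. ennreal (exp (- \<alpha> * Z s om) * exp (- lam * Z l om)) \<partial>M)"
      using s Z_nonneg by (intro nn_integral_cong) (simp add: path_def)
    also have "\<dots> = ennreal (q powr (- c) * exp (- ((\<alpha> + lam / x) / (1 + 2 * (\<alpha> + lam / x) * s)) * b\<^sup>2))"
      using laplace_two[of s l lam \<alpha>] s \<delta> lam \<alpha> unfolding xq[symmetric] by (simp add: c_def x_def \<tau>_def)
    also have "(\<alpha> + lam / x) / (1 + 2 * (\<alpha> + lam / x) * s) = (\<alpha> * x + lam) / q"
    proof -
      have "(\<alpha> + lam / x) / (1 + 2 * (\<alpha> + lam / x) * s) = (x * (\<alpha> + lam / x)) / (x * (1 + 2 * (\<alpha> + lam / x) * s))"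
        using x by (intro mult_divide_mult_cancel_left[symmetric]) simp
      moreover have "x * (\<alpha> + lam / x) = \<alpha> * x + lam" using x by (simp add: field_simps)
      ultimately show ?thesis unfolding xq by simp
    qed
    \<comment> \<open>Partial fractions in \<open>q\<close>, which is affine in \<open>lam\<close>;
      the two parts become the factor \<open>C\<close> and the exponent
      \<open>p / (1 + \<xi> * lam)\<close>.\<close>
    also have "(\<alpha> * x + lam) / q = (1 + 2 * \<alpha> * \<tau>) / (2 * N) - 1 / (2 * N * q)"
    proof -
      have "2 * N * (\<alpha> * x + lam) = (1 + 2 * \<alpha> * \<tau>) * q - 1"
        by (simp add: q_def u_def x_def N_def \<tau>(2) algebra_simps)
      moreover have "(1 + 2 * \<alpha> * \<tau>) / (2 * N) - 1 / (2 * N * q) = ((1 + 2 * \<alpha> * \<tau>) * q - 1) / (2 * N * q)"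
        using N q by (simp add: field_simps)
      moreover have "(\<alpha> * x + lam) / q = (2 * N * (\<alpha> * x + lam)) / (2 * N * q)" using N by simp
      ultimately show ?thesis by simp
    qed
    also have "exp (- ((1 + 2 * \<alpha> * \<tau>) / (2 * N) - 1 / (2 * N * q)) * b\<^sup>2) = exp (- (b\<^sup>2 * (1 + 2 * \<alpha> * \<tau>) / (2 * N))) * exp (p / (1 + \<xi> * lam))"
      unfolding p_def qu exp_add[symmetric] using u by (simp add: algebra_simps diff_divide_distrib)
    also have "q powr (- c) = u powr (- c) * (1 + \<xi> * lam) powr (- (\<delta> / 2))"
      unfolding qu using u \<xi> lam by (simp add: powr_mult c_def)
    finally show ?thesis by (simp add: C_def mult_ac)
  qed
  have C: "C \<ge> 0" "p \<ge> 0" using u N by (auto simp: C_def p_def)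
  have "(\<integral>x. exp (- \<alpha> * (x s)\<^sup>2) \<partial>P) = gamma_mix C \<xi> (\<delta> / 2) p (0\<^sup>2) / gamma_mix (exp (- b\<^sup>2 / (2 * l))) (2 * l) (\<delta> / 2) (b\<^sup>2 / (2 * l)) (0\<^sup>2)"
    by (rule bridge_ratio[OF \<delta> _ _ w continuous_map_path_exp path_exp_measurable _ C(1) \<xi> C(2) L]) (use s \<alpha> in auto)
  also have "\<dots> = (C * \<xi> powr (- c)) / (exp (- b\<^sup>2 / (2 * l)) * (2 * l) powr (- c))"
    using bessel_series_pos[OF c, of 0] by (simp add: gamma_mix_def c_def[symmetric])
  also have "\<dots> = ((u powr (- c) * \<xi> powr (- c)) / (2 * l) powr (- c)) * exp (b\<^sup>2 / (2 * l) - b\<^sup>2 * (1 + 2 * \<alpha> * \<tau>) / (2 * N))"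
    by (simp add: C_def exp_diff exp_minus field_simps)
  also have "u powr (- c) * \<xi> powr (- c) = (2 * N) powr (- c)"
    using u N \<xi> powr_mult[of u \<xi> "- c"] by (simp add: \<xi>_def)
  also have "(2 * N) powr (- c) / (2 * l) powr (- c) = (N / l) powr (- c)"
    using N s by (simp add: powr_divide[symmetric])
  finally show ?thesis by (simp add: N_def \<tau>_def c_def)
qed

lemma bridge_0_0_laplace_aux:
  assumes P: "bessel_bridge_law \<delta> 1 0 0 P" and \<delta>: "\<delta> > 0" and rs: "0 < r" "r < s" "s < 1" and \<alpha>: "\<alpha> \<ge> 0" "\<alpha>' \<ge> 0"
  shows "(\<integral>x. exp (- \<alpha>' * (x r)\<^sup>2) * exp (- \<alpha> * (x s)\<^sup>2) \<partial>P) =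
     (1 + 2 * \<alpha> * (s * (1 - s)) + 2 * \<alpha>' * (r * (1 - r)) + 4 * \<alpha> * \<alpha>' * (r * (1 - s) * (s - r))) powr (- (\<delta> / 2))"
proof -
  from P obtain M :: "(real \<Rightarrow> real \<times> real) measure" and F B Z where sb: "squared_bessel \<delta> (0\<^sup>2) M F B Z"
    and w: "weakly_converges 1 (\<lambda>\<epsilon>. uniform_measure (distr M (path_borel 1) (squared_bessel.path Z 1))
        {x\<in>space (distr M (path_borel 1) (squared_bessel.path Z 1)). \<bar>x 1 - 0\<bar> \<le> \<epsilon>}) P (at_right 0)"
    by (rule bessel_bridge_lawE)
  interpret squared_bessel \<delta> "0\<^sup>2" M F B Z by (rule sb)
  define c where "c = \<delta> / 2"
  have c: "c > 0" using \<delta> by (simp add: c_def)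
  define A where "A = 1 + 2 * \<alpha> * s + 2 * \<alpha>' * r + 4 * \<alpha> * \<alpha>' * r * (s - r)"
  define H where "H = 1 + 2 * \<alpha> * (s * (1 - s)) + 2 * \<alpha>' * (r * (1 - r)) + 4 * \<alpha> * \<alpha>' * (r * (1 - s) * (s - r))"
  have A: "A > 0" unfolding A_def using rs \<alpha> by (intro add_pos_nonneg) auto
  have H: "H > 0" unfolding H_def using rs \<alpha> by (intro add_pos_nonneg) auto
  define \<xi> where "\<xi> = 2 * H / A"
  have \<xi>: "\<xi> > 0" using A H by (simp add: \<xi>_def)
  have L: "(\<integral>\<^sup>+om. ennreal (exp (- \<alpha>' * (path 1 om r)\<^sup>2) * exp (- \<alpha> * (path 1 om s)\<^sup>2) * exp (- lam * Z 1 om)) \<partial>M) =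
      ennreal (A powr (- c) * (1 + \<xi> * lam) powr (- (\<delta> / 2)) * exp (0 / (1 + \<xi> * lam)))" if lam: "lam \<ge> 0" for lam
  proof -
    have "(\<integral>\<^sup>+om. ennreal (exp (- \<alpha>' * (path 1 om r)\<^sup>2) * exp (- \<alpha> * (path 1 om s)\<^sup>2) * exp (- lam * Z 1 om)) \<partial>M) =
      (\<integral>\<^sup>+om. ennreal (exp (- \<alpha>' * Z r om) * exp (- \<alpha> * Z s om) * exp (- lam * Z 1 om)) \<partial>M)"
      using rs Z_nonneg by (intro nn_integral_cong) (simp add: path_def)
    also have "\<dots> = ennreal ((A + 2 * H * lam) powr (- \<delta> / 2))"
      using laplace_three[of r s 1 lam \<alpha> \<alpha>'] rs \<delta> lam \<alpha> by (simp add: A_def H_def algebra_simps)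
    also have "A + 2 * H * lam = A * (1 + \<xi> * lam)" using A by (simp add: \<xi>_def field_simps)
    finally show ?thesis using A \<xi> lam by (simp add: powr_mult c_def)
  qed
  have "(\<integral>x. exp (- \<alpha>' * (x r)\<^sup>2) * exp (- \<alpha> * (x s)\<^sup>2) \<partial>P) = gamma_mix (A powr (- c)) \<xi> (\<delta> / 2) 0 (0\<^sup>2) / gamma_mix (exp (- 0\<^sup>2 / (2 * 1))) (2 * 1) (\<delta> / 2) (0\<^sup>2 / (2 * 1)) (0\<^sup>2)"
  proof (rule bridge_ratio[OF \<delta> _ _ w _ _ _ _ \<xi> _ L])
    show "continuous_map (mtopology_of (path_metric 1)) euclideanreal (\<lambda>x. exp (- \<alpha>' * (x r)\<^sup>2) * exp (- \<alpha> * (x s)\<^sup>2))"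
      using rs by (intro continuous_map_real_mult continuous_map_path_exp) auto
    show "(\<lambda>x. exp (- \<alpha>' * (x r)\<^sup>2) * exp (- \<alpha> * (x s)\<^sup>2)) \<in> borel_measurable (path_borel 1)"
      using rs by (intro borel_measurable_times path_exp_measurable) auto
    show "0 \<le> exp (- \<alpha>' * (x r)\<^sup>2) * exp (- \<alpha> * (x s)\<^sup>2) \<and> exp (- \<alpha>' * (x r)\<^sup>2) * exp (- \<alpha> * (x s)\<^sup>2) \<le> 1" for x
      using \<alpha> by (auto intro!: mult_le_one)
  qed auto
  also have "\<dots> = (A powr (- c) * \<xi> powr (- c)) / (2 powr (- c))"
    using bessel_series_pos[OF c, of 0] by (simp add: gamma_mix_def c_def[symmetric])
  also have "A powr (- c) * \<xi> powr (- c) = (2 * H) powr (- c)"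
    using A H \<xi> powr_mult[of A \<xi> "- c"] by (simp add: \<xi>_def)
  also have "(2 * H) powr (- c) / 2 powr (- c) = H powr (- c)"
    using H by (simp add: powr_mult)
  finally show ?thesis by (simp add: H_def c_def)
qed

text \<open>Weak convergence sees only bounded continuous functionals, so each property is coded as
  the vanishing of some \<open>g (x s)\<close> with values between 0 and 1. Under the law
  conditioned on \<open>\<bar>x l - b\<bar> \<le> \<epsilon>\<close> its mean is at most
  \<open>\<epsilon>\<close>, hence 0 in the limit.\<close>

lemma bridge_ends:
  assumes P: "bessel_bridge_law \<delta> l a b P" and \<delta>: "\<delta> > 0" and l: "l > 0" and a: "a \<ge> 0"
  shows "s \<in> {0..l} \<Longrightarrow> AE x in P. 0 \<le> x s" "AE x in P. x 0 = a" "AE x in P. x l = b"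
proof -
  from P obtain M :: "(real \<Rightarrow> real \<times> real) measure" and F B Z where sb: "squared_bessel \<delta> (a\<^sup>2) M F B Z"
    and w: "weakly_converges l (\<lambda>\<epsilon>. uniform_measure (distr M (path_borel l) (squared_bessel.path Z l))
        {x\<in>space (distr M (path_borel l) (squared_bessel.path Z l)). \<bar>x l - b\<bar> \<le> \<epsilon>}) P (at_right 0)"
    by (rule bessel_bridge_lawE)
  interpret squared_bessel \<delta> "a\<^sup>2" M F B Z by (rule sb)
  interpret P: prob_space P by (rule bessel_bridge_law_prob[OF P])
  have sP [measurable_cong]: "sets P = sets (path_borel l)" by (rule bessel_bridge_law_sets[OF P])
  let ?R = "distr M (path_borel l) (path l)"
  let ?S = "\<lambda>\<epsilon>. {x\<in>space ?R. \<bar>x l - b\<bar> \<le> \<epsilon>}"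
  have [measurable]: "(\<lambda>x. x l) \<in> borel_measurable (path_borel l)" using l by (intro measurable_eval_path) auto
  have key: "AE x in P. g (x s) = 0"
    if s: "s \<in> {0..l}" and g: "continuous_on UNIV g" "\<And>y. 0 \<le> g y" "\<And>y. g y \<le> 1"
      and z: "\<And>om \<epsilon>. om \<in> space M \<Longrightarrow> \<epsilon> > 0 \<Longrightarrow> path l om \<in> ?S \<epsilon> \<Longrightarrow> g (path l om s) \<le> \<epsilon>" for s and g :: "real \<Rightarrow> real"
  proof -
    have [measurable]: "g \<in> borel_measurable borel" by (rule borel_measurable_continuous_onI[OF g(1)])
    have [measurable]: "(\<lambda>x. x s) \<in> borel_measurable (path_borel l)" using s by (rule measurable_eval_path)
    have "continuous_map (mtopology_of (path_metric l)) euclideanreal (\<lambda>x. g (x s))"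
      using continuous_map_compose[OF continuous_map_eval_path[of s l], of euclideanreal g] s g(1) by (simp add: comp_def)
    then have lim: "((\<lambda>\<epsilon>. \<integral>x. g (x s) \<partial>uniform_measure ?R (?S \<epsilon>)) \<longlongrightarrow> (\<integral>x. g (x s) \<partial>P)) (at_right 0)"
    proof -
      have "\<forall>x\<in>mspace (path_metric l). \<bar>g (x s)\<bar> \<le> 1" using g by (simp add: abs_of_nonneg)
      with \<open>continuous_map _ _ _\<close> w show ?thesis unfolding weakly_converges_def by blast
    qed
    have bd: "(\<integral>x. g (x s) \<partial>uniform_measure ?R (?S \<epsilon>)) \<le> \<epsilon>" if \<epsilon>: "\<epsilon> > 0" for \<epsilon>
    proof -
      have [measurable]: "?S \<epsilon> \<in> sets ?R" by simp
      have "(\<integral>\<^sup>+x. ennreal (g (x s)) * indicator (?S \<epsilon>) x \<partial>?R) = (\<integral>\<^sup>+om. ennreal (g (path l om s)) * indicator (?S \<epsilon>) (path l om) \<partial>M)"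
        by (rule nn_integral_distr) measurable
      also have "\<dots> \<le> (\<integral>\<^sup>+om. ennreal \<epsilon> * indicator (?S \<epsilon>) (path l om) \<partial>M)"
        using z[OF _ \<epsilon>] by (intro nn_integral_mono) (auto simp: indicator_def intro!: ennreal_leI)
      also have "\<dots> = ennreal \<epsilon> * (\<integral>\<^sup>+om. indicator (?S \<epsilon>) (path l om) \<partial>M)"
      proof (rule nn_integral_cmult)
        have "(indicator (?S \<epsilon>) :: _ \<Rightarrow> ennreal) \<in> borel_measurable (path_borel l)"
          by (rule borel_measurable_indicator) simp
        from measurable_compose[OF path_measurable this]
        show "(\<lambda>om. indicator (?S \<epsilon>) (path l om) :: ennreal) \<in> borel_measurable M" .
      qed
      also have "(\<integral>\<^sup>+om. indicator (?S \<epsilon>) (path l om) \<partial>M) = emeasure ?R (?S \<epsilon>)"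
      proof -
        have n1: "(\<integral>\<^sup>+x. indicator (?S \<epsilon>) x \<partial>?R) = (\<integral>\<^sup>+om. indicator (?S \<epsilon>) (path l om) \<partial>M)"
          by (rule nn_integral_distr) measurable
        have n2: "(\<integral>\<^sup>+x. indicator (?S \<epsilon>) x \<partial>?R) = emeasure ?R (?S \<epsilon>)"
          by (rule nn_integral_indicator) measurable
        show ?thesis by (rule trans[OF n1[symmetric] n2])
      qed
      finally have num: "(\<integral>\<^sup>+x. ennreal (g (x s)) * indicator (?S \<epsilon>) x \<partial>?R) \<le> ennreal \<epsilon> * emeasure ?R (?S \<epsilon>)" .
      have "(\<integral>\<^sup>+x. ennreal (g (x s)) \<partial>uniform_measure ?R (?S \<epsilon>)) = (\<integral>\<^sup>+x. ennreal (g (x s)) * indicator (?S \<epsilon>) x \<partial>?R) / emeasure ?R (?S \<epsilon>)"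
        by (rule nn_integral_uniform_measure) auto
      also have "\<dots> \<le> ennreal \<epsilon> * emeasure ?R (?S \<epsilon>) / emeasure ?R (?S \<epsilon>)"
        by (rule divide_right_mono_ennreal[OF num])
      also have "\<dots> \<le> ennreal \<epsilon>"
      proof -
        interpret R: prob_space ?R by (rule prob_space_distr) measurable
        show ?thesis
        proof (cases "emeasure ?R (?S \<epsilon>) = 0")
          case False
          then show ?thesis by (simp add: R.emeasure_eq_measure ennreal_mult_divide_eq ennreal_times_divide[symmetric] divide_ennreal)
        qed simp
      qed
      finally have "(\<integral>\<^sup>+x. ennreal (g (x s)) \<partial>uniform_measure ?R (?S \<epsilon>)) \<le> ennreal \<epsilon>" .
      moreover have "(\<integral>x. g (x s) \<partial>uniform_measure ?R (?S \<epsilon>)) = enn2real (\<integral>\<^sup>+x. ennreal (g (x s)) \<partial>uniform_measure ?R (?S \<epsilon>))"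
        using g by (intro integral_eq_nn_integral) (auto intro!: AE_I2)
      ultimately show ?thesis using \<epsilon> by (simp add: enn2real_leI)
    qed
    have "(\<integral>x. g (x s) \<partial>P) \<le> 0"
    proof (rule tendsto_le[OF _ _ lim])
      show "((\<lambda>\<epsilon>::real. \<epsilon>) \<longlongrightarrow> 0) (at_right 0)" by (rule tendsto_ident_at)
      show "\<forall>\<^sub>F \<epsilon> in at_right 0. (\<integral>x. g (x s) \<partial>uniform_measure ?R (?S \<epsilon>)) \<le> \<epsilon>"
        using eventually_at_right_less[of 0] by eventually_elim (rule bd)
    qed simp
    moreover have "integrable P (\<lambda>x. g (x s))"
      using g by (intro P.integrable_const_bound[where B = 1]) (auto intro!: AE_I2)
    moreover have "(\<integral>x. g (x s) \<partial>P) \<ge> 0" using g by (intro integral_nonneg_AE AE_I2) auto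
    ultimately show ?thesis using g by (subst integral_nonneg_eq_0_iff_AE[symmetric]) (auto intro!: AE_I2)
  qed
  show "AE x in P. 0 \<le> x s" if s: "s \<in> {0..l}"
  proof -
    have "AE x in P. min 1 (max 0 (- x s)) = 0"
    proof (rule key[OF s])
      fix om \<epsilon> assume "om \<in> space M" "\<epsilon> > (0::real)"
      then show "min 1 (max 0 (- path l om s)) \<le> \<epsilon>" using s Z_nonneg by (auto simp: path_def)
    qed (auto intro!: continuous_intros)
    then show ?thesis by eventually_elim (auto simp: min_def max_def split: if_splits)
  qed
  show "AE x in P. x 0 = a"
  proof -
    have "AE x in P. min 1 \<bar>x 0 - a\<bar> = 0"
    proof (rule key)
      fix om \<epsilon> assume "om \<in> space M" "\<epsilon> > (0::real)"
      then show "min 1 \<bar>path l om 0 - a\<bar> \<le> \<epsilon>" using l a Z_0 by (auto simp: path_def)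
    qed (use l in \<open>auto intro!: continuous_intros\<close>)
    then show ?thesis by eventually_elim (auto simp: min_def split: if_splits)
  qed
  show "AE x in P. x l = b"
  proof -
    have "AE x in P. min 1 \<bar>x l - b\<bar> = 0"
      by (rule key) (use l in \<open>auto intro!: continuous_intros\<close>)
    then show ?thesis by eventually_elim (auto simp: min_def split: if_splits)
  qed
qed

section \<open>Bridges pinned at an interior time\<close>

lemma path_concat_measurable:
  assumes r: "0 < r" "r < 1"
  shows "(\<lambda>(x, y). path_concat r x y) \<in> measurable (path_borel r \<Otimes>\<^sub>M path_borel (1 - r)) (path_borel 1)"
proof (rule measurable_into_path_borel)
  fix t :: real assume t: "t \<in> {0..1}"
  note me = measurable_compose[OF measurable_fst measurable_eval_path] measurable_compose[OF measurable_snd measurable_eval_path]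
  show "(\<lambda>p. (case p of (x, y) \<Rightarrow> path_concat r x y) t) \<in> borel_measurable (path_borel r \<Otimes>\<^sub>M path_borel (1 - r))"
  proof (cases "t \<le> r")
    case True
    then have "(\<lambda>p. (case p of (x, y) \<Rightarrow> path_concat r x y) t) = (\<lambda>p. fst p t)" using t by (auto simp: path_concat_def fun_eq_iff)
    then show ?thesis using t True me(1)[of t r "path_borel (1 - r)"] by simp
  next
    case False
    then have "(\<lambda>p. (case p of (x, y) \<Rightarrow> path_concat r x y) t) = (\<lambda>p. snd p (t - r) + (fst p r - snd p 0))" using t by (auto simp: path_concat_def fun_eq_iff)
    then show ?thesis using t r False me(1)[of r r "path_borel (1 - r)"] me(2)[of "t - r" "1 - r" "path_borel r"] me(2)[of 0 "1 - r" "path_borel r"]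
      by simp
  qed
next
  fix p assume p: "p \<in> space (path_borel r \<Otimes>\<^sub>M path_borel (1 - r))"
  obtain x y where xy: "p = (x, y)" by force
  have c: "continuous_on {0..r} x" "continuous_on {0..1-r} y"
    using p by (auto simp: xy space_pair_measure space_path_borel)
  have "continuous_on ({0..r} \<union> {r..1}) (\<lambda>t. if t \<le> r then x t else y (t - r) + (x r - y 0))"
  proof (rule continuous_on_cases)
    show "continuous_on {r..1} (\<lambda>t. y (t - r) + (x r - y 0))"
      by (intro continuous_intros continuous_on_compose2[OF c(2)]) auto
  qed (use c in auto)
  moreover have "{0..r} \<union> {r..1} = {0..1}" using r by auto
  ultimately have "continuous_on {0..1} (path_concat r x y)"
    by (subst continuous_on_cong[OF refl, of _ _ "\<lambda>t. if t \<le> r then x t else y (t - r) + (x r - y 0)"]) (auto simp: path_concat_def)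
  then show "(case p of (x, y) \<Rightarrow> path_concat r x y) \<in> space (path_borel 1)"
    by (auto simp: xy space_path_borel path_concat_def)
qed

text \<open>Covariances of the Brownian bridge: \<open>Vf\<close> is the variance, \<open>Rf\<close>
  the covariance and \<open>Ef\<close> the determinant of the two-point covariance matrix. In
  integer dimension the squared bridge is a sum of squares of independent Brownian bridges, and the
  determinant of the identity plus twice \<open>diag (a', a)\<close> times the covariance matrix is
  \<open>Df s a + 2 * a' * Mf r s a\<close>. Its power \<open>- (\<delta> / 2)\<close> is the joint
  Laplace transform in every dimension.\<close>

definition Vf :: "real \<Rightarrow> real" where "Vf r = r * (1 - r)"
definition Rf :: "real \<Rightarrow> real \<Rightarrow> real" where "Rf r s = min r s * (1 - max r s)"
definition Ef :: "real \<Rightarrow> real \<Rightarrow> real" where "Ef r s = Rf r s * \<bar>r - s\<bar>"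
definition Df :: "real \<Rightarrow> real \<Rightarrow> real" where "Df s a = 1 + 2 * a * Vf s"
definition Mf :: "real \<Rightarrow> real \<Rightarrow> real \<Rightarrow> real" where "Mf r s a = Vf r + 2 * a * Ef r s"

lemma Vf_pos: "0 < r \<Longrightarrow> r < 1 \<Longrightarrow> Vf r > 0" by (simp add: Vf_def)
lemma Ef_nonneg: "0 < r \<Longrightarrow> r < 1 \<Longrightarrow> 0 < s \<Longrightarrow> s < 1 \<Longrightarrow> Ef r s \<ge> 0" by (auto simp: Ef_def Rf_def)
lemma Rf_pos: "0 < r \<Longrightarrow> r < 1 \<Longrightarrow> 0 < s \<Longrightarrow> s < 1 \<Longrightarrow> Rf r s > 0" by (auto simp: Rf_def min_def max_def)
lemma Df_ge_1: "0 < s \<Longrightarrow> s < 1 \<Longrightarrow> a \<ge> 0 \<Longrightarrow> Df s a \<ge> 1" using Vf_pos[of s] by (simp add: Df_def)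
lemma Mf_ge: "0 < r \<Longrightarrow> r < 1 \<Longrightarrow> 0 < s \<Longrightarrow> s < 1 \<Longrightarrow> a \<ge> 0 \<Longrightarrow> Mf r s a \<ge> Vf r" using Ef_nonneg[of r s] by (simp add: Mf_def)
lemma Mf_pos: "0 < r \<Longrightarrow> r < 1 \<Longrightarrow> 0 < s \<Longrightarrow> s < 1 \<Longrightarrow> a \<ge> 0 \<Longrightarrow> Mf r s a > 0" using Mf_ge[of r s a] Vf_pos[of r] by simp
lemma VV_eq: "Vf r * Vf s = Ef r s + (Rf r s)\<^sup>2"
  unfolding Vf_def Ef_def Rf_def by (cases "r \<le> s") (simp_all add: min_def max_def algebra_simps power2_eq_square)
text \<open>The determinant identity \<open>VV_eq\<close> carried along in \<open>a\<close>: the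
  terms \<open>2 * a * Vf s * Ef r s\<close> on both sides cancel. It later eliminates
  \<open>Ef r s * Df s a\<close> after differentiations.\<close>

lemma VM_eq: "Vf s * Mf r s a = Ef r s * Df s a + (Rf r s)\<^sup>2"
  using VV_eq[of r s] unfolding Mf_def Df_def by (simp add: algebra_simps)

lemma pinned_lawE:
  assumes "pinned_bessel_bridge_law \<delta> r b Q" "0 < r" "r < 1" "\<delta> > 0" "b \<ge> 0"
  obtains P1 P2 where "bessel_bridge_law \<delta> r 0 b P1" "bessel_bridge_law \<delta> (1 - r) b 0 P2"
    "Q = distr (P1 \<Otimes>\<^sub>M P2) (path_borel 1) (\<lambda>(x, y). path_concat r x y)"
    "prob_space P1" "prob_space P2"
    "(\<lambda>(x, y). path_concat r x y) \<in> measurable (P1 \<Otimes>\<^sub>M P2) (path_borel 1)"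
    "distr (P1 \<Otimes>\<^sub>M P2) P1 fst = P1" "distr (P1 \<Otimes>\<^sub>M P2) P2 snd = P2"
    "AE p in P1 \<Otimes>\<^sub>M P2. fst p r = snd p 0"
proof -
  obtain P1 P2 where P: "bessel_bridge_law \<delta> r 0 b P1" "bessel_bridge_law \<delta> (1 - r) b 0 P2"
    "Q = distr (P1 \<Otimes>\<^sub>M P2) (path_borel 1) (\<lambda>(x, y). path_concat r x y)"
    using assms(1) unfolding pinned_bessel_bridge_law_def by blast
  interpret P1: prob_space P1 by (rule bessel_bridge_law_prob[OF P(1)])
  interpret P2: prob_space P2 by (rule bessel_bridge_law_prob[OF P(2)])
  interpret pair_prob_space P1 P2 ..
  note s = bessel_bridge_law_sets[OF P(1)] bessel_bridge_law_sets[OF P(2)]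
  have m: "(\<lambda>(x, y). path_concat r x y) \<in> measurable (P1 \<Otimes>\<^sub>M P2) (path_borel 1)"
    using path_concat_measurable[OF assms(2,3)] measurable_cong_sets[OF sets_pair_measure_cong[OF s] refl] by blast
  have d1: "distr (P1 \<Otimes>\<^sub>M P2) P1 fst = P1" by (rule P2.distr_pair_fst)
  have d2: "distr (P1 \<Otimes>\<^sub>M P2) P2 snd = P2"
  proof (rule measure_eqI)
    fix A assume "A \<in> sets (distr (P1 \<Otimes>\<^sub>M P2) P2 snd)"
    then have A: "A \<in> sets P2" by simp
    have "snd -` A \<inter> space (P1 \<Otimes>\<^sub>M P2) = space P1 \<times> A"
      using sets.sets_into_space[OF A] by (auto simp: space_pair_measure)
    then show "emeasure (distr (P1 \<Otimes>\<^sub>M P2) P2 snd) A = emeasure P2 A"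
      using A by (subst emeasure_distr) (auto simp: P2.emeasure_pair_measure_Times P1.emeasure_space_1)
  qed simp
  have "AE x in P1. x r = b" using bridge_ends(3)[OF P(1) assms(4)] assms by simp
  then have "AE x in distr (P1 \<Otimes>\<^sub>M P2) P1 fst. x r = b" unfolding d1 .
  then have a1: "AE p in P1 \<Otimes>\<^sub>M P2. fst p r = b"
    by (rule AE_distrD[OF measurable_fst])
  have "AE x in P2. x 0 = b" using bridge_ends(2)[OF P(2) assms(4)] assms by simp
  then have "AE x in distr (P1 \<Otimes>\<^sub>M P2) P2 snd. x 0 = b" unfolding d2 .
  then have a2: "AE p in P1 \<Otimes>\<^sub>M P2. snd p 0 = b"
    by (rule AE_distrD[OF measurable_snd])
  have "AE p in P1 \<Otimes>\<^sub>M P2. fst p r = snd p 0" using a1 a2 by eventually_elim simp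
  then show ?thesis using that P m d1 d2 P1.prob_space_axioms P2.prob_space_axioms by blast
qed

lemma pinned_law_prob:
  assumes "pinned_bessel_bridge_law \<delta> r b Q" "0 < r" "r < 1" "\<delta> > 0" "b \<ge> 0"
  shows "prob_space Q" "sets Q = sets (path_borel 1)"
proof -
  obtain P1 P2 where P: "Q = distr (P1 \<Otimes>\<^sub>M P2) (path_borel 1) (\<lambda>(x, y). path_concat r x y)"
    "prob_space P1" "prob_space P2" "(\<lambda>(x, y). path_concat r x y) \<in> measurable (P1 \<Otimes>\<^sub>M P2) (path_borel 1)"
    using pinned_lawE[OF assms] by metis
  interpret P1: prob_space P1 by fact
  interpret P2: prob_space P2 by fact
  interpret pair_prob_space P1 P2 ..
  show "prob_space Q" unfolding P(1) by (rule prob_space_distr[OF P(4)])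
  show "sets Q = sets (path_borel 1)" by (simp add: P(1))
qed

text \<open>The shift in \<open>path_concat\<close> is almost surely 0, so at a time
  \<open>s \<noteq> r\<close> only one of the two independent bridges is visible; which one depends
  on the side of \<open>r\<close>.\<close>

lemma pinned_law_marginal:
  assumes Q: "pinned_bessel_bridge_law \<delta> r b Q" "0 < r" "r < 1" "\<delta> > 0" "b \<ge> 0" and s: "0 < s" "s < 1" "s \<noteq> r"
  shows "\<exists>P' u l. ((s < r \<and> l = r \<and> u = s \<and> bessel_bridge_law \<delta> l 0 b P') \<or> (r < s \<and> l = 1 - r \<and> u = s - r \<and> bessel_bridge_law \<delta> l b 0 P')) \<and>
     distr Q borel (\<lambda>x. x s) = distr P' borel (\<lambda>x. x u)"
proof -
  obtain P1 P2 where P: "bessel_bridge_law \<delta> r 0 b P1" "bessel_bridge_law \<delta> (1 - r) b 0 P2"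
    "Q = distr (P1 \<Otimes>\<^sub>M P2) (path_borel 1) (\<lambda>(x, y). path_concat r x y)"
    and pp: "prob_space P1" "prob_space P2"
    and mp: "(\<lambda>(x, y). path_concat r x y) \<in> measurable (P1 \<Otimes>\<^sub>M P2) (path_borel 1)"
    and d: "distr (P1 \<Otimes>\<^sub>M P2) P1 fst = P1" "distr (P1 \<Otimes>\<^sub>M P2) P2 snd = P2"
    and ae: "AE p in P1 \<Otimes>\<^sub>M P2. fst p r = snd p 0"
    by (rule pinned_lawE[OF Q])
  have ev: "(\<lambda>x. x s) \<in> borel_measurable (path_borel 1)" using s by (intro measurable_eval_path) auto
  have s1: "sets P1 = sets (path_borel r)" and s2: "sets P2 = sets (path_borel (1 - r))"
    using bessel_bridge_law_sets P by auto
  have DQ: "distr Q borel (\<lambda>x. x s) = distr (P1 \<Otimes>\<^sub>M P2) borel (\<lambda>p. (case p of (x, y) \<Rightarrow> path_concat r x y) s)"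
    unfolding P(3) by (subst distr_distr[OF ev mp]) (simp add: comp_def)
  show ?thesis
  proof (cases "s < r")
    case True
    have m: "(\<lambda>x. x s) \<in> borel_measurable P1"
      using measurable_eval_path[of s r] s True measurable_cong_sets[OF s1 refl] by auto
    have "(\<lambda>p. (case p of (x, y) \<Rightarrow> path_concat r x y) s) = (\<lambda>x. x s) \<circ> fst"
      using s True by (auto simp: path_concat_def fun_eq_iff)
    then have "distr Q borel (\<lambda>x. x s) = distr (distr (P1 \<Otimes>\<^sub>M P2) P1 fst) borel (\<lambda>x. x s)"
      unfolding DQ by (subst distr_distr[OF m measurable_fst]) simp
    then show ?thesis unfolding d using P(1) True by blast
  next
    case False
    then have rs: "r < s" using s by simp
    have m: "(\<lambda>x. x (s - r)) \<in> borel_measurable P2" "(\<lambda>x. x 0) \<in> borel_measurable P2" "(\<lambda>x. x r) \<in> borel_measurable P1"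
      using measurable_eval_path[of "s - r" "1 - r"] measurable_eval_path[of 0 "1 - r"] measurable_eval_path[of r r] s rs Q
        measurable_cong_sets[OF s2 refl] measurable_cong_sets[OF s1 refl] by auto
    have "distr Q borel (\<lambda>x. x s) = distr (P1 \<Otimes>\<^sub>M P2) borel ((\<lambda>x. x (s - r)) \<circ> snd)"
      unfolding DQ
    proof (rule distr_cong_AE)
      show "AE p in P1 \<Otimes>\<^sub>M P2. (case p of (x, y) \<Rightarrow> path_concat r x y) s = ((\<lambda>x. x (s - r)) \<circ> snd) p"
        using ae by eventually_elim (use rs s in \<open>auto simp: path_concat_def\<close>)
      show "(\<lambda>p. (case p of (x, y) \<Rightarrow> path_concat r x y) s) \<in> borel_measurable (P1 \<Otimes>\<^sub>M P2)"
        by (rule measurable_compose[OF mp ev])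
      show "((\<lambda>x. x (s - r)) \<circ> snd) \<in> borel_measurable (P1 \<Otimes>\<^sub>M P2)"
        using measurable_compose[OF measurable_snd m(1)] by (simp add: comp_def)
    qed simp_all
    also have "\<dots> = distr (distr (P1 \<Otimes>\<^sub>M P2) P2 snd) borel (\<lambda>x. x (s - r))"
      by (subst distr_distr[OF m(1) measurable_snd]) simp
    finally show ?thesis unfolding d using P(2) rs by blast
  qed
qed

text \<open>The part of \<open>Sigma_weight\<close> that depends on neither \<open>r\<close> nor
  \<open>b\<close>, for \<open>c = \<delta> / 2\<close>.\<close>

definition kc :: "real \<Rightarrow> real" where "kc c = 1 / (2 powr (c - 1) * Gamma c)"

text \<open>Applied with \<open>r\<close> and \<open>1 - r\<close>: removing the Gaussian factor of
  one bridge from that of \<open>Sigma_weight\<close> leaves that of the other side.\<close>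

lemma inverse_diff_aux:
  fixes x y :: real
  assumes "x \<noteq> 0" "y \<noteq> 0" "x + y = 1"
  shows "1 / (2 * (x * y)) - 1 / (2 * y) = 1 / (2 * x)"
proof -
  have "1 / (2 * (x * y)) - 1 / (2 * y) = (1 - x) / (2 * (x * y))" using assms(1,2) by (simp add: field_simps)
  also have "1 - x = y" using assms(3) by simp
  finally show ?thesis using assms(2) by simp
qed

text \<open>The Gaussian factor of \<open>Sigma_weight\<close> merges with the exponents of the two
  bridge formulas, and both sides of \<open>r\<close> then give the same expression. In
  \<open>b\<close> it is a pure Gaussian, which is what makes the boundary term computable.\<close>

lemma pinned_laplace:
  assumes Q: "pinned_bessel_bridge_law \<delta> r b Q" "0 < r" "r < 1" "\<delta> > 0" "b \<ge> 0" and s: "0 < s" "s < 1" "s \<noteq> r" and a: "a \<ge> 0"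
  shows "Sigma_weight \<delta> r b * (\<integral>x. exp (- a * (x s)\<^sup>2) \<partial>Q) =
    kc (\<delta> / 2) * Mf r s a powr (- (\<delta> / 2)) * exp (- (b\<^sup>2 * Df s a / (2 * Mf r s a)))"
proof -
  define c where "c = \<delta> / 2"
  obtain P' u l where Pul: "(s < r \<and> l = r \<and> u = s \<and> bessel_bridge_law \<delta> l 0 b P') \<or> (r < s \<and> l = 1 - r \<and> u = s - r \<and> bessel_bridge_law \<delta> l b 0 P')"
    and d: "distr Q borel (\<lambda>x. x s) = distr P' borel (\<lambda>x. x u)"
    using pinned_law_marginal[OF Q s] by blast
  have V: "Vf r > 0" and M: "Mf r s a > 0" using Vf_pos Mf_pos Q s a by auto
  have sP: "sets P' = sets (path_borel l)" using Pul bessel_bridge_law_sets by blast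
  have u: "0 < u" "u < l" "l > 0" using Pul s Q by auto
  have m: "(\<lambda>x. x u) \<in> borel_measurable P'" "(\<lambda>x. x s) \<in> borel_measurable Q"
    using measurable_eval_path[of u l] measurable_eval_path[of s 1] u s measurable_cong_sets[OF sP refl] measurable_cong_sets[OF pinned_law_prob(2)[OF Q] refl] by auto
  have "(\<integral>x. exp (- a * (x s)\<^sup>2) \<partial>Q) = (\<integral>y. exp (- a * y\<^sup>2) \<partial>distr Q borel (\<lambda>x. x s))"
    by (subst integral_distr[OF m(2)]) auto
  also have "\<dots> = (\<integral>x. exp (- a * (x u)\<^sup>2) \<partial>P')"
    unfolding d by (subst integral_distr[OF m(1)]) auto
  finally have I: "(\<integral>x. exp (- a * (x s)\<^sup>2) \<partial>Q) = (\<integral>x. exp (- a * (x u)\<^sup>2) \<partial>P')" .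
  define N where "N = l + 2 * a * u * (l - u)"
  have N: "N > 0" unfolding N_def using u a by (intro add_pos_nonneg) auto
  have SW: "Sigma_weight \<delta> r b = kc c * Vf r powr (- c) * exp (- (b\<^sup>2 / (2 * Vf r)))"
    unfolding Sigma_weight_def kc_def Vf_def c_def by (simp add: powr_minus_divide mult.assoc)
  \<comment> \<open>\<open>MN\<close> and \<open>K\<close> are all that depends on the side of
    \<open>r\<close>: the factor \<open>N / l\<close> and the bridge exponent
    \<open>k\<close>.\<close>
  have main: "Sigma_weight \<delta> r b * (\<integral>x. exp (- a * (x u)\<^sup>2) \<partial>P') = kc c * Mf r s a powr (- c) * exp (- (b\<^sup>2 * Df s a / (2 * Mf r s a)))"
    if I': "(\<integral>x. exp (- a * (x u)\<^sup>2) \<partial>P') = (N / l) powr (- c) * exp (b\<^sup>2 / (2 * l) - b\<^sup>2 * k / (2 * N))"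
      and MN: "Mf r s a = Vf r * (N / l)" and K: "1 / (2 * Vf r) - 1 / (2 * l) + k / (2 * N) = Df s a / (2 * Mf r s a)" for k
  proof -
    have "Mf r s a powr (- c) = Vf r powr (- c) * (N / l) powr (- c)"
      unfolding MN by (rule powr_mult)
    moreover have "- (b\<^sup>2 / (2 * Vf r)) + (b\<^sup>2 / (2 * l) - b\<^sup>2 * k / (2 * N)) = - (b\<^sup>2 * Df s a / (2 * Mf r s a))"
    proof -
      have "- (b\<^sup>2 / (2 * Vf r)) + (b\<^sup>2 / (2 * l) - b\<^sup>2 * k / (2 * N)) = - (b\<^sup>2 * (1 / (2 * Vf r) - 1 / (2 * l) + k / (2 * N)))"
        by (simp add: algebra_simps)
      then show ?thesis unfolding K by simp
    qed
    then have "exp (- (b\<^sup>2 / (2 * Vf r))) * exp (b\<^sup>2 / (2 * l) - b\<^sup>2 * k / (2 * N)) = exp (- (b\<^sup>2 * Df s a / (2 * Mf r s a)))"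
      by (simp only: exp_add[symmetric])
    ultimately show ?thesis unfolding I' SW by (simp add: mult_ac)
  qed
  show ?thesis
  proof (cases "s < r")
    case True
    then have lu: "l = r" "u = s" "bessel_bridge_law \<delta> r 0 b P'" using Pul by auto
    have N': "Mf r s a = (1 - r) * N" using True by (simp add: N_def lu Mf_def Vf_def Ef_def Rf_def algebra_simps)
    have MN: "Mf r s a = Vf r * (N / l)" using Q by (simp add: N' lu Vf_def)
    have K: "1 / (2 * Vf r) - 1 / (2 * l) + (1 + 2 * a * s) / (2 * N) = Df s a / (2 * Mf r s a)"
    proof -
      have "N + (1 - r) * (1 + 2 * a * s) = Df s a" by (simp add: N_def lu Df_def Vf_def algebra_simps)
      moreover have "1 / (2 * Vf r) - 1 / (2 * l) = 1 / (2 * (1 - r))" using inverse_diff_aux[of "1 - r" r] Q by (simp add: lu Vf_def mult.commute)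
      moreover have "1 / (2 * (1 - r)) + (1 + 2 * a * s) / (2 * N) = (N + (1 - r) * (1 + 2 * a * s)) / (2 * ((1 - r) * N))"
        using Q N by (simp add: field_simps)
      ultimately show ?thesis by (simp add: N')
    qed
    have "(\<integral>x. exp (- a * (x u)\<^sup>2) \<partial>P') = (N / l) powr (- c) * exp (b\<^sup>2 / (2 * l) - b\<^sup>2 * (1 + 2 * a * s) / (2 * N))"
      using bridge_from_0_laplace[OF lu(3) Q(4,5) s(1) True a] by (simp add: N_def lu c_def)
    from main[OF this MN K] show ?thesis unfolding I c_def .
  next
    case False
    then have rs: "r < s" using s by simp
    then have lu: "l = 1 - r" "u = s - r" "bessel_bridge_law \<delta> (1 - r) b 0 P'" using Pul by auto
    have N': "Mf r s a = r * N" using rs by (simp add: N_def lu Mf_def Vf_def Ef_def Rf_def algebra_simps)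
    have MN: "Mf r s a = Vf r * (N / l)" using Q by (simp add: N' lu Vf_def)
    have K: "1 / (2 * Vf r) - 1 / (2 * l) + (1 + 2 * a * (l - u)) / (2 * N) = Df s a / (2 * Mf r s a)"
    proof -
      have "N + r * (1 + 2 * a * (l - u)) = Df s a" by (simp add: N_def lu Df_def Vf_def algebra_simps)
      moreover have "1 / (2 * Vf r) - 1 / (2 * l) = 1 / (2 * r)" using inverse_diff_aux[of r "1 - r"] Q by (simp add: lu Vf_def)
      moreover have "1 / (2 * r) + (1 + 2 * a * (l - u)) / (2 * N) = (N + r * (1 + 2 * a * (l - u))) / (2 * (r * N))"
        using Q N by (simp add: field_simps)
      ultimately show ?thesis by (simp add: N')
    qed
    have "(\<integral>x. exp (- a * (x u)\<^sup>2) \<partial>P') = (N / l) powr (- c) * exp (b\<^sup>2 / (2 * l) - b\<^sup>2 * (1 + 2 * a * (l - u)) / (2 * N))"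
      using bridge_to_0_laplace[OF lu(3) Q(4,5), of u a] u a by (simp add: N_def lu c_def)
    from main[OF this MN K] show ?thesis unfolding I c_def .
  qed
qed

lemma pinned_nonneg:
  assumes Q: "pinned_bessel_bridge_law \<delta> r b Q" "0 < r" "r < 1" "\<delta> > 0" "b \<ge> 0" and s: "0 < s" "s < 1" "s \<noteq> r"
  shows "AE x in Q. 0 \<le> x s"
proof -
  obtain P' u l where Pul: "(s < r \<and> l = r \<and> u = s \<and> bessel_bridge_law \<delta> l 0 b P') \<or> (r < s \<and> l = 1 - r \<and> u = s - r \<and> bessel_bridge_law \<delta> l b 0 P')"
    and d: "distr Q borel (\<lambda>x. x s) = distr P' borel (\<lambda>x. x u)"
    using pinned_law_marginal[OF Q s] by blast
  have sP: "sets P' = sets (path_borel l)" using Pul bessel_bridge_law_sets by blast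
  have u: "0 < u" "u < l" "l > 0" using Pul s Q by auto
  have m: "(\<lambda>x. x u) \<in> borel_measurable P'" "(\<lambda>x. x s) \<in> borel_measurable Q"
    using measurable_eval_path[of u l] measurable_eval_path[of s 1] u s measurable_cong_sets[OF sP refl] measurable_cong_sets[OF pinned_law_prob(2)[OF Q] refl] by auto
  have "AE x in P'. 0 \<le> x u"
    using Pul bridge_ends(1)[of \<delta> l _ _ P' u] u Q(4,5) by auto
  then have "AE y in distr P' borel (\<lambda>x. x u). 0 \<le> y" using m by (subst AE_distr_iff) auto
  then show ?thesis unfolding d[symmetric] using m by (subst (asm) AE_distr_iff) auto
qed

lemma bridge_laplace_joint:
  assumes P: "bessel_bridge_law \<delta> 1 0 0 P" and \<delta>: "\<delta> > 0" and rs: "0 < r" "r < 1" "0 < s" "s < 1" "r \<noteq> s" and a: "a \<ge> 0" "a' \<ge> 0"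
  shows "(\<integral>x. exp (- a * (x s)\<^sup>2) * exp (- a' * (x r)\<^sup>2) \<partial>P) = (Df s a + 2 * a' * Mf r s a) powr (- (\<delta> / 2))"
proof (cases "r < s")
  case True
  then show ?thesis using bridge_0_0_laplace_aux[OF P \<delta>, of r s a a'] rs a
    by (simp add: Df_def Mf_def Vf_def Ef_def Rf_def algebra_simps)
next
  case False
  then show ?thesis using bridge_0_0_laplace_aux[OF P \<delta>, of s r a' a] rs a
    by (simp add: Df_def Mf_def Vf_def Ef_def Rf_def algebra_simps)
qed

text \<open>Convexity instead of domination: \<open>1 + x \<le> exp x\<close> at
  \<open>x = h * Y\<close> and at \<open>x = - h * Y\<close> encloses the integral between
  difference quotients of \<open>L\<close> on the two sides of \<open>a\<close>. Its finiteness
  comes from the same inequality at \<open>h = a / 2\<close>.\<close>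

lemma nn_integral_laplace_derivative:
  fixes f Y :: "'a \<Rightarrow> real" and L :: "real \<Rightarrow> real"
  assumes [measurable]: "f \<in> borel_measurable N" "Y \<in> borel_measurable N"
    and pos: "AE x in N. 0 \<le> f x" "AE x in N. 0 \<le> Y x" and a: "a > 0"
    and L: "\<And>t. t > 0 \<Longrightarrow> (\<integral>\<^sup>+x. ennreal (f x * exp (- t * Y x)) \<partial>N) = ennreal (L t)" "\<And>t. t > 0 \<Longrightarrow> L t \<ge> 0"
    and L': "(L has_real_derivative - L') (at a)"
  shows "(\<integral>\<^sup>+x. ennreal (f x * (Y x * exp (- a * Y x))) \<partial>N) = ennreal L'"
proof -
  let ?G = "\<integral>\<^sup>+x. ennreal (f x * (Y x * exp (- a * Y x))) \<partial>N"
  have low: "ennreal h * ?G + ennreal (L a) \<le> ennreal (L (a - h))" if h: "0 < h" "h < a" for h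
  proof -
    have "ennreal h * ?G + ennreal (L a) = (\<integral>\<^sup>+x. ennreal h * ennreal (f x * (Y x * exp (- a * Y x))) + ennreal (f x * exp (- a * Y x)) \<partial>N)"
      unfolding L(1)[OF a, symmetric] by (subst nn_integral_add) (auto simp: nn_integral_cmult)
    also have "\<dots> \<le> (\<integral>\<^sup>+x. ennreal (f x * exp (- (a - h) * Y x)) \<partial>N)"
    proof (rule nn_integral_mono_AE)
      show "AE x in N. ennreal h * ennreal (f x * (Y x * exp (- a * Y x))) + ennreal (f x * exp (- a * Y x)) \<le> ennreal (f x * exp (- (a - h) * Y x))"
        using pos
      proof eventually_elim
        case (elim x)
        have "1 + h * Y x \<le> exp (h * Y x)" by (rule exp_ge_add_one_self)
        then have "(1 + h * Y x) * (f x * exp (- a * Y x)) \<le> exp (h * Y x) * (f x * exp (- a * Y x))"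
          using elim by (intro mult_right_mono) auto
        also have "\<dots> = f x * exp (- (a - h) * Y x)"
          by (simp add: mult_exp_exp algebra_simps)
        finally have le: "h * (f x * (Y x * exp (- a * Y x))) + f x * exp (- a * Y x) \<le> f x * exp (- (a - h) * Y x)"
          by (simp add: algebra_simps)
        have "ennreal h * ennreal (f x * (Y x * exp (- a * Y x))) + ennreal (f x * exp (- a * Y x)) = ennreal (h * (f x * (Y x * exp (- a * Y x))) + f x * exp (- a * Y x))"
          using elim h by (subst ennreal_plus) (auto simp: ennreal_mult')
        then show ?case using le by (simp add: ennreal_leI)
      qed
    qed
    also have "\<dots> = ennreal (L (a - h))" using h by (intro L) auto
    finally show ?thesis .
  qed
  have up: "ennreal (L a) \<le> ennreal (L (a + h)) + ennreal h * ?G" if h: "0 < h" for h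
  proof -
    have "ennreal (L a) = (\<integral>\<^sup>+x. ennreal (f x * exp (- a * Y x)) \<partial>N)" using L(1)[OF a] by simp
    also have "\<dots> \<le> (\<integral>\<^sup>+x. ennreal (f x * exp (- (a + h) * Y x)) + ennreal h * ennreal (f x * (Y x * exp (- a * Y x))) \<partial>N)"
    proof (rule nn_integral_mono_AE)
      show "AE x in N. ennreal (f x * exp (- a * Y x)) \<le> ennreal (f x * exp (- (a + h) * Y x)) + ennreal h * ennreal (f x * (Y x * exp (- a * Y x)))"
        using pos
      proof eventually_elim
        case (elim x)
        have "1 + - (h * Y x) \<le> exp (- (h * Y x))" by (rule exp_ge_add_one_self)
        then have "1 * (f x * exp (- a * Y x)) \<le> (exp (- (h * Y x)) + h * Y x) * (f x * exp (- a * Y x))"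
          using elim by (intro mult_right_mono) auto
        also have "\<dots> = exp (- (h * Y x)) * exp (- a * Y x) * f x + h * (f x * (Y x * exp (- a * Y x)))"
          by (simp add: algebra_simps)
        also have "exp (- (h * Y x)) * exp (- a * Y x) = exp (- (a + h) * Y x)"
          by (simp add: mult_exp_exp algebra_simps)
        finally have le: "f x * exp (- a * Y x) \<le> f x * exp (- (a + h) * Y x) + h * (f x * (Y x * exp (- a * Y x)))"
          by (simp add: mult.commute)
        have "ennreal (f x * exp (- (a + h) * Y x)) + ennreal h * ennreal (f x * (Y x * exp (- a * Y x))) = ennreal (f x * exp (- (a + h) * Y x) + h * (f x * (Y x * exp (- a * Y x))))"
          using elim h by (subst ennreal_plus) (auto simp: ennreal_mult')
        then show ?case using le by (simp add: ennreal_leI)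
      qed
    qed
    also have "\<dots> = (\<integral>\<^sup>+x. ennreal (f x * exp (- (a + h) * Y x)) \<partial>N) + ennreal h * ?G"
      by (subst nn_integral_add) (auto simp: nn_integral_cmult)
    also have "(\<integral>\<^sup>+x. ennreal (f x * exp (- (a + h) * Y x)) \<partial>N) = ennreal (L (a + h))" using h a by (intro L) auto
    finally show ?thesis .
  qed
  have "ennreal (a / 2) * ?G \<le> ennreal (L (a - a / 2))"
    using order_trans[OF _ low[of "a / 2"]] a by simp
  then have "?G \<noteq> top" using a by (auto simp: ennreal_mult_top top_unique)
  then obtain g where g: "?G = ennreal g" "g \<ge> 0" by (cases ?G) auto
  have lim: "((\<lambda>h. (L (a + h) - L a) / h) \<longlongrightarrow> - L') (at 0)" using L' by (simp add: DERIV_def)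
  have "- L' \<le> - g"
  proof (rule tendsto_upperbound)
    show "((\<lambda>h. (L (a + h) - L a) / h) \<longlongrightarrow> - L') (at_left 0)" using lim by (rule filterlim_mono) (auto simp: at_within_le_at)
    have "\<forall>\<^sub>F h in at_left 0. h < (0::real) \<and> - a < h"
      using a by (auto simp: eventually_at_left_field intro!: exI[of _ "- a"])
    then show "\<forall>\<^sub>F h in at_left 0. (L (a + h) - L a) / h \<le> - g"
    proof eventually_elim
      case (elim h)
      have hg: "ennreal (- h * g) = ennreal (- h) * ennreal g" using elim by (intro ennreal_mult') auto
      have hg0: "0 \<le> - h * g" using elim g(2) by (intro mult_nonneg_nonneg) auto
      have "ennreal (- h * g + L a) = ennreal (- h) * ?G + ennreal (L a)"
        unfolding g hg[symmetric] by (rule ennreal_plus[OF hg0 L(2)[OF a]])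
      also have "\<dots> \<le> ennreal (L (a + h))" using low[of "- h"] elim by simp
      finally have "- h * g + L a \<le> L (a + h)" using L(2)[of "a + h"] elim by simp
      then show ?case using elim by (simp add: neg_divide_le_eq mult.commute)
    qed
  qed simp
  moreover have "- g \<le> - L'"
  proof (rule tendsto_lowerbound)
    show "((\<lambda>h. (L (a + h) - L a) / h) \<longlongrightarrow> - L') (at_right 0)" using lim by (rule filterlim_mono) (auto simp: at_within_le_at)
    show "\<forall>\<^sub>F h in at_right 0. - g \<le> (L (a + h) - L a) / h"
      using eventually_at_right_less[of 0]
    proof eventually_elim
      case (elim h)
      have "ennreal (L a) \<le> ennreal (L (a + h)) + ennreal h * ?G" by (rule up[OF elim])
      also have "\<dots> = ennreal (L (a + h) + h * g)"
        unfolding g using elim g(2) L(2)[of "a + h"] a by (subst ennreal_plus) (auto simp: ennreal_mult')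
      finally have "L a \<le> L (a + h) + h * g" using L(2)[of "a + h"] elim a g(2) by (subst (asm) ennreal_le_iff) auto
      then show ?case using elim by (simp add: field_simps)
    qed
  qed simp
  ultimately show ?thesis using g by simp
qed

section \<open>The mixing weight, joint measurability and explicit moments\<close>

definition wt :: "real \<Rightarrow> real" where "wt a = indicator {0<..} a * a powr (- 1 / 2) / sqrt pi"

lemma wt_nonneg: "wt a \<ge> 0" by (simp add: wt_def)
lemma wt_measurable [measurable]: "wt \<in> borel_measurable borel" unfolding wt_def[abs_def] by measurable

lemma abs_eq_nn_integral_wt: "(\<integral>\<^sup>+a. ennreal (wt a * (x\<^sup>2 * exp (- a * x\<^sup>2))) \<partial>lborel) = ennreal \<bar>x :: real\<bar>"
proof (cases "x = 0")
  case False
  have "(\<integral>\<^sup>+a. ennreal (wt a * (x\<^sup>2 * exp (- a * x\<^sup>2))) \<partial>lborel) =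
     (\<integral>\<^sup>+a. ennreal (x\<^sup>2 / sqrt pi) * ennreal (indicator {0<..} a * a powr (1 / 2 - 1) * exp (- x\<^sup>2 * a)) \<partial>lborel)"
    by (intro nn_integral_cong) (simp add: wt_def ennreal_mult'[symmetric] mult_ac)
  also have "\<dots> = ennreal (x\<^sup>2 / sqrt pi) * ennreal (Gamma (1 / 2) * (x\<^sup>2) powr (- (1 / 2)))"
    by (subst nn_integral_cmult, measurable, subst nn_integral_gamma_scaled) (use False in auto)
  also have "\<dots> = ennreal (x\<^sup>2 / sqrt pi * (Gamma (1 / 2) * (x\<^sup>2) powr (- (1 / 2))))" by (simp add: ennreal_mult'[symmetric])
  also have "(x\<^sup>2) powr (- (1 / 2)) = 1 / \<bar>x\<bar>"
    using False by (simp add: powr_minus_divide powr_half_sqrt)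
  also have "x\<^sup>2 / sqrt pi * (Gamma (1 / 2) * (1 / \<bar>x\<bar>)) = \<bar>x\<bar>"
    using False by (simp add: Gamma_one_half_real field_simps power2_eq_square abs_mult_self_eq)
  finally show ?thesis .
qed simp

text \<open>Paths are continuous, so evaluation at \<open>t\<close> is the limit of evaluations at
  the grid points just below \<open>t\<close>, and each of these is a finite sum of products of a
  function of \<open>t\<close> with a coordinate. The indicator excludes times off the unit
  interval, where paths are \<open>undefined\<close>.\<close>

lemma eval_joint_measurable:
  "(\<lambda>(x, t). indicator {0..1} t * x t) \<in> borel_measurable (path_borel 1 \<Otimes>\<^sub>M (borel :: real measure))"
proof -
  \<comment> \<open>The index runs up to \<open>Suc n\<close> because the grid point 1 is attained
    at \<open>t = 1\<close>.\<close>
  define f where "f n = (\<lambda>(x :: real \<Rightarrow> real, t :: real). \<Sum>k\<le>Suc n. indicator {t. t \<in> {0..1} \<and> \<lfloor>real (Suc n) * t\<rfloor> = int k} t * x (real k / real (Suc n)))" for n :: nat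
  show ?thesis
  proof (rule borel_measurable_LIMSEQ_real)
    show "f n \<in> borel_measurable (path_borel 1 \<Otimes>\<^sub>M borel)" for n
    proof -
      have "(\<lambda>p. indicator {t. t \<in> {0..1} \<and> \<lfloor>real (Suc n) * t\<rfloor> = int k} (snd p) * fst p (real k / real (Suc n))) \<in> borel_measurable (path_borel 1 \<Otimes>\<^sub>M borel)"
        if k: "k \<in> {..Suc n}" for k
      proof -
        have "(\<lambda>x. x (real k / real (Suc n))) \<in> borel_measurable (path_borel 1)"
          using k by (intro measurable_eval_path) (auto simp: divide_le_eq_1 simp del: of_nat_Suc)
        from measurable_compose[OF measurable_fst this]
        have [measurable]: "(\<lambda>p. fst p (real k / real (Suc n))) \<in> borel_measurable (path_borel 1 \<Otimes>\<^sub>M borel)" .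
        show ?thesis by measurable
      qed
      then show ?thesis unfolding f_def split_beta' by (rule borel_measurable_sum)
    qed
    fix p assume p: "p \<in> space (path_borel 1 \<Otimes>\<^sub>M (borel :: real measure))"
    obtain x t where xt: "p = (x, t)" by force
    have c: "continuous_on {0..1} x" using p by (auto simp: xt space_pair_measure space_path_borel)
    show "(\<lambda>n. f n p) \<longlonglongrightarrow> (case p of (x, t) \<Rightarrow> indicator {0..1} t * x t)"
    proof (cases "t \<in> {0..1}")
      case False
      then have "f n p = 0" for n unfolding f_def xt by (auto intro!: sum.neutral simp: indicator_def simp del: of_nat_Suc sum.atMost_Suc)
      then show ?thesis using False by (simp add: xt)
    next
      case True
      define u where "u n = of_int \<lfloor>real (Suc n) * t\<rfloor> / real (Suc n)" for n
      have fl: "0 \<le> \<lfloor>real (Suc n) * t\<rfloor>" "\<lfloor>real (Suc n) * t\<rfloor> \<le> int (Suc n)" for n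
      proof -
        show "0 \<le> \<lfloor>real (Suc n) * t\<rfloor>" using True by simp
        have "real (Suc n) * t \<le> real (Suc n) * 1" using True by (intro mult_left_mono) auto
        then show "\<lfloor>real (Suc n) * t\<rfloor> \<le> int (Suc n)" unfolding floor_le_iff of_int_of_nat_eq mult_1_right by linarith
      qed
      have fe: "f n p = x (u n)" for n
      proof -
        define k0 where "k0 = nat \<lfloor>real (Suc n) * t\<rfloor>"
        have k0: "int k0 = \<lfloor>real (Suc n) * t\<rfloor>" using fl(1)[of n] unfolding k0_def by simp
        have k0le: "k0 \<le> Suc n" using fl(2)[of n] k0 by linarith
        have "f n p = (\<Sum>k\<le>Suc n. if k = k0 then x (real k / real (Suc n)) else 0)"
        proof -
          have t1: "indicator {t. t \<in> {0..1} \<and> \<lfloor>real (Suc n) * t\<rfloor> = int k} t * x (real k / real (Suc n)) = (if k = k0 then x (real k / real (Suc n)) else 0)" for k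
            using True k0[symmetric] by (simp add: indicator_def del: of_nat_Suc)
          show ?thesis unfolding f_def xt split_conv t1 ..
        qed
        also have "\<dots> = x (real k0 / real (Suc n))" by (subst sum.delta) (use k0le in auto)
        also have "real k0 = of_int \<lfloor>real (Suc n) * t\<rfloor>" using k0 by (metis of_int_of_nat_eq)
        finally show ?thesis by (simp add: u_def)
      qed
      have ub: "u n \<le> t" "t - 1 / real (Suc n) \<le> u n" "u n \<in> {0..1}" for n
      proof -
        have fb: "of_int \<lfloor>real (Suc n) * t\<rfloor> \<le> real (Suc n) * t" "real (Suc n) * t - 1 \<le> of_int \<lfloor>real (Suc n) * t\<rfloor>" by linarith+
        have "u n \<le> real (Suc n) * t / real (Suc n)" unfolding u_def by (intro divide_right_mono fb) simp
        then show "u n \<le> t" by (simp del: of_nat_Suc)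
        have "(real (Suc n) * t - 1) / real (Suc n) \<le> u n" unfolding u_def by (intro divide_right_mono fb) simp
        then show "t - 1 / real (Suc n) \<le> u n" by (simp add: diff_divide_distrib del: of_nat_Suc)
        have "0 \<le> u n" unfolding u_def using fl(1)[of n] by (intro divide_nonneg_nonneg) (auto simp del: of_nat_Suc)
        with \<open>u n \<le> t\<close> show "u n \<in> {0..1}" using True by auto
      qed
      have "(\<lambda>n. t - 1 / real (Suc n)) \<longlonglongrightarrow> t - 0" by (intro tendsto_intros LIMSEQ_Suc[OF lim_1_over_n])
      then have "u \<longlonglongrightarrow> t"
        by (intro tendsto_sandwich[of "\<lambda>n. t - 1 / real (Suc n)" u sequentially "\<lambda>_. t"] always_eventually allI ub) auto
      then have "(\<lambda>n. x (u n)) \<longlonglongrightarrow> x t"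
        using ub(3) by (intro continuous_on_tendsto_compose[OF c _ True]) (auto intro!: always_eventually)
      then show ?thesis unfolding fe using True by (simp add: xt)
    qed
  qed
qed

text \<open>\<open>al\<close> and \<open>be\<close> are the coefficients that arise when
  \<open>pinned_laplace\<close> is differentiated in \<open>a\<close>: \<open>al\<close> from the
  power of \<open>Mf\<close>, \<open>be\<close> from the exponent, where \<open>VM_eq\<close> leaves
  only the covariance.\<close>

definition al :: "real \<Rightarrow> real \<Rightarrow> real \<Rightarrow> real \<Rightarrow> real" where
  "al c r s a = kc c * (2 * c) * Ef r s * Mf r s a powr (- c - 1)"
definition be :: "real \<Rightarrow> real \<Rightarrow> real \<Rightarrow> real \<Rightarrow> real" where
  "be c r s a = kc c * (Rf r s)\<^sup>2 * Mf r s a powr (- c - 2)"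
definition Af :: "real \<Rightarrow> real \<Rightarrow> real \<Rightarrow> real" where
  "Af r s a = Df s a / (2 * Mf r s a)"
text \<open>The mean of the square root of a gamma variable with shape \<open>c\<close> and scale
  1.\<close>

definition gam :: "real \<Rightarrow> real" where "gam c = Gamma (c + 1 / 2) / Gamma c"
text \<open>Minus the derivative in \<open>a\<close> of \<open>gam c * sqrt 2 * Df s a powr (- c - 1
  / 2) * Mf r s a powr (1 / 2)\<close>, which is the mean of
  \<open>\<bar>X r\<bar> * exp (- a * (X s)^2)\<close> under the bridge.\<close>

definition kap :: "real \<Rightarrow> real \<Rightarrow> real \<Rightarrow> real \<Rightarrow> real" where
  "kap c r s a = gam c * sqrt 2 * ((2 * c + 1) * Vf s * Df s a powr (- c - 3 / 2) * Mf r s a powr (1 / 2)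
     - Ef r s * Df s a powr (- c - 1 / 2) * Mf r s a powr (- 1 / 2))"

lemma pinned_moment:
  assumes Q: "pinned_bessel_bridge_law \<delta> r b Q" "0 < r" "r < 1" "\<delta> > 0" "b \<ge> 0" and s: "0 < s" "s < 1" "s \<noteq> r" and a: "a > 0"
  shows "(\<integral>\<^sup>+x. ennreal (Sigma_weight \<delta> r b * ((x s)\<^sup>2 * exp (- a * (x s)\<^sup>2))) \<partial>Q) =
    ennreal ((al (\<delta> / 2) r s a + be (\<delta> / 2) r s a * b\<^sup>2) * exp (- (Af r s a) * b\<^sup>2))"
proof (rule nn_integral_laplace_derivative[where L = "\<lambda>t. kc (\<delta> / 2) * Mf r s t powr (- (\<delta> / 2)) * exp (- (b\<^sup>2 * Df s t / (2 * Mf r s t)))"])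
  interpret Q: prob_space Q by (rule pinned_law_prob(1)[OF Q])
  have [measurable]: "(\<lambda>x. x s) \<in> borel_measurable Q"
    using measurable_eval_path[of s 1] s measurable_cong_sets[OF pinned_law_prob(2)[OF Q] refl] by auto
  then show "(\<lambda>x. (x s)\<^sup>2) \<in> borel_measurable Q" by measurable
  have w: "Sigma_weight \<delta> r b \<ge> 0" using Q by (simp add: Sigma_weight_def Gamma_real_pos less_imp_le)
  then show "AE x in Q. 0 \<le> Sigma_weight \<delta> r b" by simp
  have k: "kc (\<delta> / 2) > 0" using Q by (simp add: kc_def Gamma_real_pos)
  show "0 \<le> kc (\<delta> / 2) * Mf r s t powr (- (\<delta> / 2)) * exp (- (b\<^sup>2 * Df s t / (2 * Mf r s t)))" for t using k by simp
  fix t :: real assume t: "t > 0"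
  have i: "integrable Q (\<lambda>x. exp (- t * (x s)\<^sup>2))" using t by (intro Q.integrable_const_bound[where B = 1]) auto
  have "(\<integral>\<^sup>+x. ennreal (Sigma_weight \<delta> r b * exp (- t * (x s)\<^sup>2)) \<partial>Q) = ennreal (\<integral>x. Sigma_weight \<delta> r b * exp (- t * (x s)\<^sup>2) \<partial>Q)"
    using i w by (intro nn_integral_eq_integral) auto
  also have "(\<integral>x. Sigma_weight \<delta> r b * exp (- t * (x s)\<^sup>2) \<partial>Q) = kc (\<delta> / 2) * Mf r s t powr (- (\<delta> / 2)) * exp (- (b\<^sup>2 * Df s t / (2 * Mf r s t)))"
    using pinned_laplace[OF Q s less_imp_le[OF t]] by simp
  finally show "(\<integral>\<^sup>+x. ennreal (Sigma_weight \<delta> r b * exp (- t * (x s)\<^sup>2)) \<partial>Q) = ennreal (kc (\<delta> / 2) * Mf r s t powr (- (\<delta> / 2)) * exp (- (b\<^sup>2 * Df s t / (2 * Mf r s t))))" .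
next
  let ?c = "\<delta> / 2" and ?e = "exp (- (b\<^sup>2 * Df s a / (2 * Mf r s a)))" and ?M = "Mf r s a"
  have M: "?M > 0" using Mf_pos Q s a by simp
  have dM: "(Mf r s has_real_derivative 2 * Ef r s) (at a)" unfolding Mf_def[abs_def] by (auto intro!: derivative_eq_intros)
  have dD: "(Df s has_real_derivative 2 * Vf s) (at a)" unfolding Df_def[abs_def] by (auto intro!: derivative_eq_intros)
  have d: "((\<lambda>t. kc ?c * Mf r s t powr (- ?c) * exp (- (b\<^sup>2 * Df s t / (2 * Mf r s t)))) has_real_derivative
     kc ?c * ((- ?c) * ?M powr (- ?c - 1) * (2 * Ef r s)) * ?e + kc ?c * ?M powr (- ?c) * (?e * - (b\<^sup>2 * (2 * Vf s * ?M - Df s a * (2 * Ef r s)) / (2 * ?M\<^sup>2)))) (at a)"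
    using M by (auto intro!: derivative_eq_intros dM dD DERIV_powr simp: field_simps power2_eq_square)
  have "2 * Vf s * ?M - Df s a * (2 * Ef r s) = 2 * (Rf r s)\<^sup>2" using VM_eq[of s r a] by (simp add: algebra_simps)
  moreover have "?M powr (- ?c - 2) = ?M powr (- ?c) / ?M\<^sup>2" using M powr_diff[of ?M "- ?c" 2] by (simp add: powr_numeral)
  moreover have "?e = exp (- Af r s a * b\<^sup>2)" by (simp add: Af_def mult_ac)
  ultimately have "kc ?c * ((- ?c) * ?M powr (- ?c - 1) * (2 * Ef r s)) * ?e + kc ?c * ?M powr (- ?c) * (?e * - (b\<^sup>2 * (2 * Vf s * ?M - Df s a * (2 * Ef r s)) / (2 * ?M\<^sup>2)))
     = - ((al ?c r s a + be ?c r s a * b\<^sup>2) * exp (- (Af r s a) * b\<^sup>2))"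
    by (simp add: al_def be_def algebra_simps)
  with d show "((\<lambda>t. kc ?c * Mf r s t powr (- ?c) * exp (- (b\<^sup>2 * Df s t / (2 * Mf r s t)))) has_real_derivative
     - ((al ?c r s a + be ?c r s a * b\<^sup>2) * exp (- (Af r s a) * b\<^sup>2))) (at a)" by (simp only:)
qed (use a in auto)

lemma nn_integral_gamma_mix_powr:
  assumes "c > 0" "C \<ge> 0" "\<xi> > 0" "q \<ge> 0"
  shows "(\<integral>\<^sup>+y. ennreal (y powr q) \<partial>gamma_mix_measure C \<xi> c 0) = ennreal (C * (Gamma (c + q) / Gamma c) * \<xi> powr q)"
proof -
  have G: "Gamma c > 0" "Gamma (c + q) > 0" using assms by (auto intro: Gamma_real_pos)
  have [measurable]: "gamma_mix C \<xi> c 0 \<in> borel_measurable borel" using assms by measurable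
  have "(\<integral>\<^sup>+y. ennreal (y powr q) \<partial>gamma_mix_measure C \<xi> c 0) = (\<integral>\<^sup>+y. ennreal (C * \<xi> powr (- c) / Gamma c) * ennreal (indicator {0<..} y * y powr (c + q - 1) * exp (- (1 / \<xi>) * y)) \<partial>lborel)"
    unfolding gamma_mix_measure_def
  proof (subst nn_integral_density)
    show "(\<integral>\<^sup>+y. ennreal (indicator {0<..} y * y powr (c - 1) * gamma_mix C \<xi> c 0 y) * ennreal (y powr q) \<partial>lborel) = (\<integral>\<^sup>+y. ennreal (C * \<xi> powr (- c) / Gamma c) * ennreal (indicator {0<..} y * y powr (c + q - 1) * exp (- (1 / \<xi>) * y)) \<partial>lborel)"
    proof (rule nn_integral_cong)
      fix y :: real
      have "indicator {0<..} y * y powr (c - 1) * gamma_mix C \<xi> c 0 y * y powr q = C * \<xi> powr (- c) / Gamma c * (indicator {0<..} y * y powr (c + q - 1) * exp (- (1 / \<xi>) * y))"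
      proof (cases "y > 0")
        case True
        have "y powr (c - 1) * y powr q = y powr (c + q - 1)" by (simp add: powr_add[symmetric] algebra_simps)
        then show ?thesis using assms True by (simp add: gamma_mix_def bessel_series_0 mult_ac)
      qed simp
      then show "ennreal (indicator {0<..} y * y powr (c - 1) * gamma_mix C \<xi> c 0 y) * ennreal (y powr q) = ennreal (C * \<xi> powr (- c) / Gamma c) * ennreal (indicator {0<..} y * y powr (c + q - 1) * exp (- (1 / \<xi>) * y))"
        using assms G by (simp add: ennreal_mult''[symmetric] ennreal_mult'[symmetric])
    qed
  qed auto
  also have "\<dots> = ennreal (C * \<xi> powr (- c) / Gamma c) * ennreal (Gamma (c + q) * (1 / \<xi>) powr (- (c + q)))"
    by (subst nn_integral_cmult, measurable, subst nn_integral_gamma_scaled) (use assms in auto)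
  also have "\<dots> = ennreal (C * \<xi> powr (- c) / Gamma c * (Gamma (c + q) * (1 / \<xi>) powr (- (c + q))))"
    using assms G by (subst ennreal_mult'[symmetric]) auto
  also have "(1 / \<xi>) powr (- (c + q)) = \<xi> powr (c + q)" using powr_minus_divide[of \<xi> "c + q"] assms by (simp add: powr_divide)
  also have "C * \<xi> powr (- c) / Gamma c * (Gamma (c + q) * \<xi> powr (c + q)) = C * (Gamma (c + q) / Gamma c) * (\<xi> powr (- c) * \<xi> powr (c + q))" by simp
  also have "\<xi> powr (- c) * \<xi> powr (c + q) = \<xi> powr q" by (simp add: powr_add[symmetric])
  finally show ?thesis .
qed

text \<open>Under the weight \<open>exp (- a * (x s)^2)\<close> the square at time \<open>r\<close>
  has a multiple of the gamma law of shape \<open>\<delta> / 2\<close> and scale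
  \<open>2 * Mf r s a / Df s a\<close>, since the base of the power in
  \<open>bridge_laplace_joint\<close> is affine in the second parameter.\<close>

lemma bridge_tilted_moment:
  assumes P: "bessel_bridge_law \<delta> 1 0 0 P" and \<delta>: "\<delta> > 0" and rs: "0 < r" "r < 1" "0 < s" "s < 1" "r \<noteq> s" and a: "a \<ge> 0" and q: "q \<ge> 0"
  shows "(\<integral>\<^sup>+x. ennreal (((x r)\<^sup>2) powr q * exp (- a * (x s)\<^sup>2)) \<partial>P) =
    ennreal (Df s a powr (- (\<delta> / 2)) * (Gamma (\<delta> / 2 + q) / Gamma (\<delta> / 2)) * (2 * Mf r s a / Df s a) powr q)"
proof -
  interpret P: prob_space P by (rule bessel_bridge_law_prob[OF P])
  have m [measurable]: "(\<lambda>x. x s) \<in> borel_measurable P" "(\<lambda>x. x r) \<in> borel_measurable P"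
    using measurable_eval_path[of s 1] measurable_eval_path[of r 1] rs measurable_cong_sets[OF bessel_bridge_law_sets[OF P] refl] by auto
  let ?D = "Df s a" and ?M = "Mf r s a"
  have D: "?D > 0" using Df_ge_1[of s a] rs a by simp
  have M: "?M > 0" using Mf_pos rs a by simp
  let ?\<mu> = "distr (density P (\<lambda>x. ennreal (exp (- a * (x s)\<^sup>2)))) borel (\<lambda>x. (x r)\<^sup>2)"
  have "?\<mu> = gamma_mix_measure (?D powr (- (\<delta> / 2))) (2 * ?M / ?D) (\<delta> / 2) 0"
  proof (rule gamma_mix_measure_unique)
    show "AE x in ?\<mu>. 0 \<le> x" by (subst AE_distr_iff) auto
    fix lam :: real assume lam: "lam \<ge> 0"
    have "(\<integral>\<^sup>+x. ennreal (exp (- lam * x)) \<partial>?\<mu>) = (\<integral>\<^sup>+x. ennreal (exp (- a * (x s)\<^sup>2) * exp (- lam * (x r)\<^sup>2)) \<partial>P)"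
    proof -
      have "(\<integral>\<^sup>+x. ennreal (exp (- lam * x)) \<partial>?\<mu>) = (\<integral>\<^sup>+x. ennreal (exp (- lam * (x r)\<^sup>2)) \<partial>density P (\<lambda>x. ennreal (exp (- a * (x s)\<^sup>2))))"
        by (rule nn_integral_distr) (auto intro!: borel_measurable_power m)
      also have "\<dots> = (\<integral>\<^sup>+x. ennreal (exp (- a * (x s)\<^sup>2)) * ennreal (exp (- lam * (x r)\<^sup>2)) \<partial>P)"
        by (rule nn_integral_density) measurable
      finally show ?thesis by (simp add: ennreal_mult')
    qed
    also have "\<dots> = ennreal (\<integral>x. exp (- a * (x s)\<^sup>2) * exp (- lam * (x r)\<^sup>2) \<partial>P)"
      using a lam by (intro nn_integral_eq_integral P.integrable_const_bound[where B = 1]) (auto simp: mult_le_one)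
    also have "\<dots> = ennreal ((?D + 2 * lam * ?M) powr (- (\<delta> / 2)))"
      using bridge_laplace_joint[OF P \<delta> rs a lam] by simp
    also have "?D + 2 * lam * ?M = ?D * (1 + 2 * ?M / ?D * lam)" using D by (simp add: field_simps)
    also have "(?D * (1 + 2 * ?M / ?D * lam)) powr (- (\<delta> / 2)) = ?D powr (- (\<delta> / 2)) * (1 + 2 * ?M / ?D * lam) powr (- (\<delta> / 2))"
      by (rule powr_mult)
    finally show "(\<integral>\<^sup>+x. ennreal (exp (- lam * x)) \<partial>?\<mu>) = ennreal (?D powr (- (\<delta> / 2)) * (1 + 2 * ?M / ?D * lam) powr (- (\<delta> / 2)) * exp (0 / (1 + 2 * ?M / ?D * lam)))"
      by simp
  qed (use \<delta> D M in auto)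
  then have "(\<integral>\<^sup>+y. ennreal (y powr q) \<partial>?\<mu>) = ennreal (Df s a powr (- (\<delta> / 2)) * (Gamma (\<delta> / 2 + q) / Gamma (\<delta> / 2)) * (2 * Mf r s a / Df s a) powr q)"
    using nn_integral_gamma_mix_powr[of "\<delta> / 2" "?D powr (- (\<delta> / 2))" "2 * ?M / ?D" q] \<delta> D M q by simp
  moreover have "(\<integral>\<^sup>+y. ennreal (y powr q) \<partial>?\<mu>) = (\<integral>\<^sup>+x. ennreal (((x r)\<^sup>2) powr q * exp (- a * (x s)\<^sup>2)) \<partial>P)"
  proof -
    have "(\<integral>\<^sup>+y. ennreal (y powr q) \<partial>?\<mu>) = (\<integral>\<^sup>+x. ennreal (((x r)\<^sup>2) powr q) \<partial>density P (\<lambda>x. ennreal (exp (- a * (x s)\<^sup>2))))"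
      by (rule nn_integral_distr) (auto intro!: borel_measurable_power m)
    also have "\<dots> = (\<integral>\<^sup>+x. ennreal (exp (- a * (x s)\<^sup>2)) * ennreal (((x r)\<^sup>2) powr q) \<partial>P)"
      by (rule nn_integral_density) measurable
    finally show ?thesis by (simp add: ennreal_mult'[symmetric] mult.commute)
  qed
  ultimately show ?thesis by simp
qed

lemma bridge_kernel:
  assumes P: "bessel_bridge_law \<delta> 1 0 0 P" and \<delta>: "\<delta> > 0" and rs: "0 < r" "r < 1" "0 < s" "s < 1" "r \<noteq> s" and a: "a > 0"
  shows "(\<integral>\<^sup>+x. ennreal (\<bar>x r\<bar> * ((x s)\<^sup>2 * exp (- a * (x s)\<^sup>2))) \<partial>P) = ennreal (kap (\<delta> / 2) r s a)"
proof (rule nn_integral_laplace_derivative[where L = "\<lambda>t. gam (\<delta> / 2) * sqrt 2 * (Df s t powr (- (\<delta> / 2) - 1 / 2) * Mf r s t powr (1 / 2))"])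
  have m [measurable]: "(\<lambda>x. x s) \<in> borel_measurable P" "(\<lambda>x. x r) \<in> borel_measurable P"
    using measurable_eval_path[of s 1] measurable_eval_path[of r 1] rs measurable_cong_sets[OF bessel_bridge_law_sets[OF P] refl] by auto
  show "(\<lambda>x. \<bar>x r\<bar>) \<in> borel_measurable P" "(\<lambda>x. (x s)\<^sup>2) \<in> borel_measurable P" by measurable
  have g: "gam (\<delta> / 2) > 0" using \<delta> by (auto simp: gam_def intro!: divide_pos_pos Gamma_real_pos)
  show "0 \<le> gam (\<delta> / 2) * sqrt 2 * (Df s t powr (- (\<delta> / 2) - 1 / 2) * Mf r s t powr (1 / 2))" for t using g by simp
  fix t :: real assume t: "t > 0"
  have D: "Df s t > 0" using Df_ge_1[of s t] rs t by simp
  have M: "Mf r s t > 0" using Mf_pos rs t by simp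
  have "\<bar>x r\<bar> = ((x r)\<^sup>2) powr (1/2)" for x :: "real \<Rightarrow> real" by (simp add: powr_half_sqrt)
  then have "(\<integral>\<^sup>+x. ennreal (\<bar>x r\<bar> * exp (- t * (x s)\<^sup>2)) \<partial>P) = ennreal (Df s t powr (- (\<delta> / 2)) * gam (\<delta> / 2) * (2 * Mf r s t / Df s t) powr (1 / 2))"
    using bridge_tilted_moment[OF P \<delta> rs less_imp_le[OF t], of "1/2"] by (simp add: gam_def)
  also have "(2 * Mf r s t / Df s t) powr (1 / 2) = sqrt 2 * Mf r s t powr (1 / 2) * Df s t powr (- 1 / 2)"
    using M D by (simp add: powr_mult powr_divide powr_half_sqrt powr_minus_divide)
  also have "Df s t powr (- (\<delta> / 2)) * gam (\<delta> / 2) * (sqrt 2 * Mf r s t powr (1 / 2) * Df s t powr (- 1 / 2)) =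
     gam (\<delta> / 2) * sqrt 2 * ((Df s t powr (- (\<delta> / 2)) * Df s t powr (- 1 / 2)) * Mf r s t powr (1 / 2))" by simp
  also have "Df s t powr (- (\<delta> / 2)) * Df s t powr (- 1 / 2) = Df s t powr (- (\<delta> / 2) - 1 / 2)" by (simp add: powr_add[symmetric])
  finally show "(\<integral>\<^sup>+x. ennreal (\<bar>x r\<bar> * exp (- t * (x s)\<^sup>2)) \<partial>P) = ennreal (gam (\<delta> / 2) * sqrt 2 * (Df s t powr (- (\<delta> / 2) - 1 / 2) * Mf r s t powr (1 / 2)))" .
next
  let ?c = "\<delta> / 2"
  have D: "Df s a > 0" using Df_ge_1[of s a] rs a by simp
  have M: "Mf r s a > 0" using Mf_pos rs a by simp
  have dM: "(Mf r s has_real_derivative 2 * Ef r s) (at a)" unfolding Mf_def[abs_def] by (auto intro!: derivative_eq_intros)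
  have dD: "(Df s has_real_derivative 2 * Vf s) (at a)" unfolding Df_def[abs_def] by (auto intro!: derivative_eq_intros)
  have d1: "((\<lambda>t. Df s t powr (- ?c - 1 / 2)) has_real_derivative (- ?c - 1 / 2) * Df s a powr (- ?c - 1 / 2 - 1) * (2 * Vf s)) (at a)"
    using DERIV_fun_powr[OF dD D, of "- ?c - 1/2"] by simp
  have d2: "((\<lambda>t. Mf r s t powr (1 / 2)) has_real_derivative (1 / 2) * Mf r s a powr (1 / 2 - 1) * (2 * Ef r s)) (at a)"
    using DERIV_fun_powr[OF dM M, of "1/2"] by simp
  have e: "- ?c - 1 / 2 - 1 = - ?c - 3 / 2" "1 / 2 - 1 = - 1 / (2 :: real)" by simp_all
  have "((\<lambda>t. gam ?c * sqrt 2 * (Df s t powr (- ?c - 1 / 2) * Mf r s t powr (1 / 2))) has_real_derivative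
     gam ?c * sqrt 2 * ((- ?c - 1 / 2) * Df s a powr (- ?c - 3 / 2) * (2 * Vf s) * Mf r s a powr (1 / 2) + (1 / 2) * Mf r s a powr (- 1 / 2) * (2 * Ef r s) * Df s a powr (- ?c - 1 / 2))) (at a)"
    using DERIV_cmult[OF DERIV_mult[OF d1 d2], of "gam ?c * sqrt 2"] unfolding e by simp
  moreover have "gam ?c * sqrt 2 * ((- ?c - 1 / 2) * Df s a powr (- ?c - 3 / 2) * (2 * Vf s) * Mf r s a powr (1 / 2) + (1 / 2) * Mf r s a powr (- 1 / 2) * (2 * Ef r s) * Df s a powr (- ?c - 1 / 2)) = - kap ?c r s a"
    by (simp add: kap_def algebra_simps)
  ultimately show "((\<lambda>t. gam ?c * sqrt 2 * (Df s t powr (- ?c - 1 / 2) * Mf r s t powr (1 / 2))) has_real_derivative - kap ?c r s a) (at a)"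
    by (simp only:)
qed (use a in auto)

section \<open>The distributions $\mu_\alpha$ on Gaussian mixtures\<close>

lemma nn_integral_gauss:
  assumes q: "q > 0" and A: "A > (0::real)"
  shows "(\<integral>\<^sup>+x. ennreal (indicator {0<..} x * (x powr (2 * q - 1) * exp (- A * x\<^sup>2))) \<partial>lborel) = ennreal (Gamma q * A powr (- q) / 2)"
proof -
  let ?f = "\<lambda>y. y powr (q - 1) * exp (- A * y)"
  have G: "Gamma q * A powr (- q) \<ge> 0" using q by (simp add: Gamma_real_pos less_imp_le)
  have hb: "has_bochner_integral lborel (\<lambda>y. indicator {0<..} y * ?f y) (Gamma q * A powr (- q))"
    using nn_integral_gamma_scaled[OF q A] G by (intro has_bochner_integral_nn_integral) (auto simp: mult.assoc)
  then have si: "set_integrable lborel {0<..} ?f"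
    by (simp add: set_integrable_def has_bochner_integral_iff)
  then have "?f absolutely_integrable_on {0<..}"
    unfolding set_integrable_def by (subst integrable_completion) auto
  moreover have "integral {0<..} ?f = Gamma q * A powr (- q)"
    using set_borel_integral_eq_integral(2)[OF si] hb by (simp add: set_lebesgue_integral_def has_bochner_integral_iff)
  moreover have im: "(\<lambda>x::real. x\<^sup>2) ` {0<..} = {0<..}"
  proof (safe intro!: zero_less_power)
    fix y :: real assume "y > 0" then show "y \<in> (\<lambda>x. x\<^sup>2) ` {0<..}" by (intro image_eqI[of _ _ "sqrt y"]) auto
  qed
  moreover have "(\<lambda>x. \<bar>2 * x\<bar> * ?f (x\<^sup>2)) absolutely_integrable_on {0<..} \<and> integral {0<..} (\<lambda>x. \<bar>2 * x\<bar> * ?f (x\<^sup>2)) = Gamma q * A powr (- q)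
     \<longleftrightarrow> ?f absolutely_integrable_on ((\<lambda>x. x\<^sup>2) ` {0<..}) \<and> integral ((\<lambda>x. x\<^sup>2) ` {0<..}) ?f = Gamma q * A powr (- q)"
    by (rule has_absolute_integral_change_of_variables_1'[where g = "\<lambda>x. x\<^sup>2"])
      (auto intro!: derivative_eq_intros simp: inj_on_def power2_eq_iff)
  ultimately have ai: "(\<lambda>x. \<bar>2 * x\<bar> * ?f (x\<^sup>2)) absolutely_integrable_on {0<..}" and iv: "integral {0<..} (\<lambda>x. \<bar>2 * x\<bar> * ?f (x\<^sup>2)) = Gamma q * A powr (- q)"
    by auto
  have "((\<lambda>x. \<bar>2 * x\<bar> * ?f (x\<^sup>2)) has_integral Gamma q * A powr (- q)) {0<..}"
    using integrable_integral[OF set_lebesgue_integral_eq_integral(1)[OF ai]] unfolding iv by blast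
  from has_integral_mult_right[OF this, of "1/2"]
  have h: "((\<lambda>x. 1 / 2 * (\<bar>2 * x\<bar> * ?f (x\<^sup>2))) has_integral Gamma q * A powr (- q) / 2) {0<..}" by simp
  have eq: "1 / 2 * (\<bar>2 * x\<bar> * ?f (x\<^sup>2)) = x powr (2 * q - 1) * exp (- A * x\<^sup>2)" if "x \<in> {0<..}" for x :: real
  proof -
    have "x\<^sup>2 = x powr 2" using that by (simp add: powr_numeral)
    then have "(x\<^sup>2) powr (q - 1) = x powr (2 * (q - 1))" by (simp only: powr_powr)
    moreover have "x * x powr (2 * (q - 1)) = x powr (2 * q - 1)" using that by (simp add: powr_mult_base algebra_simps)
    ultimately show ?thesis using that by simp
  qed
  have "((\<lambda>x. x powr (2 * q - 1) * exp (- A * x\<^sup>2)) has_integral Gamma q * A powr (- q) / 2) {0<..}"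
    by (rule iffD1[OF has_integral_cong h]) (rule eq)
  then show ?thesis by (intro nn_integral_has_integral_lebesgue) auto
qed

text \<open>Analytic continuation of the Gamma integral, one unit of \<open>q\<close> at a time.
  Integrating a kernel in \<open>t\<close> from 0 to \<open>A\<close> brings the next Taylor
  subtraction and a factor \<open>1 / x^2\<close>, and Tonelli turns
  \<open>t powr (- (q + 1))\<close> into \<open>A powr (- q) / (- q)\<close>. All integrands stay
  nonnegative.\<close>

lemma nn_integral_gauss_step:
  fixes f :: "real \<Rightarrow> real \<Rightarrow> real" and e :: "real \<Rightarrow> real"
  assumes [measurable]: "(\<lambda>p. f (fst p) (snd p)) \<in> borel_measurable (borel \<Otimes>\<^sub>M borel)"
    and f: "\<And>t x. t \<ge> 0 \<Longrightarrow> 0 \<le> f t x"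
    and A: "A > 0" and C: "C \<ge> 0" and q: "q < 0"
    and e: "\<And>x. x > 0 \<Longrightarrow> (\<integral>\<^sup>+t. ennreal (f t x) * indicator {0..A} t \<partial>lborel) = ennreal (e x)"
    and I: "\<And>t. t > 0 \<Longrightarrow> (\<integral>\<^sup>+x. ennreal (indicator {0<..} x * (x powr (2 * q + 1) * f t x)) \<partial>lborel) = ennreal (C * t powr (- (q + 1)))"
  shows "(\<integral>\<^sup>+x. ennreal (indicator {0<..} x * (x powr (2 * q + 1) * e x)) \<partial>lborel) = ennreal (C * (A powr (- q) / (- q)))"
proof -
  have "(\<integral>\<^sup>+x. ennreal (indicator {0<..} x * (x powr (2 * q + 1) * e x)) \<partial>lborel) =
     (\<integral>\<^sup>+x. (\<integral>\<^sup>+t. ennreal (indicator {0<..} x * x powr (2 * q + 1)) * (ennreal (f t x) * indicator {0..A} t) \<partial>lborel) \<partial>lborel)"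
  proof (rule nn_integral_cong)
    fix x :: real
    have ft: "(\<lambda>t. f t x) \<in> borel_measurable borel"
      using measurable_compose[OF measurable_Pair2'[of x borel borel] assms(1)] by simp
    have "(\<lambda>t. ennreal (f t x) * indicator {0..A} t) \<in> borel_measurable lborel"
      using measurable_compose[OF ft measurable_ennreal] by (intro borel_measurable_times_ennreal borel_measurable_indicator) auto
    then have "(\<integral>\<^sup>+t. ennreal (indicator {0<..} x * x powr (2 * q + 1)) * (ennreal (f t x) * indicator {0..A} t) \<partial>lborel) =
       ennreal (indicator {0<..} x * x powr (2 * q + 1)) * (\<integral>\<^sup>+t. ennreal (f t x) * indicator {0..A} t \<partial>lborel)"
      by (rule nn_integral_cmult)
    then show "ennreal (indicator {0<..} x * (x powr (2 * q + 1) * e x)) = (\<integral>\<^sup>+t. ennreal (indicator {0<..} x * x powr (2 * q + 1)) * (ennreal (f t x) * indicator {0..A} t) \<partial>lborel)"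
      using e[of x] by (cases "x > 0") (auto simp: ennreal_mult'[symmetric])
  qed
  also have "\<dots> = (\<integral>\<^sup>+t. (\<integral>\<^sup>+x. ennreal (indicator {0<..} x * x powr (2 * q + 1)) * (ennreal (f t x) * indicator {0..A} t) \<partial>lborel) \<partial>lborel)"
    by (rule lborel_pair.Fubini') measurable
  also have "\<dots> = (\<integral>\<^sup>+t. ennreal (indicator {0..A} t * (C * t powr (- (q + 1)))) \<partial>lborel)"
  proof (rule nn_integral_cong_AE)
    \<comment> \<open>The single value \<open>t = 0\<close>, about which \<open>I\<close> says
      nothing, is a null set.\<close>
    show "AE t in lborel. (\<integral>\<^sup>+x. ennreal (indicator {0<..} x * x powr (2 * q + 1)) * (ennreal (f t x) * indicator {0..A} t) \<partial>lborel) = ennreal (indicator {0..A} t * (C * t powr (- (q + 1))))"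
      using AE_lborel_singleton[of 0]
    proof eventually_elim
      case (elim t)
      show ?case
      proof (cases "t \<in> {0..A}")
        case True
        then have t: "t > 0" using elim by auto
        have "(\<integral>\<^sup>+x. ennreal (indicator {0<..} x * x powr (2 * q + 1)) * (ennreal (f t x) * indicator {0..A} t) \<partial>lborel) =
          (\<integral>\<^sup>+x. ennreal (indicator {0<..} x * (x powr (2 * q + 1) * f t x)) \<partial>lborel)"
          using True f[of t] by (intro nn_integral_cong) (simp add: ennreal_mult''[symmetric] mult.assoc)
        then show ?thesis using I[OF t] True by simp
      qed simp
    qed
  qed
  also have "\<dots> = ennreal (C * (A powr (- q) / (- q)))"
  proof (rule nn_integral_has_integral_lebesgue)
    have "((\<lambda>t. t powr (- (q + 1))) has_integral A powr (- (q + 1) + 1) / (- (q + 1) + 1)) {0..A}"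
      using A q by (intro has_integral_powr_from_0) auto
    from has_integral_mult_right[OF this, of C]
    show "((\<lambda>t. C * t powr (- (q + 1))) has_integral C * (A powr (- q) / (- q))) {0..A}" by simp
  qed (use C in auto)
  finally show ?thesis .
qed

lemma nonpos_Ints_between:
  assumes "of_int m < x" "x < of_int (m + 1)"
  shows "(x::real) \<notin> \<int>\<^sub>\<le>\<^sub>0"
proof
  assume "x \<in> \<int>\<^sub>\<le>\<^sub>0"
  then obtain n where "x = of_int n" by (auto elim!: nonpos_Ints_cases)
  then show False using assms unfolding of_int_less_iff by auto
qed

text \<open>One step down from \<open>nn_integral_gauss\<close>. \<open>Gamma q\<close> is negative
  in this range, which accounts for the sign.\<close>

lemma nn_integral_gauss1:
  assumes q: "- 1 < q" "q < 0" and A: "A > (0::real)"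
  shows "(\<integral>\<^sup>+x. ennreal (indicator {0<..} x * (x powr (2 * q - 1) * (1 - exp (- A * x\<^sup>2)))) \<partial>lborel) = ennreal (- (Gamma q * A powr (- q) / 2))"
proof -
  have G: "Gamma (q + 1) > 0" using q by (intro Gamma_real_pos) auto
  have Gq: "Gamma (q + 1) = q * Gamma q" using q by (intro Gamma_plus1 nonpos_Ints_between[of "- 1"]) auto
  have "(\<integral>\<^sup>+x. ennreal (indicator {0<..} x * (x powr (2 * q + 1) * ((1 - exp (- A * x\<^sup>2)) / x\<^sup>2))) \<partial>lborel) = ennreal (Gamma (q + 1) / 2 * (A powr (- q) / (- q)))"
  proof (rule nn_integral_gauss_step[where f = "\<lambda>t x. exp (- t * x\<^sup>2)"])
    fix x :: real assume x: "x > 0"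
    have "(\<integral>\<^sup>+t. ennreal (exp (- t * x\<^sup>2)) * indicator {0..A} t \<partial>lborel) = ennreal (- exp (- A * x\<^sup>2) / x\<^sup>2 - (- exp (- 0 * x\<^sup>2) / x\<^sup>2))"
      using x A by (intro nn_integral_FTC_Icc) (auto intro!: derivative_eq_intros simp: power2_eq_square)
    then show "(\<integral>\<^sup>+t. ennreal (exp (- t * x\<^sup>2)) * indicator {0..A} t \<partial>lborel) = ennreal ((1 - exp (- A * x\<^sup>2)) / x\<^sup>2)"
      by (simp add: diff_divide_distrib)
  next
    fix t :: real assume "t > 0"
    then show "(\<integral>\<^sup>+x. ennreal (indicator {0<..} x * (x powr (2 * q + 1) * exp (- t * x\<^sup>2))) \<partial>lborel) = ennreal (Gamma (q + 1) / 2 * t powr (- (q + 1)))"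
      using nn_integral_gauss[of "q + 1" t] q by (simp add: add.commute)
  qed (use A G q in auto)
  moreover have "indicator {0<..} x * (x powr (2 * q + 1) * ((1 - exp (- A * x\<^sup>2)) / x\<^sup>2)) = indicator {0<..} x * (x powr (2 * q - 1) * (1 - exp (- A * x\<^sup>2)))" for x :: real
  proof (cases "x > 0")
    case True
    then have "x powr (2 * q + 1) = x powr (2 * q - 1) * x\<^sup>2" using powr_add[of x "2 * q - 1" 2] by (simp add: powr_numeral add.commute)
    then show ?thesis using True by simp
  qed simp
  moreover have "Gamma (q + 1) / 2 * (A powr (- q) / (- q)) = - (Gamma q * A powr (- q) / 2)" using q by (simp add: Gq)
  ultimately show ?thesis using q by (simp add: Gq)
qed

text \<open>A second step down; \<open>Gamma q\<close> is positive again.\<close>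

lemma nn_integral_gauss2:
  assumes q: "- 2 < q" "q < - 1" and A: "A > (0::real)"
  shows "(\<integral>\<^sup>+x. ennreal (indicator {0<..} x * (x powr (2 * q - 1) * (exp (- A * x\<^sup>2) - 1 + A * x\<^sup>2))) \<partial>lborel) = ennreal (Gamma q * A powr (- q) / 2)"
proof -
  have Gq: "Gamma (q + 1) = q * Gamma q" using q by (intro Gamma_plus1 nonpos_Ints_between[of "- 2"]) auto
  have G2: "Gamma (q + 1 + 1) = (q + 1) * Gamma (q + 1)" using q by (intro Gamma_plus1 nonpos_Ints_between[of "- 1"]) auto
  have "Gamma (q + 1 + 1) > 0" using q by (intro Gamma_real_pos) auto
  then have G: "Gamma (q + 1) < 0" using q unfolding G2 by (simp add: zero_less_mult_iff)
  have "(\<integral>\<^sup>+x. ennreal (indicator {0<..} x * (x powr (2 * q + 1) * ((exp (- A * x\<^sup>2) - 1 + A * x\<^sup>2) / x\<^sup>2))) \<partial>lborel) = ennreal (- Gamma (q + 1) / 2 * (A powr (- q) / (- q)))"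
  proof (rule nn_integral_gauss_step[where f = "\<lambda>t x. 1 - exp (- t * x\<^sup>2)"])
    fix x :: real assume x: "x > 0"
    have "(\<integral>\<^sup>+t. ennreal (1 - exp (- t * x\<^sup>2)) * indicator {0..A} t \<partial>lborel) = ennreal ((A + exp (- A * x\<^sup>2) / x\<^sup>2) - (0 + exp (- 0 * x\<^sup>2) / x\<^sup>2))"
      using x A by (intro nn_integral_FTC_Icc) (auto intro!: derivative_eq_intros simp: power2_eq_square)
    moreover have "(A + exp (- A * x\<^sup>2) / x\<^sup>2) - (0 + exp (- 0 * x\<^sup>2) / x\<^sup>2) = (exp (- A * x\<^sup>2) - 1 + A * x\<^sup>2) / x\<^sup>2"
      using x by (simp add: field_simps)
    ultimately show "(\<integral>\<^sup>+t. ennreal (1 - exp (- t * x\<^sup>2)) * indicator {0..A} t \<partial>lborel) = ennreal ((exp (- A * x\<^sup>2) - 1 + A * x\<^sup>2) / x\<^sup>2)"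
      by simp
  next
    fix t :: real assume "t > 0"
    then show "(\<integral>\<^sup>+x. ennreal (indicator {0<..} x * (x powr (2 * q + 1) * (1 - exp (- t * x\<^sup>2)))) \<partial>lborel) = ennreal (- Gamma (q + 1) / 2 * t powr (- (q + 1)))"
      using nn_integral_gauss1[of "q + 1" t] q by (simp add: add.commute)
  qed (use A G q in auto)
  moreover have "indicator {0<..} x * (x powr (2 * q + 1) * ((exp (- A * x\<^sup>2) - 1 + A * x\<^sup>2) / x\<^sup>2)) = indicator {0<..} x * (x powr (2 * q - 1) * (exp (- A * x\<^sup>2) - 1 + A * x\<^sup>2))" for x :: real
  proof (cases "x > 0")
    case True
    then have "x powr (2 * q + 1) = x powr (2 * q - 1) * x\<^sup>2" using powr_add[of x "2 * q - 1" 2] by (simp add: powr_numeral add.commute)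
    then show ?thesis using True by simp
  qed simp
  moreover have "- Gamma (q + 1) / 2 * (A powr (- q) / (- q)) = Gamma q * A powr (- q) / 2" using q by (simp add: Gq)
  ultimately show ?thesis using q by (simp add: Gq)
qed

section \<open>Mixtures of Gaussians and their derivatives at 0\<close>

lemma fubini_scale:
  fixes \<alpha> A :: "'a \<Rightarrow> real" and e :: "real \<Rightarrow> real \<Rightarrow> real" and I :: "real \<Rightarrow> real"
  assumes N: "sigma_finite_measure N" and [measurable]: "\<alpha> \<in> borel_measurable N" "A \<in> borel_measurable N"
    and [measurable]: "(\<lambda>p. e (fst p) (snd p)) \<in> borel_measurable (borel \<Otimes>\<^sub>M borel)"
    and A: "\<And>om. om \<in> space N \<Longrightarrow> A om > 0"
    and e: "\<And>A x. A > 0 \<Longrightarrow> 0 \<le> e A x" "\<And>A. A > 0 \<Longrightarrow> (\<integral>\<^sup>+x. ennreal (e A x) \<partial>lborel) = ennreal (I A)" "\<And>A. A > 0 \<Longrightarrow> 0 \<le> I A"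
    and int: "integrable N (\<lambda>om. \<alpha> om * I (A om))"
  shows "integrable lborel (\<lambda>x. \<integral>om. \<alpha> om * e (A om) x \<partial>N)"
    "(\<integral>x. (\<integral>om. \<alpha> om * e (A om) x \<partial>N) \<partial>lborel) = (\<integral>om. \<alpha> om * I (A om) \<partial>N)"
proof -
  interpret N: sigma_finite_measure N by fact
  interpret pair_sigma_finite N lborel ..
  have ea [measurable]: "e a \<in> borel_measurable borel" for a
    using measurable_compose[OF measurable_Pair1'[of a borel borel] assms(4)] by simp
  have hb: "has_bochner_integral lborel (e a) (I a)" if "a > 0" for a
    using e that by (intro has_bochner_integral_nn_integral) auto
  \<comment> \<open>\<open>\<alpha>\<close> may change sign, so absolute integrability comes first;
    as \<open>e\<close> is nonnegative, the absolute integrals are given by the same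
    \<open>I\<close>.\<close>
  have int2: "integrable (N \<Otimes>\<^sub>M lborel) (\<lambda>(om, x). \<alpha> om * e (A om) x)"
  proof (rule Fubini_integrable)
    have "(\<lambda>p. (\<lambda>p. e (fst p) (snd p)) (A (fst p), snd p)) \<in> borel_measurable (N \<Otimes>\<^sub>M lborel)"
      by (rule measurable_compose[OF _ assms(4)]) measurable
    then show "(\<lambda>(om, x). \<alpha> om * e (A om) x) \<in> borel_measurable (N \<Otimes>\<^sub>M lborel)" by (simp add: split_beta')
    have nrm: "(\<integral>x. norm (case (om, x) of (om, x) \<Rightarrow> \<alpha> om * e (A om) x) \<partial>lborel) = norm (\<alpha> om * I (A om))" if "om \<in> space N" for om
      using hb[OF A[OF that]] e A[OF that] by (simp add: abs_mult has_bochner_integral_iff)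
    show "integrable N (\<lambda>om. \<integral>x. norm (case (om, x) of (om, x) \<Rightarrow> \<alpha> om * e (A om) x) \<partial>lborel)"
      by (rule iffD2[OF Bochner_Integration.integrable_cong[OF refl nrm] integrable_norm[OF int]])
    show "AE om in N. integrable lborel (\<lambda>x. case (om, x) of (om, x) \<Rightarrow> \<alpha> om * e (A om) x)"
      using hb A by (intro AE_I2) (auto simp: has_bochner_integral_iff)
  qed
  show "integrable lborel (\<lambda>x. \<integral>om. \<alpha> om * e (A om) x \<partial>N)"
    using integrable_snd[OF int2] .
  have "(\<integral>x. (\<integral>om. \<alpha> om * e (A om) x \<partial>N) \<partial>lborel) = (\<integral>om. (\<integral>x. \<alpha> om * e (A om) x \<partial>lborel) \<partial>N)"
    by (rule Fubini_integral[OF int2])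
  also have "\<dots> = (\<integral>om. \<alpha> om * I (A om) \<partial>N)"
    using hb A by (intro Bochner_Integration.integral_cong) (auto simp: has_bochner_integral_iff)
  finally show "(\<integral>x. (\<integral>om. \<alpha> om * e (A om) x \<partial>N) \<partial>lborel) = (\<integral>om. \<alpha> om * I (A om) \<partial>N)" .
qed

lemma powr_le_1_plus:
  assumes "A > (0::real)" "0 \<le> r" "r \<le> q"
  shows "A powr r \<le> 1 + A powr q"
proof (cases "A \<ge> 1")
  case True
  then have "A powr r \<le> A powr q" using assms by (intro powr_mono) auto
  then show ?thesis by simp
next
  case False
  then have "A powr r \<le> 1" using assms by (intro powr_le1) auto
  then show ?thesis by (smt (verit) powr_ge_zero)
qed

lemma one_minus_exp_square_le: "0 \<le> u \<Longrightarrow> 1 - exp (- u\<^sup>2) \<le> (u :: real)"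
proof (cases "u \<le> 1")
  case True
  assume u: "0 \<le> u"
  have "1 - u\<^sup>2 \<le> exp (- u\<^sup>2)" using exp_ge_add_one_self[of "- u\<^sup>2"] by simp
  moreover have "u\<^sup>2 \<le> u" using u True by (simp add: power2_eq_square mult_left_le)
  ultimately show ?thesis by linarith
next
  case False
  then show ?thesis by (smt (verit) exp_ge_zero)
qed

lemma mult_exp_neg_le_1: "y * exp (- y) \<le> (1 :: real)"
proof -
  have "y \<le> exp y" using exp_ge_add_one_self[of y] by linarith
  then have "y * exp (- y) \<le> exp y * exp (- y)" by (intro mult_right_mono) auto
  then show ?thesis by (simp add: mult_exp_exp)
qed

lemma DERIV_integral:
  fixes F F' :: "real \<Rightarrow> 'a \<Rightarrow> real"
  assumes \<rho>: "\<rho> > 0"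
    and int: "\<And>x. \<bar>x - y\<bar> < \<rho> \<Longrightarrow> integrable N (F x)"
    and der: "\<And>x om. \<bar>x - y\<bar> < \<rho> \<Longrightarrow> om \<in> space N \<Longrightarrow> ((\<lambda>x. F x om) has_real_derivative F' x om) (at x)"
    and bd: "\<And>x om. \<bar>x - y\<bar> < \<rho> \<Longrightarrow> om \<in> space N \<Longrightarrow> \<bar>F' x om\<bar> \<le> w om"
    and w: "integrable N w" and m: "F' y \<in> borel_measurable N"
  shows "((\<lambda>x. \<integral>om. F x om \<partial>N) has_real_derivative (\<integral>om. F' y om \<partial>N)) (at y)"
  unfolding has_field_derivative_iff
proof (rule tendsto_at_iff_sequentially[THEN iffD2], intro allI impI)
  fix X :: "nat \<Rightarrow> real" assume X: "\<forall>i. X i \<in> UNIV - {y}" "X \<longlonglongrightarrow> y"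
  have "\<forall>\<^sub>F i in sequentially. \<bar>X i - y\<bar> < \<rho>"
    using X(2) \<rho> by (auto simp: tendsto_iff dist_real_def)
  then obtain n0 where n0: "\<And>i. i \<ge> n0 \<Longrightarrow> \<bar>X i - y\<bar> < \<rho>" by (auto simp: eventually_sequentially)
  let ?X = "\<lambda>i. X (i + n0)"
  have Xr: "\<bar>?X i - y\<bar> < \<rho>" "?X i \<noteq> y" for i using n0 X(1) by auto
  have X2: "?X \<longlonglongrightarrow> y" using X(2) by (rule LIMSEQ_ignore_initial_segment)
  have l: "(\<lambda>i. \<integral>om. (F (?X i) om - F y om) / (?X i - y) \<partial>N) \<longlonglongrightarrow> (\<integral>om. F' y om \<partial>N)"
  proof (rule integral_dominated_convergence[where w = w])
    show "(\<lambda>om. (F (?X i) om - F y om) / (?X i - y)) \<in> borel_measurable N" for i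
      using int[OF Xr(1)[of i]] int[of y] \<rho> by (auto dest!: borel_measurable_integrable)
    show "AE om in N. (\<lambda>i. (F (?X i) om - F y om) / (?X i - y)) \<longlonglongrightarrow> F' y om"
    proof (intro AE_I2)
      fix om assume "om \<in> space N"
      then have "((\<lambda>x. (F x om - F y om) / (x - y)) \<longlongrightarrow> F' y om) (at y)"
        using der[of y om] \<rho> by (simp add: has_field_derivative_iff)
      then show "(\<lambda>i. (F (?X i) om - F y om) / (?X i - y)) \<longlonglongrightarrow> F' y om"
        using X2 Xr(2) unfolding tendsto_at_iff_sequentially by (auto simp: comp_def)
    qed
    show "AE om in N. norm ((F (?X i) om - F y om) / (?X i - y)) \<le> w om" for i
    proof (intro AE_I2)
      fix om assume om: "om \<in> space N"
      have "norm (F (?X i) om - F y om) \<le> w om * norm (?X i - y)"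
      proof (rule field_differentiable_bound[where S = "ball y \<rho>" and f' = "\<lambda>x. F' x om"])
        fix x assume "x \<in> ball y \<rho>"
        then have x: "\<bar>x - y\<bar> < \<rho>" by (simp add: dist_real_def abs_minus_commute)
        show "((\<lambda>x. F x om) has_field_derivative F' x om) (at x within ball y \<rho>)"
          using der[OF x om] by (rule has_field_derivative_at_within)
        show "norm (F' x om) \<le> w om" using bd[OF x om] by simp
      qed (use Xr[of i] \<rho> in \<open>auto simp: dist_real_def abs_minus_commute\<close>)
      then show "norm ((F (?X i) om - F y om) / (?X i - y)) \<le> w om"
        using Xr(2)[of i] by (simp add: field_simps)
    qed
  qed (use w m in auto)
  have e: "(\<integral>om. (F (?X i) om - F y om) / (?X i - y) \<partial>N) = ((\<integral>om. F (?X i) om \<partial>N) - (\<integral>om. F y om \<partial>N)) / (?X i - y)" for i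
    using int[OF Xr(1)[of i]] int[of y] \<rho> by simp
  have "(\<lambda>i. (((\<lambda>z. ((\<integral>om. F z om \<partial>N) - (\<integral>om. F y om \<partial>N)) / (z - y)) \<circ> X) (i + n0))) \<longlonglongrightarrow> (\<integral>om. F' y om \<partial>N)"
    using l unfolding e comp_def .
  then show "((\<lambda>z. ((\<integral>om. F z om \<partial>N) - (\<integral>om. F y om \<partial>N)) / (z - y)) \<circ> X) \<longlonglongrightarrow> (\<integral>om. F' y om \<partial>N)"
    by (rule LIMSEQ_offset)
qed

lemma at_0_within_nonneg_neq_bot: "at (x::real) within {0..} \<noteq> bot" if "x \<ge> 0"
proof -
  have "x islimpt {x..x+1}" by (simp add: islimpt_Icc)
  then have "x islimpt {0..}" by (rule islimpt_subset) (use that in auto)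
  then show ?thesis by (simp add: trivial_limit_within)
qed

text \<open>The shape of the value of \<open>Sigma_measure\<close> on \<Phi> as a function of
  \<open>b\<close>, with \<open>N\<close> the measure on the mixing parameters. \<open>iA\<close>
  and \<open>iB\<close> are the moments that appear in the final value; \<open>iA\<close> together
  with \<open>ia\<close> also gives the differentiability at 0 demanded by \<open>mu\<close> for the
  given \<open>c\<close>. \<open>\<psi>\<close> is prescribed on the half line only.\<close>

locale gaussian_mixture =
  fixes N :: "'a measure" and \<alpha> \<beta> A :: "'a \<Rightarrow> real" and \<psi> :: "real \<Rightarrow> real" and c :: real
  assumes N: "sigma_finite_measure N" and m [measurable]: "\<alpha> \<in> borel_measurable N" "\<beta> \<in> borel_measurable N" "A \<in> borel_measurable N"
    and A: "\<And>om. om \<in> space N \<Longrightarrow> A om > 0" and c: "c > 0"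
    and ia: "integrable N \<alpha>" and ib: "integrable N \<beta>"
    and iA: "integrable N (\<lambda>om. \<alpha> om * A om powr (3 / 2 - c))" and iB: "integrable N (\<lambda>om. \<beta> om * A om powr (1 / 2 - c))"
    and \<psi>: "\<And>b. b \<ge> 0 \<Longrightarrow> \<psi> b = (\<integral>om. (\<alpha> om + \<beta> om * b\<^sup>2) * exp (- A om * b\<^sup>2) \<partial>N)"
begin

lemma exp_le_1: "om \<in> space N \<Longrightarrow> exp (- A om * b\<^sup>2) \<le> 1"
  using A[of om] by simp

lemma integrable_mult_bounded:
  fixes f g :: "'a \<Rightarrow> real"
  assumes f: "integrable N f" and g: "g \<in> borel_measurable N" "\<And>om. om \<in> space N \<Longrightarrow> \<bar>g om\<bar> \<le> C"
  shows "integrable N (\<lambda>om. f om * g om)"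
proof (rule Bochner_Integration.integrable_bound[OF integrable_mult_right[OF integrable_norm[OF f], of C]])
  show "(\<lambda>om. f om * g om) \<in> borel_measurable N" using f g(1) by simp
  show "AE om in N. norm (f om * g om) \<le> norm (C * norm (f om))"
  proof (intro AE_I2)
    fix om assume "om \<in> space N"
    then have "\<bar>f om\<bar> * \<bar>g om\<bar> \<le> \<bar>f om\<bar> * \<bar>C\<bar>" using g(2)[of om] by (intro mult_left_mono) auto
    then show "norm (f om * g om) \<le> norm (C * norm (f om))" by (simp add: abs_mult mult.commute)
  qed
qed

text \<open>Interpolation: a power between 0 and \<open>3 / 2 - c\<close> is at most the sum of the
  two extreme ones. It yields half a moment of \<open>A\<close> for \<open>c \<le> 1\<close> and a
  full one for \<open>c \<le> 1 / 2\<close>.\<close>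

lemma integrable_powr_between:
  assumes r: "0 \<le> r" "r \<le> 3 / 2 - c"
  shows "integrable N (\<lambda>om. \<alpha> om * A om powr r)"
proof (rule Bochner_Integration.integrable_bound[OF Bochner_Integration.integrable_add[OF integrable_norm[OF ia] integrable_norm[OF iA]]])
  show "AE om in N. norm (\<alpha> om * A om powr r) \<le> norm (norm (\<alpha> om) + norm (\<alpha> om * A om powr (3 / 2 - c)))"
  proof (intro AE_I2)
    fix om assume "om \<in> space N"
    then have "\<bar>\<alpha> om\<bar> * A om powr r \<le> \<bar>\<alpha> om\<bar> * (1 + A om powr (3 / 2 - c))"
      using r A by (intro mult_left_mono powr_le_1_plus) auto
    then show "norm (\<alpha> om * A om powr r) \<le> norm (norm (\<alpha> om) + norm (\<alpha> om * A om powr (3 / 2 - c)))"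
      by (simp add: abs_mult algebra_simps)
  qed
qed simp

lemma integrable_exp: "integrable N (\<lambda>om. \<alpha> om * exp (- A om * b\<^sup>2))" "integrable N (\<lambda>om. \<beta> om * exp (- A om * b\<^sup>2))"
  using exp_le_1 by (auto intro!: integrable_mult_bounded[where C = 1] ia ib)

lemma integrable_term: "integrable N (\<lambda>om. (\<alpha> om + \<beta> om * b\<^sup>2) * exp (- A om * b\<^sup>2))"
proof -
  have "integrable N (\<lambda>om. \<alpha> om * exp (- A om * b\<^sup>2) + b\<^sup>2 * (\<beta> om * exp (- A om * b\<^sup>2)))"
    using integrable_exp by (intro Bochner_Integration.integrable_add integrable_mult_right) auto
  then show ?thesis by (simp add: algebra_simps)
qed

lemma psi_split: "b \<ge> 0 \<Longrightarrow> \<psi> b = (\<integral>om. \<alpha> om * exp (- A om * b\<^sup>2) \<partial>N) + b\<^sup>2 * (\<integral>om. \<beta> om * exp (- A om * b\<^sup>2) \<partial>N)"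
proof -
  assume "b \<ge> 0"
  then have "\<psi> b = (\<integral>om. \<alpha> om * exp (- A om * b\<^sup>2) + b\<^sup>2 * (\<beta> om * exp (- A om * b\<^sup>2)) \<partial>N)"
    unfolding \<psi>[OF \<open>b \<ge> 0\<close>] by (intro Bochner_Integration.integral_cong) (auto simp: algebra_simps)
  also have "\<dots> = (\<integral>om. \<alpha> om * exp (- A om * b\<^sup>2) \<partial>N) + b\<^sup>2 * (\<integral>om. \<beta> om * exp (- A om * b\<^sup>2) \<partial>N)"
    using integrable_exp by simp
  finally show ?thesis .
qed

lemma psi_0: "\<psi> 0 = (\<integral>om. \<alpha> om \<partial>N)" using psi_split[of 0] by simp

text \<open>Every member of the mixture is even in \<open>b\<close>. The difference quotient of the
  Gaussian factor is dominated by \<open>A powr (1 / 2)\<close>, integrable against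
  \<open>\<alpha>\<close> for \<open>c \<le> 1\<close>, the range in which
  \<open>mu (2 * c - 3)\<close> involves a first derivative.\<close>

lemma psi_deriv_0:
  assumes c1: "c \<le> 1"
  shows "(\<psi> has_vector_derivative 0) (at 0 within {0..})"
  unfolding has_real_derivative_iff_has_vector_derivative[symmetric] has_field_derivative_iff
proof (rule tendsto_at_iff_sequentially[THEN iffD2], intro allI impI)
  fix X :: "nat \<Rightarrow> real" assume X: "\<forall>i. X i \<in> {0..} - {0}" "X \<longlonglongrightarrow> 0"
  have Xp: "X i > 0" for i using X(1) by (metis DiffD1 DiffD2 atLeast_iff insertI1 less_eq_real_def singletonI)
  obtain B where "\<forall>i. norm (X i) \<le> B" using convergent_imp_Bseq[OF convergentI[OF X(2)]] by (rule BseqE)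
  then have B: "\<bar>X i\<bar> \<le> B" for i by simp
  have i12: "integrable N (\<lambda>om. \<alpha> om * A om powr (1 / 2))" using c1 by (intro integrable_powr_between) auto
  let ?q = "\<lambda>b om. \<alpha> om * ((exp (- A om * b\<^sup>2) - 1) / b) + b * (\<beta> om * exp (- A om * b\<^sup>2))"
  have "(\<lambda>i. \<integral>om. ?q (X i) om \<partial>N) \<longlonglongrightarrow> (\<integral>om. 0 \<partial>N)"
  proof (rule integral_dominated_convergence[where w = "\<lambda>om. \<bar>\<alpha> om * A om powr (1 / 2)\<bar> + B * \<bar>\<beta> om\<bar>"])
    show "integrable N (\<lambda>om. \<bar>\<alpha> om * A om powr (1 / 2)\<bar> + B * \<bar>\<beta> om\<bar>)"
      using i12 ib by (intro Bochner_Integration.integrable_add integrable_mult_right integrable_abs) auto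
    show "AE om in N. (\<lambda>i. ?q (X i) om) \<longlonglongrightarrow> 0"
    proof (intro AE_I2)
      fix om
      have "((\<lambda>b. exp (- A om * b\<^sup>2)) has_real_derivative 0) (at 0)" by (auto intro!: derivative_eq_intros)
      then have "((\<lambda>b. (exp (- A om * b\<^sup>2) - 1) / b) \<longlongrightarrow> 0) (at 0)" by (simp add: has_field_derivative_iff)
      then have l: "(\<lambda>i. (exp (- A om * (X i)\<^sup>2) - 1) / X i) \<longlonglongrightarrow> 0"
      proof -
        assume lim: "((\<lambda>b. (exp (- A om * b\<^sup>2) - 1) / b) \<longlongrightarrow> 0) (at 0)"
        have "((\<lambda>b. (exp (- A om * b\<^sup>2) - 1) / b) \<circ> X) \<longlonglongrightarrow> 0"
        proof (rule tendsto_at_iff_sequentially[THEN iffD1, rule_format, OF lim])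
          show "X i \<in> UNIV - {0}" for i using Xp[of i] by simp
        qed (rule X(2))
        then show ?thesis by (simp only: comp_def)
      qed
      have "(\<lambda>i. ?q (X i) om) \<longlonglongrightarrow> \<alpha> om * 0 + 0 * (\<beta> om * exp (- A om * 0\<^sup>2))"
        by (intro tendsto_intros l X(2))
      then show "(\<lambda>i. ?q (X i) om) \<longlonglongrightarrow> 0" by simp
    qed
    show "AE om in N. norm (?q (X i) om) \<le> \<bar>\<alpha> om * A om powr (1 / 2)\<bar> + B * \<bar>\<beta> om\<bar>" for i
    proof (intro AE_I2)
      fix om assume om: "om \<in> space N"
      have Ap: "A om > 0" using A om by simp
      \<comment> \<open>A linear bound in \<open>u = sqrt A * b\<close> in place of the quadratic
        one: after division by \<open>b\<close> it costs only half a moment of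
        \<open>A\<close>.\<close>
      have "1 - exp (- (sqrt (A om) * X i)\<^sup>2) \<le> sqrt (A om) * X i" using Ap Xp[of i] by (intro one_minus_exp_square_le) auto
      then have "1 - exp (- A om * (X i)\<^sup>2) \<le> sqrt (A om) * X i" using Ap by (simp add: power_mult_distrib)
      then have "\<bar>(exp (- A om * (X i)\<^sup>2) - 1) / X i\<bar> \<le> A om powr (1/2)"
      proof -
        assume le: "1 - exp (- A om * (X i)\<^sup>2) \<le> sqrt (A om) * X i"
        have "\<bar>exp (- A om * (X i)\<^sup>2) - 1\<bar> = 1 - exp (- A om * (X i)\<^sup>2)" using exp_le_1[OF om, of "X i"] by linarith
        then have "\<bar>(exp (- A om * (X i)\<^sup>2) - 1) / X i\<bar> = (1 - exp (- A om * (X i)\<^sup>2)) / X i"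
          using Xp[of i] by (simp only: abs_divide abs_of_pos)
        also have "\<dots> \<le> sqrt (A om)" using le Xp[of i] by (simp only: pos_divide_le_eq)
        finally show ?thesis using Ap by (simp only: powr_half_sqrt)
      qed
      then have "\<bar>\<alpha> om * ((exp (- A om * (X i)\<^sup>2) - 1) / X i)\<bar> \<le> \<bar>\<alpha> om * A om powr (1 / 2)\<bar>"
        unfolding abs_mult by (intro mult_left_mono) auto
      moreover have "\<bar>X i * (\<beta> om * exp (- A om * (X i)\<^sup>2))\<bar> \<le> B * (\<bar>\<beta> om\<bar> * 1)"
        unfolding abs_mult using B[of i] exp_le_1[OF om, of "X i"] Xp[of i] by (intro mult_mono) auto
      ultimately show "norm (?q (X i) om) \<le> \<bar>\<alpha> om * A om powr (1 / 2)\<bar> + B * \<bar>\<beta> om\<bar>"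
        by (simp add: abs_triangle_ineq[THEN order_trans])
    qed
  qed auto
  moreover have "(\<integral>om. ?q (X i) om \<partial>N) = (\<psi> (X i) - \<psi> 0) / (X i - 0)" for i
  proof -
    have "(\<integral>om. ?q (X i) om \<partial>N) = (\<integral>om. (\<alpha> om * exp (- A om * (X i)\<^sup>2) - \<alpha> om) / X i + X i * (\<beta> om * exp (- A om * (X i)\<^sup>2)) \<partial>N)"
      by (intro Bochner_Integration.integral_cong) (auto simp: algebra_simps diff_divide_distrib)
    also have "\<dots> = ((\<integral>om. \<alpha> om * exp (- A om * (X i)\<^sup>2) \<partial>N) - (\<integral>om. \<alpha> om \<partial>N)) / X i + X i * (\<integral>om. \<beta> om * exp (- A om * (X i)\<^sup>2) \<partial>N)"
      using integrable_exp ia by simp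
    also have "\<dots> = (\<psi> (X i) - \<psi> 0) / (X i - 0)"
      using Xp[of i] by (simp add: psi_split psi_0 field_simps power2_eq_square)
    finally show ?thesis .
  qed
  ultimately show "((\<lambda>y. (\<psi> y - \<psi> 0) / (y - 0)) \<circ> X) \<longlonglongrightarrow> 0" by (simp add: comp_def)
qed

lemma half_deriv_1: "c \<le> 1 \<Longrightarrow> half_line_deriv (Suc 0) \<psi> 0 = 0"
  unfolding half_line_deriv_def by (simp add: vector_derivative_within[OF at_0_within_nonneg_neq_bot psi_deriv_0])

lemma integrable_A: "c \<le> 1 / 2 \<Longrightarrow> integrable N (\<lambda>om. \<alpha> om * A om)"
proof -
  assume "c \<le> 1 / 2"
  then have "integrable N (\<lambda>om. \<alpha> om * A om powr 1)" by (intro integrable_powr_between) auto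
  then show ?thesis using A by (subst Bochner_Integration.integrable_cong[OF refl]) (auto simp: less_imp_le)
qed

definition psi' :: "real \<Rightarrow> 'a \<Rightarrow> real" where
  "psi' b om = (2 * \<beta> om * b - 2 * A om * b * (\<alpha> om + \<beta> om * b\<^sup>2)) * exp (- A om * b\<^sup>2)"

text \<open>The cubic term is harmless because \<open>y * exp (- y) \<le> 1\<close> at
  \<open>y = A * b^2\<close>. The factor \<open>b\<close> is kept so that the quotient
  \<open>psi' b / b\<close> still has an integrable bound.\<close>

lemma psi'_bound:
  assumes "om \<in> space N" "0 \<le> b"
  shows "\<bar>psi' b om\<bar> \<le> b * (4 * \<bar>\<beta> om\<bar> + 2 * \<bar>\<alpha> om * A om\<bar>)"
proof -
  let ?e = "exp (- A om * b\<^sup>2)"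
  have Ap: "A om > 0" using A assms by simp
  have e: "0 \<le> ?e" "?e \<le> 1" using exp_le_1[OF assms(1)] by auto
  have ye: "A om * b\<^sup>2 * ?e \<le> 1" using mult_exp_neg_le_1[of "A om * b\<^sup>2"] by simp
  have "psi' b om = b * (2 * \<beta> om * ?e - 2 * (\<alpha> om * A om) * ?e - 2 * \<beta> om * (A om * b\<^sup>2 * ?e))"
    by (simp add: psi'_def algebra_simps)
  also have "\<bar>\<dots>\<bar> \<le> b * (2 * \<bar>\<beta> om\<bar> * 1 + 2 * \<bar>\<alpha> om * A om\<bar> * 1 + 2 * \<bar>\<beta> om\<bar> * 1)"
  proof -
    have 1: "\<bar>2 * \<beta> om * ?e\<bar> \<le> 2 * \<bar>\<beta> om\<bar> * 1" using e by (simp add: abs_mult mult_left_le)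
    have 2: "\<bar>2 * (\<alpha> om * A om) * ?e\<bar> \<le> 2 * \<bar>\<alpha> om * A om\<bar> * 1" using e by (simp add: abs_mult mult_left_le)
    have "\<bar>2 * \<beta> om * (A om * b\<^sup>2 * ?e)\<bar> = 2 * \<bar>\<beta> om\<bar> * (A om * b\<^sup>2 * ?e)" using Ap e by (simp add: abs_mult)
    also have "\<dots> \<le> 2 * \<bar>\<beta> om\<bar> * 1" by (rule mult_left_mono[OF ye]) simp
    finally have 3: "\<bar>2 * \<beta> om * (A om * b\<^sup>2 * ?e)\<bar> \<le> 2 * \<bar>\<beta> om\<bar> * 1" .
    have tri: "\<bar>x - y - z\<bar> \<le> X + Y + Z" if "\<bar>x\<bar> \<le> X" "\<bar>y\<bar> \<le> Y" "\<bar>z\<bar> \<le> Z" for x y z X Y Z :: real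
      using that by linarith
    show ?thesis unfolding abs_mult[of b] abs_of_nonneg[OF assms(2)]
      by (rule mult_left_mono[OF tri[OF 1 2 3] assms(2)])
  qed
  finally show ?thesis by (simp add: algebra_simps)
qed

lemma psi'_measurable [measurable]: "psi' b \<in> borel_measurable N" unfolding psi'_def[abs_def] by measurable


lemma psi_deriv:
  assumes c1: "c \<le> 1 / 2" and x: "x > 0"
  shows "(\<psi> has_vector_derivative (\<integral>om. psi' x om \<partial>N)) (at x within {0..})"
proof -
  have "((\<lambda>b. \<integral>om. (\<alpha> om + \<beta> om * b\<^sup>2) * exp (- A om * b\<^sup>2) \<partial>N) has_real_derivative (\<integral>om. psi' x om \<partial>N)) (at x)"
  proof (rule DERIV_integral[where \<rho> = x and w = "\<lambda>om. (2 * x) * (4 * \<bar>\<beta> om\<bar> + 2 * \<bar>\<alpha> om * A om\<bar>)"])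
    show "x > 0" by fact
    show "integrable N (\<lambda>om. (\<alpha> om + \<beta> om * b\<^sup>2) * exp (- A om * b\<^sup>2))" for b by (rule integrable_term)
    show "psi' x \<in> borel_measurable N" by (rule psi'_measurable)
    show "integrable N (\<lambda>om. (2 * x) * (4 * \<bar>\<beta> om\<bar> + 2 * \<bar>\<alpha> om * A om\<bar>))"
      using ib integrable_A[OF c1] by (intro integrable_mult_right Bochner_Integration.integrable_add integrable_abs) auto
    fix b om assume b: "\<bar>b - x\<bar> < x" and om: "om \<in> space N"
    show "((\<lambda>b. (\<alpha> om + \<beta> om * b\<^sup>2) * exp (- A om * b\<^sup>2)) has_real_derivative psi' b om) (at b)"
      unfolding psi'_def by (auto intro!: derivative_eq_intros simp: algebra_simps)
    have "\<bar>psi' b om\<bar> \<le> b * (4 * \<bar>\<beta> om\<bar> + 2 * \<bar>\<alpha> om * A om\<bar>)" using b by (intro psi'_bound om) auto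
    also have "\<dots> \<le> (2 * x) * (4 * \<bar>\<beta> om\<bar> + 2 * \<bar>\<alpha> om * A om\<bar>)" using b by (intro mult_right_mono) auto
    finally show "\<bar>psi' b om\<bar> \<le> (2 * x) * (4 * \<bar>\<beta> om\<bar> + 2 * \<bar>\<alpha> om * A om\<bar>)" .
  qed
  then have "((\<lambda>b. \<integral>om. (\<alpha> om + \<beta> om * b\<^sup>2) * exp (- A om * b\<^sup>2) \<partial>N) has_vector_derivative (\<integral>om. psi' x om \<partial>N)) (at x within {0..})"
    by (rule has_vector_derivative_at_within[OF has_real_derivative_iff_has_vector_derivative[THEN iffD1]])
  then show ?thesis
    by (rule has_vector_derivative_transform[rotated 2]) (use x in simp, simp only: \<psi> atLeast_iff)
qed

text \<open>\<open>half_line_deriv\<close> iterates one-sided derivatives, so the first derivative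
  must be known on the whole half line before the limit of \<open>psi' b / b\<close> at 0 can be
  taken by domination.\<close>

lemma half_deriv_2:
  assumes c1: "c \<le> 1 / 2"
  shows "half_line_deriv (Suc (Suc 0)) \<psi> 0 = 2 * (\<integral>om. \<beta> om - \<alpha> om * A om \<partial>N)"
proof -
  let ?d = "\<lambda>x. vector_derivative \<psi> (at x within {0..})"
  have d0: "?d 0 = 0" using c1 by (intro vector_derivative_within at_0_within_nonneg_neq_bot psi_deriv_0) auto
  have dx: "?d x = (\<integral>om. psi' x om \<partial>N)" if "x > 0" for x
    using that by (intro vector_derivative_within at_0_within_nonneg_neq_bot psi_deriv c1) auto
  have "(?d has_vector_derivative (\<integral>om. 2 * (\<beta> om - \<alpha> om * A om) \<partial>N)) (at 0 within {0..})"
    unfolding has_real_derivative_iff_has_vector_derivative[symmetric] has_field_derivative_iff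
  proof (rule tendsto_at_iff_sequentially[THEN iffD2], intro allI impI)
    fix X :: "nat \<Rightarrow> real" assume X: "\<forall>i. X i \<in> {0..} - {0}" "X \<longlonglongrightarrow> 0"
    have Xp: "X i > 0" for i using X(1) by (metis DiffD1 DiffD2 atLeast_iff insertI1 less_eq_real_def singletonI)
    have "(\<lambda>i. \<integral>om. psi' (X i) om / X i \<partial>N) \<longlonglongrightarrow> (\<integral>om. 2 * (\<beta> om - \<alpha> om * A om) \<partial>N)"
    proof (rule integral_dominated_convergence[where w = "\<lambda>om. 4 * \<bar>\<beta> om\<bar> + 2 * \<bar>\<alpha> om * A om\<bar>"])
      show "integrable N (\<lambda>om. 4 * \<bar>\<beta> om\<bar> + 2 * \<bar>\<alpha> om * A om\<bar>)"
        using ib integrable_A[OF c1] by (intro Bochner_Integration.integrable_add integrable_mult_right integrable_abs) auto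
      show "AE om in N. norm (psi' (X i) om / X i) \<le> 4 * \<bar>\<beta> om\<bar> + 2 * \<bar>\<alpha> om * A om\<bar>" for i
        using psi'_bound[of _ "X i"] Xp[of i] by (intro AE_I2) (auto simp: divide_le_eq mult.commute)
      show "AE om in N. (\<lambda>i. psi' (X i) om / X i) \<longlonglongrightarrow> 2 * (\<beta> om - \<alpha> om * A om)"
      proof (intro AE_I2)
        fix om
        have "(\<lambda>i. (2 * \<beta> om - 2 * A om * (\<alpha> om + \<beta> om * (X i)\<^sup>2)) * exp (- A om * (X i)\<^sup>2)) \<longlonglongrightarrow> (2 * \<beta> om - 2 * A om * (\<alpha> om + \<beta> om * 0\<^sup>2)) * exp (- A om * 0\<^sup>2)"
          by (intro tendsto_intros X(2))
        moreover have "(2 * \<beta> om - 2 * A om * (\<alpha> om + \<beta> om * (X i)\<^sup>2)) * exp (- A om * (X i)\<^sup>2) = psi' (X i) om / X i" for i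
          using Xp[of i] by (simp add: psi'_def field_simps)
        ultimately show "(\<lambda>i. psi' (X i) om / X i) \<longlonglongrightarrow> 2 * (\<beta> om - \<alpha> om * A om)" by (simp add: algebra_simps)
      qed
    qed auto
    then show "((\<lambda>y. (?d y - ?d 0) / (y - 0)) \<circ> X) \<longlonglongrightarrow> (\<integral>om. 2 * (\<beta> om - \<alpha> om * A om) \<partial>N)"
      by (simp add: comp_def d0 dx[OF Xp])
  qed
  then have "half_line_deriv (Suc (Suc 0)) \<psi> 0 = (\<integral>om. 2 * (\<beta> om - \<alpha> om * A om) \<partial>N)"
    unfolding half_line_deriv_def by (simp add: vector_derivative_within[OF at_0_within_nonneg_neq_bot])
  then show ?thesis by (simp only: integral_mult_right_zero)
qed




abbreviation "alpha_moment \<equiv> \<integral>om. \<alpha> om * A om powr (3 / 2 - c) \<partial>N"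
abbreviation "beta_moment \<equiv> \<integral>om. \<beta> om * A om powr (1 / 2 - c) \<partial>N"

text \<open>The common frame of all regimes: \<open>e1\<close> and \<open>e2\<close> are Gaussian
  kernels after their Taylor subtractions, and the signs \<open>s1\<close>, \<open>s2\<close> make
  them nonnegative, as the Gamma factors alternate in sign below 0. Each sign enters twice and
  disappears, so the value looks the same in every regime.\<close>

lemma mixture_half_line_integral:
  fixes e1 e2 :: "real \<Rightarrow> real \<Rightarrow> real"
  assumes p: "p = c - 3 / 2"
    and [measurable]: "(\<lambda>x. e1 (fst x) (snd x)) \<in> borel_measurable (borel \<Otimes>\<^sub>M borel)" "(\<lambda>x. e2 (fst x) (snd x)) \<in> borel_measurable (borel \<Otimes>\<^sub>M borel)"
    and e1: "\<And>A x. A > 0 \<Longrightarrow> 0 \<le> e1 A x" "\<And>A. A > 0 \<Longrightarrow> (\<integral>\<^sup>+x. ennreal (e1 A x) \<partial>lborel) = ennreal (s1 * (Gamma p * A powr (- p) / 2))"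
      "0 \<le> s1 * Gamma p" "\<And>A x. x \<le> 0 \<Longrightarrow> e1 A x = 0"
    and e2: "\<And>A x. A > 0 \<Longrightarrow> 0 \<le> e2 A x" "\<And>A. A > 0 \<Longrightarrow> (\<integral>\<^sup>+x. ennreal (e2 A x) \<partial>lborel) = ennreal (s2 * (Gamma (p + 1) * A powr (- (p + 1)) / 2))"
      "0 \<le> s2 * Gamma (p + 1)" "\<And>A x. x \<le> 0 \<Longrightarrow> e2 A x = 0"
    and s: "s1 * s1 = 1" "s2 * s2 = 1"
    and D: "\<And>x. x > 0 \<Longrightarrow> D x * x powr (2 * p - 1) = s1 * (\<integral>om. \<alpha> om * e1 (A om) x \<partial>N) + s2 * (\<integral>om. \<beta> om * e2 (A om) x \<partial>N)"
  shows "(LINT x:{0<..}|lborel. D x * x powr (2 * p - 1)) =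
    Gamma p / 2 * alpha_moment + Gamma (p + 1) / 2 * beta_moment"
proof -
  have ex: "- p = 3 / 2 - c" "- (p + 1) = 1 / 2 - c" using p by auto
  have q1: "(\<lambda>om. \<alpha> om * (s1 * (Gamma p * A om powr (- p) / 2))) = (\<lambda>om. s1 * (Gamma p / 2) * (\<alpha> om * A om powr (3 / 2 - c)))"
    unfolding ex by (intro ext) (simp add: mult_ac)
  have q2: "(\<lambda>om. \<beta> om * (s2 * (Gamma (p + 1) * A om powr (- (p + 1)) / 2))) = (\<lambda>om. s2 * (Gamma (p + 1) / 2) * (\<beta> om * A om powr (1 / 2 - c)))"
    unfolding ex by (intro ext) (simp add: mult_ac)
  have n1: "0 \<le> s1 * (Gamma p * a powr (- p) / 2)" for a using mult_nonneg_nonneg[OF e1(3) powr_ge_zero[of a "- p"]] by (simp add: mult_ac)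
  have n2: "0 \<le> s2 * (Gamma (p + 1) * a powr (- (p + 1)) / 2)" for a using mult_nonneg_nonneg[OF e2(3) powr_ge_zero[of a "- (p + 1)"]] by (simp add: mult_ac)
  have i1: "integrable N (\<lambda>om. \<alpha> om * (s1 * (Gamma p * A om powr (- p) / 2)))" unfolding q1 by (intro integrable_mult_right iA)
  have i2: "integrable N (\<lambda>om. \<beta> om * (s2 * (Gamma (p + 1) * A om powr (- (p + 1)) / 2)))" unfolding q2 by (intro integrable_mult_right iB)
  note f1 = fubini_scale[where I = "\<lambda>a. s1 * (Gamma p * a powr (- p) / 2)", OF N m(1) m(3) assms(2) A e1(1,2) n1 i1]
  note f2 = fubini_scale[where I = "\<lambda>a. s2 * (Gamma (p + 1) * a powr (- (p + 1)) / 2)", OF N m(2) m(3) assms(3) A e2(1,2) n2 i2]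
  have "(LINT x:{0<..}|lborel. D x * x powr (2 * p - 1)) = (\<integral>x. s1 * (\<integral>om. \<alpha> om * e1 (A om) x \<partial>N) + s2 * (\<integral>om. \<beta> om * e2 (A om) x \<partial>N) \<partial>lborel)"
    unfolding set_lebesgue_integral_def
  proof (intro Bochner_Integration.integral_cong refl)
    fix x :: real
    show "indicator {0<..} x *\<^sub>R (D x * x powr (2 * p - 1)) = s1 * (\<integral>om. \<alpha> om * e1 (A om) x \<partial>N) + s2 * (\<integral>om. \<beta> om * e2 (A om) x \<partial>N)"
      by (cases "x > 0") (simp_all add: D e1(4) e2(4))
  qed
  also have "\<dots> = s1 * (s1 * (Gamma p / 2) * alpha_moment) + s2 * (s2 * (Gamma (p + 1) / 2) * beta_moment)"
  proof -
    have "(\<integral>x. s1 * (\<integral>om. \<alpha> om * e1 (A om) x \<partial>N) + s2 * (\<integral>om. \<beta> om * e2 (A om) x \<partial>N) \<partial>lborel) =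
        s1 * (\<integral>x. (\<integral>om. \<alpha> om * e1 (A om) x \<partial>N) \<partial>lborel) + s2 * (\<integral>x. (\<integral>om. \<beta> om * e2 (A om) x \<partial>N) \<partial>lborel)"
      using f1(1) f2(1) by simp
    then show ?thesis by (simp only: f1(2) f2(2) q1 q2 integral_mult_right_zero)
  qed
  also have "\<dots> = (s1 * s1) * (Gamma p / 2 * alpha_moment) + (s2 * s2) * (Gamma (p + 1) / 2 * beta_moment)"
    by (simp only: mult_ac)
  finally show ?thesis by (simp only: s mult_1)
qed

lemma Gamma_neg: "- 1 < q \<Longrightarrow> q < 0 \<Longrightarrow> Gamma q < (0 :: real)"
proof -
  assume q: "- 1 < q" "q < 0"
  have "Gamma (q + 1) = q * Gamma q" using q by (intro Gamma_plus1 nonpos_Ints_between[of "- 1"]) auto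
  moreover have "Gamma (q + 1) > 0" using q by (intro Gamma_real_pos) auto
  ultimately show "Gamma q < 0" using q by (simp add: zero_less_mult_iff)
qed

lemma Gamma_pos_below: "- 2 < q \<Longrightarrow> q < - 1 \<Longrightarrow> Gamma q > (0 :: real)"
proof -
  assume q: "- 2 < q" "q < - 1"
  have "Gamma (q + 1) = q * Gamma q" using q by (intro Gamma_plus1 nonpos_Ints_between[of "- 2"]) auto
  moreover have "Gamma (q + 1) < 0" using q by (intro Gamma_neg) auto
  ultimately show "Gamma q > 0" using q by (simp add: mult_less_0_iff)
qed

lemma powr_two_more: "x > 0 \<Longrightarrow> x powr (2 * (p + 1) - 1) = x powr (2 * p - 1) * (x :: real)\<^sup>2"
  using powr_add[of x "2 * p - 1" 2] by (simp add: algebra_simps)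

lemma half_line_integral_1:
  assumes p: "p = c - 3 / 2" "p > 0"
  shows "(LINT x:{0<..}|lborel. \<psi> x * x powr (2 * p - 1)) =
    Gamma p / 2 * alpha_moment + Gamma (p + 1) / 2 * beta_moment"
proof (rule mixture_half_line_integral[OF p(1), where ?s1.0 = 1 and ?s2.0 = 1 and ?e1.0 = "\<lambda>A x. indicator {0<..} x * (x powr (2 * p - 1) * exp (- A * x\<^sup>2))"
      and ?e2.0 = "\<lambda>A x. indicator {0<..} x * (x powr (2 * (p + 1) - 1) * exp (- A * x\<^sup>2))"])
  fix x :: real assume x: "x > 0"
  have "(\<integral>om. \<alpha> om * (indicator {0<..} x * (x powr (2 * p - 1) * exp (- A om * x\<^sup>2))) \<partial>N) = x powr (2 * p - 1) * (\<integral>om. \<alpha> om * exp (- A om * x\<^sup>2) \<partial>N)"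
    using x by (subst integral_mult_right_zero[symmetric]) (simp add: mult_ac)
  moreover have "(\<integral>om. \<beta> om * (indicator {0<..} x * (x powr (2 * (p + 1) - 1) * exp (- A om * x\<^sup>2))) \<partial>N) = x powr (2 * p - 1) * x\<^sup>2 * (\<integral>om. \<beta> om * exp (- A om * x\<^sup>2) \<partial>N)"
    unfolding powr_two_more[OF x] using x by (subst integral_mult_right_zero[symmetric]) (simp add: mult_ac)
  ultimately show "\<psi> x * x powr (2 * p - 1) = 1 * (\<integral>om. \<alpha> om * (indicator {0<..} x * (x powr (2 * p - 1) * exp (- A om * x\<^sup>2))) \<partial>N) + 1 * (\<integral>om. \<beta> om * (indicator {0<..} x * (x powr (2 * (p + 1) - 1) * exp (- A om * x\<^sup>2))) \<partial>N)"
    using x by (simp add: psi_split algebra_simps)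
qed (use p nn_integral_gauss[of p] nn_integral_gauss[of "p + 1"] Gamma_real_pos[of p] Gamma_real_pos[of "p + 1"] in auto)

text \<open>The \<open>\<beta>\<close> part carries a factor \<open>b^2\<close> and so remains
  integrable without subtraction as long as \<open>p + 1 > 0\<close>. Since the linear Taylor term
  vanishes, this one statement covers \<open>1 < c < 3 / 2\<close> as well as
  \<open>1 / 2 < c \<le> 1\<close>.\<close>

lemma half_line_integral_2:
  assumes p: "p = c - 3 / 2" "- 1 < p" "p < 0"
  shows "(LINT x:{0<..}|lborel. (\<psi> x - \<psi> 0) * x powr (2 * p - 1)) =
    Gamma p / 2 * alpha_moment + Gamma (p + 1) / 2 * beta_moment"
proof (rule mixture_half_line_integral[OF p(1), where ?s1.0 = "- 1" and ?s2.0 = 1 and ?e1.0 = "\<lambda>A x. indicator {0<..} x * (x powr (2 * p - 1) * (1 - exp (- A * x\<^sup>2)))"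
      and ?e2.0 = "\<lambda>A x. indicator {0<..} x * (x powr (2 * (p + 1) - 1) * exp (- A * x\<^sup>2))"])
  fix x :: real assume x: "x > 0"
  have "(\<integral>om. \<alpha> om * (indicator {0<..} x * (x powr (2 * p - 1) * (1 - exp (- A om * x\<^sup>2)))) \<partial>N) = x powr (2 * p - 1) * (\<integral>om. \<alpha> om - \<alpha> om * exp (- A om * x\<^sup>2) \<partial>N)"
    using x by (subst integral_mult_right_zero[symmetric]) (simp add: algebra_simps)
  moreover have "(\<integral>om. \<beta> om * (indicator {0<..} x * (x powr (2 * (p + 1) - 1) * exp (- A om * x\<^sup>2))) \<partial>N) = x powr (2 * p - 1) * x\<^sup>2 * (\<integral>om. \<beta> om * exp (- A om * x\<^sup>2) \<partial>N)"
    unfolding powr_two_more[OF x] using x by (subst integral_mult_right_zero[symmetric]) (simp add: mult_ac)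
  moreover have "(\<integral>om. \<alpha> om - \<alpha> om * exp (- A om * x\<^sup>2) \<partial>N) = (\<integral>om. \<alpha> om \<partial>N) - (\<integral>om. \<alpha> om * exp (- A om * x\<^sup>2) \<partial>N)"
    by (intro Bochner_Integration.integral_diff ia integrable_exp)
  ultimately show "(\<psi> x - \<psi> 0) * x powr (2 * p - 1) = - 1 * (\<integral>om. \<alpha> om * (indicator {0<..} x * (x powr (2 * p - 1) * (1 - exp (- A om * x\<^sup>2)))) \<partial>N) + 1 * (\<integral>om. \<beta> om * (indicator {0<..} x * (x powr (2 * (p + 1) - 1) * exp (- A om * x\<^sup>2))) \<partial>N)"
    unfolding psi_split[OF less_imp_le[OF x]] psi_0 by (simp only:) (simp add: algebra_simps)
qed (use p nn_integral_gauss1[of p] nn_integral_gauss[of "p + 1"] Gamma_neg[of p] Gamma_real_pos[of "p + 1"] in auto)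

lemma half_line_integral_3:
  assumes p: "p = c - 3 / 2" "- 2 < p" "p < - 1"
  shows "(LINT x:{0<..}|lborel. (\<psi> x - \<psi> 0 - x\<^sup>2 * (\<integral>om. \<beta> om - \<alpha> om * A om \<partial>N)) * x powr (2 * p - 1)) =
    Gamma p / 2 * alpha_moment + Gamma (p + 1) / 2 * beta_moment"
proof (rule mixture_half_line_integral[OF p(1), where ?s1.0 = 1 and ?s2.0 = "- 1" and ?e1.0 = "\<lambda>A x. indicator {0<..} x * (x powr (2 * p - 1) * (exp (- A * x\<^sup>2) - 1 + A * x\<^sup>2))"
      and ?e2.0 = "\<lambda>A x. indicator {0<..} x * (x powr (2 * (p + 1) - 1) * (1 - exp (- A * x\<^sup>2)))"])
  have iAl: "integrable N (\<lambda>om. \<alpha> om * A om)" using p by (intro integrable_A) auto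
  fix x :: real assume x: "x > 0"
  have "(\<integral>om. \<alpha> om * (indicator {0<..} x * (x powr (2 * p - 1) * (exp (- A om * x\<^sup>2) - 1 + A om * x\<^sup>2))) \<partial>N) = x powr (2 * p - 1) * (\<integral>om. \<alpha> om * exp (- A om * x\<^sup>2) - \<alpha> om + x\<^sup>2 * (\<alpha> om * A om) \<partial>N)"
    using x by (subst integral_mult_right_zero[symmetric]) (simp add: algebra_simps)
  moreover have "(\<integral>om. \<beta> om * (indicator {0<..} x * (x powr (2 * (p + 1) - 1) * (1 - exp (- A om * x\<^sup>2)))) \<partial>N) = x powr (2 * p - 1) * x\<^sup>2 * (\<integral>om. \<beta> om - \<beta> om * exp (- A om * x\<^sup>2) \<partial>N)"
    unfolding powr_two_more[OF x] using x by (subst integral_mult_right_zero[symmetric]) (simp add: algebra_simps)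
  moreover have "(\<integral>om. \<alpha> om * exp (- A om * x\<^sup>2) - \<alpha> om + x\<^sup>2 * (\<alpha> om * A om) \<partial>N) =
      (\<integral>om. \<alpha> om * exp (- A om * x\<^sup>2) \<partial>N) - (\<integral>om. \<alpha> om \<partial>N) + x\<^sup>2 * (\<integral>om. \<alpha> om * A om \<partial>N)"
    using ia integrable_exp iAl by simp
  moreover have "(\<integral>om. \<beta> om - \<beta> om * exp (- A om * x\<^sup>2) \<partial>N) = (\<integral>om. \<beta> om \<partial>N) - (\<integral>om. \<beta> om * exp (- A om * x\<^sup>2) \<partial>N)"
    by (intro Bochner_Integration.integral_diff ib integrable_exp)
  moreover have "(\<integral>om. \<beta> om - \<alpha> om * A om \<partial>N) = (\<integral>om. \<beta> om \<partial>N) - (\<integral>om. \<alpha> om * A om \<partial>N)"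
    by (intro Bochner_Integration.integral_diff ib iAl)
  ultimately show "(\<psi> x - \<psi> 0 - x\<^sup>2 * (\<integral>om. \<beta> om - \<alpha> om * A om \<partial>N)) * x powr (2 * p - 1) = 1 * (\<integral>om. \<alpha> om * (indicator {0<..} x * (x powr (2 * p - 1) * (exp (- A om * x\<^sup>2) - 1 + A om * x\<^sup>2))) \<partial>N) + - 1 * (\<integral>om. \<beta> om * (indicator {0<..} x * (x powr (2 * (p + 1) - 1) * (1 - exp (- A om * x\<^sup>2)))) \<partial>N)"
    unfolding psi_split[OF less_imp_le[OF x]] psi_0 by (simp only:) (simp add: algebra_simps)
next
  fix a x :: real assume "a > 0"
  show "0 \<le> indicator {0<..} x * (x powr (2 * p - 1) * (exp (- a * x\<^sup>2) - 1 + a * x\<^sup>2))"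
    using exp_ge_add_one_self[of "- a * x\<^sup>2"] by (intro mult_nonneg_nonneg) auto
qed (use p nn_integral_gauss2[of p] nn_integral_gauss1[of "p + 1"] Gamma_pos_below[of p] Gamma_neg[of "p + 1"] in auto)

lemma nat_real_atMost: "real n \<le> t \<Longrightarrow> t < real n + 1 \<Longrightarrow> {j. real j \<le> t} = {..n}"
proof (intro set_eqI)
  fix j assume "real n \<le> t" "t < real n + 1"
  then show "j \<in> {j. real j \<le> t} \<longleftrightarrow> j \<in> {..n}" by (cases "j \<le> n") auto
qed

lemma Gamma_half_shift: "p = c - 3 / 2 \<Longrightarrow> p \<notin> \<int>\<^sub>\<le>\<^sub>0 \<Longrightarrow> Gamma (c + 1 / 2) = (p + 1) * (p * Gamma p)"
proof -
  assume p: "p = c - 3 / 2" "p \<notin> \<int>\<^sub>\<le>\<^sub>0"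
  have "p + 1 \<notin> \<int>\<^sub>\<le>\<^sub>0" using p(2) plus_one_in_nonpos_Ints_imp by blast
  then have "Gamma (p + 1 + 1) = (p + 1) * (p * Gamma p)" using p(2) by (simp only: Gamma_plus1 not_False_eq_True)
  moreover have "p + 1 + 1 = c + 1 / 2" using p(1) by simp
  ultimately show ?thesis by simp
qed

text \<open>\<open>Gamma (2 * c)\<close> is \<open>Gamma (2 * p)\<close> times three linear factors.
  The middle one is \<open>\<delta> - 2\<close> and cancels the denominator of
  \<open>boundary_term\<close>; \<open>Gamma (2 * p)\<close> cancels the normalisation of
  \<open>mu\<close>; the outer two combine with \<open>Gamma p\<close> to
  \<open>Gamma (c + 1 / 2)\<close>.\<close>

lemma boundary_term_aux:
  assumes p: "p = c - 3 / 2" and al: "2 * p \<notin> \<int>\<^sub>\<le>\<^sub>0"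
    and D: "\<And>x. x > 0 \<Longrightarrow> \<psi> x - (\<Sum>j | real j \<le> - (2 * c - 3). x ^ j / fact j * half_line_deriv j \<psi> 0) = D x"
    and J: "(LINT x:{0<..}|lborel. D x * x powr (2 * p - 1)) =
    Gamma p / 2 * alpha_moment + Gamma (p + 1) / 2 * beta_moment"
  shows "boundary_term (2 * c) \<psi> = Gamma (c + 1 / 2) / 2 *
    (alpha_moment + (c - 3 / 2) * beta_moment)"
proof -
  let ?K1 = "\<integral>om. \<alpha> om * A om powr (3 / 2 - c) \<partial>N" and ?K2 = "\<integral>om. \<beta> om * A om powr (1 / 2 - c) \<partial>N"
  have al1: "2 * p + 1 \<notin> \<int>\<^sub>\<le>\<^sub>0" using al plus_one_in_nonpos_Ints_imp by blast
  have al2: "2 * p + 1 + 1 \<notin> \<int>\<^sub>\<le>\<^sub>0" using al1 plus_one_in_nonpos_Ints_imp by blast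
  have pn: "p \<notin> \<int>\<^sub>\<le>\<^sub>0"
  proof
    assume "p \<in> \<int>\<^sub>\<le>\<^sub>0"
    then obtain n where "n \<le> 0" "p = of_int n" by (auto elim!: nonpos_Ints_cases)
    then have "2 * p = of_int (2 * n)" "2 * n \<le> 0" by auto
    then show False using al by (metis nonpos_Ints_of_int)
  qed
  have "Gamma (2 * p + 1 + 1 + 1) = (2 * p + 1 + 1) * ((2 * p + 1) * (2 * p * Gamma (2 * p)))"
    using al al1 al2 by (simp only: Gamma_plus1 not_False_eq_True)
  moreover have "2 * p + 1 + 1 + 1 = 2 * c" using p by simp
  ultimately have G2: "Gamma (2 * c) = (2 * p + 1 + 1) * ((2 * p + 1) * (2 * p * Gamma (2 * p)))" by simp
  have G0: "Gamma (2 * p) \<noteq> 0" using al by (simp add: Gamma_eq_zero_iff)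
  have c1: "c \<noteq> 1" using al1 p by auto
  have ex: "2 * c - 3 = 2 * p" using p by simp
  have "mu (2 * c - 3) \<psi> = (LINT x:{0<..}|lborel. (1 / Gamma (2 * p)) * (D x * x powr (2 * p - 1)))"
    unfolding mu_def using al D unfolding ex
    by (auto intro!: set_lebesgue_integral_cong)
  also have "\<dots> = (1 / Gamma (2 * p)) * (Gamma p / 2 * ?K1 + Gamma (p + 1) / 2 * ?K2)"
    by (simp only: set_integral_mult_right J)
  also have "\<dots> = (1 / Gamma (2 * p)) * (Gamma p / 2 * (?K1 + p * ?K2))"
    unfolding Gamma_plus1[OF pn] by (simp add: algebra_simps)
  finally have mu: "mu (2 * c - 3) \<psi> = (1 / Gamma (2 * p)) * (Gamma p / 2 * (?K1 + p * ?K2))" .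
  have "boundary_term (2 * c) \<psi> = Gamma (2 * c) / (4 * (2 * c - 2)) * mu (2 * c - 3) \<psi>"
    using c1 by (simp add: boundary_term_def)
  also have "\<dots> = (p + 1) * (p * Gamma p) / 2 * (?K1 + p * ?K2)"
  proof -
    have d: "4 * (2 * c - 2) = 4 * (2 * p + 1)" using p by simp
    have "2 * p + 1 \<noteq> 0" using c1 p by auto
    moreover have "(2 * p + 1 + 1) * (n * (2 * p * Z)) / (4 * n) * ((1 / Z) * (Gamma p / 2 * X)) = (p + 1) * (p * Gamma p) / 2 * X"
      if "n \<noteq> 0" "Z \<noteq> 0" for n Z X :: real
      using that by (simp add: field_simps)
    ultimately show ?thesis unfolding mu G2 d using G0 by (simp only: not_False_eq_True)
  qed
  finally show ?thesis using Gamma_half_shift[OF p pn] p by simp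
qed

text \<open>\<open>mu\<close> gains Taylor terms as \<open>c\<close> decreases, becomes a derivative
  at 0 for \<open>\<delta> = 3\<close> and \<open>\<delta> = 1\<close>, and is replaced by the
  filled-in value at \<open>\<delta> = 2\<close>; yet the value is always the analytic continuation
  in \<open>c\<close> of the case without subtractions. The exceptional dimensions are computed
  directly.\<close>

theorem boundary_term_mixture:
  "boundary_term (2 * c) \<psi> = Gamma (c + 1 / 2) / 2 *
    (alpha_moment + (c - 3 / 2) * beta_moment)"
  (is "_ = _ * (?K1 + _ * ?K2)")
proof -
  define p where p: "p = c - 3 / 2"
  have h0: "half_line_deriv 0 \<psi> 0 = \<psi> 0" by (simp add: half_line_deriv_def)
  consider "c > 3 / 2" | "c = 3 / 2" | "1 < c" "c < 3 / 2" | "c = 1" | "1 / 2 < c" "c < 1" | "c = 1 / 2" | "c < 1 / 2" by linarith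
  then show ?thesis
  proof cases
    case 1
    have e: "{j. real j \<le> - (2 * c - 3)} = {}" using 1 by auto
    have "2 * p \<notin> \<int>\<^sub>\<le>\<^sub>0" using 1 p by (auto elim!: nonpos_Ints_cases)
    then show ?thesis using 1 p by (intro boundary_term_aux[OF p _ _ half_line_integral_1[OF p]]) (auto simp: e)
  next
    case 2
    \<comment> \<open>At \<open>\<delta> = 3\<close>, \<open>mu 0\<close> is evaluation at 0, and
      the second moment has the coefficient \<open>c - 3 / 2 = 0\<close>.\<close>
    have c1: "\<psi> 0 = ?K1" unfolding psi_0 using A by (intro Bochner_Integration.integral_cong) (auto simp: 2 order.strict_implies_not_eq[symmetric])
    have "Gamma (3 :: real) = 2" using Gamma_fact[of 2, where 'a = real] by (simp add: numeral_3_eq_3 numeral_2_eq_2)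
    moreover have "Gamma (2 :: real) = 1" using Gamma_fact[of 1, where 'a = real] by simp
    ultimately show ?thesis using c1 by (simp add: 2 boundary_term_def mu_def h0)
  next
    case 3
    have e: "{j. real j \<le> 3 - 2 * c} = {..0}" using 3 by (intro nat_real_atMost) auto
    have "2 * p \<notin> \<int>\<^sub>\<le>\<^sub>0" using 3 p by (intro nonpos_Ints_between[of "- 1"]) auto
    then show ?thesis using 3 p by (intro boundary_term_aux[OF p _ _ half_line_integral_2[OF p]]) (auto simp: e h0)
  next
    case 4
    have pn: "p \<notin> \<int>\<^sub>\<le>\<^sub>0" using 4 p by (intro nonpos_Ints_between[of "- 1"]) auto
    \<comment> \<open>Here \<open>p = - 1 / 2\<close>, so the factor \<open>- 1 / 4\<close> of the
      convention is the product \<open>(p + 1) * p\<close> of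
      \<open>Gamma_half_shift\<close>.\<close>
    have "boundary_term (2 * c) \<psi> = - (1 / 4) * (LINT x:{0<..}|lborel. (\<psi> x - \<psi> 0) * x powr (2 * p - 1))"
      using 4 p by (simp add: boundary_term_def mult.commute)
    also have "\<dots> = - (1 / 4) * (Gamma p / 2 * ?K1 + Gamma (p + 1) / 2 * ?K2)"
      using 4 p by (subst half_line_integral_2[OF p]) auto
    finally show ?thesis unfolding Gamma_half_shift[OF p pn] Gamma_plus1[OF pn] using 4 p by (simp add: algebra_simps)
  next
    case 5
    have e: "{j. real j \<le> 3 - 2 * c} = {..1}" using 5 by (intro nat_real_atMost) auto
    have "2 * p \<notin> \<int>\<^sub>\<le>\<^sub>0" using 5 p by (intro nonpos_Ints_between[of "- 2"]) auto
    then show ?thesis using 5 p half_deriv_1 by (intro boundary_term_aux[OF p _ _ half_line_integral_2[OF p]]) (auto simp: e h0 atMost_Suc)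
  next
    case 6
    have iAl: "integrable N (\<lambda>om. \<alpha> om * A om)" using 6 by (intro integrable_A) auto
    have "?K1 = (\<integral>om. \<alpha> om * A om \<partial>N)" using A by (intro Bochner_Integration.integral_cong) (auto simp: 6 less_imp_le)
    moreover have "?K2 = (\<integral>om. \<beta> om \<partial>N)" using A by (intro Bochner_Integration.integral_cong) (auto simp: 6 order.strict_implies_not_eq[symmetric])
    moreover have "half_line_deriv 2 \<psi> 0 = 2 * (\<integral>om. \<beta> om - \<alpha> om * A om \<partial>N)"
      using half_deriv_2 by (simp add: 6 numeral_2_eq_2)
    moreover have "mu (- 2) \<psi> = half_line_deriv 2 \<psi> 0"
      using nonpos_Ints_of_int[of "- 2", where 'a = real] by (simp add: mu_def)
    moreover have "(\<integral>om. \<beta> om - \<alpha> om * A om \<partial>N) = (\<integral>om. \<beta> om \<partial>N) - (\<integral>om. \<alpha> om * A om \<partial>N)"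
      by (intro Bochner_Integration.integral_diff ib iAl)
    ultimately show ?thesis by (simp add: 6 boundary_term_def algebra_simps)
  next
    case 7
    \<comment> \<open>\<open>c > 0\<close> keeps \<open>3 - 2 * c\<close> below 3, so derivatives
      beyond the second never occur; the first one vanishes.\<close>
    have e: "{j. real j \<le> 3 - 2 * c} = {..2}" using 7 c by (intro nat_real_atMost) auto
    have "2 * p \<notin> \<int>\<^sub>\<le>\<^sub>0" using 7 c p by (intro nonpos_Ints_between[of "- 3"]) auto
    moreover have "half_line_deriv 2 \<psi> 0 = 2 * (\<integral>om. \<beta> om - \<alpha> om * A om \<partial>N)" using half_deriv_2 7 by (simp add: numeral_2_eq_2)
    ultimately show ?thesis using 7 c p half_deriv_1
      by (intro boundary_term_aux[OF p _ _ half_line_integral_3[OF p]]) (auto simp: e h0 atMost_Suc numeral_2_eq_2)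
  qed
qed

end

section \<open>The two-point kernel\<close>

abbreviation "lborel2 \<equiv> lborel \<Otimes>\<^sub>M lborel :: (real \<times> real) measure"

lemma nn_integral_weighted_abs:
  fixes W X :: "'a \<Rightarrow> real"
  assumes Q: "sigma_finite_measure Q" and [measurable]: "W \<in> borel_measurable Q" "X \<in> borel_measurable Q" and Wp: "AE x in Q. 0 \<le> W x"
    and G: "\<And>a. a > 0 \<Longrightarrow> (\<integral>\<^sup>+x. ennreal (W x * ((X x)\<^sup>2 * exp (- a * (X x)\<^sup>2))) \<partial>Q) = ennreal (G a)"
  shows "(\<integral>\<^sup>+x. ennreal (W x * \<bar>X x\<bar>) \<partial>Q) = (\<integral>\<^sup>+a. ennreal (wt a * G a) \<partial>lborel)"
proof -
  interpret Q: sigma_finite_measure Q by fact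
  interpret pair_sigma_finite Q lborel ..
  have "(\<integral>\<^sup>+x. ennreal (W x * \<bar>X x\<bar>) \<partial>Q) = (\<integral>\<^sup>+x. ennreal (W x) * (\<integral>\<^sup>+a. ennreal (wt a * ((X x)\<^sup>2 * exp (- a * (X x)\<^sup>2))) \<partial>lborel) \<partial>Q)"
    unfolding abs_eq_nn_integral_wt using Wp by (intro nn_integral_cong_AE) (auto simp: ennreal_mult)
  also have "\<dots> = (\<integral>\<^sup>+x. (\<integral>\<^sup>+a. ennreal (W x) * ennreal (wt a * ((X x)\<^sup>2 * exp (- a * (X x)\<^sup>2))) \<partial>lborel) \<partial>Q)"
    by (intro nn_integral_cong nn_integral_cmult[symmetric]) measurable
  also have "\<dots> = (\<integral>\<^sup>+a. (\<integral>\<^sup>+x. ennreal (W x) * ennreal (wt a * ((X x)\<^sup>2 * exp (- a * (X x)\<^sup>2))) \<partial>Q) \<partial>lborel)"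
    by (rule Fubini'[symmetric]) measurable
  also have "\<dots> = (\<integral>\<^sup>+a. ennreal (wt a * G a) \<partial>lborel)"
  proof (intro nn_integral_cong)
    fix a :: real
    show "(\<integral>\<^sup>+x. ennreal (W x) * ennreal (wt a * ((X x)\<^sup>2 * exp (- a * (X x)\<^sup>2))) \<partial>Q) = ennreal (wt a * G a)"
    proof (cases "a > 0")
      case True
      have "(\<integral>\<^sup>+x. ennreal (W x) * ennreal (wt a * ((X x)\<^sup>2 * exp (- a * (X x)\<^sup>2))) \<partial>Q) = (\<integral>\<^sup>+x. ennreal (wt a) * ennreal (W x * ((X x)\<^sup>2 * exp (- a * (X x)\<^sup>2))) \<partial>Q)"
        using Wp by (intro nn_integral_cong_AE) (auto simp: ennreal_mult'[symmetric] wt_nonneg mult_ac)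
      also have "\<dots> = ennreal (wt a) * (\<integral>\<^sup>+x. ennreal (W x * ((X x)\<^sup>2 * exp (- a * (X x)\<^sup>2))) \<partial>Q)"
        by (intro nn_integral_cmult) measurable
      also have "\<dots> = ennreal (wt a) * ennreal (G a)" by (simp only: G[OF True])
      finally show ?thesis using wt_nonneg[of a] by (simp add: ennreal_mult')
    qed (simp add: wt_def)
  qed
  finally show ?thesis .
qed

text \<open>Serves both the bridge, with \<open>W x = x r\<close>, and the pinned law, with
  \<open>W\<close> constant. The moments \<open>G s a\<close> are given only for
  \<open>s \<noteq> r\<close>, which loses a null set of \<open>s\<close>. The first conclusion
  transfers the domination of the kernel to the path side.\<close>

lemma weighted_path_integral:
  fixes Q :: "(real \<Rightarrow> real) measure" and W \<phi>0 :: "_ \<Rightarrow> real" and G :: "real \<Rightarrow> real \<Rightarrow> real"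
  assumes Q: "prob_space Q" "sets Q = sets (path_borel 1)"
    and W [measurable]: "W \<in> borel_measurable Q" and Wp: "AE x in Q. 0 \<le> W x"
    and \<phi>m [measurable]: "\<phi>0 \<in> borel_measurable borel" and \<phi>0: "\<And>s. s \<notin> {0<..<1} \<Longrightarrow> \<phi>0 s = 0"
    and nn: "\<And>s. 0 < s \<Longrightarrow> s < 1 \<Longrightarrow> s \<noteq> r \<Longrightarrow> AE x in Q. 0 \<le> x s"
    and G: "\<And>s a. 0 < s \<Longrightarrow> s < 1 \<Longrightarrow> s \<noteq> r \<Longrightarrow> a > 0 \<Longrightarrow> (\<integral>\<^sup>+x. ennreal (W x * ((x s)\<^sup>2 * exp (- a * (x s)\<^sup>2))) \<partial>Q) = ennreal (G s a)"
    and Gp: "\<And>s a. 0 < s \<Longrightarrow> s < 1 \<Longrightarrow> s \<noteq> r \<Longrightarrow> a > 0 \<Longrightarrow> 0 \<le> G s a"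
    and Gm [measurable]: "(\<lambda>p. G (fst p) (snd p)) \<in> borel_measurable (borel \<Otimes>\<^sub>M borel)"
    and int: "integrable lborel2 (\<lambda>p. \<phi>0 (fst p) * (wt (snd p) * G (fst p) (snd p)))"
  shows "(\<integral>\<^sup>+x. ennreal (norm (W x * (\<integral>s. \<phi>0 s * x s \<partial>lborel))) \<partial>Q) \<le> (\<integral>\<^sup>+p. ennreal (norm (\<phi>0 (fst p) * (wt (snd p) * G (fst p) (snd p)))) \<partial>lborel2)"
    and "(\<integral>x. W x * (\<integral>s. \<phi>0 s * x s \<partial>lborel) \<partial>Q) = (\<integral>p. \<phi>0 (fst p) * (wt (snd p) * G (fst p) (snd p)) \<partial>lborel2)"
proof -
  interpret Q: prob_space Q by (rule Q(1))
  interpret pair_sigma_finite Q lborel ..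
  have ev: "(\<lambda>p. indicator {0..1} (snd p) * fst p (snd p)) \<in> borel_measurable (Q \<Otimes>\<^sub>M (borel :: real measure))"
    by (subst measurable_cong_sets[OF sets_pair_measure_cong[OF Q(2) refl] refl]) (use eval_joint_measurable in \<open>simp add: case_prod_unfold\<close>)
  have evl [measurable]: "(\<lambda>p. indicator {0..1} (snd p) * fst p (snd p)) \<in> borel_measurable (Q \<Otimes>\<^sub>M (lborel :: real measure))"
    by (subst measurable_cong_sets[OF sets_pair_measure_cong[OF refl sets_lborel] refl]) (rule ev)
  have evs: "(\<lambda>x. x s) \<in> borel_measurable Q" if "0 < s" "s < 1" for s
    using measurable_eval_path[of s 1] that measurable_cong_sets[OF Q(2) refl] by auto
  have Gs: "G s \<in> borel_measurable borel" for s using measurable_compose[OF measurable_Pair1'[of s borel borel] Gm] by simp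
  \<comment> \<open>\<open>\<phi>0\<close> vanishes off the open interval, so the indicator may be
    inserted; with it evaluation is jointly measurable.\<close>
  have pe: "\<phi>0 s * x s = \<phi>0 s * (indicator {0..1} s * x s)" for s and x :: "real \<Rightarrow> real"
    using \<phi>0[of s] by (cases "s \<in> {0<..<1}") auto
  have gm': "(\<lambda>a. wt a * G s a) \<in> borel_measurable lborel" for s
  proof -
    note Gs[of s, measurable]
    show ?thesis by measurable
  qed
  then have gm: "(\<lambda>a. ennreal (wt a * G s a)) \<in> borel_measurable lborel" for s by (intro measurable_compose[OF _ measurable_ennreal])
  have abs1: "(\<integral>\<^sup>+x. ennreal (W x * \<bar>x s\<bar>) \<partial>Q) = (\<integral>\<^sup>+a. ennreal (wt a * G s a) \<partial>lborel)" if s: "0 < s" "s < 1" "s \<noteq> r" for s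
    by (rule nn_integral_weighted_abs[OF Q.sigma_finite_measure W evs[OF s(1,2)] Wp G[OF s]])
  let ?F = "\<lambda>p. W (fst p) * (\<phi>0 (snd p) * (indicator {0..1} (snd p) * fst p (snd p)))"
  have Fm: "?F \<in> borel_measurable (Q \<Otimes>\<^sub>M lborel)" by measurable
  have sr: "AE s in lborel. s \<noteq> r" by (rule AE_lborel_singleton)
  have "(\<integral>\<^sup>+p. ennreal (norm (?F p)) \<partial>(Q \<Otimes>\<^sub>M lborel)) = (\<integral>\<^sup>+s. (\<integral>\<^sup>+x. ennreal (norm (?F (x, s))) \<partial>Q) \<partial>lborel)"
    by (rule nn_integral_snd[symmetric]) measurable
  also have "\<dots> = (\<integral>\<^sup>+s. (\<integral>\<^sup>+a. ennreal (norm (\<phi>0 s * (wt a * G s a))) \<partial>lborel) \<partial>lborel)"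
  proof (rule nn_integral_cong_AE, use sr in eventually_elim)
    fix s assume sr: "s \<noteq> r"
    show "(\<integral>\<^sup>+x. ennreal (norm (?F (x, s))) \<partial>Q) = (\<integral>\<^sup>+a. ennreal (norm (\<phi>0 s * (wt a * G s a))) \<partial>lborel)"
    proof (cases "s \<in> {0<..<1}")
      case True
      then have s: "0 < s" "s < 1" by auto
      note [measurable] = evs[OF s(1,2)] Gs[of s]
      have "(\<integral>\<^sup>+x. ennreal (norm (?F (x, s))) \<partial>Q) = (\<integral>\<^sup>+x. ennreal \<bar>\<phi>0 s\<bar> * ennreal (W x * \<bar>x s\<bar>) \<partial>Q)"
        using Wp s by (intro nn_integral_cong_AE) (auto simp: ennreal_mult'[symmetric] abs_mult mult_ac)
      also have "\<dots> = ennreal \<bar>\<phi>0 s\<bar> * (\<integral>\<^sup>+a. ennreal (wt a * G s a) \<partial>lborel)"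
        by (subst nn_integral_cmult) (auto simp: abs1[OF s sr])
      also have "\<dots> = (\<integral>\<^sup>+a. ennreal \<bar>\<phi>0 s\<bar> * ennreal (wt a * G s a) \<partial>lborel)" by (intro nn_integral_cmult[symmetric] gm)
      also have "\<dots> = (\<integral>\<^sup>+a. ennreal (norm (\<phi>0 s * (wt a * G s a))) \<partial>lborel)"
      proof (intro nn_integral_cong)
        fix a
        have "0 \<le> wt a * G s a" using Gp[OF s sr, of a] wt_nonneg[of a] by (cases "a > 0") (auto simp: wt_def)
        then have e: "\<bar>wt a * G s a\<bar> = wt a * G s a" by (rule abs_of_nonneg)
        show "ennreal \<bar>\<phi>0 s\<bar> * ennreal (wt a * G s a) = ennreal (norm (\<phi>0 s * (wt a * G s a)))"
          by (simp only: real_norm_def abs_mult[of "\<phi>0 s"] e ennreal_mult'[OF abs_ge_zero])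
      qed
      finally show ?thesis .
    qed (simp add: \<phi>0)
  qed
  also have "\<dots> = (\<integral>\<^sup>+p. ennreal (norm (\<phi>0 (fst p) * (wt (snd p) * G (fst p) (snd p)))) \<partial>lborel2)"
    by (subst lborel.nn_integral_fst[symmetric]) (auto simp: case_prod_unfold)
  finally have nF: "(\<integral>\<^sup>+p. ennreal (norm (?F p)) \<partial>(Q \<Otimes>\<^sub>M lborel)) = (\<integral>\<^sup>+p. ennreal (norm (\<phi>0 (fst p) * (wt (snd p) * G (fst p) (snd p)))) \<partial>lborel2)" .
  have "(\<integral>\<^sup>+p. ennreal (norm (\<phi>0 (fst p) * (wt (snd p) * G (fst p) (snd p)))) \<partial>lborel2) < \<infinity>" using int by (simp add: integrable_iff_bounded)
  then have iF: "integrable (Q \<Otimes>\<^sub>M lborel) ?F" using Fm nF by (simp add: integrable_iff_bounded)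
  have "(\<integral>\<^sup>+x. ennreal (norm (W x * (\<integral>s. \<phi>0 s * x s \<partial>lborel))) \<partial>Q) \<le> (\<integral>\<^sup>+x. (\<integral>\<^sup>+s. ennreal (norm (?F (x, s))) \<partial>lborel) \<partial>Q)"
  proof (intro nn_integral_mono)
    fix x
    have e: "W x * (\<integral>s. \<phi>0 s * x s \<partial>lborel) = (\<integral>s. ?F (x, s) \<partial>lborel)" unfolding pe by simp
    show "ennreal (norm (W x * (\<integral>s. \<phi>0 s * x s \<partial>lborel))) \<le> (\<integral>\<^sup>+s. ennreal (norm (?F (x, s))) \<partial>lborel)"
    \<comment> \<open>For a section that is not integrable the inner Bochner integral is 0 by
      convention, and the bound is trivial.\<close>
    proof (cases "integrable lborel (\<lambda>s. ?F (x, s))")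
      case True
      then show ?thesis unfolding e by (rule integral_norm_bound_ennreal)
    next
      case False
      then show ?thesis unfolding e not_integrable_integral_eq[OF False] by simp
    qed
  qed
  also have "\<dots> = (\<integral>\<^sup>+p. ennreal (norm (?F p)) \<partial>(Q \<Otimes>\<^sub>M lborel))"
    by (rule lborel.nn_integral_fst) measurable
  finally show "(\<integral>\<^sup>+x. ennreal (norm (W x * (\<integral>s. \<phi>0 s * x s \<partial>lborel))) \<partial>Q) \<le> (\<integral>\<^sup>+p. ennreal (norm (\<phi>0 (fst p) * (wt (snd p) * G (fst p) (snd p)))) \<partial>lborel2)"
    unfolding nF .
  have iF': "integrable (Q \<Otimes>\<^sub>M lborel) (case_prod (\<lambda>x s. W x * (\<phi>0 s * (indicator {0..1} s * x s))))"
    using iF by (simp add: case_prod_unfold)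
  have "(\<integral>x. W x * (\<integral>s. \<phi>0 s * x s \<partial>lborel) \<partial>Q) = (\<integral>x. (\<integral>s. W x * (\<phi>0 s * (indicator {0..1} s * x s)) \<partial>lborel) \<partial>Q)"
    unfolding pe by simp
  also have "\<dots> = (\<integral>s. (\<integral>x. W x * (\<phi>0 s * (indicator {0..1} s * x s)) \<partial>Q) \<partial>lborel)"
    by (rule Fubini_integral[OF iF', symmetric])
  also have "\<dots> = (\<integral>s. (\<integral>a. \<phi>0 s * (wt a * G s a) \<partial>lborel) \<partial>lborel)"
  proof (rule Bochner_Integration.integral_cong_AE)
    show "(\<lambda>s. \<integral>x. W x * (\<phi>0 s * (indicator {0..1} s * x s)) \<partial>Q) \<in> borel_measurable lborel"
      by (rule borel_measurable_integrable[OF integrable_snd[OF iF']])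
    show "(\<lambda>s. \<integral>a. \<phi>0 s * (wt a * G s a) \<partial>lborel) \<in> borel_measurable lborel" by measurable
    show "AE s in lborel. (\<integral>x. W x * (\<phi>0 s * (indicator {0..1} s * x s)) \<partial>Q) = (\<integral>a. \<phi>0 s * (wt a * G s a) \<partial>lborel)"
    proof (use sr in eventually_elim)
      fix s assume sr: "s \<noteq> r"
      show "(\<integral>x. W x * (\<phi>0 s * (indicator {0..1} s * x s)) \<partial>Q) = (\<integral>a. \<phi>0 s * (wt a * G s a) \<partial>lborel)"
      proof (cases "s \<in> {0<..<1}")
        case True
        then have s: "0 < s" "s < 1" by auto
        note [measurable] = evs[OF s(1,2)] Gs[of s]
        have g0: "0 \<le> wt a * G s a" for a using Gp[OF s sr, of a] wt_nonneg[of a] by (cases "a > 0") (auto simp: wt_def)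
        have "(\<integral>x. W x * \<bar>x s\<bar> \<partial>Q) = enn2real (\<integral>\<^sup>+x. ennreal (W x * \<bar>x s\<bar>) \<partial>Q)"
          using Wp by (intro integral_eq_nn_integral) auto
        also have "\<dots> = enn2real (\<integral>\<^sup>+a. ennreal (wt a * G s a) \<partial>lborel)" by (simp only: abs1[OF s sr])
        also have "\<dots> = (\<integral>a. wt a * G s a \<partial>lborel)" by (intro integral_eq_nn_integral[symmetric] gm' AE_I2 g0)
        finally have 1: "(\<integral>x. W x * \<bar>x s\<bar> \<partial>Q) = (\<integral>a. wt a * G s a \<partial>lborel)" .
        have "(\<integral>x. W x * (\<phi>0 s * (indicator {0..1} s * x s)) \<partial>Q) = (\<integral>x. \<phi>0 s * (W x * \<bar>x s\<bar>) \<partial>Q)"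
          using nn[OF s sr] s by (intro Bochner_Integration.integral_cong_AE) (auto simp: mult_ac)
        then show ?thesis using 1 by simp
      qed (simp add: \<phi>0)
    qed
  qed
  also have "\<dots> = (\<integral>p. \<phi>0 (fst p) * (wt (snd p) * G (fst p) (snd p)) \<partial>lborel2)"
    using lborel_pair.integral_fst'[OF int] by simp
  finally show "(\<integral>x. W x * (\<integral>s. \<phi>0 s * x s \<partial>lborel) \<partial>Q) = (\<integral>p. \<phi>0 (fst p) * (wt (snd p) * G (fst p) (snd p)) \<partial>lborel2)" .
qed

section \<open>Domination of the kernels\<close>

definition Gd :: "real \<Rightarrow> real \<Rightarrow> real" where
  "Gd c a = indicator {0<..} a * (if a < 1 then a powr (- 1 / 2) else a powr (- 1 - min c (1 / 2) / 2))"

definition ipow :: "real \<Rightarrow> real \<Rightarrow> real" where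
  "ipow c u = indicator {0<..<1} u * u powr (min c (1 / 2) / 2 - 1)"

text \<open>Integrable singularities at the zeros \<open>s = 0\<close>, \<open>s = 1\<close> and
  \<open>s = r\<close> of \<open>Ef r s\<close>. As \<open>ipow\<close> vanishes off the unit
  interval, the two sides of \<open>r\<close> need one term each.\<close>

definition Sd :: "real \<Rightarrow> real \<Rightarrow> real \<Rightarrow> real" where
  "Sd c r s = indicator {0<..<1} s + (ipow c s + ipow c (1 - s) + (ipow c (s - r) + ipow c (r - s)))"

lemma Gd_measurable [measurable]: "Gd c \<in> borel_measurable borel" unfolding Gd_def[abs_def] by measurable
lemma ipow_measurable [measurable]: "ipow c \<in> borel_measurable borel" unfolding ipow_def[abs_def] by measurable
lemma Gd_nonneg: "0 \<le> Gd c a" by (simp add: Gd_def)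
lemma ipow_nonneg: "0 \<le> ipow c a" by (simp add: ipow_def)

text \<open>For small \<open>a\<close> the negative powers of \<open>M\<close> are bounded by
  \<open>B\<close>. For large \<open>a\<close> the decay must come from
  \<open>M \<ge> 2 * a * E\<close>, where \<open>E\<close> may be tiny, so only a power
  \<open>\<xi> < 1\<close> of this bound is spent. With \<open>c1 = min c (1 / 2)\<close> the last
  two kernels decay like \<open>a\<close> to the power \<open>- c1 - \<xi>\<close>; the choice
  \<open>\<xi> = 1 - c1 / 2\<close> halves the available room, leaving \<open>- 1 - c1 / 2\<close>
  at infinity and a singularity of order \<open>1 - c1 / 2\<close> in \<open>E\<close>, both
  integrable.\<close>

lemma kernel_bounds:
  fixes a c v M E D :: real
  assumes c: "c > 0" and v: "0 < v" "v \<le> 1" and M: "v \<le> M" "2 * a * E \<le> M" and E: "0 < E" "E \<le> 1" and D: "1 \<le> D" "D \<le> 1 + a" and a: "a > 0"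
  defines "\<xi> \<equiv> 1 - min c (1 / 2) / 2" and "B \<equiv> v powr (- (c + 3))"
  shows "a powr (- 1 / 2) * (E * M powr (- c - 1)) \<le> 4 * B * (Gd c a * (1 + E powr (- \<xi>)))"
    and "a powr (- 1 / 2) * M powr (- c - 2) \<le> 4 * B * (Gd c a * (1 + E powr (- \<xi>)))"
    and "a powr (- 1 / 2) * (E * D powr (3 / 2 - c) * M powr (- 5 / 2)) \<le> 4 * B * (Gd c a * (1 + E powr (- \<xi>)))"
    and "a powr (- 1 / 2) * (D powr (1 / 2 - c) * M powr (- 5 / 2)) \<le> 4 * B * (Gd c a * (1 + E powr (- \<xi>)))"
proof -
  define c1 where "c1 = min c (1 / 2)"
  have c1: "0 < c1" "c1 \<le> c" "c1 \<le> 1 / 2" using c by (auto simp: c1_def)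
  have th: "\<xi> = 1 - c1 / 2" by (simp add: \<xi>_def c1_def)
  define e where "e = E powr (- \<xi>)"
  have e: "0 \<le> e" by (simp add: e_def)
  have Mp: "M > 0" using v M by linarith
  have B: "B > 0" using v by (simp add: B_def)
  have vk: "v powr (- k) \<le> B" if "k \<le> c + 3" for k
    unfolding B_def using that v by (intro powr_mono') auto
  have M0: "M powr (- k) \<le> B" if "0 \<le> k" "k \<le> c + 3" for k
  proof -
    have "M powr (- k) \<le> v powr (- k)" using that v M by (intro powr_mono2') auto
    then show ?thesis using vk[OF that(2)] by linarith
  qed
  let ?g = "\<lambda>T. a powr (- 1 / 2) * T \<le> 4 * B * (Gd c a * (1 + e))"
  have "?g (E * M powr (- c - 1)) \<and> ?g (M powr (- c - 2)) \<and> ?g (E * D powr (3 / 2 - c) * M powr (- 5 / 2)) \<and> ?g (D powr (1 / 2 - c) * M powr (- 5 / 2))"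
  proof (cases "a < 1")
    case True
    have g: "?g T" if T: "T \<le> 4 * B" for T
    proof -
      have "a powr (- 1 / 2) * T \<le> a powr (- 1 / 2) * (4 * B)" using T by (intro mult_left_mono) auto
      also have "\<dots> = 4 * B * (a powr (- 1 / 2) * 1)" by simp
      also have "\<dots> \<le> 4 * B * (a powr (- 1 / 2) * (1 + e))" using B e by (intro mult_left_mono) auto
      finally show ?thesis using True a by (simp add: Gd_def)
    qed
    have Dk: "D powr k \<le> 4" if "k \<le> 2" for k
    proof -
      have "D powr k \<le> D powr 2" using D that by (intro powr_mono) auto
      also have "\<dots> \<le> 2 powr 2" using D True by (intro powr_mono2) auto
      finally show ?thesis by simp
    qed
    have ee: "- c - 1 = - (c + 1)" "- c - 2 = - (c + 2)" by auto
    have m1: "M powr (- c - 1) \<le> B" and m2: "M powr (- c - 2) \<le> B" unfolding ee using c by (intro M0; simp)+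
    have m5: "M powr (- 5 / 2) \<le> B" using M0[of "5 / 2"] c by simp
    have "E * M powr (- c - 1) \<le> 1 * B" using E m1 by (intro mult_mono) auto
    moreover have "D powr (1 / 2 - c) * M powr (- 5 / 2) \<le> 4 * B" using Dk m5 c by (intro mult_mono) auto
    moreover have "(E * D powr (3 / 2 - c)) * M powr (- 5 / 2) \<le> (1 * 4) * B" using Dk m5 c E by (intro mult_mono mult_nonneg_nonneg) auto
    ultimately show ?thesis using m2 B by (intro conjI g) linarith+
  next
    case False
    then have a1: "a \<ge> 1" by simp
    have ka: "a powr k \<le> a powr (- 1 - c1 / 2)" if "k \<le> - 1 - c1 / 2" for k using a1 that by (intro powr_mono) auto
    have g: "?g T" if T: "T \<le> 4 * B * (a powr k * (1 + e))" "k \<le> - 1 / 2 - c1 / 2" for T k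
    proof -
      have "a powr (- 1 / 2) * T \<le> a powr (- 1 / 2) * (4 * B * (a powr k * (1 + e)))" using T by (intro mult_left_mono) auto
      also have "\<dots> = 4 * B * (a powr (- 1 / 2 + k) * (1 + e))" by (simp only: powr_add mult_ac)
      also have "\<dots> \<le> 4 * B * (a powr (- 1 - c1 / 2) * (1 + e))" using B e T(2) by (intro mult_left_mono mult_right_mono ka) auto
      finally show ?thesis using False a by (simp add: Gd_def c1_def)
    qed
    have EM: "E * M powr (- 1) \<le> a powr (- 1)"
    proof -
      have "a * E \<le> 2 * a * E" using a E by simp
      then have "a * E \<le> M" using M by linarith
      then show ?thesis using Mp a by (simp add: powr_minus_divide field_simps)
    qed
    have Mth: "M powr (- k) \<le> a powr (- \<xi>) * e * B" if k: "\<xi> \<le> k" "k \<le> c + 3" for k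
    proof -
      have "M powr (- k) = M powr (- \<xi>) * M powr (- (k - \<xi>))" by (simp add: powr_add[symmetric])
      also have "\<dots> \<le> (a * E) powr (- \<xi>) * B"
      proof (intro mult_mono M0)
        have aE: "a * E > 0" using a E by simp
        then have "a * E \<le> M" using M(2) by linarith
        then show "M powr (- \<xi>) \<le> (a * E) powr (- \<xi>)" using aE c1 th by (intro powr_mono2') auto
      qed (use k c1 th in auto)
      also have "\<dots> = a powr (- \<xi>) * e * B" by (simp add: powr_mult e_def)
      finally show ?thesis .
    qed
    \<comment> \<open>Replacing \<open>c\<close> by \<open>c1 \<le> 1 / 2\<close> makes the exponent
      of \<open>D\<close> nonnegative, so that \<open>D \<le> 2 * a\<close> can be inserted.\<close>
    have Dk: "D powr (k - c) \<le> 4 * a powr (k - c1)" if "1 / 2 \<le> k" "k \<le> 2" for k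
    proof -
      have "D powr (k - c) \<le> D powr (k - c1)" using D c1 by (intro powr_mono) auto
      also have "\<dots> \<le> (2 * a) powr (k - c1)" using D a1 c1 that by (intro powr_mono2) auto
      also have "\<dots> = 2 powr (k - c1) * a powr (k - c1)" by (rule powr_mult)
      also have "\<dots> \<le> 2 powr 2 * a powr (k - c1)" using that c1 by (intro mult_right_mono powr_mono) auto
      finally show ?thesis by simp
    qed
    have t1: "E * M powr (- c - 1) \<le> 4 * B * (a powr (- 1) * (1 + e))"
    proof -
      have ee: "- c - 1 = - 1 + - c" by simp
      have "E * M powr (- c - 1) = (E * M powr (- 1)) * M powr (- c)" unfolding ee powr_add by (simp only: mult.assoc)
      also have "\<dots> \<le> a powr (- 1) * B" using M0[of c] c E by (intro mult_mono EM) auto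
      also have "\<dots> \<le> 4 * (a powr (- 1) * B) * (1 + e)"
      proof -
        have "0 \<le> a powr (- 1) * B" using B by simp
        then show ?thesis using mult_nonneg_nonneg[of "a powr (- 1) * B" e] e unfolding distrib_left by linarith
      qed
      finally show ?thesis by (simp only: mult_ac)
    qed
    have t2: "M powr (- c - 2) \<le> 4 * B * (a powr (- \<xi>) * (1 + e))"
    proof -
      have ee: "- c - 2 = - (c + 2)" by simp
      have "M powr (- c - 2) \<le> a powr (- \<xi>) * e * B" unfolding ee using c c1 th by (intro Mth) auto
      also have "\<dots> \<le> 4 * B * (a powr (- \<xi>) * (1 + e))" using B e by (simp add: algebra_simps)
      finally show ?thesis .
    qed
    have t4: "D powr (1 / 2 - c) * M powr (- 5 / 2) \<le> 4 * B * (a powr (1 / 2 - c1 - \<xi>) * (1 + e))"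
    proof -
      have "D powr (1 / 2 - c) * M powr (- 5 / 2) \<le> (4 * a powr (1 / 2 - c1)) * (a powr (- \<xi>) * e * B)"
        using Mth[of "5 / 2"] c c1 th by (intro mult_mono Dk) auto
      also have "\<dots> = 4 * B * (a powr (1 / 2 - c1 - \<xi>) * e)" using powr_add[of a "1 / 2 - c1" "- \<xi>"] by (simp add: mult_ac)
      also have "\<dots> \<le> 4 * B * (a powr (1 / 2 - c1 - \<xi>) * (1 + e))" using B by (intro mult_left_mono) auto
      finally show ?thesis .
    qed
    have t3: "E * D powr (3 / 2 - c) * M powr (- 5 / 2) \<le> 4 * B * (a powr (3 / 2 - c1 - 1 - \<xi>) * (1 + e))"
    proof -
      have "E * D powr (3 / 2 - c) * M powr (- 5 / 2) = (D powr (3 / 2 - c) * (E * M powr (- 1))) * M powr (- (3 / 2))"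
        using powr_add[of M "- 1" "- (3 / 2)"] by (simp add: mult_ac)
      also have "\<dots> \<le> ((4 * a powr (3 / 2 - c1)) * a powr (- 1)) * (a powr (- \<xi>) * e * B)"
        using E c c1 th by (intro mult_mono Dk EM Mth mult_nonneg_nonneg) auto
      also have "\<dots> = 4 * B * ((a powr (3 / 2 - c1) * a powr (- 1) * a powr (- \<xi>)) * e)" by (simp only: mult_ac)
      also have "a powr (3 / 2 - c1) * a powr (- 1) * a powr (- \<xi>) = a powr (3 / 2 - c1 - 1 - \<xi>)" by (simp only: powr_add[symmetric]) (simp add: algebra_simps)
      also have "4 * B * (a powr (3 / 2 - c1 - 1 - \<xi>) * e) \<le> 4 * B * (a powr (3 / 2 - c1 - 1 - \<xi>) * (1 + e))" using B by (intro mult_left_mono) auto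
      finally show ?thesis .
    qed
    show ?thesis using g[OF t1] g[OF t2] g[OF t3] g[OF t4] c1 th by auto
  qed
  then show "a powr (- 1 / 2) * (E * M powr (- c - 1)) \<le> 4 * B * (Gd c a * (1 + E powr (- \<xi>)))"
    and "a powr (- 1 / 2) * M powr (- c - 2) \<le> 4 * B * (Gd c a * (1 + E powr (- \<xi>)))"
    and "a powr (- 1 / 2) * (E * D powr (3 / 2 - c) * M powr (- 5 / 2)) \<le> 4 * B * (Gd c a * (1 + E powr (- \<xi>)))"
    and "a powr (- 1 / 2) * (D powr (1 / 2 - c) * M powr (- 5 / 2)) \<le> 4 * B * (Gd c a * (1 + E powr (- \<xi>)))"
    by (auto simp: e_def)
qed

text \<open>When \<open>r\<close> keeps the distance \<open>\<rho>\<close> from the ends,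
  \<open>Ef r s\<close> is at least a multiple of \<open>s * (1 - s) * \<bar>r - s\<bar>\<close>,
  and at most one of these three factors can be small.\<close>

lemma Ef_lower:
  assumes \<rho>: "0 < \<rho>" "\<rho> \<le> 1 / 2" and r: "\<rho> \<le> r" "r \<le> 1 - \<rho>" and s: "0 < s" "s < 1" "s \<noteq> r"
  shows "0 < Ef r s" "Ef r s \<le> 1" "(Rf r s)\<^sup>2 \<le> 1" "\<rho>\<^sup>2 \<le> Vf r"
    and "\<exists>m\<in>{s, 1 - s, \<bar>r - s\<bar>}. \<rho>\<^sup>2 * (\<rho> / 2)\<^sup>2 * m \<le> Ef r s"
proof -
  have r01: "0 < r" "r < 1" using \<rho> r by auto
  have R: "0 < Rf r s" using r01 s by (intro Rf_pos) auto
  then show "0 < Ef r s" using s by (simp add: Ef_def)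
  have R1: "Rf r s \<le> 1 * 1" unfolding Rf_def using r01 s by (intro mult_mono) auto
  have "Rf r s * \<bar>r - s\<bar> \<le> 1 * 1" using R R1 r01 s by (intro mult_mono) auto
  then show "Ef r s \<le> 1" by (simp add: Ef_def)
  show "(Rf r s)\<^sup>2 \<le> 1" using R R1 by (simp add: power_le_one)
  have V: "\<rho> * \<rho> \<le> r * (1 - r)" using \<rho> r by (intro mult_mono) auto
  then show "\<rho>\<^sup>2 \<le> Vf r" by (simp add: Vf_def power2_eq_square)
  have "(r * s) * ((1 - r) * (1 - s)) \<le> Rf r s"
    unfolding Rf_def using r01 s by (intro mult_mono) (auto simp: min_def max_def mult_left_le mult_left_le_one_le)
  then have Rl: "(r * (1 - r)) * (s * (1 - s)) \<le> Rf r s" by (simp add: mult_ac)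
  have "\<rho>\<^sup>2 * (s * (1 - s)) \<le> (r * (1 - r)) * (s * (1 - s))"
    using V s by (intro mult_right_mono) (auto simp: power2_eq_square)
  then have Rl2: "\<rho>\<^sup>2 * (s * (1 - s)) \<le> Rf r s" using Rl by linarith
  have El: "\<rho>\<^sup>2 * (s * (1 - s) * \<bar>r - s\<bar>) \<le> Ef r s"
    using mult_right_mono[OF Rl2, of "\<bar>r - s\<bar>"] by (simp add: Ef_def mult_ac)
  have key: "\<rho>\<^sup>2 * (\<rho> / 2)\<^sup>2 * m \<le> Ef r s" if m: "m * (x * y) = s * (1 - s) * \<bar>r - s\<bar>" "\<rho> / 2 \<le> x" "\<rho> / 2 \<le> y" "0 \<le> m" for m x y
  proof -
    have "(\<rho> / 2) * (\<rho> / 2) \<le> x * y" using m \<rho> by (intro mult_mono) auto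
    then have "m * ((\<rho> / 2) * (\<rho> / 2)) \<le> m * (x * y)" using m(4) by (intro mult_left_mono)
    then have "\<rho>\<^sup>2 * (m * ((\<rho> / 2) * (\<rho> / 2))) \<le> \<rho>\<^sup>2 * (s * (1 - s) * \<bar>r - s\<bar>)" unfolding m(1) by (intro mult_left_mono) auto
    then show ?thesis using El by (simp add: power2_eq_square mult_ac)
  qed
  consider "s < \<rho> / 2" | "1 - s < \<rho> / 2" | "\<rho> / 2 \<le> s" "\<rho> / 2 \<le> 1 - s" by linarith
  then show "\<exists>m\<in>{s, 1 - s, \<bar>r - s\<bar>}. \<rho>\<^sup>2 * (\<rho> / 2)\<^sup>2 * m \<le> Ef r s"
  proof cases
    case 1
    then have "\<rho>\<^sup>2 * (\<rho> / 2)\<^sup>2 * s \<le> Ef r s" using \<rho> r s by (intro key[of s "1 - s" "\<bar>r - s\<bar>"]) (auto simp: mult_ac)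
    then show ?thesis by blast
  next
    case 2
    then have "\<rho>\<^sup>2 * (\<rho> / 2)\<^sup>2 * (1 - s) \<le> Ef r s" using \<rho> r s by (intro key[of "1 - s" s "\<bar>r - s\<bar>"]) (auto simp: mult_ac)
    then show ?thesis by blast
  next
    case 3
    then have "\<rho>\<^sup>2 * (\<rho> / 2)\<^sup>2 * \<bar>r - s\<bar> \<le> Ef r s" using \<rho> r s by (intro key[of "\<bar>r - s\<bar>" s "1 - s"]) (auto simp: mult_ac)
    then show ?thesis by blast
  qed
qed

lemma Ef_powr_bound:
  assumes \<rho>: "0 < \<rho>" "\<rho> \<le> 1 / 2" and r: "\<rho> \<le> r" "r \<le> 1 - \<rho>" and s: "0 < s" "s < 1" "s \<noteq> r" and c: "c > 0"
  shows "1 + Ef r s powr (- (1 - min c (1 / 2) / 2)) \<le> (1 + (\<rho>\<^sup>2 * (\<rho> / 2)\<^sup>2) powr (- (1 - min c (1 / 2) / 2))) * Sd c r s"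
proof -
  define q where "q = - (1 - min c (1 / 2) / 2)"
  have q: "q \<le> 0" "min c (1 / 2) / 2 - 1 = q" by (auto simp: q_def)
  define k where "k = \<rho>\<^sup>2 * (\<rho> / 2)\<^sup>2"
  have k: "k > 0" using \<rho> by (simp add: k_def)
  obtain m where m: "m \<in> {s, 1 - s, \<bar>r - s\<bar>}" "k * m \<le> Ef r s" using Ef_lower(5)[OF \<rho> r s] unfolding k_def by blast
  have mp: "0 < m" using m(1) s by auto
  have i: "m powr q \<le> ipow c s + ipow c (1 - s) + (ipow c (s - r) + ipow c (r - s))"
  proof -
    have u: "ipow c u = u powr q" if "0 < u" "u < 1" for u using that by (simp add: ipow_def q(2))
    note p = ipow_nonneg[of c s] ipow_nonneg[of c "1 - s"] ipow_nonneg[of c "s - r"] ipow_nonneg[of c "r - s"]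
    consider "m = s" | "m = 1 - s" | "m = s - r" "s > r" | "m = r - s" "r > s" using m(1) s by fastforce
    then show ?thesis by cases (use p u[of m] s r \<rho> in auto)
  qed
  have "Ef r s powr q \<le> (k * m) powr q" using k mp m(2) q by (intro powr_mono2') auto
  also have "\<dots> = k powr q * m powr q" by (rule powr_mult)
  also have "\<dots> \<le> k powr q * Sd c r s" using i s unfolding Sd_def by (intro mult_left_mono) auto
  finally have 1: "Ef r s powr q \<le> k powr q * Sd c r s" .
  have "1 \<le> Sd c r s" using s by (simp add: Sd_def ipow_nonneg)
  then show ?thesis using 1 unfolding q_def[symmetric] k_def[symmetric] by (simp add: algebra_simps)
qed

lemma nn_integral_ipow: "c > 0 \<Longrightarrow> \<exists>K. (\<integral>\<^sup>+u. ennreal (ipow c u) \<partial>lborel) \<le> ennreal K"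
proof -
  assume c: "c > 0"
  define q where "q = min c (1 / 2) / 2 - 1"
  have q: "- 1 < q" using c by (auto simp: q_def)
  have "(\<integral>\<^sup>+u. ennreal (indicator {0..1} u * u powr q) \<partial>lborel) = ennreal (1 powr (q + 1) / (q + 1))"
    using has_integral_powr_from_0[OF q, of 1] by (intro nn_integral_has_integral_lebesgue) auto
  moreover have "(\<integral>\<^sup>+u. ennreal (ipow c u) \<partial>lborel) \<le> (\<integral>\<^sup>+u. ennreal (indicator {0..1} u * u powr q) \<partial>lborel)"
    by (intro nn_integral_mono ennreal_leI) (auto simp: ipow_def q_def indicator_def)
  ultimately show ?thesis by metis
qed

text \<open>Uniform in \<open>r\<close>, since every singular term is a translate or reflection of
  the one integrable function \<open>ipow\<close>.\<close>

lemma nn_integral_Sd: "c > 0 \<Longrightarrow> \<exists>K\<ge>0. \<forall>r. (\<integral>\<^sup>+s. ennreal (Sd c r s) \<partial>lborel) \<le> ennreal K"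
proof -
  assume "c > 0"
  then obtain K where K: "(\<integral>\<^sup>+u. ennreal (ipow c u) \<partial>lborel) \<le> ennreal K" using nn_integral_ipow by blast
  define K' where "K' = max K 0"
  have K': "(\<integral>\<^sup>+u. ennreal (ipow c u) \<partial>lborel) \<le> ennreal K'" "K' \<ge> 0"
    using K by (auto simp: K'_def max_def ennreal_neg)
  have af: "(\<integral>\<^sup>+s. ennreal (ipow c (t + b * s)) \<partial>lborel) \<le> ennreal K'" if "\<bar>b\<bar> = 1" for t b :: real
  proof -
    have "b \<noteq> 0" using that by auto
    then show ?thesis using nn_integral_real_affine[of "\<lambda>u. ennreal (ipow c u)" b t] that K' by simp
  qed
  have "(\<integral>\<^sup>+s. ennreal (Sd c r s) \<partial>lborel) \<le> ennreal (1 + (K' + K' + (K' + K')))" for r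
  proof -
    have "(\<integral>\<^sup>+s. ennreal (Sd c r s) \<partial>lborel) = (\<integral>\<^sup>+s. ennreal (indicator {0<..<1} s) + (ennreal (ipow c s) + ennreal (ipow c (1 - s)) + (ennreal (ipow c (s - r)) + ennreal (ipow c (r - s)))) \<partial>lborel)"
      unfolding Sd_def by (intro nn_integral_cong) (simp add: ipow_nonneg ennreal_plus[symmetric] del: ennreal_plus)
    also have "\<dots> = (\<integral>\<^sup>+s. ennreal (indicator {0<..<1 :: real} s) \<partial>lborel) + ((\<integral>\<^sup>+s. ennreal (ipow c s) \<partial>lborel) + (\<integral>\<^sup>+s. ennreal (ipow c (1 - s)) \<partial>lborel) + ((\<integral>\<^sup>+s. ennreal (ipow c (s - r)) \<partial>lborel) + (\<integral>\<^sup>+s. ennreal (ipow c (r - s)) \<partial>lborel)))"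
      by (simp add: nn_integral_add)
    also have "\<dots> \<le> ennreal 1 + (ennreal K' + ennreal K' + (ennreal K' + ennreal K'))"
      using K'(1) af[of "- 1" 1] af[of 1 "- r"] af[of "- 1" r] by (intro add_mono) (auto simp: ennreal_indicator)
    also have "\<dots> = ennreal (1 + (K' + K' + (K' + K')))" using K'(2) by (simp only: ennreal_plus[symmetric] add_nonneg_nonneg zero_le_one)
    finally show ?thesis .
  qed
  moreover have "0 \<le> 1 + (K' + K' + (K' + K'))" using K'(2) by simp
  ultimately show ?thesis by blast
qed

lemma nn_integral_Gd: "c > 0 \<Longrightarrow> \<exists>K\<ge>0. (\<integral>\<^sup>+a. ennreal (Gd c a) \<partial>lborel) \<le> ennreal K"
proof -
  assume c: "c > 0"
  define q where "q = - 1 - min c (1 / 2) / 2"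
  have q: "q < - 1" using c by (auto simp: q_def)
  have 1: "(\<integral>\<^sup>+u. ennreal (indicator {0..1} u * u powr (- 1 / 2)) \<partial>lborel) = ennreal (1 powr (- 1 / 2 + 1) / (- 1 / 2 + 1))"
    using has_integral_powr_from_0[of "- 1 / 2" 1] by (intro nn_integral_has_integral_lebesgue) auto
  have 2: "(\<integral>\<^sup>+u. ennreal (indicator {1..} u * u powr q) \<partial>lborel) = ennreal (- (1 powr (q + 1)) / (q + 1))"
    using has_integral_powr_to_inf[OF q, of 1] by (intro nn_integral_has_integral_lebesgue) auto
  have "(\<integral>\<^sup>+a. ennreal (Gd c a) \<partial>lborel) \<le> (\<integral>\<^sup>+u. ennreal (indicator {0..1} u * u powr (- 1 / 2)) + ennreal (indicator {1..} u * u powr q) \<partial>lborel)"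
    by (intro nn_integral_mono) (auto simp: Gd_def q_def indicator_def)
  also have "\<dots> = (\<integral>\<^sup>+u. ennreal (indicator {0..1} u * u powr (- 1 / 2)) \<partial>lborel) + (\<integral>\<^sup>+u. ennreal (indicator {1..} u * u powr q) \<partial>lborel)"
    by (rule nn_integral_add) measurable
  also have "\<dots> = ennreal 2 + ennreal (- 1 / (q + 1))" unfolding 1 2 by simp
  also have "\<dots> = ennreal (2 + - 1 / (q + 1))" using q by (intro ennreal_plus[symmetric]) (auto simp: divide_nonpos_neg)
  finally have "(\<integral>\<^sup>+a. ennreal (Gd c a) \<partial>lborel) \<le> ennreal (2 + - 1 / (q + 1))" .
  moreover have "0 \<le> - 1 / (q + 1)" by (rule divide_nonpos_neg) (use q in auto)
  then have "0 \<le> 2 + - 1 / (q + 1)" by linarith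
  ultimately show ?thesis by blast
qed

lemma Mf_measurable [measurable (raw)]:
  assumes [measurable]: "f \<in> borel_measurable N" "g \<in> borel_measurable N" "k \<in> borel_measurable N"
  shows "(\<lambda>x. Mf (f x) (g x) (k x)) \<in> borel_measurable N" "(\<lambda>x. Ef (f x) (g x)) \<in> borel_measurable N" "(\<lambda>x. Rf (f x) (g x)) \<in> borel_measurable N"
    "(\<lambda>x. Df (g x) (k x)) \<in> borel_measurable N" "(\<lambda>x. Vf (g x)) \<in> borel_measurable N"
    "(\<lambda>x. al c (f x) (g x) (k x)) \<in> borel_measurable N" "(\<lambda>x. be c (f x) (g x) (k x)) \<in> borel_measurable N"
    "(\<lambda>x. Af (f x) (g x) (k x)) \<in> borel_measurable N" "(\<lambda>x. kap c (f x) (g x) (k x)) \<in> borel_measurable N"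
    "(\<lambda>x. Sd c (f x) (g x)) \<in> borel_measurable N"
  unfolding Mf_def Ef_def Rf_def Vf_def Df_def al_def be_def Af_def kap_def Sd_def by measurable

abbreviation "kernels_below c C r s a \<equiv>
  wt a * al c r s a \<le> C * (Gd c a * Sd c r s) \<and>
  wt a * be c r s a \<le> C * (Gd c a * Sd c r s) \<and>
  wt a * (al c r s a * Af r s a powr (3 / 2 - c)) \<le> C * (Gd c a * Sd c r s) \<and>
  wt a * (be c r s a * Af r s a powr (1 / 2 - c)) \<le> C * (Gd c a * Sd c r s)"

text \<open>\<open>C\<close> and \<open>K\<close> are chosen before \<open>r\<close>. This
  uniformity, used with a \<open>\<rho>\<close> taken from the support of \<open>h\<close>, is what
  permits the exchange of the integral over \<open>r\<close> with those over \<open>s\<close> and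
  \<open>a\<close>.\<close>

lemma kernels_dominated:
  assumes c: "c > 0" and \<rho>: "0 < \<rho>" "\<rho> \<le> 1 / 2"
  obtains C K where "0 \<le> K"
    "\<And>r. (\<integral>\<^sup>+p. ennreal (C * (Gd c (snd p) * Sd c r (fst p))) \<partial>lborel2) \<le> ennreal K"
    "\<And>r s a. \<rho> \<le> r \<Longrightarrow> r \<le> 1 - \<rho> \<Longrightarrow> 0 < s \<Longrightarrow> s < 1 \<Longrightarrow> s \<noteq> r \<Longrightarrow> a > 0 \<Longrightarrow>
      kernels_below c C r s a"
proof -
  define k where "k = 1 + (\<rho>\<^sup>2 * (\<rho> / 2)\<^sup>2) powr (- (1 - min c (1 / 2) / 2))"
  define B where "B = (\<rho>\<^sup>2) powr (- (c + 3))"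
  define X where "X = kc c * (2 * c + 1) * (1 + 2 powr c)"
  have kc: "kc c > 0" using c by (simp add: kc_def Gamma_real_pos)
  have X: "X > 0" unfolding X_def using kc c by (intro mult_pos_pos) (auto simp: add_pos_pos)
  have k: "k \<ge> 1" by (simp add: k_def)
  have B: "B > 0" using \<rho> by (simp add: B_def)
  define C where "C = X * (4 * B * k)"
  have C: "C > 0" using X B k by (simp add: C_def)
  obtain K1 where K1: "K1 \<ge> 0" "\<And>r. (\<integral>\<^sup>+s. ennreal (Sd c r s) \<partial>lborel) \<le> ennreal K1" using nn_integral_Sd[OF c] by blast
  obtain K2 where K2: "K2 \<ge> 0" "(\<integral>\<^sup>+a. ennreal (Gd c a) \<partial>lborel) \<le> ennreal K2" using nn_integral_Gd[OF c] by blast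
  show thesis
  proof (rule that)
    show "0 \<le> C * (K1 * K2)" using C K1 K2 by simp
    fix r
    have "(\<integral>\<^sup>+p. ennreal (C * (Gd c (snd p) * Sd c r (fst p))) \<partial>lborel2) = (\<integral>\<^sup>+s. (\<integral>\<^sup>+a. ennreal (C * Sd c r s) * ennreal (Gd c a) \<partial>lborel) \<partial>lborel)"
    proof -
      have "ennreal (C * (Gd c a * Sd c r s)) = ennreal (C * Sd c r s) * ennreal (Gd c a)" for s a
        by (subst ennreal_mult''[symmetric]) (auto simp: Gd_nonneg mult_ac)
      moreover have "(\<integral>\<^sup>+p. ennreal (C * (Gd c (snd p) * Sd c r (fst p))) \<partial>lborel2) = (\<integral>\<^sup>+s. (\<integral>\<^sup>+a. ennreal (C * (Gd c (snd (s, a)) * Sd c r (fst (s, a)))) \<partial>lborel) \<partial>lborel)"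
        by (intro lborel.nn_integral_fst[symmetric]) measurable
      ultimately show ?thesis by (simp only: fst_conv snd_conv)
    qed
    also have "\<dots> = (\<integral>\<^sup>+s. ennreal C * ennreal (Sd c r s) * (\<integral>\<^sup>+a. ennreal (Gd c a) \<partial>lborel) \<partial>lborel)"
      using C by (intro nn_integral_cong) (simp add: nn_integral_cmult ennreal_mult')
    also have "\<dots> = ennreal C * (\<integral>\<^sup>+s. ennreal (Sd c r s) \<partial>lborel) * (\<integral>\<^sup>+a. ennreal (Gd c a) \<partial>lborel)"
      by (simp add: nn_integral_cmult nn_integral_multc)
    also have "\<dots> \<le> ennreal C * ennreal K1 * ennreal K2" by (intro mult_mono K1 K2 order_refl) auto
    also have "\<dots> = ennreal (C * (K1 * K2))" using C K1(1) K2(1) by (simp add: ennreal_mult'[symmetric] mult.assoc)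
    finally show "(\<integral>\<^sup>+p. ennreal (C * (Gd c (snd p) * Sd c r (fst p))) \<partial>lborel2) \<le> ennreal (C * (K1 * K2))" .
  next
    fix r s a assume r: "\<rho> \<le> r" "r \<le> 1 - \<rho>" and s: "0 < s" "s < 1" "s \<noteq> r" and a: "(a::real) > 0"
    note El = Ef_lower[OF \<rho> r s]
    have r01: "0 < r" "r < 1" using \<rho> r by auto
    let ?E = "Ef r s" and ?M = "Mf r s a" and ?D = "Df s a"
    have Mp: "?M > 0" using r01 s a by (intro Mf_pos) auto
    have Vs: "0 \<le> Vf s" "Vf s \<le> 1 / 2"
    proof -
      have "s * (1 - s) \<le> 1 / 2" using sum_power2_ge_zero[of "s - 1 / 2" 0] by (simp add: power2_eq_square algebra_simps)
      then show "0 \<le> Vf s" "Vf s \<le> 1 / 2" using s by (auto simp: Vf_def)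
    qed
    have D: "1 \<le> ?D" "?D \<le> 1 + a" using Vs a mult_left_mono[OF Vs(2), of "2 * a"] by (auto simp: Df_def)
    have M: "\<rho>\<^sup>2 \<le> ?M" "2 * a * ?E \<le> ?M"
    proof -
      have "0 \<le> 2 * a * ?E" using a El(1) by simp
      moreover have "0 \<le> \<rho>\<^sup>2" by simp
      ultimately show "\<rho>\<^sup>2 \<le> ?M" "2 * a * ?E \<le> ?M" using El(4) unfolding Mf_def by linarith+
    qed
    have v: "0 < \<rho>\<^sup>2" "\<rho>\<^sup>2 \<le> 1" using \<rho> by (auto intro: power_le_one)
    note kb = kernel_bounds[OF c v M El(1,2) D a]
    have up: "4 * B * (Gd c a * (1 + ?E powr (- (1 - min c (1 / 2) / 2)))) \<le> 4 * B * (Gd c a * (k * Sd c r s))"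
      using Ef_powr_bound[OF \<rho> r s c] B Gd_nonneg[of c a] unfolding k_def by (intro mult_left_mono) auto
    have fin: "wt a * F \<le> C * (Gd c a * Sd c r s)"
      if F: "F \<le> x * T" "x \<le> X" and T: "a powr (- 1 / 2) * T \<le> 4 * B * (Gd c a * (1 + ?E powr (- (1 - min c (1 / 2) / 2))))" and n: "0 \<le> T" for F T x
    proof -
      have F': "F \<le> X * T" using F mult_right_mono[OF F(2) n] by linarith
      have sp: "1 \<le> sqrt pi" using pi_ge_two by simp
      have "wt a * F \<le> wt a * (X * T)" using F' by (intro mult_left_mono wt_nonneg)
      also have "\<dots> = a powr (- 1 / 2) * (X * T) / sqrt pi" using a by (simp add: wt_def)
      also have "\<dots> \<le> a powr (- 1 / 2) * (X * T) / 1" using X n sp by (intro divide_left_mono) auto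
      also have "\<dots> = X * (a powr (- 1 / 2) * T)" by simp
      also have "\<dots> \<le> X * (4 * B * (Gd c a * (k * Sd c r s)))" using X T up by (intro mult_left_mono) auto
      also have "\<dots> = C * (Gd c a * Sd c r s)" by (simp add: C_def)
      finally show ?thesis .
    qed
    have p2: "2 powr (c - 3 / 2) \<le> 2 powr c" "2 powr (c - 1 / 2) \<le> 2 powr c" by (auto intro: powr_mono)
    then have p3: "2 powr (c - 3 / 2) \<le> 1 + 2 powr c" "2 powr (c - 1 / 2) \<le> 1 + 2 powr c" by linarith+
    have X1: "kc c * (2 * c) \<le> X" and X2: "kc c \<le> X" and X3: "kc c * (2 * c) * 2 powr (c - 3 / 2) \<le> X" and X4: "kc c * 2 powr (c - 1 / 2) \<le> X"
    proof -
      have e: "X = kc c * ((2 * c + 1) * (1 + 2 powr c))" by (simp add: X_def)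
      have kx: "x \<le> (2 * c + 1) * (1 + 2 powr c) \<Longrightarrow> kc c * x \<le> X" for x unfolding e using kc by (intro mult_left_mono) auto
      have l1: "2 * c * 1 \<le> (2 * c + 1) * (1 + 2 powr c)" using c by (intro mult_mono) auto
      have l2: "1 * 1 \<le> (2 * c + 1) * (1 + 2 powr c)" using c by (intro mult_mono) auto
      have l3: "(2 * c) * 2 powr (c - 3 / 2) \<le> (2 * c + 1) * (1 + 2 powr c)" using c by (intro mult_mono p3) auto
      have l4: "1 * 2 powr (c - 1 / 2) \<le> (2 * c + 1) * (1 + 2 powr c)" using c by (intro mult_mono p3) auto
      show "kc c * (2 * c) \<le> X" "kc c \<le> X" "kc c * (2 * c) * 2 powr (c - 3 / 2) \<le> X" "kc c * 2 powr (c - 1 / 2) \<le> X"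
        using kx[OF l1] kx[OF l2] kx[OF l3] kx[OF l4] by (simp_all add: mult.assoc)
    qed
    have AM: "Af r s a powr q = ?D powr q * (2 powr (- q) * ?M powr (- q))" for q
      unfolding Af_def using D Mp by (simp add: powr_divide powr_mult powr_minus_divide)
    have 3: "al c r s a * Af r s a powr (3 / 2 - c) = (kc c * (2 * c) * 2 powr (c - 3 / 2)) * (?E * ?D powr (3 / 2 - c) * ?M powr (- 5 / 2))"
    proof -
      have "?M powr (- 5 / 2) = ?M powr (- c - 1) * ?M powr (- (3 / 2 - c))" by (simp add: powr_add[symmetric])
      then show ?thesis unfolding AM al_def by simp
    qed
    have 4: "be c r s a * Af r s a powr (1 / 2 - c) = (kc c * 2 powr (c - 1 / 2)) * ((Rf r s)\<^sup>2 * (?D powr (1 / 2 - c) * ?M powr (- 5 / 2)))"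
    proof -
      have "?M powr (- 5 / 2) = ?M powr (- c - 2) * ?M powr (- (1 / 2 - c))" by (simp add: powr_add[symmetric])
      then show ?thesis unfolding AM be_def by simp
    qed
    have R: "(Rf r s)\<^sup>2 * y \<le> y" if "0 \<le> y" for y using mult_right_mono[OF El(3) that] by simp
    show "kernels_below c C r s a"
    proof (intro conjI)
      show "wt a * al c r s a \<le> C * (Gd c a * Sd c r s)"
        using El(1) by (intro fin[OF _ X1 kb(1)[folded B_def]]) (auto simp: al_def)
      show "wt a * be c r s a \<le> C * (Gd c a * Sd c r s)"
        using R[of "?M powr (- c - 2)"] kc by (intro fin[OF _ X2 kb(2)[folded B_def]]) (auto simp: be_def mult.assoc intro!: mult_left_mono)
      show "wt a * (al c r s a * Af r s a powr (3 / 2 - c)) \<le> C * (Gd c a * Sd c r s)"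
        using El(1) by (intro fin[OF _ X3 kb(3)[folded B_def]]) (auto simp: 3)
      show "wt a * (be c r s a * Af r s a powr (1 / 2 - c)) \<le> C * (Gd c a * Sd c r s)"
        unfolding 4 using R kc by (intro fin[OF _ X4 kb(4)[folded B_def]] mult_left_mono) auto
    qed
  qed
qed

text \<open>The jump of \<open>\<partial>\<^sub>r\<close> of the kernel at \<open>r = s\<close>.\<close>

definition J1 :: "real \<Rightarrow> real \<Rightarrow> real \<Rightarrow> real" where
  "J1 c s a = - (2 * sqrt 2 * gam c * sqrt (Vf s)) * Df s a powr (- c - 3 / 2) * (1 + (1 - 2 * c) * Vf s * a)"

text \<open>Both \<open>- \<partial>\<^sub>r\<^sup>2\<close> of the kernel and the boundary term of a single pair \<open>(s, a)\<close>.\<close>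

definition Bt :: "real \<Rightarrow> real \<Rightarrow> real \<Rightarrow> real \<Rightarrow> real" where
  "Bt c r s a = gam c / sqrt 2 * Df s a powr (1 / 2 - c) * Mf r s a powr (- 5 / 2) * (c * Ef r s * Df s a + (c - 3 / 2) * (Rf r s)\<^sup>2)"

section \<open>The second derivative of the kernel and integration by parts\<close>

lemma DERIV_powr_comp:
  fixes f :: "real \<Rightarrow> real"
  shows "(f has_real_derivative f') (at x) \<Longrightarrow> f x > 0 \<Longrightarrow> ((\<lambda>x. f x powr q) has_real_derivative (q * f x powr (q - 1) * f')) (at x)"
  by (rule DERIV_chain2[OF has_real_derivative_powr])

text \<open>For \<open>r \<le> s\<close> the kernel is an elementary function of the quadratic polynomial \<open>QL\<close>.\<close>

definition QL :: "real \<Rightarrow> real \<Rightarrow> real \<Rightarrow> real" where "QL s a r = r * (Df s a - (1 + 2 * a * (1 - s)) * r)"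
definition QL' :: "real \<Rightarrow> real \<Rightarrow> real \<Rightarrow> real" where "QL' s a r = Df s a - 2 * (1 + 2 * a * (1 - s)) * r"
definition kL :: "real \<Rightarrow> real \<Rightarrow> real \<Rightarrow> real \<Rightarrow> real" where
  "kL c s a r = gam c * sqrt 2 * Df s a powr (- c - 3 / 2) * (2 * c * Vf s * QL s a r powr (1 / 2) + (1 - s)\<^sup>2 * (r\<^sup>2 * QL s a r powr (- 1 / 2)))"
definition kL' :: "real \<Rightarrow> real \<Rightarrow> real \<Rightarrow> real \<Rightarrow> real" where
  "kL' c s a r = gam c * sqrt 2 * Df s a powr (- c - 3 / 2) * (c * Vf s * (QL s a r powr (- 1 / 2) * QL' s a r)
     + (1 - s)\<^sup>2 * (2 * r * QL s a r powr (- 1 / 2) - 1 / 2 * (r\<^sup>2 * QL s a r powr (- 3 / 2) * QL' s a r)))"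
definition kL'' :: "real \<Rightarrow> real \<Rightarrow> real \<Rightarrow> real \<Rightarrow> real" where
  "kL'' c s a r = gam c * sqrt 2 * Df s a powr (- c - 3 / 2) * ((Df s a)\<^sup>2 * QL s a r powr (- 5 / 2) *
     (3 / 4 * ((1 - s) * r)\<^sup>2 - c / 2 * Vf s * QL s a r))"

lemma QL_deriv: "(QL s a has_real_derivative QL' s a r) (at r)"
  unfolding QL_def[abs_def] QL'_def by (auto intro!: derivative_eq_intros simp: algebra_simps)

lemma QL'_deriv: "(QL' s a has_real_derivative - 2 * (1 + 2 * a * (1 - s))) (at r)"
  unfolding QL'_def[abs_def] by (auto intro!: derivative_eq_intros)

lemma QL_pos:
  assumes "0 < s" "s < 1" "0 \<le> a" "0 < r" "r \<le> s"
  shows "QL s a r > 0"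
proof -
  have "(1 + 2 * a * (1 - s)) * r \<le> (1 + 2 * a * (1 - s)) * s" using assms by (intro mult_left_mono) auto
  also have "\<dots> < Df s a" using assms by (simp add: Df_def Vf_def algebra_simps)
  finally show ?thesis using assms by (simp add: QL_def)
qed

lemma kL_deriv:
  assumes M: "QL s a r > 0"
  shows "(kL c s a has_real_derivative kL' c s a r) (at r)"
proof -
  note d1 = DERIV_powr_comp[OF QL_deriv M, of "1 / 2"] and d2 = DERIV_powr_comp[OF QL_deriv M, of "- 1 / 2"]
  have dsq: "((\<lambda>r. r\<^sup>2) has_real_derivative 2 * r) (at r)" by (auto intro!: derivative_eq_intros)
  have "(kL c s a has_real_derivative gam c * sqrt 2 * Df s a powr (- c - 3 / 2) * (2 * c * Vf s * (1 / 2 * QL s a r powr (1 / 2 - 1) * QL' s a r)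
    + (1 - s)\<^sup>2 * (2 * r * QL s a r powr (- 1 / 2) + (- 1 / 2 * QL s a r powr (- 1 / 2 - 1) * QL' s a r) * r\<^sup>2))) (at r)"
    unfolding kL_def[abs_def] by (intro DERIV_cmult DERIV_add DERIV_mult d1 d2 dsq)
  then show ?thesis by (rule DERIV_cong) (simp add: kL'_def algebra_simps)
qed

text \<open>All powers of \<open>QL\<close> are reduced to the lowest one, \<open>w\<close>. As a
  quadratic polynomial in \<open>r\<close> with discriminant \<open>(Df s a)^2\<close>,
  \<open>QL\<close> satisfies \<open>QL'^2 + 4 * m * QL = Df^2\<close>; this collapses
  \<open>i1\<close> to a constant and \<open>i2\<close> to a multiple of \<open>r^2\<close>, which
  is why the second derivative is so short.\<close>

lemma kL'_deriv:
  assumes M: "QL s a r > 0"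
  shows "(kL' c s a has_real_derivative kL'' c s a r) (at r)"
proof -
  note d1 = DERIV_powr_comp[OF QL_deriv M, of "- 1 / 2"] and d2 = DERIV_powr_comp[OF QL_deriv M, of "- 3 / 2"]
  define w where "w = QL s a r powr (- 5 / 2)"
  define m where "m = 1 + 2 * a * (1 - s)"
  have w1: "QL s a r powr (- 3 / 2) = QL s a r * w" using powr_add[of "QL s a r" 1 "- 5 / 2"] M by (simp add: w_def)
  have w2: "QL s a r powr (- 1 / 2) = (QL s a r)\<^sup>2 * w" using powr_add[of "QL s a r" 2 "- 5 / 2"] M by (simp add: w_def)
  have dsq: "((\<lambda>r. r\<^sup>2) has_real_derivative 2 * r) (at r)" by (auto intro!: derivative_eq_intros)
  have dl: "((\<lambda>r. 2 * r) has_real_derivative 2) (at r)" by (auto intro!: derivative_eq_intros)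
  have dm: "(QL' s a has_real_derivative - 2 * m) (at r)" unfolding m_def by (rule QL'_deriv)
  have "(kL' c s a has_real_derivative gam c * sqrt 2 * Df s a powr (- c - 3 / 2) * (c * Vf s * ((- 1 / 2 * QL s a r powr (- 1 / 2 - 1) * QL' s a r) * QL' s a r + (- 2 * m) * QL s a r powr (- 1 / 2))
    + (1 - s)\<^sup>2 * ((2 * QL s a r powr (- 1 / 2) + (- 1 / 2 * QL s a r powr (- 1 / 2 - 1) * QL' s a r) * (2 * r))
       - 1 / 2 * ((2 * r * QL s a r powr (- 3 / 2) + (- 3 / 2 * QL s a r powr (- 3 / 2 - 1) * QL' s a r) * r\<^sup>2) * QL' s a r + (- 2 * m) * (r\<^sup>2 * QL s a r powr (- 3 / 2)))))) (at r)"
    unfolding kL'_def[abs_def] by (intro DERIV_cmult DERIV_add DERIV_diff DERIV_mult d1 d2 dsq dl dm)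
  moreover have "(c * Vf s * ((- 1 / 2 * QL s a r powr (- 1 / 2 - 1) * QL' s a r) * QL' s a r + (- 2 * m) * QL s a r powr (- 1 / 2))
    + (1 - s)\<^sup>2 * ((2 * QL s a r powr (- 1 / 2) + (- 1 / 2 * QL s a r powr (- 1 / 2 - 1) * QL' s a r) * (2 * r))
       - 1 / 2 * ((2 * r * QL s a r powr (- 3 / 2) + (- 3 / 2 * QL s a r powr (- 3 / 2 - 1) * QL' s a r) * r\<^sup>2) * QL' s a r + (- 2 * m) * (r\<^sup>2 * QL s a r powr (- 3 / 2)))))
    = (Df s a)\<^sup>2 * w * (3 / 4 * ((1 - s) * r)\<^sup>2 - c / 2 * Vf s * QL s a r)"
  proof -
    have e: "- 1 / 2 - 1 = (- 3 / 2 :: real)" "- 3 / 2 - 1 = (- 5 / 2 :: real)" by auto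
    have i1: "- 1 / 2 * (QL' s a r)\<^sup>2 - 2 * m * QL s a r = - 1 / 2 * (Df s a)\<^sup>2"
      unfolding QL_def QL'_def m_def[symmetric] by (simp add: power2_eq_square algebra_simps)
    have i2: "2 * (QL s a r)\<^sup>2 - 2 * r * QL s a r * QL' s a r + 3 / 4 * r\<^sup>2 * (QL' s a r)\<^sup>2 + r\<^sup>2 * m * QL s a r = 3 / 4 * (Df s a)\<^sup>2 * r\<^sup>2"
      unfolding QL_def QL'_def m_def[symmetric] by (simp add: power2_eq_square algebra_simps)
    have "(c * Vf s * ((- 1 / 2 * QL s a r powr (- 3 / 2) * QL' s a r) * QL' s a r + (- 2 * m) * QL s a r powr (- 1 / 2))
    + (1 - s)\<^sup>2 * ((2 * QL s a r powr (- 1 / 2) + (- 1 / 2 * QL s a r powr (- 3 / 2) * QL' s a r) * (2 * r))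
       - 1 / 2 * ((2 * r * QL s a r powr (- 3 / 2) + (- 3 / 2 * QL s a r powr (- 5 / 2) * QL' s a r) * r\<^sup>2) * QL' s a r + (- 2 * m) * (r\<^sup>2 * QL s a r powr (- 3 / 2)))))
      = w * (c * Vf s * QL s a r * (- 1 / 2 * (QL' s a r)\<^sup>2 - 2 * m * QL s a r)
        + (1 - s)\<^sup>2 * (2 * (QL s a r)\<^sup>2 - 2 * r * QL s a r * QL' s a r + 3 / 4 * r\<^sup>2 * (QL' s a r)\<^sup>2 + r\<^sup>2 * m * QL s a r))"
      unfolding w1 w2 w_def[symmetric] by (simp add: power2_eq_square algebra_simps)
    also have "\<dots> = (Df s a)\<^sup>2 * w * (3 / 4 * ((1 - s) * r)\<^sup>2 - c / 2 * Vf s * QL s a r)"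
      unfolding i1 i2 power_mult_distrib by (simp add: algebra_simps)
    finally show ?thesis unfolding e .
  qed
  ultimately show ?thesis unfolding kL''_def w_def by (simp only:)
qed

lemma kL''_cont: "QL s a r > 0 \<Longrightarrow> isCont (kL'' c s a) r"
  unfolding kL''_def[abs_def]
  by (intro continuous_mult continuous_diff continuous_power continuous_const continuous_ident
      DERIV_isCont[OF DERIV_powr_comp[OF QL_deriv]] DERIV_isCont[OF QL_deriv])

lemma Mf_eq_QL: "r \<le> s \<Longrightarrow> Mf r s a = QL s a r"
  by (simp add: Mf_def QL_def Vf_def Ef_def Rf_def Df_def min_def max_def) (simp add: algebra_simps power2_eq_square)

lemma Rf_eq_left: "r \<le> s \<Longrightarrow> Rf r s = (1 - s) * r"
  by (simp add: Rf_def min_def max_def)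

lemma Df_pos: "0 < s \<Longrightarrow> s < 1 \<Longrightarrow> 0 \<le> a \<Longrightarrow> Df s a > 0"
  by (simp add: Df_def Vf_def add_pos_nonneg)

text \<open>On \<open>r \<le> s\<close> the covariance is \<open>(1 - s) * r\<close>, and
  \<open>VM_eq\<close> expresses \<open>Ef r s * Df s a\<close> by it and by \<open>QL\<close>. In
  the new form no absolute value is left, so it can be differentiated.\<close>

lemma kap_eq_kL:
  assumes "0 < s" "s < 1" "0 \<le> a" "0 < r" "r \<le> s"
  shows "kap c r s a = kL c s a r"
proof -
  have M: "QL s a r > 0" by (rule QL_pos[OF assms])
  have D: "Df s a > 0" using assms by (intro Df_pos) auto
  define u where "u = QL s a r powr (- 1 / 2)"
  define d where "d = Df s a powr (- c - 3 / 2)"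
  have u: "QL s a r powr (1 / 2) = QL s a r * u" using powr_add[of "QL s a r" 1 "- 1 / 2"] M by (simp add: u_def)
  have d: "Df s a powr (- c - 1 / 2) = Df s a * d" using powr_add[of "Df s a" 1 "- c - 3 / 2"] D by (simp add: d_def algebra_simps)
  have VM: "Ef r s * Df s a = Vf s * QL s a r - ((1 - s) * r)\<^sup>2"
    using VM_eq[of s r a] assms by (simp add: Mf_eq_QL Rf_eq_left)
  have "kap c r s a = gam c * sqrt 2 * (d * u) * ((2 * c + 1) * Vf s * QL s a r - Ef r s * Df s a)"
    unfolding kap_def Mf_eq_QL[OF assms(5)] u d unfolding u_def d_def by (simp add: algebra_simps)
  also have "\<dots> = kL c s a r" unfolding VM kL_def u unfolding u_def d_def by (simp add: algebra_simps power2_eq_square)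
  finally show ?thesis .
qed

lemma Bt_eq_kL'':
  assumes "0 < s" "s < 1" "0 \<le> a" "0 < r" "r \<le> s"
  shows "Bt c r s a = - kL'' c s a r"
proof -
  have D: "Df s a > 0" using assms by (intro Df_pos) auto
  have VM: "Vf s * QL s a r = Ef r s * Df s a + ((1 - s) * r)\<^sup>2"
    using VM_eq[of s r a] assms by (simp add: Mf_eq_QL Rf_eq_left)
  have d: "Df s a powr (1 / 2 - c) = (Df s a)\<^sup>2 * Df s a powr (- c - 3 / 2)" using powr_add[of "Df s a" 2 "- c - 3 / 2"] D by (simp add: algebra_simps)
  have s2: "1 / sqrt 2 = sqrt 2 / (2 :: real)" by (simp add: field_simps)
  have e: "gam c / sqrt 2 = gam c * sqrt 2 / 2" using s2 by (simp add: field_simps)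
  have f: "c / 2 * Vf s * QL s a r = c / 2 * (Ef r s * Df s a + ((1 - s) * r)\<^sup>2)" unfolding VM[symmetric] by (simp only: mult.assoc)
  define R2 where "R2 = ((1 - s) * r)\<^sup>2"
  show ?thesis unfolding Bt_def kL''_def Mf_eq_QL[OF assms(5)] Rf_eq_left[OF assms(5)] d e f R2_def[symmetric]
    by (simp add: field_simps)
qed

text \<open>The fundamental theorem for \<open>h1 * kL - h * kL'\<close>. The powers of
  \<open>QL\<close> are singular at \<open>r = 0\<close>, so the interval starts at a point
  \<open>\<rho>' > 0\<close> where \<open>h\<close> still vanishes and contributes no boundary
  term.\<close>

lemma left_part:
  fixes h h1 h2 :: "real \<Rightarrow> real"
  assumes s: "0 < s" "s < 1" "0 \<le> a" and \<rho>: "\<rho> > 0"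
    and h: "\<And>r. (h has_real_derivative h1 r) (at r)" "\<And>r. (h1 has_real_derivative h2 r) (at r)" "\<And>r. isCont h2 r"
    and z: "\<And>r. r \<le> \<rho> \<Longrightarrow> h r = 0 \<and> h1 r = 0 \<and> h2 r = 0"
  shows "has_bochner_integral lborel (\<lambda>r. indicator {0..s} r * (h2 r * kap c r s a + h r * Bt c r s a)) (h1 s * kL c s a s - h s * kL' c s a s)"
proof -
  define \<rho>' where "\<rho>' = min \<rho> s / 2"
  have r': "0 < \<rho>'" "\<rho>' \<le> s" "\<rho>' \<le> \<rho>" using s \<rho> by (auto simp: \<rho>'_def)
  have "has_bochner_integral lborel (\<lambda>r. (h2 r * kL c s a r - h r * kL'' c s a r) * indicator {\<rho>'..s} r)
    ((h1 s * kL c s a s - h s * kL' c s a s) - (h1 \<rho>' * kL c s a \<rho>' - h \<rho>' * kL' c s a \<rho>'))"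
  proof (rule has_bochner_integral_FTC_Icc_real)
    fix r assume r: "\<rho>' \<le> r" "r \<le> s"
    have M: "QL s a r > 0" using QL_pos[OF s] r r' by auto
    show "((\<lambda>r. h1 r * kL c s a r - h r * kL' c s a r) has_real_derivative (h2 r * kL c s a r - h r * kL'' c s a r)) (at r)"
      by (rule DERIV_cong[OF DERIV_diff[OF DERIV_mult[OF h(2) kL_deriv[OF M]] DERIV_mult[OF h(1) kL'_deriv[OF M]]]]) (simp add: algebra_simps)
    show "isCont (\<lambda>r. h2 r * kL c s a r - h r * kL'' c s a r) r"
      by (intro continuous_diff continuous_mult h(3) DERIV_isCont[OF h(1)] DERIV_isCont[OF kL_deriv[OF M]] kL''_cont[OF M])
  qed (use r' in auto)
  moreover have "(h2 r * kL c s a r - h r * kL'' c s a r) * indicator {\<rho>'..s} r = indicator {0..s} r * (h2 r * kap c r s a + h r * Bt c r s a)" for r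
  proof (cases "r \<in> {\<rho>'..s}")
    case True
    then show ?thesis using kap_eq_kL[OF s, of r c] Bt_eq_kL''[OF s, of r c] r' by auto
  next
    case False
    then show ?thesis using z[of r] r' by (auto simp: indicator_def)
  qed
  moreover have "h1 \<rho>' = 0" "h \<rho>' = 0" using z[of \<rho>'] r' by auto
  ultimately show ?thesis by simp
qed

lemma reflect: "Vf (1 - s) = Vf s" "Rf (1 - r) (1 - s) = Rf r s" "Ef (1 - r) (1 - s) = Ef r s" "Df (1 - s) a = Df s a" "Mf (1 - r) (1 - s) a = Mf r s a"
proof -
  show V: "Vf (1 - s) = Vf s" for s by (simp add: Vf_def)
  show R: "Rf (1 - r) (1 - s) = Rf r s" by (auto simp: Rf_def min_def max_def)
  show E: "Ef (1 - r) (1 - s) = Ef r s" unfolding Ef_def R by (simp add: abs_minus_commute)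
  show "Df (1 - s) a = Df s a" by (simp add: Df_def V)
  show "Mf (1 - r) (1 - s) a = Mf r s a" unfolding Mf_def V E ..
qed

text \<open>The right half is the left half after reflecting \<open>r\<close> and \<open>s\<close>;
  this leaves \<open>kap\<close> and \<open>Bt\<close> invariant and reverses the sign of
  \<open>h1\<close>. The boundary terms with \<open>h1 s\<close> cancel, as the kernel is continuous
  across the diagonal, and the two one-sided derivatives add up to the jump.\<close>

lemma kernel_by_parts:
  fixes h h1 h2 :: "real \<Rightarrow> real"
  assumes s: "0 < s" "s < 1" "0 \<le> a" and \<rho>: "\<rho> > 0"
    and h: "\<And>r. (h has_real_derivative h1 r) (at r)" "\<And>r. (h1 has_real_derivative h2 r) (at r)" "\<And>r. isCont h2 r"
    and z: "\<And>r. r \<le> \<rho> \<or> 1 - \<rho> \<le> r \<Longrightarrow> h r = 0 \<and> h1 r = 0 \<and> h2 r = 0"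
  shows "has_bochner_integral lborel (\<lambda>r. indicator {0<..<1} r * (h2 r * kap c r s a + h r * Bt c r s a)) (h s * J1 c s a)"
proof -
  let ?g = "\<lambda>r. h2 r * kap c r s a + h r * Bt c r s a"
  have L: "has_bochner_integral lborel (\<lambda>r. indicator {0..s} r * ?g r) (h1 s * kL c s a s - h s * kL' c s a s)"
    using z by (intro left_part[OF s \<rho> h]) auto
  have "has_bochner_integral lborel (\<lambda>r. indicator {0..1 - s} r * (h2 (1 - r) * kap c r (1 - s) a + h (1 - r) * Bt c r (1 - s) a))
    ((- h1 (1 - (1 - s))) * kL c (1 - s) a (1 - s) - h (1 - (1 - s)) * kL' c (1 - s) a (1 - s))"
  proof (rule left_part[where ?h1.0 = "\<lambda>r. - h1 (1 - r)" and \<rho> = \<rho>])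
    have d: "((\<lambda>r. 1 - r) has_real_derivative - 1) (at r)" for r :: real by (auto intro!: derivative_eq_intros)
    show "((\<lambda>r. h (1 - r)) has_real_derivative - h1 (1 - r)) (at r)" for r
      using DERIV_chain2[OF h(1) d, of r] by simp
    show "((\<lambda>r. - h1 (1 - r)) has_real_derivative h2 (1 - r)) (at r)" for r
      using DERIV_minus[OF DERIV_chain2[OF h(2) d, of r]] by simp
    show "isCont (\<lambda>r. h2 (1 - r)) r" for r by (rule isCont_o2[OF _ h(3)]) (intro continuous_diff continuous_const continuous_ident)
    show "h (1 - r) = 0 \<and> - h1 (1 - r) = 0 \<and> h2 (1 - r) = 0" if "r \<le> \<rho>" for r using z[of "1 - r"] that by auto
  qed (use s \<rho> in auto)
  then have "has_bochner_integral lborel (\<lambda>r. indicator {0..1 - s} (1 + (- 1) * r) * (h2 (1 - (1 + (- 1) * r)) * kap c (1 + (- 1) * r) (1 - s) a + h (1 - (1 + (- 1) * r)) * Bt c (1 + (- 1) * r) (1 - s) a))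
    (((- h1 (1 - (1 - s))) * kL c (1 - s) a (1 - s) - h (1 - (1 - s)) * kL' c (1 - s) a (1 - s)) /\<^sub>R \<bar>- 1\<bar>)"
    by (subst (asm) lborel_has_bochner_integral_real_affine_iff[where c = "- 1" and t = 1]) auto
  moreover have "kap c (1 - r) (1 - s) a = kap c r s a" "Bt c (1 - r) (1 - s) a = Bt c r s a" for r
    unfolding kap_def Bt_def reflect by auto
  moreover have "indicator {0..1 - s} (1 - r) = (indicator {s..1} r :: real)" for r by (auto simp: indicator_def)
  ultimately have R: "has_bochner_integral lborel (\<lambda>r. indicator {s..1} r * ?g r) (- h1 s * kL c (1 - s) a (1 - s) - h s * kL' c (1 - s) a (1 - s))"
    by simp
  have Ms: "QL s a s = Vf s" "QL (1 - s) a (1 - s) = Vf s" by (simp_all add: QL_def Df_def Vf_def algebra_simps)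
  have V: "Vf s > 0" using s by (intro Vf_pos)
  have k: "kL c (1 - s) a (1 - s) = kL c s a s" unfolding kL_def Ms reflect by (simp add: mult_ac)
  define u where "u = Vf s powr (- 3 / 2)"
  have u: "Vf s powr (- 1 / 2) = Vf s * u" "sqrt (Vf s) = (Vf s)\<^sup>2 * u"
    using powr_add[of "Vf s" 1 "- 3 / 2"] powr_add[of "Vf s" 2 "- 3 / 2"] V by (auto simp: u_def powr_half_sqrt)
  have J: "- kL' c s a s - kL' c (1 - s) a (1 - s) = J1 c s a"
  proof -
    have 1: "QL' s a s = 1 - 2 * s - 2 * a * Vf s" "QL' (1 - s) a (1 - s) = 2 * s - 1 - 2 * a * Vf s"
      by (simp_all add: QL'_def Df_def Vf_def algebra_simps)
    have id: "(c * Vf s * (Vf s * u * (1 - 2 * s - 2 * a * Vf s)) + (1 - s)\<^sup>2 * (2 * s * (Vf s * u) - 1 / 2 * (s\<^sup>2 * u * (1 - 2 * s - 2 * a * Vf s)))) + (c * Vf s * (Vf s * u * (2 * s - 1 - 2 * a * Vf s)) + s\<^sup>2 * (2 * (1 - s) * (Vf s * u) - 1 / 2 * ((1 - s)\<^sup>2 * u * (2 * s - 1 - 2 * a * Vf s))))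
      = 2 * ((Vf s)\<^sup>2 * u) * (1 + (1 - 2 * c) * Vf s * a)"
      unfolding Vf_def by (simp add: power2_eq_square field_simps)
    define F where "F = gam c * sqrt 2 * Df s a powr (- c - 3 / 2)"
    have k1: "kL' c s a s = F * (c * Vf s * (Vf s * u * (1 - 2 * s - 2 * a * Vf s)) + (1 - s)\<^sup>2 * (2 * s * (Vf s * u) - 1 / 2 * (s\<^sup>2 * u * (1 - 2 * s - 2 * a * Vf s))))"
      unfolding kL'_def Ms 1 u_def[symmetric] u F_def by simp
    have k2: "kL' c (1 - s) a (1 - s) = F * (c * Vf s * (Vf s * u * (2 * s - 1 - 2 * a * Vf s)) + s\<^sup>2 * (2 * (1 - s) * (Vf s * u) - 1 / 2 * ((1 - s)\<^sup>2 * u * (2 * s - 1 - 2 * a * Vf s))))"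
      unfolding kL'_def Ms reflect 1 u_def[symmetric] u F_def by simp
    have j: "J1 c s a = - F * (2 * ((Vf s)\<^sup>2 * u) * (1 + (1 - 2 * c) * Vf s * a))"
      unfolding J1_def u F_def by (simp add: mult_ac)
    have g: "- (F * x) - F * y = - F * (x + y)" for x y :: real by (simp add: algebra_simps)
    show ?thesis unfolding k1 k2 j id[symmetric] by (rule g)
  qed
  have sum: "has_bochner_integral lborel (\<lambda>r. indicator {0..s} r * ?g r + indicator {s..1} r * ?g r) (h s * J1 c s a)"
    using has_bochner_integral_add[OF L R] unfolding k J[symmetric] by (simp add: algebra_simps)
  have ae: "AE r in lborel. indicator {0..s} r * ?g r + indicator {s..1} r * ?g r = indicator {0<..<1} r * ?g r"
    using AE_lborel_singleton[of s] AE_lborel_singleton[of 0] AE_lborel_singleton[of 1]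
    by eventually_elim (use s in \<open>auto simp: indicator_def\<close>)
  have m: "(\<lambda>r. indicator {0<..<1} r * ?g r) \<in> borel_measurable lborel"
  proof -
    have [measurable]: "h \<in> borel_measurable borel" "h2 \<in> borel_measurable borel"
      using DERIV_isCont[OF h(1)] h(3) by (auto intro!: borel_measurable_continuous_onI continuous_at_imp_continuous_on)
    show ?thesis unfolding kap_def Bt_def Mf_def Ef_def Rf_def Vf_def Df_def by measurable
  qed
  show ?thesis
    using sum by (rule has_bochner_integral_cong_AE[THEN iffD1, rotated 3]) (use m ae borel_measurable_has_bochner_integral[OF sum] in auto)
qed

section \<open>Beta integrals and the total mass of the jump\<close>

lemma nn_integral_beta_prime:
  assumes x: "0 < x" "x < q" and v: "v > 0"
  shows "(\<integral>\<^sup>+a. ennreal (indicator {0<..} a * (a powr (x - 1) * (1 + v * a) powr (- q))) \<partial>lborel) =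
    ennreal (v powr (- x) * (Gamma x * Gamma (q - x) / Gamma q))"
proof -
  \<comment> \<open>Writing \<open>(1 + v * a) powr (- q)\<close> as a Gamma integral over
    \<open>y\<close> and exchanging the order of integration leaves two Gamma integrals.\<close>
  let ?f = "\<lambda>a y. ennreal (indicator {0<..} a * indicator {0<..} y * (a powr (x - 1) * y powr (q - 1) * exp (- (1 + v * a) * y)))"
  have q: "q > 0" using x by simp
  have G: "Gamma q > 0" "Gamma x > 0" "Gamma (q - x) > 0" using x q by (auto intro: Gamma_real_pos)
  have 1: "(\<integral>\<^sup>+y. ?f a y \<partial>lborel) = ennreal (Gamma q) * ennreal (indicator {0<..} a * (a powr (x - 1) * (1 + v * a) powr (- q)))" for a
  proof (cases "a > 0")
    case True
    have "(\<integral>\<^sup>+y. ?f a y \<partial>lborel) = (\<integral>\<^sup>+y. ennreal (a powr (x - 1)) * ennreal (indicator {0<..} y * y powr (q - 1) * exp (- (1 + v * a) * y)) \<partial>lborel)"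
      using True by (intro nn_integral_cong) (simp add: ennreal_mult'[symmetric] mult_ac)
    also have "\<dots> = ennreal (a powr (x - 1)) * ennreal (Gamma q * (1 + v * a) powr (- q))"
    proof -
      have g: "(\<integral>\<^sup>+y. ennreal (indicator {0<..} y * y powr (q - 1) * exp (- (1 + v * a) * y)) \<partial>lborel) = ennreal (Gamma q * (1 + v * a) powr (- q))"
        using True v q by (intro nn_integral_gamma_scaled add_pos_pos mult_pos_pos) auto
      have "(\<integral>\<^sup>+y. ennreal (a powr (x - 1)) * ennreal (indicator {0<..} y * y powr (q - 1) * exp (- (1 + v * a) * y)) \<partial>lborel) =
          ennreal (a powr (x - 1)) * (\<integral>\<^sup>+y. ennreal (indicator {0<..} y * y powr (q - 1) * exp (- (1 + v * a) * y)) \<partial>lborel)"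
        by (intro nn_integral_cmult) measurable
      then show ?thesis by (simp only: g)
    qed
    finally show ?thesis using True G by (simp add: ennreal_mult'[symmetric] mult_ac)
  qed simp
  have 2: "(\<integral>\<^sup>+a. ?f a y \<partial>lborel) = ennreal (Gamma x * v powr (- x)) * ennreal (indicator {0<..} y * y powr (q - x - 1) * exp (- 1 * y))" for y
  proof (cases "y > 0")
    case True
    have "(\<integral>\<^sup>+a. ?f a y \<partial>lborel) = (\<integral>\<^sup>+a. ennreal (y powr (q - 1) * exp (- y)) * ennreal (indicator {0<..} a * a powr (x - 1) * exp (- (v * y) * a)) \<partial>lborel)"
    proof (intro nn_integral_cong)
      fix a
      have "exp (- (1 + v * a) * y) = exp (- y) * exp (- (v * y) * a)" by (simp add: exp_add[symmetric] algebra_simps)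
      then show "?f a y = ennreal (y powr (q - 1) * exp (- y)) * ennreal (indicator {0<..} a * a powr (x - 1) * exp (- (v * y) * a))"
        using True by (simp only: ennreal_mult'[symmetric] mult_nonneg_nonneg powr_ge_zero exp_ge_zero) (simp add: mult_ac)
    qed
    also have "\<dots> = ennreal (y powr (q - 1) * exp (- y)) * ennreal (Gamma x * (v * y) powr (- x))"
    proof -
      have g: "(\<integral>\<^sup>+a. ennreal (indicator {0<..} a * a powr (x - 1) * exp (- (v * y) * a)) \<partial>lborel) = ennreal (Gamma x * (v * y) powr (- x))"
        using True v x by (intro nn_integral_gamma_scaled mult_pos_pos) auto
      have "(\<integral>\<^sup>+a. ennreal (y powr (q - 1) * exp (- y)) * ennreal (indicator {0<..} a * a powr (x - 1) * exp (- (v * y) * a)) \<partial>lborel) =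
          ennreal (y powr (q - 1) * exp (- y)) * (\<integral>\<^sup>+a. ennreal (indicator {0<..} a * a powr (x - 1) * exp (- (v * y) * a)) \<partial>lborel)"
        by (intro nn_integral_cmult) measurable
      then show ?thesis by (simp only: g)
    qed
    also have "\<dots> = ennreal (y powr (q - 1) * exp (- y) * (Gamma x * (v * y) powr (- x)))"
      using G True by (intro ennreal_mult[symmetric]) auto
    also have "y powr (q - 1) * exp (- y) * (Gamma x * (v * y) powr (- x)) = (Gamma x * v powr (- x)) * (y powr (q - x - 1) * exp (- y))"
    proof -
      have "y powr (q - x - 1) = y powr (q - 1) * y powr (- x)" using powr_add[of y "q - 1" "- x"] by (simp add: algebra_simps)
      then show ?thesis by (simp add: powr_mult mult_ac)
    qed
    finally show ?thesis using True G by (simp add: ennreal_mult'[symmetric])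
  qed simp
  have "ennreal (Gamma q) * (\<integral>\<^sup>+a. ennreal (indicator {0<..} a * (a powr (x - 1) * (1 + v * a) powr (- q))) \<partial>lborel) = (\<integral>\<^sup>+a. \<integral>\<^sup>+y. ?f a y \<partial>lborel \<partial>lborel)"
    unfolding 1 by (subst nn_integral_cmult) auto
  also have "\<dots> = (\<integral>\<^sup>+y. \<integral>\<^sup>+a. ?f a y \<partial>lborel \<partial>lborel)" by (rule lborel_pair.Fubini') measurable
  also have "\<dots> = ennreal (Gamma x * v powr (- x)) * ennreal (Gamma (q - x) * 1 powr (- (q - x)))"
  proof -
    have g: "(\<integral>\<^sup>+y. ennreal (indicator {0<..} y * y powr (q - x - 1) * exp (- 1 * y)) \<partial>lborel) = ennreal (Gamma (q - x) * 1 powr (- (q - x)))"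
      using x by (intro nn_integral_gamma_scaled) auto
    have "(\<integral>\<^sup>+y. ennreal (Gamma x * v powr (- x)) * ennreal (indicator {0<..} y * y powr (q - x - 1) * exp (- 1 * y)) \<partial>lborel) =
        ennreal (Gamma x * v powr (- x)) * (\<integral>\<^sup>+y. ennreal (indicator {0<..} y * y powr (q - x - 1) * exp (- 1 * y)) \<partial>lborel)"
      by (intro nn_integral_cmult) measurable
    then show ?thesis by (simp only: 2 g)
  qed
  finally have eq: "ennreal (Gamma q) * (\<integral>\<^sup>+a. ennreal (indicator {0<..} a * (a powr (x - 1) * (1 + v * a) powr (- q))) \<partial>lborel) = ennreal (Gamma x * v powr (- x) * Gamma (q - x))"
    using G by (simp add: ennreal_mult'[symmetric])
  have "(\<integral>\<^sup>+a. ennreal (indicator {0<..} a * (a powr (x - 1) * (1 + v * a) powr (- q))) \<partial>lborel) = ennreal (1 / Gamma q) * ennreal (Gamma x * v powr (- x) * Gamma (q - x))"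
    using G unfolding eq[symmetric] mult.assoc[symmetric] by (simp add: ennreal_mult'[symmetric])
  also have "\<dots> = ennreal (v powr (- x) * (Gamma x * Gamma (q - x) / Gamma q))" using G by (simp add: ennreal_mult'[symmetric] mult_ac)
  finally show ?thesis .
qed

text \<open>Two Beta integrals, with exponents \<open>1 / 2\<close> and \<open>3 / 2\<close>. Their
  coefficients \<open>c\<close> and \<open>(1 - 2 * c) / 4\<close> add up to half of
  \<open>c + 1 / 2\<close>, the factor that separates \<open>Gamma (c + 3 / 2)\<close> from
  \<open>Gamma (c + 1 / 2)\<close>; so neither \<open>c\<close> nor \<open>s\<close>
  remains.\<close>

lemma integral_wt_J1:
  assumes c: "c > 0" and s: "0 < s" "s < 1"
  shows "(\<integral>a. wt a * J1 c s a \<partial>lborel) = - 1"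
proof -
  let ?V = "Vf s"
  have V: "?V > 0" using s by (rule Vf_pos)
  define f where "f x a = indicator {0<..} a * (a powr (x - 1) * (1 + 2 * ?V * a) powr (- c - 3 / 2))" for x a :: real
  have hb: "has_bochner_integral lborel (f x) ((2 * ?V) powr (- x) * (Gamma x * Gamma (c + 3 / 2 - x) / Gamma (c + 3 / 2)))" if "0 < x" "x < c + 3 / 2" for x
    using nn_integral_beta_prime[of x "c + 3 / 2" "2 * ?V"] that V Gamma_real_pos[of x] Gamma_real_pos[of "c + 3 / 2"] Gamma_real_pos[of "c + 3 / 2 - x"]
    by (intro has_bochner_integral_nn_integral) (auto simp: f_def[abs_def] minus_add_distrib)
  define K where "K = 2 * sqrt 2 * gam c * sqrt ?V / sqrt pi"
  have eq: "wt a * J1 c s a = - K * (f (1 / 2) a + (1 - 2 * c) * ?V * f (3 / 2) a)" for a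
  proof (cases "a > 0")
    case True
    have ph: "a powr (3 / 2 - 1) = a * a powr (1 / 2 - 1)" using powr_add[of a 1 "- (1 / 2)"] True by simp
    have DD: "Df s a = 1 + 2 * ?V * a" by (simp add: Df_def mult_ac)
    define X where "X = (1 + 2 * ?V * a) powr (- c - 3 / 2)"
    define Y where "Y = a powr (1 / 2 - 1)"
    have Y: "a powr (- 1 / 2) = Y" by (simp add: Y_def)
    show ?thesis unfolding f_def ph wt_def J1_def DD X_def[symmetric] Y_def[symmetric] Y K_def using True by (simp add: field_simps)
  qed (simp add: wt_def f_def)
  have G0: "Gamma c > 0" "Gamma (c + 1 / 2) > 0" using c by (auto intro: Gamma_real_pos)
  have G: "Gamma (c + 3 / 2) = (c + 1 / 2) * Gamma (c + 1 / 2)" "Gamma (c + 1) = c * Gamma c" "Gamma (3 / 2) = sqrt pi / 2"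
    using Gamma_real_plus1[of "c + 1 / 2"] Gamma_real_plus1[of c] Gamma_real_plus1[of "1 / 2"] c by (auto simp: add.commute Gamma_one_half_real)
  let ?w = "(2 * ?V) powr (- (1 / 2))"
  have w3: "(2 * ?V) powr (- (3 / 2)) = ?w / (2 * ?V)" using powr_add[of "2 * ?V" "- (1 / 2)" "- 1"] V by (simp add: powr_minus_divide)
  have w: "?w = 1 / (sqrt 2 * sqrt ?V)" using V by (simp add: powr_minus_divide powr_half_sqrt real_sqrt_mult)
  have "(\<integral>a. wt a * J1 c s a \<partial>lborel) = - K * (?w * (Gamma (1 / 2) * Gamma (c + 1) / Gamma (c + 3 / 2)) + (1 - 2 * c) * ?V * (?w / (2 * ?V) * (Gamma (3 / 2) * Gamma c / Gamma (c + 3 / 2))))"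
    unfolding eq using hb[of "1 / 2"] hb[of "3 / 2"] c by (simp add: has_bochner_integral_iff w3 add.commute[of 1 c])
  also have "\<dots> = - K * (?w * sqrt pi * ((c + 1 / 2) * Gamma c) / (2 * ((c + 1 / 2) * Gamma (c + 1 / 2))))"
  proof -
    define Z where "Z = (c + 1 / 2) * Gamma (c + 1 / 2)"
    have "Z > 0" using c G0 by (simp add: Z_def)
    then have "?w * (sqrt pi * (c * Gamma c) / Z) + (1 - 2 * c) * ?V * (?w / (2 * ?V) * (sqrt pi / 2 * Gamma c / Z)) = ?w * sqrt pi * ((c + 1 / 2) * Gamma c) / (2 * Z)"
      using V by (simp add: field_simps)
    then show ?thesis unfolding G Gamma_one_half_real Z_def by (simp only:)
  qed
  also have "\<dots> = - K * (?w * sqrt pi * Gamma c / (2 * Gamma (c + 1 / 2)))" using c by simp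
  also have "\<dots> = - 1" unfolding K_def w gam_def using G0 V by (simp add: field_simps)
  finally show ?thesis .
qed

text \<open>The exponent of \<open>Af\<close> compensates those in \<open>al\<close> and
  \<open>be\<close>: the powers of \<open>Mf\<close> combine to \<open>- 5 / 2\<close> whatever
  \<open>c\<close> is, and only \<open>Df\<close> keeps a power that depends on
  \<open>c\<close>.\<close>

lemma Bt_eq:
  assumes c: "c > 0" and r: "0 < r" "r < 1" and s: "0 < s" "s < 1" and a: "a > 0"
  shows "Gamma (c + 1 / 2) / 2 * (al c r s a * Af r s a powr (3 / 2 - c) + (c - 3 / 2) * (be c r s a * Af r s a powr (1 / 2 - c))) = Bt c r s a"
proof -
  let ?M = "Mf r s a" and ?D = "Df s a"
  have Mp: "?M > 0" using r s a by (intro Mf_pos) auto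
  have Dp: "?D > 0" using s a by (intro Df_pos) auto
  have G: "Gamma c > 0" using c by (rule Gamma_real_pos)
  have AM: "Af r s a powr q = ?D powr q * (2 powr (- q) * ?M powr (- q))" for q
    unfolding Af_def using Dp Mp by (simp add: powr_divide powr_mult powr_minus_divide)
  define w where "w = ?M powr (- 5 / 2)"
  define d where "d = ?D powr (1 / 2 - c)"
  define t where "t = 2 powr (c - 1)"
  have M1: "?M powr (- c - 1) * ?M powr (- (3 / 2 - c)) = w" "?M powr (- c - 2) * ?M powr (- (1 / 2 - c)) = w"
    by (simp_all add: powr_add[symmetric] w_def)
  have D1: "?D powr (3 / 2 - c) = ?D * d" using powr_add[of ?D 1 "1 / 2 - c"] Dp by (simp add: d_def)
  have t1: "2 powr (- (3 / 2 - c)) = t / sqrt 2" using powr_add[of 2 "c - 1" "- (1 / 2)"] by (simp add: t_def powr_minus_divide powr_half_sqrt)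
  have t2: "2 powr (- (1 / 2 - c)) = t * sqrt 2" using powr_add[of 2 "c - 1" "1 / 2"] by (simp add: t_def powr_half_sqrt)
  have tp: "t > 0" by (simp add: t_def)
  have kt: "kc c = 1 / (t * Gamma c)" by (simp add: kc_def t_def)
  have 1: "al c r s a * Af r s a powr (3 / 2 - c) = 2 * c / (Gamma c * sqrt 2) * (Ef r s * ?D) * d * w"
  proof -
    have "al c r s a * Af r s a powr (3 / 2 - c) = kc c * (2 * c) * Ef r s * (?D * d) * (t / sqrt 2) * (?M powr (- c - 1) * ?M powr (- (3 / 2 - c)))"
      unfolding AM al_def D1 t1 by (simp only: mult_ac)
    then show ?thesis unfolding M1 kt using tp by (simp add: field_simps)
  qed
  have 2: "be c r s a * Af r s a powr (1 / 2 - c) = sqrt 2 / Gamma c * (Rf r s)\<^sup>2 * d * w"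
  proof -
    have "be c r s a * Af r s a powr (1 / 2 - c) = kc c * (Rf r s)\<^sup>2 * d * (t * sqrt 2) * (?M powr (- c - 2) * ?M powr (- (1 / 2 - c)))"
      unfolding AM be_def t2 d_def by (simp only: mult_ac)
    then show ?thesis unfolding M1 kt using tp by (simp add: field_simps)
  qed
  have s2: "sqrt 2 / 2 = 1 / sqrt (2 :: real)" by (simp add: field_simps)
  have "Gamma (c + 1 / 2) / 2 * (al c r s a * Af r s a powr (3 / 2 - c) + (c - 3 / 2) * (be c r s a * Af r s a powr (1 / 2 - c))) =
    Gamma (c + 1 / 2) / Gamma c * d * w * ((1 / sqrt 2) * (c * (Ef r s * ?D)) + (sqrt 2 / 2) * ((c - 3 / 2) * (Rf r s)\<^sup>2))"
    unfolding 1 2 using G by (simp add: field_simps)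
  also have "\<dots> = Bt c r s a" unfolding s2 Bt_def gam_def w_def d_def by (simp add: field_simps)
  finally show ?thesis .
qed

text \<open>For \<open>kap\<close>, \<open>VM_eq\<close> turns the difference in the definition into
  a sum of nonnegative terms.\<close>

lemma kernel_nonneg:
  assumes c: "c > 0" and r: "0 < r" "r < 1" and s: "0 < s" "s < 1" and a: "a > 0"
  shows "0 \<le> al c r s a" "0 \<le> be c r s a" "0 < Af r s a" "0 \<le> kap c r s a"
proof -
  have Mp: "Mf r s a > 0" using r s a by (intro Mf_pos) auto
  have D: "Df s a > 0" using s a by (intro Df_pos) auto
  have kc: "kc c > 0" using c by (simp add: kc_def Gamma_real_pos)
  have E: "0 \<le> Ef r s" using r s by (intro Ef_nonneg) auto
  show "0 \<le> al c r s a" "0 \<le> be c r s a" using kc c E by (auto simp: al_def be_def)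
  show "0 < Af r s a" using D Mp by (simp add: Af_def)
  define u where "u = Mf r s a powr (- 1 / 2)"
  define d where "d = Df s a powr (- c - 3 / 2)"
  have u: "Mf r s a powr (1 / 2) = Mf r s a * u" using powr_add[of "Mf r s a" 1 "- 1 / 2"] Mp by (simp add: u_def)
  have d: "Df s a powr (- c - 1 / 2) = Df s a * d" using powr_add[of "Df s a" 1 "- c - 3 / 2"] D by (simp add: d_def algebra_simps)
  have VM: "Ef r s * Df s a = Vf s * Mf r s a - (Rf r s)\<^sup>2" using VM_eq[of s r a] r s by simp
  have "kap c r s a = gam c * sqrt 2 * (d * u) * ((2 * c + 1) * Vf s * Mf r s a - Ef r s * Df s a)"
    unfolding kap_def u d unfolding u_def d_def by (simp add: algebra_simps)
  also have "\<dots> = gam c * sqrt 2 * (d * u) * (2 * c * Vf s * Mf r s a + (Rf r s)\<^sup>2)" unfolding VM by (simp add: algebra_simps)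
  also have "0 \<le> \<dots>"
    using c Mp Vf_pos[OF s] Gamma_real_pos[of c] Gamma_real_pos[of "c + 1 / 2"] by (intro mult_nonneg_nonneg add_nonneg_nonneg) (auto simp: gam_def u_def d_def)
  finally show "0 \<le> kap c r s a" .
qed

section \<open>From the kernels back to integrals over paths\<close>

lemma wt_nonpos: "a \<le> 0 \<Longrightarrow> wt a = 0" by (simp add: wt_def)

lemma Bt_measurable [measurable (raw)]:
  assumes [measurable]: "f \<in> borel_measurable N" "g \<in> borel_measurable N" "k \<in> borel_measurable N"
  shows "(\<lambda>x. Bt c (f x) (g x) (k x)) \<in> borel_measurable N"
  unfolding Bt_def by measurable

lemma AE_fst_neq: "AE p in lborel \<Otimes>\<^sub>M lborel. fst p \<noteq> (r :: real)"
proof (rule lborel_pair.AE_pair_measure)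
  show "AE x in lborel. AE y in lborel. fst (x, y) \<noteq> r"
    using AE_lborel_singleton[of r] by eventually_elim simp
qed measurable

lemma integrable_dominated:
  fixes F :: "real \<Rightarrow> real \<Rightarrow> real"
  assumes K: "(\<integral>\<^sup>+p. ennreal (C * (Gd c (snd p) * Sd c r (fst p))) \<partial>lborel2) \<le> ennreal K" and K0: "0 \<le> K"
    and \<phi>m [measurable]: "\<phi>0 \<in> borel_measurable borel" and \<phi>0: "\<And>s. s \<notin> {0<..<1} \<Longrightarrow> \<phi>0 s = 0" and L: "\<And>s. \<bar>\<phi>0 s\<bar> \<le> L"
    and Fm [measurable]: "(\<lambda>p. F (fst p) (snd p)) \<in> borel_measurable lborel2" and X: "0 \<le> X"
    and b: "\<And>s a. 0 < s \<Longrightarrow> s < 1 \<Longrightarrow> s \<noteq> r \<Longrightarrow> a > 0 \<Longrightarrow> \<bar>F s a\<bar> \<le> X * (C * (Gd c a * Sd c r s))" and F0: "\<And>s a. a \<le> 0 \<Longrightarrow> F s a = 0"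
  shows "integrable lborel2 (\<lambda>p. \<phi>0 (fst p) * F (fst p) (snd p))"
    "(\<integral>\<^sup>+p. ennreal (norm (\<phi>0 (fst p) * F (fst p) (snd p))) \<partial>lborel2) \<le> ennreal (L * X * K)"
proof -
  have L0: "0 \<le> L" using L[of 0] by linarith
  have "(\<integral>\<^sup>+p. ennreal (norm (\<phi>0 (fst p) * F (fst p) (snd p))) \<partial>lborel2) \<le>
    (\<integral>\<^sup>+p. ennreal (L * X) * ennreal (C * (Gd c (snd p) * Sd c r (fst p))) \<partial>lborel2)"
  proof (rule nn_integral_mono_AE, rule eventually_mono[OF AE_fst_neq[of r]])
    fix p :: "real \<times> real" assume p: "fst p \<noteq> r"
    obtain s a where sa: "p = (s, a)" by (cases p)
    show "ennreal (norm (\<phi>0 (fst p) * F (fst p) (snd p))) \<le> ennreal (L * X) * ennreal (C * (Gd c (snd p) * Sd c r (fst p)))"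
    proof (cases "0 < s \<and> s < 1 \<and> a > 0")
      case True
      then have "\<bar>\<phi>0 s\<bar> * \<bar>F s a\<bar> \<le> L * (X * (C * (Gd c a * Sd c r s)))" using p sa L L0 by (intro mult_mono b) auto
      then show ?thesis using sa L0 X by (simp add: abs_mult ennreal_mult'[symmetric] mult.assoc ennreal_leI)
    next
      case False
      then have "\<phi>0 s * F s a = 0" using \<phi>0[of s] F0[of a s] by auto
      then show ?thesis using sa by auto
    qed
  qed
  also have "\<dots> = ennreal (L * X) * (\<integral>\<^sup>+p. ennreal (C * (Gd c (snd p) * Sd c r (fst p))) \<partial>lborel2)"
    by (intro nn_integral_cmult) measurable
  also have "\<dots> \<le> ennreal (L * X) * ennreal K" by (intro mult_left_mono K) auto
  also have "\<dots> = ennreal (L * X * K)" using L0 X K0 by (intro ennreal_mult[symmetric]) auto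
  finally show 1: "(\<integral>\<^sup>+p. ennreal (norm (\<phi>0 (fst p) * F (fst p) (snd p))) \<partial>lborel2) \<le> ennreal (L * X * K)" .
  show "integrable lborel2 (\<lambda>p. \<phi>0 (fst p) * F (fst p) (snd p))"
    unfolding integrable_iff_bounded using order.strict_trans1[OF 1] by (auto simp: ennreal_less_top)
qed

lemma path_functional_measurable:
  assumes [measurable]: "\<phi>0 \<in> borel_measurable borel" and \<phi>0: "\<And>s. s \<notin> {0<..<1} \<Longrightarrow> \<phi>0 s = 0"
  shows "(\<lambda>X. \<integral>s. \<phi>0 s * X s \<partial>lborel) \<in> borel_measurable (path_borel 1)"
proof -
  have pe: "\<phi>0 s * x s = \<phi>0 s * (indicator {0..1} s * x s)" for s and x :: "real \<Rightarrow> real"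
    using \<phi>0[of s] by (cases "s \<in> {0<..<1}") auto
  have ev: "(\<lambda>p. indicator {0..1} (snd p) * fst p (snd p)) \<in> borel_measurable (path_borel 1 \<Otimes>\<^sub>M (borel :: real measure))"
    using eval_joint_measurable by (simp add: case_prod_unfold)
  have [measurable]: "(\<lambda>p. indicator {0..1} (snd p) * fst p (snd p)) \<in> borel_measurable (path_borel 1 \<Otimes>\<^sub>M (lborel :: real measure))"
    by (subst measurable_cong_sets[OF sets_pair_measure_cong[OF refl sets_lborel] refl]) (rule ev)
  have m: "(\<lambda>p. \<phi>0 (snd p) * (indicator {0..1} (snd p) * fst p (snd p))) \<in> borel_measurable (path_borel 1 \<Otimes>\<^sub>M lborel)" by measurable
  show ?thesis unfolding pe using m by (intro lborel.borel_measurable_lebesgue_integral) (simp add: case_prod_unfold)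
qed

text \<open>The mixture runs over the pairs \<open>(s, a)\<close>: \<Phi> integrates over
  \<open>s\<close> and the mixing weight over \<open>a\<close>. \<open>boundary_term_mixture\<close>
  then moves the distribution inside both integrals, where \<open>Bt_eq\<close> evaluates
  it.\<close>

lemma boundary_term_Sigma:
  assumes \<delta>: "\<delta> > 0" and r: "0 < r" "r < 1" and Q: "\<And>b. 0 \<le> b \<Longrightarrow> pinned_bessel_bridge_law \<delta> r b (Q b)"
    and \<phi>m [measurable]: "\<phi>0 \<in> borel_measurable borel" and \<phi>0: "\<And>s. s \<notin> {0<..<1} \<Longrightarrow> \<phi>0 s = 0" and L: "\<And>s. \<bar>\<phi>0 s\<bar> \<le> L"
    and \<Phi>: "\<And>X. X \<in> space (path_borel 1) \<Longrightarrow> \<Phi> X = (\<integral>s. \<phi>0 s * X s \<partial>lborel)"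
  shows "boundary_term \<delta> (\<lambda>b. \<integral>X. \<Phi> X \<partial>(Sigma_measure \<delta> r b (Q b))) =
    (\<integral>p. \<phi>0 (fst p) * (wt (snd p) * Bt (\<delta> / 2) r (fst p) (snd p)) \<partial>lborel2)"
proof -
  define c where "c = \<delta> / 2"
  have c: "c > 0" and \<delta>c: "\<delta> = 2 * c" using \<delta> by (auto simp: c_def)
  let ?N = "lborel \<Otimes>\<^sub>M lborel :: (real \<times> real) measure"
  \<comment> \<open>The distance of \<open>r\<close> from the ends, so that \<open>r\<close> itself
    lies in the range of \<open>kernels_dominated\<close>.\<close>
  define \<rho> where "\<rho> = min r (1 - r)"
  have \<rho>: "0 < \<rho>" "\<rho> \<le> 1 / 2" "\<rho> \<le> r" "r \<le> 1 - \<rho>" using r by (auto simp: \<rho>_def min_def)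
  obtain C K where K0: "0 \<le> K" and K: "\<And>r. (\<integral>\<^sup>+p. ennreal (C * (Gd c (snd p) * Sd c r (fst p))) \<partial>?N) \<le> ennreal K"
    and dom: "\<And>r s a. \<rho> \<le> r \<Longrightarrow> r \<le> 1 - \<rho> \<Longrightarrow> 0 < s \<Longrightarrow> s < 1 \<Longrightarrow> s \<noteq> r \<Longrightarrow> a > 0 \<Longrightarrow>
      kernels_below c C r s a"
    by (rule kernels_dominated[OF c \<rho>(1,2)]) (rule that)
  have dint: "integrable ?N (\<lambda>p. \<phi>0 (fst p) * (wt (snd p) * F (fst p) (snd p)))"
    if Fm [measurable]: "(\<lambda>p. F (fst p) (snd p)) \<in> borel_measurable ?N"
      and b: "\<And>s a. 0 < s \<Longrightarrow> s < 1 \<Longrightarrow> s \<noteq> r \<Longrightarrow> a > 0 \<Longrightarrow> 0 \<le> F s a \<and> wt a * F s a \<le> C * (Gd c a * Sd c r s)" for F :: "real \<Rightarrow> real \<Rightarrow> real"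
  proof (rule integrable_dominated(1)[OF K K0 \<phi>m \<phi>0 L, where X = 1])
    show "(\<lambda>p. wt (snd p) * F (fst p) (snd p)) \<in> borel_measurable ?N" by measurable
    show "\<bar>wt a * F s a\<bar> \<le> 1 * (C * (Gd c a * Sd c r s))" if "0 < s" "s < 1" "s \<noteq> r" "a > 0" for s a
      using b[OF that] wt_nonneg[of a] by (simp add: abs_mult)
  qed (auto simp: wt_nonpos)
  define \<alpha> where "\<alpha> p = \<phi>0 (fst p) * (wt (snd p) * al c r (fst p) (snd p))" for p
  define \<beta> where "\<beta> p = \<phi>0 (fst p) * (wt (snd p) * be c r (fst p) (snd p))" for p
  \<comment> \<open>The value 1 at irrelevant parameters keeps \<open>A\<close> positive everywhere;
    \<open>\<alpha>\<close> and \<open>\<beta>\<close> vanish there.\<close>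
  define A where "A p = (if 0 < fst p \<and> fst p < 1 \<and> 0 < snd p then Af r (fst p) (snd p) else 1)" for p :: "real \<times> real"
  have [measurable]: "\<alpha> \<in> borel_measurable ?N" "\<beta> \<in> borel_measurable ?N" "A \<in> borel_measurable ?N"
    unfolding \<alpha>_def[abs_def] \<beta>_def[abs_def] A_def[abs_def] by measurable
  have Aeq: "\<phi>0 (fst p) * (wt (snd p) * f (A p)) = \<phi>0 (fst p) * (wt (snd p) * f (Af r (fst p) (snd p)))" for p and f :: "real \<Rightarrow> real"
    using \<phi>0[of "fst p"] wt_nonpos[of "snd p"] by (cases "0 < fst p \<and> fst p < 1 \<and> 0 < snd p") (auto simp: A_def)
  have A: "A p > 0" for p using kernel_nonneg(3)[OF c r, of "fst p" "snd p"] by (simp add: A_def)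
  have ia: "integrable ?N \<alpha>" unfolding \<alpha>_def[abs_def] using dom[OF \<rho>(3,4)] kernel_nonneg[OF c r] by (intro dint) auto
  have ib: "integrable ?N \<beta>" unfolding \<beta>_def[abs_def] using dom[OF \<rho>(3,4)] kernel_nonneg[OF c r] by (intro dint) auto
  have eA: "\<alpha> p * A p powr (3 / 2 - c) = \<phi>0 (fst p) * (wt (snd p) * (al c r (fst p) (snd p) * Af r (fst p) (snd p) powr (3 / 2 - c)))" for p
    using Aeq[of p "\<lambda>x. al c r (fst p) (snd p) * x powr (3 / 2 - c)"] by (simp add: \<alpha>_def mult_ac)
  have eB: "\<beta> p * A p powr (1 / 2 - c) = \<phi>0 (fst p) * (wt (snd p) * (be c r (fst p) (snd p) * Af r (fst p) (snd p) powr (1 / 2 - c)))" for p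
    using Aeq[of p "\<lambda>x. be c r (fst p) (snd p) * x powr (1 / 2 - c)"] by (simp add: \<beta>_def mult_ac)
  have iA: "integrable ?N (\<lambda>p. \<alpha> p * A p powr (3 / 2 - c))" unfolding eA using dom[OF \<rho>(3,4)] kernel_nonneg[OF c r] by (intro dint) auto
  have iB: "integrable ?N (\<lambda>p. \<beta> p * A p powr (1 / 2 - c))" unfolding eB using dom[OF \<rho>(3,4)] kernel_nonneg[OF c r] by (intro dint) auto
  have sf: "sigma_finite_measure ?N" unfolding lborel_prod by (rule sigma_finite_lborel)
  \<comment> \<open>First for the explicit mixture, whose integrand must be known to be integrable
    before \<open>link\<close> can identify it with \<open>\<psi>\<close>.\<close>
  interpret g0: gaussian_mixture ?N \<alpha> \<beta> A "\<lambda>b. \<integral>p. (\<alpha> p + \<beta> p * b\<^sup>2) * exp (- A p * b\<^sup>2) \<partial>?N" c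
    by (rule gaussian_mixture.intro) (use sf A c ia ib iA iB in auto)
  define \<psi> where "\<psi> = (\<lambda>b. \<integral>X. \<Phi> X \<partial>(Sigma_measure \<delta> r b (Q b)))"
  have link: "\<psi> b = (\<integral>p. (\<alpha> p + \<beta> p * b\<^sup>2) * exp (- A p * b\<^sup>2) \<partial>?N)" if b: "b \<ge> 0" for b
  proof -
    note Qb = Q[OF b] r \<delta> b
    have sQ: "sets (Q b) = sets (path_borel 1)" by (rule pinned_law_prob(2)[OF Qb])
    have spQ: "space (Q b) = space (path_borel 1)" using sQ by (rule sets_eq_imp_space_eq)
    let ?W = "Sigma_weight \<delta> r b"
    have W: "0 \<le> ?W" unfolding Sigma_weight_def using \<delta> r by (simp add: Gamma_real_pos less_imp_le)
    have "\<Phi> \<in> borel_measurable (path_borel 1) \<longleftrightarrow> (\<lambda>X. \<integral>s. \<phi>0 s * X s \<partial>lborel) \<in> borel_measurable (path_borel 1)"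
      by (rule measurable_cong) (rule \<Phi>)
    then have "\<Phi> \<in> borel_measurable (path_borel 1)" using path_functional_measurable[OF \<phi>m \<phi>0] by simp
    then have \<Phi>m: "\<Phi> \<in> borel_measurable (Q b)" by (subst measurable_cong_sets[OF sQ refl])
    let ?G = "\<lambda>s a. (al c r s a + be c r s a * b\<^sup>2) * exp (- (Af r s a) * b\<^sup>2)"
    have eG: "(\<alpha> p + \<beta> p * b\<^sup>2) * exp (- A p * b\<^sup>2) = \<phi>0 (fst p) * (wt (snd p) * ?G (fst p) (snd p))" for p
      using Aeq[of p "\<lambda>x. (al c r (fst p) (snd p) + be c r (fst p) (snd p) * b\<^sup>2) * exp (- x * b\<^sup>2)"] by (simp add: \<alpha>_def \<beta>_def algebra_simps)
    have "\<psi> b = (\<integral>X. ?W * \<Phi> X \<partial>(Q b))"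
      unfolding \<psi>_def Sigma_measure_def using \<Phi>m W by (subst integral_density) auto
    also have "\<dots> = (\<integral>X. ?W * (\<integral>s. \<phi>0 s * X s \<partial>lborel) \<partial>(Q b))"
      by (intro Bochner_Integration.integral_cong refl) (simp add: \<Phi> spQ)
    also have "\<dots> = (\<integral>p. \<phi>0 (fst p) * (wt (snd p) * ?G (fst p) (snd p)) \<partial>?N)"
    proof (rule weighted_path_integral(2)[where r = r])
      show "prob_space (Q b)" by (rule pinned_law_prob(1)[OF Qb])
      show "AE x in Q b. 0 \<le> x s" if "0 < s" "s < 1" "s \<noteq> r" for s by (rule pinned_nonneg[OF Qb that])
      show "(\<integral>\<^sup>+x. ennreal (?W * ((x s)\<^sup>2 * exp (- a * (x s)\<^sup>2))) \<partial>Q b) = ennreal (?G s a)" if "0 < s" "s < 1" "s \<noteq> r" "a > 0" for s a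
        unfolding c_def by (rule pinned_moment[OF Qb that])
      show "0 \<le> ?G s a" if "0 < s" "s < 1" "s \<noteq> r" "a > 0" for s a using kernel_nonneg[OF c r, of s a] that by simp
      show "(\<lambda>p. ?G (fst p) (snd p)) \<in> borel_measurable (borel \<Otimes>\<^sub>M borel)" by measurable
      show "integrable ?N (\<lambda>p. \<phi>0 (fst p) * (wt (snd p) * ?G (fst p) (snd p)))" using g0.integrable_term[of b] unfolding eG .
    qed (use sQ W \<phi>0 in auto)
    finally show ?thesis unfolding eG .
  qed
  interpret g: gaussian_mixture ?N \<alpha> \<beta> A \<psi> c
    by (rule gaussian_mixture.intro) (use sf A c ia ib iA iB link in auto)
  have "boundary_term \<delta> \<psi> = (\<integral>p. Gamma (c + 1 / 2) / 2 * (\<alpha> p * A p powr (3 / 2 - c) + (c - 3 / 2) * (\<beta> p * A p powr (1 / 2 - c))) \<partial>?N)"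
    unfolding \<delta>c g.boundary_term_mixture using iA iB by simp
  also have "\<dots> = (\<integral>p. \<phi>0 (fst p) * (wt (snd p) * Bt c r (fst p) (snd p)) \<partial>?N)"
  proof (intro Bochner_Integration.integral_cong refl)
    fix p
    show "Gamma (c + 1 / 2) / 2 * (\<alpha> p * A p powr (3 / 2 - c) + (c - 3 / 2) * (\<beta> p * A p powr (1 / 2 - c))) = \<phi>0 (fst p) * (wt (snd p) * Bt c r (fst p) (snd p))"
    proof (cases "0 < fst p \<and> fst p < 1 \<and> 0 < snd p")
      case True
      then have b: "Bt c r (fst p) (snd p) = Gamma (c + 1 / 2) / 2 * (al c r (fst p) (snd p) * Af r (fst p) (snd p) powr (3 / 2 - c) + (c - 3 / 2) * (be c r (fst p) (snd p) * Af r (fst p) (snd p) powr (1 / 2 - c)))"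
        by (intro Bt_eq[OF c r, symmetric]) auto
      have "G * (x * (w * u) + k * (x * (w * v))) = x * (w * (G * (u + k * v)))" for G x w u k v :: real by (simp add: algebra_simps)
      then show ?thesis unfolding eA eB b .
    next
      case False
      then show ?thesis unfolding eA eB using \<phi>0[of "fst p"] wt_nonpos[of "snd p"] by auto
    qed
  qed
  finally show ?thesis unfolding \<psi>_def c_def .
qed

text \<open>The tilted moment with \<open>a = 0\<close> and \<open>q = 1\<close>; the second time
  \<open>r / 2\<close> is an arbitrary interior time other than \<open>r\<close>.\<close>

lemma bridge_second_moment:
  assumes P: "bessel_bridge_law \<delta> 1 0 0 P" and \<delta>: "\<delta> > 0" and r: "0 < r" "r < 1"
  shows "(\<integral>\<^sup>+x. ennreal ((x r)\<^sup>2) \<partial>P) = ennreal (\<delta> * Vf r)"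
proof -
  have "(\<integral>\<^sup>+x. ennreal (((x r)\<^sup>2) powr 1 * exp (- 0 * (x (r / 2))\<^sup>2)) \<partial>P) =
    ennreal (Df (r / 2) 0 powr (- (\<delta> / 2)) * (Gamma (\<delta> / 2 + 1) / Gamma (\<delta> / 2)) * (2 * Mf r (r / 2) 0 / Df (r / 2) 0) powr 1)"
    using r by (intro bridge_tilted_moment[OF P \<delta>]) auto
  moreover have "Gamma (\<delta> / 2 + 1) / Gamma (\<delta> / 2) = \<delta> / 2"
  proof -
    have "Gamma (\<delta> / 2 + 1) = \<delta> / 2 * Gamma (\<delta> / 2)" by (rule Gamma_real_plus1) (use \<delta> in simp)
    moreover have "Gamma (\<delta> / 2) > 0" by (rule Gamma_real_pos) (use \<delta> in simp)
    ultimately show ?thesis by simp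
  qed
  moreover have "Df (r / 2) 0 = 1" "Mf r (r / 2) 0 = Vf r" by (simp_all add: Df_def Mf_def)
  ultimately show ?thesis using Vf_pos[OF r] by simp
qed

text \<open>The bound on the kernel comes from probability rather than from its formula:
  \<open>\<bar>X r * X s\<bar>\<close> is at most the sum of the squares, whose mean is at most
  \<delta> because \<open>Vf \<le> 1 / 2\<close>. It is uniform in \<open>r\<close>, up to the end
  points.\<close>

lemma bridge_inner:
  assumes P: "bessel_bridge_law \<delta> 1 0 0 P" and \<delta>: "\<delta> > 0" and r: "0 < r" "r < 1"
    and \<phi>m [measurable]: "\<phi>0 \<in> borel_measurable borel" and \<phi>0: "\<And>s. s \<notin> {0<..<1} \<Longrightarrow> \<phi>0 s = 0" and L: "\<And>s. \<bar>\<phi>0 s\<bar> \<le> L"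
  defines "c \<equiv> \<delta> / 2"
  shows "(\<integral>\<^sup>+p. ennreal (norm (\<phi>0 (fst p) * (wt (snd p) * kap c r (fst p) (snd p)))) \<partial>lborel2) \<le> ennreal (L * \<delta>)"
    and "(\<integral>\<^sup>+X. ennreal (norm (X r * (\<integral>s. \<phi>0 s * X s \<partial>lborel))) \<partial>P) \<le> ennreal (L * \<delta>)"
    and "(\<integral>X. X r * (\<integral>s. \<phi>0 s * X s \<partial>lborel) \<partial>P) = (\<integral>p. \<phi>0 (fst p) * (wt (snd p) * kap c r (fst p) (snd p)) \<partial>lborel2)"
proof -
  interpret P: prob_space P by (rule bessel_bridge_law_prob[OF P])
  have sP: "sets P = sets (path_borel 1)" by (rule bessel_bridge_law_sets[OF P])
  have c: "c > 0" using \<delta> by (simp add: c_def)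
  have L0: "0 \<le> L" using L[of 0] by linarith
  have evs: "(\<lambda>x. x s) \<in> borel_measurable P" if "0 < s" "s < 1" for s
    using measurable_eval_path[of s 1] that by (subst measurable_cong_sets[OF sP refl]) auto
  have nn: "AE x in P. 0 \<le> x s" if "0 < s" "s < 1" for s using that by (intro bridge_ends(1)[OF P]) (use \<delta> in auto)
  have V: "Vf s \<le> 1 / 2" for s
    using sum_power2_ge_zero[of "s - 1 / 2" 0] by (simp add: Vf_def power2_eq_square algebra_simps)
  have kint: "(\<integral>\<^sup>+a. ennreal (wt a * kap c r s a) \<partial>lborel) \<le> ennreal \<delta>" if s: "0 < s" "s < 1" "s \<noteq> r" for s
  proof -
    note evs[OF r, measurable] evs[OF s(1,2), measurable]
    have "(\<integral>\<^sup>+a. ennreal (wt a * kap c r s a) \<partial>lborel) = (\<integral>\<^sup>+x. ennreal (\<bar>x r\<bar> * \<bar>x s\<bar>) \<partial>P)"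
      unfolding c_def using bridge_kernel[OF P \<delta> r s(1,2)] s
      by (intro nn_integral_weighted_abs[symmetric] P.sigma_finite_measure borel_measurable_abs evs r) auto
    also have "\<dots> \<le> (\<integral>\<^sup>+x. ennreal ((x r)\<^sup>2) + ennreal ((x s)\<^sup>2) \<partial>P)"
    proof (intro nn_integral_mono)
      fix x :: "real \<Rightarrow> real"
      have "2 * (\<bar>x r\<bar> * \<bar>x s\<bar>) \<le> (x r)\<^sup>2 + (x s)\<^sup>2" using sum_squares_bound[of "\<bar>x r\<bar>" "\<bar>x s\<bar>"] by (simp add: mult.assoc)
      moreover have "0 \<le> \<bar>x r\<bar> * \<bar>x s\<bar>" by simp
      ultimately have "\<bar>x r\<bar> * \<bar>x s\<bar> \<le> (x r)\<^sup>2 + (x s)\<^sup>2" by linarith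
      then show "ennreal (\<bar>x r\<bar> * \<bar>x s\<bar>) \<le> ennreal ((x r)\<^sup>2) + ennreal ((x s)\<^sup>2)"
        using ennreal_leI[of "\<bar>x r\<bar> * \<bar>x s\<bar>" "(x r)\<^sup>2 + (x s)\<^sup>2"] ennreal_plus[OF zero_le_power2[of "x r"] zero_le_power2[of "x s"]] by (simp only:)
    qed
    also have "\<dots> = ennreal (\<delta> * Vf r) + ennreal (\<delta> * Vf s)"
      unfolding bridge_second_moment[OF P \<delta> r, symmetric] bridge_second_moment[OF P \<delta> s(1,2), symmetric] by (intro nn_integral_add) measurable
    also have "\<dots> = ennreal (\<delta> * Vf r + \<delta> * Vf s)" using \<delta> Vf_pos[OF r] Vf_pos[OF s(1,2)] by (intro ennreal_plus[symmetric]) auto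
    also have "\<dots> \<le> ennreal \<delta>"
    proof (intro ennreal_leI)
      have "\<delta> * Vf r \<le> \<delta> * (1 / 2)" "\<delta> * Vf s \<le> \<delta> * (1 / 2)" using \<delta> V by (intro mult_left_mono; simp)+
      then show "\<delta> * Vf r + \<delta> * Vf s \<le> \<delta>" by linarith
    qed
    finally show ?thesis .
  qed
  let ?N = "lborel \<Otimes>\<^sub>M lborel :: (real \<times> real) measure"
  let ?f = "\<lambda>p. \<phi>0 (fst p) * (wt (snd p) * kap c r (fst p) (snd p))"
  have srAE: "AE s in lborel. s \<noteq> r" by (rule AE_lborel_singleton)
  have "(\<integral>\<^sup>+p. ennreal (norm (?f p)) \<partial>?N) = (\<integral>\<^sup>+s. (\<integral>\<^sup>+a. ennreal (norm (?f (s, a))) \<partial>lborel) \<partial>lborel)"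
    by (intro lborel.nn_integral_fst[symmetric]) measurable
  also have "\<dots> \<le> (\<integral>\<^sup>+s. ennreal (L * \<delta>) * indicator {0<..<1 :: real} s \<partial>lborel)"
  proof (rule nn_integral_mono_AE, rule eventually_mono[OF srAE])
    fix s assume sr: "s \<noteq> r"
    show "(\<integral>\<^sup>+a. ennreal (norm (?f (s, a))) \<partial>lborel) \<le> ennreal (L * \<delta>) * indicator {0<..<1} s"
    proof (cases "s \<in> {0<..<1}")
      case True
      then have s: "0 < s" "s < 1" by auto
      have "(\<integral>\<^sup>+a. ennreal (norm (?f (s, a))) \<partial>lborel) = (\<integral>\<^sup>+a. ennreal \<bar>\<phi>0 s\<bar> * ennreal (wt a * kap c r s a) \<partial>lborel)"
      proof (intro nn_integral_cong)
        fix a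
        have "0 \<le> wt a * kap c r s a" using kernel_nonneg(4)[OF c r s, of a] wt_nonneg[of a] by (cases "a > 0") (auto simp: wt_nonpos)
        then have e: "\<bar>wt a * kap c r s a\<bar> = wt a * kap c r s a" by (rule abs_of_nonneg)
        show "ennreal (norm (?f (s, a))) = ennreal \<bar>\<phi>0 s\<bar> * ennreal (wt a * kap c r s a)"
          by (simp only: fst_conv snd_conv real_norm_def abs_mult[of "\<phi>0 s"] e ennreal_mult'[OF abs_ge_zero])
      qed
      also have "\<dots> = ennreal \<bar>\<phi>0 s\<bar> * (\<integral>\<^sup>+a. ennreal (wt a * kap c r s a) \<partial>lborel)" by (intro nn_integral_cmult) measurable
      also have "\<dots> \<le> ennreal L * ennreal \<delta>" using L[of s] by (intro mult_mono kint s sr ennreal_leI) auto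
      finally show ?thesis using True L0 \<delta> by (simp add: ennreal_mult)
    qed (simp add: \<phi>0)
  qed
  also have "\<dots> = ennreal (L * \<delta>)" by (subst nn_integral_cmult_indicator) auto
  finally show 1: "(\<integral>\<^sup>+p. ennreal (norm (?f p)) \<partial>?N) \<le> ennreal (L * \<delta>)" .
  have int: "integrable ?N ?f" unfolding integrable_iff_bounded using order.strict_trans1[OF 1] by (auto simp: ennreal_less_top)
  have G: "(\<integral>\<^sup>+x. ennreal (x r * ((x s)\<^sup>2 * exp (- a * (x s)\<^sup>2))) \<partial>P) = ennreal (kap c r s a)" if "0 < s" "s < 1" "s \<noteq> r" "a > 0" for s a
  proof -
    have "(\<integral>\<^sup>+x. ennreal (x r * ((x s)\<^sup>2 * exp (- a * (x s)\<^sup>2))) \<partial>P) = (\<integral>\<^sup>+x. ennreal (\<bar>x r\<bar> * ((x s)\<^sup>2 * exp (- a * (x s)\<^sup>2))) \<partial>P)"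
      using nn[OF r] by (intro nn_integral_cong_AE) auto
    then show ?thesis unfolding c_def using bridge_kernel[OF P \<delta> r that(1,2) _ that(4)] that(3) by simp
  qed
  have km: "(\<lambda>p. kap c r (fst p) (snd p)) \<in> borel_measurable (borel \<Otimes>\<^sub>M borel)" by measurable
  have kp: "0 \<le> kap c r s a" if "0 < s" "s < 1" "s \<noteq> r" "a > 0" for s a using kernel_nonneg(4)[OF c r] that by simp
  note w = weighted_path_integral[where r = r and W = "\<lambda>x. x r" and G = "kap c r", OF P.prob_space_axioms sP evs[OF r] nn[OF r] \<phi>m \<phi>0 nn G kp km int]
  show "(\<integral>\<^sup>+X. ennreal (norm (X r * (\<integral>s. \<phi>0 s * X s \<partial>lborel))) \<partial>P) \<le> ennreal (L * \<delta>)"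
    by (rule order.trans[OF w(1) 1])
  show "(\<integral>X. X r * (\<integral>s. \<phi>0 s * X s \<partial>lborel) \<partial>P) = (\<integral>p. ?f p \<partial>?N)" by (rule w(2))
qed

text \<open>The bound is demanded only where \<open>g r\<close> is nonzero, since the kernel
  \<open>Bt\<close> is controlled only away from the ends of the interval, hence on the support of
  \<open>h\<close>.\<close>

lemma kernel_swap:
  fixes g :: "real \<Rightarrow> real" and H :: "real \<Rightarrow> real \<times> real \<Rightarrow> real"
  assumes g: "integrable lborel g" and Hm [measurable]: "(\<lambda>q. H (fst q) (snd q)) \<in> borel_measurable (lborel \<Otimes>\<^sub>M lborel2)"
    and b: "\<And>r. g r \<noteq> 0 \<Longrightarrow> (\<integral>\<^sup>+p. ennreal (norm (H r p)) \<partial>lborel2) \<le> ennreal K"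
  shows "integrable (lborel \<Otimes>\<^sub>M lborel2) (\<lambda>q. g (fst q) * H (fst q) (snd q))"
    "(\<integral>r. g r * (\<integral>p. H r p \<partial>lborel2) \<partial>lborel) = (\<integral>q. g (fst q) * H (fst q) (snd q) \<partial>(lborel \<Otimes>\<^sub>M lborel2))"
proof -
  let ?N = "lborel \<Otimes>\<^sub>M lborel :: (real \<times> real) measure"
  have sf: "sigma_finite_measure ?N" unfolding lborel_prod by (rule sigma_finite_lborel)
  interpret pair_sigma_finite lborel ?N by (intro pair_sigma_finite.intro sigma_finite_lborel sf)
  have gm [measurable]: "g \<in> borel_measurable lborel" using g by simp
  have Hr: "H r \<in> borel_measurable ?N" for r using measurable_compose[OF measurable_Pair1'[of r lborel ?N] Hm] by simp
  have "(\<integral>\<^sup>+q. ennreal (norm (g (fst q) * H (fst q) (snd q))) \<partial>(lborel \<Otimes>\<^sub>M ?N)) = (\<integral>\<^sup>+r. (\<integral>\<^sup>+p. ennreal (norm (g (fst (r, p)) * H (fst (r, p)) (snd (r, p)))) \<partial>?N) \<partial>lborel)"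
    by (intro sigma_finite_measure.nn_integral_fst[OF sf, symmetric]) measurable
  also have "\<dots> \<le> (\<integral>\<^sup>+r. ennreal (norm (g r)) * ennreal K \<partial>lborel)"
  proof (intro nn_integral_mono)
    fix r
    have "(\<integral>\<^sup>+p. ennreal (norm (g (fst (r, p)) * H (fst (r, p)) (snd (r, p)))) \<partial>?N) = (\<integral>\<^sup>+p. ennreal (norm (g r)) * ennreal (norm (H r p)) \<partial>?N)"
      by (simp only: fst_conv snd_conv norm_mult ennreal_mult'[OF norm_ge_zero])
    also have "\<dots> = ennreal (norm (g r)) * (\<integral>\<^sup>+p. ennreal (norm (H r p)) \<partial>?N)" using Hr by (intro nn_integral_cmult) auto
    also have "\<dots> \<le> ennreal (norm (g r)) * ennreal K" using b[of r] by (cases "g r = 0") (auto intro: mult_left_mono)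
    finally show "(\<integral>\<^sup>+p. ennreal (norm (g (fst (r, p)) * H (fst (r, p)) (snd (r, p)))) \<partial>?N) \<le> ennreal (norm (g r)) * ennreal K" .
  qed
  also have "\<dots> = (\<integral>\<^sup>+r. ennreal (norm (g r)) \<partial>lborel) * ennreal K" by (intro nn_integral_multc) measurable
  also have "\<dots> < \<infinity>" using g by (auto simp: integrable_iff_bounded ennreal_mult_less_top)
  finally show int: "integrable (lborel \<Otimes>\<^sub>M ?N) (\<lambda>q. g (fst q) * H (fst q) (snd q))" by (simp add: integrable_iff_bounded)
  show "(\<integral>r. g r * (\<integral>p. H r p \<partial>?N) \<partial>lborel) = (\<integral>q. g (fst q) * H (fst q) (snd q) \<partial>(lborel \<Otimes>\<^sub>M ?N))"
    using integral_fst'[OF int] by simp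
qed

lemma bridge_term:
  assumes P: "bessel_bridge_law \<delta> 1 0 0 P" and \<delta>: "\<delta> > 0"
    and \<phi>m [measurable]: "\<phi>0 \<in> borel_measurable borel" and \<phi>0: "\<And>s. s \<notin> {0<..<1} \<Longrightarrow> \<phi>0 s = 0" and L: "\<And>s. \<bar>\<phi>0 s\<bar> \<le> L"
    and g: "integrable lborel g" and g0: "\<And>r. r \<notin> {0<..<1} \<Longrightarrow> g r = 0"
  shows "(\<integral>X. (\<integral>r. g r * X r \<partial>lborel) * (\<integral>s. \<phi>0 s * X s \<partial>lborel) \<partial>P) =
    (\<integral>r. g r * (\<integral>p. \<phi>0 (fst p) * (wt (snd p) * kap (\<delta> / 2) r (fst p) (snd p)) \<partial>lborel2) \<partial>lborel)"
proof -
  interpret P: prob_space P by (rule bessel_bridge_law_prob[OF P])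
  interpret pair_sigma_finite P lborel ..
  have sP: "sets P = sets (path_borel 1)" by (rule bessel_bridge_law_sets[OF P])
  have evs: "(\<lambda>x. x s) \<in> borel_measurable P" if "0 < s" "s < 1" for s
    using measurable_eval_path[of s 1] that by (subst measurable_cong_sets[OF sP refl]) auto
  have pe: "g s * x s = g s * (indicator {0..1} s * x s)" for s and x :: "real \<Rightarrow> real"
    using g0[of s] by (cases "s \<in> {0<..<1}") auto
  have ev: "(\<lambda>p. indicator {0..1} (snd p) * fst p (snd p)) \<in> borel_measurable (P \<Otimes>\<^sub>M (borel :: real measure))"
    by (subst measurable_cong_sets[OF sets_pair_measure_cong[OF sP refl] refl]) (use eval_joint_measurable in \<open>simp add: case_prod_unfold\<close>)
  have [measurable]: "(\<lambda>p. indicator {0..1} (snd p) * fst p (snd p)) \<in> borel_measurable (P \<Otimes>\<^sub>M (lborel :: real measure))"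
    by (subst measurable_cong_sets[OF sets_pair_measure_cong[OF refl sets_lborel] refl]) (rule ev)
  have [measurable]: "g \<in> borel_measurable lborel" using g by simp
  define F where "F X = (\<integral>s. \<phi>0 s * X s \<partial>lborel)" for X :: "real \<Rightarrow> real"
  have Fm [measurable]: "F \<in> borel_measurable P"
    unfolding F_def[abs_def] by (subst measurable_cong_sets[OF sP refl]) (rule path_functional_measurable[OF \<phi>m \<phi>0])
  let ?f = "\<lambda>p. (g (snd p) * (indicator {0..1} (snd p) * fst p (snd p))) * F (fst p)"
  have fm: "?f \<in> borel_measurable (P \<Otimes>\<^sub>M lborel)" by measurable
  have "(\<integral>\<^sup>+p. ennreal (norm (?f p)) \<partial>(P \<Otimes>\<^sub>M lborel)) = (\<integral>\<^sup>+r. (\<integral>\<^sup>+X. ennreal (norm (?f (X, r))) \<partial>P) \<partial>lborel)"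
    by (rule nn_integral_snd[symmetric]) (use fm in measurable)
  also have "\<dots> \<le> (\<integral>\<^sup>+r. ennreal (norm (g r)) * ennreal (L * \<delta>) \<partial>lborel)"
  proof (intro nn_integral_mono)
    fix r
    show "(\<integral>\<^sup>+X. ennreal (norm (?f (X, r))) \<partial>P) \<le> ennreal (norm (g r)) * ennreal (L * \<delta>)"
    proof (cases "r \<in> {0<..<1}")
      case True
      then have r: "0 < r" "r < 1" by auto
      have i1: "indicator {0..1} r = (1 :: real)" using r by simp
      have "(\<integral>\<^sup>+X. ennreal (norm (?f (X, r))) \<partial>P) = (\<integral>\<^sup>+X. ennreal (norm (g r)) * ennreal (norm (X r * F X)) \<partial>P)"
        by (simp only: fst_conv snd_conv i1 mult_1 mult.assoc norm_mult[of "g r"] ennreal_mult'[OF norm_ge_zero])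
      also have "\<dots> = ennreal (norm (g r)) * (\<integral>\<^sup>+X. ennreal (norm (X r * F X)) \<partial>P)"
        by (intro nn_integral_cmult measurable_compose[OF borel_measurable_times[OF evs[OF r] Fm]]) measurable
      also have "\<dots> \<le> ennreal (norm (g r)) * ennreal (L * \<delta>)"
        unfolding F_def by (intro mult_left_mono bridge_inner(2)[OF P \<delta> r \<phi>m \<phi>0 L]) auto
      finally show ?thesis .
    qed (simp add: g0)
  qed
  also have "\<dots> = (\<integral>\<^sup>+r. ennreal (norm (g r)) \<partial>lborel) * ennreal (L * \<delta>)" by (intro nn_integral_multc) measurable
  also have "\<dots> < \<infinity>" using g by (auto simp: integrable_iff_bounded ennreal_mult_less_top)
  finally have "integrable (P \<Otimes>\<^sub>M lborel) ?f" using fm by (simp add: integrable_iff_bounded)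
  then have int: "integrable (P \<Otimes>\<^sub>M lborel) (case_prod (\<lambda>X r. (g r * (indicator {0..1} r * X r)) * F X))" by (simp add: case_prod_unfold)
  have "(\<integral>X. (\<integral>r. g r * X r \<partial>lborel) * F X \<partial>P) = (\<integral>X. (\<integral>r. (g r * (indicator {0..1} r * X r)) * F X \<partial>lborel) \<partial>P)"
    unfolding pe by simp
  also have "\<dots> = (\<integral>r. (\<integral>X. (g r * (indicator {0..1} r * X r)) * F X \<partial>P) \<partial>lborel)" by (rule Fubini_integral[OF int, symmetric])
  also have "\<dots> = (\<integral>r. g r * (\<integral>p. \<phi>0 (fst p) * (wt (snd p) * kap (\<delta> / 2) r (fst p) (snd p)) \<partial>lborel2) \<partial>lborel)"
  proof (intro Bochner_Integration.integral_cong refl)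
    fix r
    show "(\<integral>X. (g r * (indicator {0..1} r * X r)) * F X \<partial>P) = g r * (\<integral>p. \<phi>0 (fst p) * (wt (snd p) * kap (\<delta> / 2) r (fst p) (snd p)) \<partial>lborel2)"
    proof (cases "r \<in> {0<..<1}")
      case True
      then have r: "0 < r" "r < 1" by auto
      have i1: "indicator {0..1} r = (1 :: real)" using r by simp
      have b: "(\<integral>X. X r * F X \<partial>P) = (\<integral>p. \<phi>0 (fst p) * (wt (snd p) * kap (\<delta> / 2) r (fst p) (snd p)) \<partial>lborel2)"
        unfolding F_def by (rule bridge_inner(3)[OF P \<delta> r \<phi>m \<phi>0 L])
      have "(\<integral>X. (g r * (indicator {0..1} r * X r)) * F X \<partial>P) = (\<integral>X. g r * (X r * F X) \<partial>P)" by (simp only: i1 mult_1 mult.assoc)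
      then show ?thesis by (simp only: integral_mult_right_zero b)
    qed (simp add: g0)
  qed
  finally show ?thesis unfolding F_def .
qed

text \<open>The complement of the support is open, so the derivatives vanish on it together with
  \<open>h\<close>; compactness keeps the support at a positive distance from the ends. The bound
  \<open>1 / 2\<close> is the one that \<open>kernels_dominated\<close> asks for.\<close>

lemma C2_compact_support_vanish:
  assumes h: "h \<in> C2_compact_support"
  obtains \<rho> where "0 < \<rho>" "\<rho> \<le> 1 / 2" "\<And>r. r \<le> \<rho> \<or> 1 - \<rho> \<le> r \<Longrightarrow> h r = 0 \<and> deriv h r = 0 \<and> deriv (deriv h) r = 0"
proof -
  define S where "S = closure {x. h x \<noteq> 0}"
  have S: "S \<subseteq> {0<..<1}" using h by (simp add: C2_compact_support_def S_def)
  have "bounded S" using S by (intro bounded_subset[OF bounded_closed_interval[of 0 1]]) auto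
  then have cS: "compact S" by (simp add: compact_eq_bounded_closed S_def)
  have op: "open (- S)" by (simp add: S_def open_Compl)
  have v0: "h r = 0" if "r \<in> - S" for r using that closure_subset[of "{x. h x \<noteq> 0}"] by (auto simp: S_def)
  have v1: "deriv h r = 0" if "r \<in> - S" for r
  proof (rule DERIV_imp_deriv)
    show "(h has_field_derivative 0) (at r)"
      by (rule has_field_derivative_transform_within_open[OF DERIV_const[of 0] op that]) (simp add: v0)
  qed
  have v2: "deriv (deriv h) r = 0" if "r \<in> - S" for r
  proof (rule DERIV_imp_deriv)
    show "(deriv h has_field_derivative 0) (at r)"
      by (rule has_field_derivative_transform_within_open[OF DERIV_const[of 0] op that]) (simp add: v1)
  qed
  have "\<exists>\<rho>. 0 < \<rho> \<and> \<rho> \<le> 1 / 2 \<and> (\<forall>r. r \<le> \<rho> \<or> 1 - \<rho> \<le> r \<longrightarrow> r \<in> - S)"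
  proof (cases "S = {}")
    case True
    then show ?thesis by (intro exI[of _ "1 / 2"]) auto
  next
    case False
    obtain m where m: "m \<in> S" "\<And>t. t \<in> S \<Longrightarrow> m \<le> t" using compact_attains_inf[OF cS False] by blast
    obtain M where M: "M \<in> S" "\<And>t. t \<in> S \<Longrightarrow> t \<le> M" using compact_attains_sup[OF cS False] by blast
    have mM: "0 < m" "M < 1" using m(1) M(1) S by auto
    define \<rho> where "\<rho> = min (m / 2) (min ((1 - M) / 2) (1 / 2))"
    have \<rho>: "\<rho> \<le> m / 2" "\<rho> \<le> (1 - M) / 2" "\<rho> \<le> 1 / 2" "0 < \<rho>" using mM by (auto simp: \<rho>_def min_def)
    have "r \<in> - S" if "r \<le> \<rho> \<or> 1 - \<rho> \<le> r" for r
    proof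
      assume "r \<in> S"
      then have "m \<le> r" "r \<le> M" using m(2) M(2) by auto
      note mr = this
      from that show False
      proof
        assume "r \<le> \<rho>"
        then show False using mr \<rho> mM by linarith
      next
        assume "1 - \<rho> \<le> r"
        then have "1 - M \<le> \<rho>" using mr by linarith
        then have "1 - M \<le> (1 - M) / 2" using \<rho>(2) by (rule order_trans)
        then have "1 \<le> M" by (simp add: field_simps)
        then show False using mM by simp
      qed
    qed
    then show ?thesis using \<rho> by blast
  qed
  then show thesis using that v0 v1 v2 by blast
qed

text \<open>Passing to the open interval changes the integrals only by a null set and excludes the
  times 0 and 1, at which the kernels degenerate.\<close>

lemma interval_cut:
  fixes f :: "real \<Rightarrow> real"
  assumes f: "continuous_on {0..1} f"
  shows "(\<lambda>s. indicator {0<..<1} s * f s) \<in> borel_measurable borel" "integrable lborel (\<lambda>s. indicator {0<..<1} s * f s)"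
    "\<exists>L. \<forall>s. \<bar>indicator {0<..<1} s * f s\<bar> \<le> L"
    "continuous_on {0..1} g \<Longrightarrow> inner01 f g = (\<integral>s. (indicator {0<..<1} s * f s) * g s \<partial>lborel)"
proof -
  have m: "(\<lambda>s. indicator {0<..<1} s * k s) \<in> borel_measurable borel" if "continuous_on {0..1} k" for k :: "real \<Rightarrow> real"
  proof -
    have "continuous_on {0<..<1} k" by (rule continuous_on_subset[OF that]) auto
    then show ?thesis using borel_measurable_continuous_on_indicator[of "{0<..<1}" k] by simp
  qed
  show "(\<lambda>s. indicator {0<..<1} s * f s) \<in> borel_measurable borel" by (rule m[OF f])
  have "set_integrable lborel {0..1} f" by (rule borel_integrable_atLeastAtMost'[OF f])
  then have "set_integrable lborel {0<..<1} f" by (rule set_integrable_subset) auto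
  then show "integrable lborel (\<lambda>s. indicator {0<..<1} s * f s)" by (simp add: set_integrable_def)
  have "bounded (f ` {0..1})" by (intro compact_imp_bounded compact_continuous_image f) auto
  then obtain L where "\<forall>x\<in>{0..1}. \<bar>f x\<bar> \<le> L" by (auto simp: bounded_iff)
  then have L: "\<bar>f x\<bar> \<le> L" if "x \<in> {0..1}" for x using that by blast
  have "\<bar>indicator {0<..<1} s * f s\<bar> \<le> L" for s
    using L[of s] L[of 0] by (cases "s \<in> {0<..<1}") auto
  then show "\<exists>L. \<forall>s. \<bar>indicator {0<..<1} s * f s\<bar> \<le> L" by blast
  assume g: "continuous_on {0..1} g"
  have fg: "continuous_on {0..1} (\<lambda>r. f r * g r)" by (intro continuous_on_mult f g)
  have m1: "(\<lambda>r. indicator {0..1} r *\<^sub>R (f r * g r)) \<in> borel_measurable lborel"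
    using borel_measurable_continuous_on_indicator[OF _ fg] by simp
  have e: "(indicator {0<..<1} s * f s) * g s = indicator {0<..<1} s * (f s * g s)" for s by (simp only: mult.assoc)
  show "inner01 f g = (\<integral>s. (indicator {0<..<1} s * f s) * g s \<partial>lborel)"
    unfolding inner01_def set_lebesgue_integral_def e
  proof (rule Bochner_Integration.integral_cong_AE[OF m1])
    show "(\<lambda>s. indicator {0<..<1} s * (f s * g s)) \<in> borel_measurable lborel" using m[OF fg] by simp
    show "AE r in lborel. indicator {0..1} r *\<^sub>R (f r * g r) = indicator {0<..<1} r * (f r * g r)"
      using AE_lborel_singleton[of 0] AE_lborel_singleton[of 1] by eventually_elim (auto simp: indicator_def)
  qed
qed

text \<open>By linearity the difference quotient is constant for
  \<open>\<epsilon> \<noteq> 0\<close>. Continuity of the path makes the two integrals into which it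
  is split exist.\<close>

lemma directional_deriv_inner01:
  assumes c: "continuous_on {0..1} \<phi>" "continuous_on {0..1} X" "continuous_on {0..1} h"
  shows "directional_deriv h (inner01 \<phi>) X = inner01 \<phi> h"
proof -
  have i: "set_integrable lborel {0..1} (\<lambda>r. \<phi> r * X r)" "set_integrable lborel {0..1} (\<lambda>r. \<phi> r * h r)"
    by (intro borel_integrable_atLeastAtMost' continuous_on_mult c)+
  have e: "inner01 \<phi> (\<lambda>r. X r + \<epsilon> * h r) = inner01 \<phi> X + \<epsilon> * inner01 \<phi> h" for \<epsilon>
  proof -
    have "inner01 \<phi> (\<lambda>r. X r + \<epsilon> * h r) = (LINT r:{0..1}|lborel. \<phi> r * X r + \<epsilon> * (\<phi> r * h r))"
      unfolding inner01_def by (simp add: algebra_simps)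
    also have "\<dots> = inner01 \<phi> X + \<epsilon> * inner01 \<phi> h"
      unfolding inner01_def using i by (subst set_integral_add(2)) auto
    finally show ?thesis .
  qed
  have "((\<lambda>\<epsilon>. (inner01 \<phi> (\<lambda>r. X r + \<epsilon> * h r) - inner01 \<phi> X) / \<epsilon>) \<longlongrightarrow> inner01 \<phi> h) (at 0)"
  proof (rule Lim_transform_eventually[OF tendsto_const])
    show "\<forall>\<^sub>F \<epsilon> in at 0. inner01 \<phi> h = (inner01 \<phi> (\<lambda>r. X r + \<epsilon> * h r) - inner01 \<phi> X) / \<epsilon>"
      by (auto simp: eventually_at_filter e)
  qed
  then show ?thesis unfolding directional_deriv_def by (intro tendsto_Lim) auto
qed

theorem theorem2p1:
  fixes \<delta> :: real and \<phi> h :: "real \<Rightarrow> real"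
    and P :: "(real \<Rightarrow> real) measure"
    and Q :: "real \<Rightarrow> real \<Rightarrow> (real \<Rightarrow> real) measure"
    and \<Phi> :: "(real \<Rightarrow> real) \<Rightarrow> real"
  assumes "\<delta> > 0"
    and "bessel_bridge_law \<delta> 1 0 0 P"
    and "\<And>r b. 0 < r \<Longrightarrow> r < 1 \<Longrightarrow> 0 \<le> b \<Longrightarrow> pinned_bessel_bridge_law \<delta> r b (Q r b)"
    and "continuous_on {0..1} \<phi>"
    and "\<And>X. \<Phi> X = inner01 \<phi> X"
    and "h \<in> C2_compact_support"
  shows "(\<integral>X. directional_deriv h \<Phi> X \<partial>P) =
     - (\<integral>X. inner01 (deriv (deriv h)) X * \<Phi> X \<partial>P)
     - (LINT r:{0<..<1}|lborel. h r *
          boundary_term \<delta> (\<lambda>b. \<integral>X. \<Phi> X \<partial>(Sigma_measure \<delta> r b (Q r b))))"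
proof -
  define c where "c = \<delta> / 2"
  have c: "c > 0" using assms(1) by (simp add: c_def)
  let ?N = "lborel \<Otimes>\<^sub>M lborel :: (real \<times> real) measure"
  define h1 where "h1 = deriv h"
  define h2 where "h2 = deriv h1"
  have hd: "(h has_real_derivative h1 r) (at r)" "(h1 has_real_derivative h2 r) (at r)" for r
    using assms(6) by (auto simp: C2_compact_support_def h1_def h2_def DERIV_deriv_iff_real_differentiable)
  have h2c: "continuous_on UNIV h2" using assms(6) by (simp add: C2_compact_support_def h1_def h2_def)
  have hc: "continuous_on {0..1} h" by (intro continuous_at_imp_continuous_on ballI DERIV_isCont[OF hd(1)])
  have h2c': "continuous_on {0..1} h2" by (rule continuous_on_subset[OF h2c]) simp
  obtain \<rho> where \<rho>: "0 < \<rho>" "\<rho> \<le> 1 / 2" and z: "\<And>r. r \<le> \<rho> \<or> 1 - \<rho> \<le> r \<Longrightarrow> h r = 0 \<and> h1 r = 0 \<and> h2 r = 0"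
    by (rule C2_compact_support_vanish[OF assms(6), folded h1_def, folded h2_def]) (rule that)
  define \<phi>0 where "\<phi>0 = (\<lambda>s. indicator {0<..<1} s * \<phi> s)"
  have \<phi>m [measurable]: "\<phi>0 \<in> borel_measurable borel" unfolding \<phi>0_def by (rule interval_cut(1)[OF assms(4)])
  have \<phi>z: "\<phi>0 s = 0" if "s \<notin> {0<..<1}" for s using that by (simp add: \<phi>0_def)
  obtain L where L: "\<And>s. \<bar>\<phi>0 s\<bar> \<le> L" using interval_cut(3)[OF assms(4)] unfolding \<phi>0_def by blast
  have L0: "0 \<le> L" using L[of 0] by linarith
  define g1 where "g1 = (\<lambda>r. indicator {0<..<1} r * h2 r)"
  define g2 where "g2 = (\<lambda>r. indicator {0<..<1} r * h r)"
  have g1: "integrable lborel g1" unfolding g1_def by (rule interval_cut(2)[OF h2c'])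
  have g2: "integrable lborel g2" unfolding g2_def by (rule interval_cut(2)[OF hc])
  have g1z: "g1 r = 0" if "r \<notin> {0<..<1}" for r using that by (simp add: g1_def)
  interpret P: prob_space P by (rule bessel_bridge_law_prob[OF assms(2)])
  have spP: "space P = space (path_borel 1)" by (rule sets_eq_imp_space_eq[OF bessel_bridge_law_sets[OF assms(2)]])
  have path: "continuous_on {0..1} X" if "X \<in> space (path_borel 1)" for X using that by (simp add: space_path_borel)
  have \<Phi>e: "\<Phi> = inner01 \<phi>" by (rule ext) (rule assms(5))
  have \<Phi>0: "\<Phi> X = (\<integral>s. \<phi>0 s * X s \<partial>lborel)" if "X \<in> space (path_borel 1)" for X
    unfolding \<Phi>e \<phi>0_def by (rule interval_cut(4)[OF assms(4) path[OF that]])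
  define I where "I = (\<integral>s. \<phi>0 s * h s \<partial>lborel)"
  have lhs: "(\<integral>X. directional_deriv h \<Phi> X \<partial>P) = I"
  proof -
    have "(\<integral>X. directional_deriv h \<Phi> X \<partial>P) = (\<integral>X. inner01 \<phi> h \<partial>P)"
      unfolding \<Phi>e by (intro Bochner_Integration.integral_cong refl directional_deriv_inner01 assms(4) path hc) (simp add: spP)
    also have "\<dots> = inner01 \<phi> h" by (simp add: P.prob_space)
    also have "\<dots> = I" unfolding I_def \<phi>0_def by (rule interval_cut(4)[OF assms(4) hc])
    finally show ?thesis .
  qed
  define H1 where "H1 r p = \<phi>0 (fst p) * (wt (snd p) * kap c r (fst p) (snd p))" for r and p :: "real \<times> real"
  define H2 where "H2 r p = \<phi>0 (fst p) * (wt (snd p) * Bt c r (fst p) (snd p))" for r and p :: "real \<times> real"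
  have T1: "(\<integral>X. inner01 h2 X * \<Phi> X \<partial>P) = (\<integral>r. g1 r * (\<integral>p. H1 r p \<partial>?N) \<partial>lborel)"
  proof -
    have "(\<integral>X. inner01 h2 X * \<Phi> X \<partial>P) = (\<integral>X. (\<integral>r. g1 r * X r \<partial>lborel) * (\<integral>s. \<phi>0 s * X s \<partial>lborel) \<partial>P)"
      by (intro Bochner_Integration.integral_cong refl) (simp add: \<Phi>0 spP g1_def interval_cut(4)[OF h2c' path])
    also have "\<dots> = (\<integral>r. g1 r * (\<integral>p. H1 r p \<partial>?N) \<partial>lborel)"
      unfolding H1_def c_def by (rule bridge_term[OF assms(2,1) \<phi>m \<phi>z L g1 g1z])
    finally show ?thesis .
  qed
  have T2: "(LINT r:{0<..<1}|lborel. h r * boundary_term \<delta> (\<lambda>b. \<integral>X. \<Phi> X \<partial>(Sigma_measure \<delta> r b (Q r b)))) = (\<integral>r. g2 r * (\<integral>p. H2 r p \<partial>?N) \<partial>lborel)"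
    unfolding set_lebesgue_integral_def
  proof (intro Bochner_Integration.integral_cong refl)
    fix r
    show "indicator {0<..<1} r *\<^sub>R (h r * boundary_term \<delta> (\<lambda>b. \<integral>X. \<Phi> X \<partial>(Sigma_measure \<delta> r b (Q r b)))) = g2 r * (\<integral>p. H2 r p \<partial>?N)"
    proof (cases "r \<in> {0<..<1}")
      case True
      then have r: "0 < r" "r < 1" by auto
      have "boundary_term \<delta> (\<lambda>b. \<integral>X. \<Phi> X \<partial>(Sigma_measure \<delta> r b (Q r b))) = (\<integral>p. H2 r p \<partial>?N)"
        unfolding H2_def c_def by (rule boundary_term_Sigma[OF assms(1) r assms(3)[OF r] \<phi>m \<phi>z L \<Phi>0])
      then show ?thesis using True by (simp add: g2_def)
    qed (simp add: g2_def)
  qed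
  obtain C K where K0: "0 \<le> K" and K: "\<And>r. (\<integral>\<^sup>+p. ennreal (C * (Gd c (snd p) * Sd c r (fst p))) \<partial>?N) \<le> ennreal K"
    and dom: "\<And>r s a. \<rho> \<le> r \<Longrightarrow> r \<le> 1 - \<rho> \<Longrightarrow> 0 < s \<Longrightarrow> s < 1 \<Longrightarrow> s \<noteq> r \<Longrightarrow> a > 0 \<Longrightarrow>
      kernels_below c C r s a"
    by (rule kernels_dominated[OF c \<rho>]) (rule that)
  define G where "G = Gamma (c + 1 / 2) / 2"
  have G: "0 \<le> G" using Gamma_real_pos[of "c + 1 / 2"] c by (simp add: G_def)
  \<comment> \<open>\<open>Bt_eq\<close> writes \<open>Bt\<close> as a signed combination of the two
    dominated kernels, so the bound is uniform over the support of \<open>h\<close>.\<close>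
  have Bb: "\<bar>wt a * Bt c r s a\<bar> \<le> (G * (1 + \<bar>c - 3 / 2\<bar>)) * (C * (Gd c a * Sd c r s))"
    if r: "\<rho> \<le> r" "r \<le> 1 - \<rho>" and s: "0 < s" "s < 1" "s \<noteq> r" "a > 0" for r s a
  proof -
    have r01: "0 < r" "r < 1" using r \<rho> by auto
    define x y where "x = wt a * (al c r s a * Af r s a powr (3 / 2 - c))" and "y = wt a * (be c r s a * Af r s a powr (1 / 2 - c))"
    define Y where "Y = C * (Gd c a * Sd c r s)"
    have xy: "0 \<le> x" "0 \<le> y" "x \<le> Y" "y \<le> Y"
      using dom[OF r s] kernel_nonneg[OF c r01 s(1,2,4)] wt_nonneg[of a] by (auto simp: x_def y_def Y_def)
    have "wt a * Bt c r s a = G * (x + (c - 3 / 2) * y)"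
    proof -
      have "w * (g * (u + k * v)) = g * (w * u + k * (w * v))" for w g u k v :: real by (simp add: algebra_simps)
      then show ?thesis unfolding Bt_eq[OF c r01 s(1,2,4), symmetric] x_def y_def G_def .
    qed
    also have "\<bar>\<dots>\<bar> = G * \<bar>x + (c - 3 / 2) * y\<bar>" using G by (simp add: abs_mult)
    also have "\<dots> \<le> G * (Y + \<bar>c - 3 / 2\<bar> * Y)"
    proof (intro mult_left_mono G)
      have "\<bar>(c - 3 / 2) * y\<bar> \<le> \<bar>c - 3 / 2\<bar> * Y" unfolding abs_mult using xy by (intro mult_left_mono) auto
      then show "\<bar>x + (c - 3 / 2) * y\<bar> \<le> Y + \<bar>c - 3 / 2\<bar> * Y" using xy by linarith
    qed
    finally show ?thesis unfolding Y_def by (simp add: algebra_simps)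
  qed
  have m1: "(\<lambda>q. H1 (fst q) (snd q)) \<in> borel_measurable (lborel \<Otimes>\<^sub>M ?N)" unfolding H1_def by measurable
  have m2: "(\<lambda>q. H2 (fst q) (snd q)) \<in> borel_measurable (lborel \<Otimes>\<^sub>M ?N)" unfolding H2_def by measurable
  have b1: "(\<integral>\<^sup>+p. ennreal (norm (H1 r p)) \<partial>?N) \<le> ennreal (L * \<delta>)" if "g1 r \<noteq> 0" for r
  proof -
    have r: "0 < r" "r < 1" using that by (auto simp: g1_def indicator_def split: if_splits)
    show ?thesis unfolding H1_def c_def by (rule bridge_inner(1)[OF assms(2,1) r \<phi>m \<phi>z L])
  qed
  have b2: "(\<integral>\<^sup>+p. ennreal (norm (H2 r p)) \<partial>?N) \<le> ennreal (L * (G * (1 + \<bar>c - 3 / 2\<bar>)) * K)" if "g2 r \<noteq> 0" for r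
  proof -
    have "h r \<noteq> 0" using that by (auto simp: g2_def)
    then have "\<not> (r \<le> \<rho> \<or> 1 - \<rho> \<le> r)" using z[of r] by blast
    then have r: "\<rho> \<le> r" "r \<le> 1 - \<rho>" by auto
    show ?thesis unfolding H2_def
    proof (rule integrable_dominated(2)[OF K K0 \<phi>m \<phi>z L])
      show "(\<lambda>p. wt (snd p) * Bt c r (fst p) (snd p)) \<in> borel_measurable ?N" by measurable
      show "\<bar>wt a * Bt c r s a\<bar> \<le> (G * (1 + \<bar>c - 3 / 2\<bar>)) * (C * (Gd c a * Sd c r s))" if "0 < s" "s < 1" "s \<noteq> r" "a > 0" for s a
        by (rule Bb[OF r that])
    qed (use G in \<open>auto simp: wt_nonpos\<close>)
  qed
  have s1: "integrable (lborel \<Otimes>\<^sub>M ?N) (\<lambda>q. g1 (fst q) * H1 (fst q) (snd q))" by (rule kernel_swap(1)[OF g1 m1 b1])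
  have e1: "(\<integral>r. g1 r * (\<integral>p. H1 r p \<partial>?N) \<partial>lborel) = (\<integral>q. g1 (fst q) * H1 (fst q) (snd q) \<partial>(lborel \<Otimes>\<^sub>M ?N))"
    by (rule kernel_swap(2)[OF g1 m1 b1])
  have s2: "integrable (lborel \<Otimes>\<^sub>M ?N) (\<lambda>q. g2 (fst q) * H2 (fst q) (snd q))" by (rule kernel_swap(1)[OF g2 m2 b2])
  have e2: "(\<integral>r. g2 r * (\<integral>p. H2 r p \<partial>?N) \<partial>lborel) = (\<integral>q. g2 (fst q) * H2 (fst q) (snd q) \<partial>(lborel \<Otimes>\<^sub>M ?N))"
    by (rule kernel_swap(2)[OF g2 m2 b2])
  have sf: "sigma_finite_measure ?N" unfolding lborel_prod by (rule sigma_finite_lborel)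
  interpret LN: pair_sigma_finite lborel ?N by (intro pair_sigma_finite.intro sigma_finite_lborel sf)
  define J where "J p = \<phi>0 (fst p) * (wt (snd p) * (h (fst p) * J1 c (fst p) (snd p)))" for p
  \<comment> \<open>For fixed \<open>(s, a)\<close> the second derivative moved from
    \<open>h\<close> to the kernel cancels against the boundary kernel; only the jump at
    \<open>r = s\<close> remains.\<close>
  have inner: "(\<integral>r. g1 r * H1 r p + g2 r * H2 r p \<partial>lborel) = J p" for p
  proof (cases "0 < fst p \<and> fst p < 1 \<and> 0 < snd p")
    case True
    define s a where "s = fst p" and "a = snd p"
    have sa: "0 < s" "s < 1" "0 \<le> a" using True by (auto simp: s_def a_def)
    have "has_bochner_integral lborel (\<lambda>r. indicator {0<..<1} r * (h2 r * kap c r s a + h r * Bt c r s a)) (h s * J1 c s a)"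
      using h2c by (intro kernel_by_parts[OF sa \<rho>(1) hd _ z]) (auto simp: continuous_on_eq_continuous_at)
    then have "(\<integral>r. indicator {0<..<1} r * (h2 r * kap c r s a + h r * Bt c r s a) \<partial>lborel) = h s * J1 c s a"
      by (rule has_bochner_integral_integral_eq)
    moreover have "g1 r * H1 r p + g2 r * H2 r p = (\<phi>0 s * wt a) * (indicator {0<..<1} r * (h2 r * kap c r s a + h r * Bt c r s a))" for r
      unfolding g1_def g2_def H1_def H2_def s_def a_def by (simp add: algebra_simps)
    ultimately show ?thesis unfolding J_def s_def[symmetric] a_def[symmetric] by (simp add: mult.assoc)
  next
    case False
    then have "\<phi>0 (fst p) = 0 \<or> wt (snd p) = 0" using \<phi>z[of "fst p"] wt_nonpos[of "snd p"] by auto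
    then show ?thesis by (auto simp: H1_def H2_def J_def)
  qed
  have int: "integrable (lborel \<Otimes>\<^sub>M ?N) (case_prod (\<lambda>r p. g1 r * H1 r p + g2 r * H2 r p))"
    using Bochner_Integration.integrable_add[OF s1 s2] by (simp add: case_prod_unfold)
  have iJ: "integrable ?N J" using LN.integrable_snd[OF int] unfolding inner by simp
  \<comment> \<open>The two terms are treated together: the cancellation takes place under the
    integral over \<open>r\<close>, which is therefore carried out first, followed by the one over
    \<open>a\<close>, where the jump has total mass -1.\<close>
  have "(\<integral>X. inner01 h2 X * \<Phi> X \<partial>P) + (LINT r:{0<..<1}|lborel. h r * boundary_term \<delta> (\<lambda>b. \<integral>X. \<Phi> X \<partial>(Sigma_measure \<delta> r b (Q r b)))) =
    (\<integral>q. g1 (fst q) * H1 (fst q) (snd q) + g2 (fst q) * H2 (fst q) (snd q) \<partial>(lborel \<Otimes>\<^sub>M ?N))"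
    unfolding T1 T2 e1 e2 by (rule Bochner_Integration.integral_add[OF s1 s2, symmetric])
  also have "\<dots> = (\<integral>p. J p \<partial>?N)"
    using LN.integral_snd[OF int] unfolding inner by (simp add: case_prod_unfold)
  also have "\<dots> = (\<integral>s. (\<integral>a. J (s, a) \<partial>lborel) \<partial>lborel)"
    by (rule lborel_pair.integral_fst'[OF iJ, symmetric])
  also have "\<dots> = (\<integral>s. - (\<phi>0 s * h s) \<partial>lborel)"
  proof (intro Bochner_Integration.integral_cong refl)
    fix s
    show "(\<integral>a. J (s, a) \<partial>lborel) = - (\<phi>0 s * h s)"
    proof (cases "s \<in> {0<..<1}")
      case True
      have "J (s, a) = (\<phi>0 s * h s) * (wt a * J1 c s a)" for a by (simp add: J_def)
      then show ?thesis using integral_wt_J1[OF c, of s] True by simp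
    qed (simp add: J_def \<phi>z)
  qed
  also have "\<dots> = - I" by (simp add: I_def)
  finally show ?thesis unfolding lhs h1_def[symmetric] h2_def[symmetric] by linarith
qed

end
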